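(* Let $F$ be a field and $V$ a finite-dimensional $F$-vector space of positive dimension. Then $$H_p(\mathrm{Dec}_V;\mathrm{FC}(V))\cong\begin{cases}\mathrm{St}^\infty(V)&\text{if }p=0,\\0&\text{otherwise,}\end{cases}$$ with the isomorphism for $p=0$ induced by the map $\mathrm{pr}^{\mathrm{St}}:\mathrm{FC}(V)\to\mathrm{St}^\infty(V)$.
   Context: Let $n=\dim V\ge 1$. **Infinite Steinberg module.** $\mathrm{St}(V)=\widetilde H_{n-2}(T(V);\mathbb Q)$, $T(V)$ the Tits building (nerve of the poset of proper nonzero subspaces). It is generated by apartment classes $[v_1,\dots,v_n]$ of ordered $n$-tuples of vectors, subject to: $[v_1,\dots,v_n]=0$ if the $v_i$ are linearly dependent; $[v_{\tau(1)},\dots,v_{\tau(n)}]=\mathrm{sgn}(\tau)[v_1,\dots,v_n]$; $[\lambda v_1,v_2,\dots,v_n]=[v_1,\dots,v_n]$ for $\lambda\in F^\times$; $\sum_{i=0}^n(-1)^i[v_0,\dots,\widehat{v_i},\dots,v_n]=0$. $\mathrm{St}^2(V)=\mathrm{St}(V)\otimes\mathrm{St}(V)$, with product $\mathrm{St}^2(V_1)\otimes\mathrm{St}^2(V_2)\to\mathrm{St}^2(V_1\oplus V_2)$ concatenating apartments in both factors. $\mathrm{St}^\infty(V)$ is the cokernel of $\bigoplus_{V_1\oplus V_2=V,\;V_1,V_2\ne0}\mathrm{St}^2(V_1)\otimes\mathrm{St}^2(V_2)\to\mathrm{St}^2(V)$, with quotient map $\pi$. **Formal correlators.** An affine basis of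 $V$ is a tuple $u_0,\dots,u_n$ with $u_1-u_0,\dots,u_n-u_0$ a basis. $\mathrm{FC}(V)$ is the $\mathbb Q$-vector space generated by symbols $\mathrm{FC}[u_0:\cdots:u_n]$ for affine bases, modulo: $\mathrm{FC}[u_0:\cdots:u_n]=\mathrm{FC}[u_0-u:\cdots:u_n-u]$ for $u\in V$; $\mathrm{FC}[u_0:u_1:\cdots:u_n]=\mathrm{FC}[u_1:\cdots:u_n:u_0]$; and for $n=n_1+n_2$, $n_1,n_2>0$, the sum of $\mathrm{FC}[u_0:w]$ over all shuffles $w$ of $(u_1,\dots,u_{n_1})$ and $(u_{n_1+1},\dots,u_n)$ vanishes. $\mathrm{pr}^{\mathrm{St}}(\mathrm{FC}[u_0:\cdots:u_n])=\pi\big([u_n-u_0,\dots,u_1-u_0]\otimes[u_n-u_0,u_{n-1}-u_n,\dots,u_1-u_2]\big)$. **Decomposition operators.** Let $\omega_{ij}=\omega_{ji}$ ($i\ne j$) be letters and define in the free associative algebra $\mathbf S(s_0,s_1)=\omega_{s_0s_1}$ and $\mathbf S(s_0,\dots,s_n)=\mathbf S(s_0,\dots,s_{n-1})\otimes\omega_{s_0s_n}-\sum_{i=1}^{n-1}\mathbf S(s_0,\dots,\widehat{s_{i+1}},\dots,s_n)\otimes\omega_{s_is_{i+1}}+\sum_{i=1}^{n-1}\mathbf S(s_0,\dots,\widehat{s_i},\dots,s_n)\otimes\omega_{s_is_{i+1}}$. Write $\mathbf S(0,\dots,n)=\sum_{\iota\in T(n)}\mathrm{sign}(\iota)\,\omega_{i_1j_1}\otimes\cdots\otimes\omega_{i_nj_n}$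 with $T(n)$ a set of ordered $n$-tuples $\iota=(\{i_1,j_1\},\dots,\{i_n,j_n\})$ of edges of the complete graph on $\{0,\dots,n\}$ and $\mathrm{sign}(\iota)=\pm1$. For nonzero $h\in V^\vee$, $D_h:\mathrm{FC}(V)\to\mathrm{FC}(V)$ is $D_h(\mathrm{FC}[u_0:\cdots:u_n])=\sum_{\iota\in T(n)}\mathrm{sign}(\iota)\,\mathrm{FC}\big[0:\tfrac{u_{i_1}-u_{j_1}}{h(u_{i_1}-u_{j_1})}:\cdots:\tfrac{u_{i_n}-u_{j_n}}{h(u_{i_n}-u_{j_n})}\big]$, omitting terms with a zero denominator. One has $D_{h_1}D_{h_2}=D_{h_1}$. **$\mathrm{Dec}_V$ and its homology.** $\mathrm{Dec}_V$ is the semigroup of nonzero functionals $h\in V^\vee$ with multiplication $h_1h_2=h_1$, acting on $\mathrm{FC}(V)$ by $h\mapsto D_h$. For a $\mathbb Q$-vector space $M$ with $\mathrm{Dec}_V$-action, $H_p(\mathrm{Dec}_V;M)$ is the homology of the complex $B_k=\mathbb Q[\mathrm{Dec}_V]^{\otimes k}\otimes M$ ($k\ge0$) with $d([s_1|\cdots|s_k]\otimes m)=[s_2|\cdots|s_k]\otimes m+\sum_{i=1}^{k-1}(-1)^i[s_1|\cdots|s_is_{i+1}|\cdots|s_k]\otimes m+(-1)^k[s_1|\cdots|s_{k-1}]\otimes s_km$. *)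

theory Defs
  imports
    Complex_Main
    "HOL-Algebra.Module"
    "HOL-Algebra.AbelCoset"
    "HOL-Combinatorics.Permutations"
    "HOL-Library.Poly_Mapping"
begin

section \<open>Rational vector spaces\<close>

text \<open>
  Rational vector spaces are modules in the sense of HOL-Algebra over the ring of rationals.
  The module record extends the ring record, so its multiplication fields exist but have no
  meaning for a module; they are left undefined.
\<close>

definition rat_ring :: "rat ring" where
  "rat_ring = \<lparr>carrier = UNIV, monoid.mult = (*), one = 1, zero = 0, add = (+)\<rparr>"

definition free_module :: "'x set \<Rightarrow> (rat, 'x \<Rightarrow>\<^sub>0 rat) module" where
  "free_module X =
     \<lparr>carrier = {p. Poly_Mapping.keys p \<subseteq> X}, monoid.mult = undefined, one = undefined,
      zero = 0, add = (+), smult = (\<lambda>c. Poly_Mapping.map ((*) c))\<rparr>"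

definition lin_ext :: "(rat, 'm) module \<Rightarrow> ('x \<Rightarrow> 'm) \<Rightarrow> ('x \<Rightarrow>\<^sub>0 rat) \<Rightarrow> 'm" where
  "lin_ext M g p =
     (\<Oplus>\<^bsub>M\<^esub>x\<in>Poly_Mapping.keys p. Poly_Mapping.lookup p x \<odot>\<^bsub>M\<^esub> g x)"

definition submodule_hull :: "(rat, 'm) module \<Rightarrow> 'm set \<Rightarrow> 'm set" where
  "submodule_hull M A = (\<lambda>N. submodule N rat_ring M) hull A"

definition quot_module :: "(rat, 'm) module \<Rightarrow> 'm set \<Rightarrow> (rat, 'm set) module" where
  "quot_module M N =
     \<lparr>carrier = a_rcosets\<^bsub>M\<^esub> N, monoid.mult = undefined, one = undefined,
      zero = N, add = set_add M,
      smult = (\<lambda>c X. \<Union>x\<in>X. N +>\<^bsub>M\<^esub> (c \<odot>\<^bsub>M\<^esub> x))\<rparr>"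

text \<open>
  The map on a quotient induced by a map that is constant on cosets, as in the isomorphism
  theorems of HOL-Algebra.
\<close>

definition induced_map :: "('m \<Rightarrow> 'n) \<Rightarrow> 'm set \<Rightarrow> 'n" where
  "induced_map f X = the_elem (f ` X)"

definition linear_maps :: "(rat, 'm) module \<Rightarrow> (rat, 'n) module \<Rightarrow> ('m \<Rightarrow> 'n) set" where
  "linear_maps M N =
     {f \<in> carrier M \<rightarrow> carrier N.
        (\<forall>x\<in>carrier M. \<forall>y\<in>carrier M. f (x \<oplus>\<^bsub>M\<^esub> y) = f x \<oplus>\<^bsub>N\<^esub> f y) \<and>
        (\<forall>c. \<forall>x\<in>carrier M. f (c \<odot>\<^bsub>M\<^esub> x) = c \<odot>\<^bsub>N\<^esub> f x)}"

definition linear_isos :: "(rat, 'm) module \<Rightarrow> (rat, 'n) module \<Rightarrow> ('m \<Rightarrow> 'n) set" where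
  "linear_isos M N = {f \<in> linear_maps M N. bij_betw f (carrier M) (carrier N)}"

definition tensor_relations ::
  "(rat, 'm) module \<Rightarrow> (rat, 'n) module \<Rightarrow> ('m \<times> 'n \<Rightarrow>\<^sub>0 rat) set" where
  "tensor_relations M N =
     {Poly_Mapping.single (x \<oplus>\<^bsub>M\<^esub> x', y) 1
        - Poly_Mapping.single (x, y) 1 - Poly_Mapping.single (x', y) 1
        | x x' y. x \<in> carrier M \<and> x' \<in> carrier M \<and> y \<in> carrier N} \<union>
     {Poly_Mapping.single (x, y \<oplus>\<^bsub>N\<^esub> y') 1
        - Poly_Mapping.single (x, y) 1 - Poly_Mapping.single (x, y') 1
        | x y y'. x \<in> carrier M \<and> y \<in> carrier N \<and> y' \<in> carrier N} \<union>
     {Poly_Mapping.single (c \<odot>\<^bsub>M\<^esub> x, y) 1 - Poly_Mapping.single (x, y) c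
        | c x y. x \<in> carrier M \<and> y \<in> carrier N} \<union>
     {Poly_Mapping.single (x, c \<odot>\<^bsub>N\<^esub> y) 1 - Poly_Mapping.single (x, y) c
        | c x y. x \<in> carrier M \<and> y \<in> carrier N}"

definition tensor_hull ::
  "(rat, 'm) module \<Rightarrow> (rat, 'n) module \<Rightarrow> ('m \<times> 'n \<Rightarrow>\<^sub>0 rat) set" where
  "tensor_hull M N =
     submodule_hull (free_module (carrier M \<times> carrier N)) (tensor_relations M N)"

definition tensor ::
  "(rat, 'm) module \<Rightarrow> (rat, 'n) module \<Rightarrow> (rat, ('m \<times> 'n \<Rightarrow>\<^sub>0 rat) set) module" where
  "tensor M N = quot_module (free_module (carrier M \<times> carrier N)) (tensor_hull M N)"

definition pure_tensor ::
  "(rat, 'm) module \<Rightarrow> (rat, 'n) module \<Rightarrow> 'm \<Rightarrow> 'n \<Rightarrow> ('m \<times> 'n \<Rightarrow>\<^sub>0 rat) set" where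
  "pure_tensor M N x y =
     tensor_hull M N +>\<^bsub>free_module (carrier M \<times> carrier N)\<^esub> Poly_Mapping.single (x, y) 1"


section \<open>Reduced homology of the nerve of a poset of sets\<close>

text \<open>
  Simplices are strictly increasing lists. Everything is indexed by the number \<open>m\<close> of vertices,
  that is, \<open>m = k + 1\<close> for \<open>k\<close>-simplices, so that the augmentation is the boundary map from
  \<open>m = 1\<close> to \<open>m = 0\<close> and \<open>reduced_homology P m\<close> is the reduced homology in degree \<open>m - 1\<close>
  (including degree \<open>-1\<close>).
\<close>

definition order_chains :: "'a set set \<Rightarrow> nat \<Rightarrow> (rat, 'a set list \<Rightarrow>\<^sub>0 rat) module" where
  "order_chains P m = free_module {c. sorted_wrt (\<subset>) c \<and> set c \<subseteq> P \<and> length c = m}"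

definition order_boundary :: "('a set list \<Rightarrow>\<^sub>0 rat) \<Rightarrow> ('a set list \<Rightarrow>\<^sub>0 rat)" where
  "order_boundary =
     lin_ext (free_module UNIV)
       (\<lambda>c. \<Sum>i<length c. Poly_Mapping.single (take i c @ drop (Suc i) c) ((- 1) ^ i))"

definition order_boundaries :: "'a set set \<Rightarrow> nat \<Rightarrow> ('a set list \<Rightarrow>\<^sub>0 rat) set" where
  "order_boundaries P m = order_boundary ` carrier (order_chains P (Suc m))"

definition reduced_homology ::
  "'a set set \<Rightarrow> nat \<Rightarrow> (rat, ('a set list \<Rightarrow>\<^sub>0 rat) set) module" where
  "reduced_homology P m =
     quot_module
       ((order_chains P m)
          \<lparr>carrier := {z \<in> carrier (order_chains P m). order_boundary z = 0}\<rparr>)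
       (order_boundaries P m)"


section \<open>Homology of a semigroup with coefficients\<close>

text \<open>
  \<open>bar_chains S M k\<close> is the tensor product of the \<open>k\<close>-th tensor power of the semigroup algebra of
  \<open>S\<close> with \<open>M\<close>, realised as the finitely supported functions from \<open>k\<close>-tuples in \<open>S\<close> to \<open>M\<close>;
  \<open>bar_elem M [s\<^sub>1, \<dots>, s\<^sub>k] m\<close> is the element \<open>[s\<^sub>1|\<dots>|s\<^sub>k] \<otimes> m\<close>.
\<close>

definition bar_chains ::
  "'s set \<Rightarrow> (rat, 'm) module \<Rightarrow> nat \<Rightarrow> (rat, 's list \<Rightarrow> 'm) module" where
  "bar_chains S M k =
     \<lparr>carrier = {f. (\<forall>l. f l \<in> carrier M) \<and> finite {l. f l \<noteq> \<zero>\<^bsub>M\<^esub>} \<and>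
                    (\<forall>l. f l \<noteq> \<zero>\<^bsub>M\<^esub> \<longrightarrow> length l = k \<and> set l \<subseteq> S)},
      monoid.mult = undefined, one = undefined,
      zero = (\<lambda>l. \<zero>\<^bsub>M\<^esub>), add = (\<lambda>f g l. f l \<oplus>\<^bsub>M\<^esub> g l),
      smult = (\<lambda>c f l. c \<odot>\<^bsub>M\<^esub> f l)\<rparr>"

definition bar_elem :: "(rat, 'm) module \<Rightarrow> 's list \<Rightarrow> 'm \<Rightarrow> 's list \<Rightarrow> 'm" where
  "bar_elem M l m = (\<lambda>l'. if l' = l then m else \<zero>\<^bsub>M\<^esub>)"

definition bar_face_sum ::
  "'s set \<Rightarrow> ('s \<Rightarrow> 's \<Rightarrow> 's) \<Rightarrow> ('s \<Rightarrow> 'm \<Rightarrow> 'm) \<Rightarrow> (rat, 'm) module \<Rightarrow>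
     's list \<Rightarrow> 'm \<Rightarrow> 's list \<Rightarrow> 'm" where
  "bar_face_sum S mul act M l m =
     (let k = length l; B = bar_chains S M (k - 1) in
        bar_elem M (tl l) m
        \<oplus>\<^bsub>B\<^esub> (\<Oplus>\<^bsub>B\<^esub>i\<in>{1..<k}. (- 1) ^ i \<odot>\<^bsub>B\<^esub>
               bar_elem M (take (i - 1) l @ [mul (l ! (i - 1)) (l ! i)] @ drop (i + 1) l) m)
        \<oplus>\<^bsub>B\<^esub> ((- 1) ^ k \<odot>\<^bsub>B\<^esub> bar_elem M (butlast l) (act (last l) m)))"

definition bar_diff ::
  "'s set \<Rightarrow> ('s \<Rightarrow> 's \<Rightarrow> 's) \<Rightarrow> ('s \<Rightarrow> 'm \<Rightarrow> 'm) \<Rightarrow> (rat, 'm) module \<Rightarrow>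
     nat \<Rightarrow> ('s list \<Rightarrow> 'm) \<Rightarrow> 's list \<Rightarrow> 'm" where
  "bar_diff S mul act M k f =
     (if k = 0 then (\<lambda>l. \<zero>\<^bsub>M\<^esub>)
      else \<Oplus>\<^bsub>bar_chains S M (k - 1)\<^esub>l\<in>{l. f l \<noteq> \<zero>\<^bsub>M\<^esub>}.
             bar_face_sum S mul act M l (f l))"

definition bar_cycles ::
  "'s set \<Rightarrow> ('s \<Rightarrow> 's \<Rightarrow> 's) \<Rightarrow> ('s \<Rightarrow> 'm \<Rightarrow> 'm) \<Rightarrow> (rat, 'm) module \<Rightarrow>
     nat \<Rightarrow> (rat, 's list \<Rightarrow> 'm) module" where
  "bar_cycles S mul act M p =
     (bar_chains S M p)
       \<lparr>carrier := {f \<in> carrier (bar_chains S M p).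
                      bar_diff S mul act M p f = (\<lambda>l. \<zero>\<^bsub>M\<^esub>)}\<rparr>"

definition bar_boundaries ::
  "'s set \<Rightarrow> ('s \<Rightarrow> 's \<Rightarrow> 's) \<Rightarrow> ('s \<Rightarrow> 'm \<Rightarrow> 'm) \<Rightarrow> (rat, 'm) module \<Rightarrow>
     nat \<Rightarrow> ('s list \<Rightarrow> 'm) set" where
  "bar_boundaries S mul act M p =
     bar_diff S mul act M (Suc p) ` carrier (bar_chains S M (Suc p))"

definition semigroup_homology ::
  "'s set \<Rightarrow> ('s \<Rightarrow> 's \<Rightarrow> 's) \<Rightarrow> ('s \<Rightarrow> 'm \<Rightarrow> 'm) \<Rightarrow> (rat, 'm) module \<Rightarrow>
     nat \<Rightarrow> (rat, ('s list \<Rightarrow> 'm) set) module" where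
  "semigroup_homology S mul act M p =
     quot_module (bar_cycles S mul act M p) (bar_boundaries S mul act M p)"

definition homology_class ::
  "'s set \<Rightarrow> ('s \<Rightarrow> 's \<Rightarrow> 's) \<Rightarrow> ('s \<Rightarrow> 'm \<Rightarrow> 'm) \<Rightarrow> (rat, 'm) module \<Rightarrow>
     nat \<Rightarrow> ('s list \<Rightarrow> 'm) \<Rightarrow> ('s list \<Rightarrow> 'm) set" where
  "homology_class S mul act M p z =
     bar_boundaries S mul act M p +>\<^bsub>bar_cycles S mul act M p\<^esub> z"


section \<open>The noncommutative polynomials of the decomposition operators\<close>

text \<open>
  The letter \<open>\<omega>\<^sub>i\<^sub>j\<close> is the two-element set \<open>{i, j}\<close>, and elements of the free associative ring
  are integral combinations of words.
\<close>

definition append_letter :: "(nat set list \<Rightarrow>\<^sub>0 int) \<Rightarrow> nat set \<Rightarrow> (nat set list \<Rightarrow>\<^sub>0 int)" where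
  "append_letter p e = frag_extend (\<lambda>w. frag_of (w @ [e])) p"

definition delete_nth :: "nat \<Rightarrow> 'a list \<Rightarrow> 'a list" where
  "delete_nth i xs = take i xs @ drop (Suc i) xs"

text \<open>Only lists of length at least two are meaningful arguments of \<open>SS\<close>.\<close>

function SS :: "nat list \<Rightarrow> (nat set list \<Rightarrow>\<^sub>0 int)" where
  "SS s =
     (if length s < 2 then 0
      else if length s = 2 then frag_of [{s ! 0, s ! 1}]
      else let n = length s - 1 in
        append_letter (SS (butlast s)) {s ! 0, s ! n}
        - (\<Sum>i\<in>{1..n - 1}. append_letter (SS (delete_nth (i + 1) s)) {s ! i, s ! (i + 1)})
        + (\<Sum>i\<in>{1..n - 1}. append_letter (SS (delete_nth i s)) {s ! i, s ! (i + 1)}))"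
  by auto
termination
  by (relation "measure length") (auto simp: delete_nth_def)

declare SS.simps [simp del]


section \<open>Steinberg modules and formal correlators\<close>

text \<open>The ambient vector space \<open>V\<close> is the whole type; subspaces are sets.\<close>

locale steinberg_space = vector_space scale
  for scale :: "'a::field \<Rightarrow> 'b::ab_group_add \<Rightarrow> 'b" (infixr \<open>*s\<close> 75)
begin

definition basis_tuple :: "'b set \<Rightarrow> 'b list \<Rightarrow> bool" where
  "basis_tuple W v \<longleftrightarrow> distinct v \<and> independent (set v) \<and> span (set v) = W"

definition tits_poset :: "'b set \<Rightarrow> 'b set set" where
  "tits_poset W = {U. subspace U \<and> U \<noteq> {0} \<and> U \<subset> W}"

text \<open>
  Degree \<open>dim W - 2\<close> of the nerve, that is, chains of \<open>dim W - 1\<close> subspaces.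
\<close>

definition St :: "'b set \<Rightarrow> (rat, ('b set list \<Rightarrow>\<^sub>0 rat) set) module" where
  "St W = reduced_homology (tits_poset W) (dim W - 1)"

text \<open>
  The fundamental cycle of the apartment of a basis \<open>v\<close>: the signed sum over all orderings of
  \<open>v\<close> of the flags spanned by proper nonempty initial segments.
\<close>

definition apartment_cycle :: "'b list \<Rightarrow> ('b set list \<Rightarrow>\<^sub>0 rat)" where
  "apartment_cycle v =
     (\<Sum>\<sigma> | \<sigma> permutes {..<length v}.
        Poly_Mapping.single
          (map (\<lambda>k. span ((\<lambda>i. v ! \<sigma> i) ` {..<k})) [1..<length v])
          (of_int (sign \<sigma>)))"

definition apartment :: "'b set \<Rightarrow> 'b list \<Rightarrow> ('b set list \<Rightarrow>\<^sub>0 rat) set" where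
  "apartment W v =
     (if distinct v \<and> independent (set v)
      then order_boundaries (tits_poset W) (dim W - 1)
             +>\<^bsub>order_chains (tits_poset W) (dim W - 1)\<^esub> apartment_cycle v
      else \<zero>\<^bsub>St W\<^esub>)"

definition "St2 W = tensor (St W) (St W)"

definition "apartment2 W v w = pure_tensor (St W) (St W) (apartment W v) (apartment W w)"

definition tuples :: "'b set \<Rightarrow> 'b list set" where
  "tuples W = {v. set v \<subseteq> W \<and> length v = dim W}"

text \<open>
  The linear map with source \<open>St2 V1 \<otimes> St2 V2\<close> that concatenates apartments in both factors.
  As apartments generate, it is determined by this property on the source; outside the source
  its value is fixed by extensionality.
\<close>

definition "concat_product V1 V2 =
  (THE \<Phi>. \<Phi> \<in> linear_maps (tensor (St2 V1) (St2 V2)) (St2 (span (V1 \<union> V2))) \<and>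
      \<Phi> \<in> extensional (carrier (tensor (St2 V1) (St2 V2))) \<and>
      (\<forall>a\<in>tuples V1. \<forall>a'\<in>tuples V1. \<forall>b\<in>tuples V2. \<forall>b'\<in>tuples V2.
         \<Phi> (pure_tensor (St2 V1) (St2 V2) (apartment2 V1 a a') (apartment2 V2 b b'))
         = apartment2 (span (V1 \<union> V2)) (a @ b) (a' @ b')))"

definition decompositions :: "('b set \<times> 'b set) set" where
  "decompositions =
     {(V1, V2). subspace V1 \<and> subspace V2 \<and> V1 \<noteq> {0} \<and> V2 \<noteq> {0} \<and>
        V1 \<inter> V2 = {0} \<and> span (V1 \<union> V2) = UNIV}"

definition "decomposables =
  submodule_hull (St2 UNIV)
    (\<Union>(V1, V2)\<in>decompositions. concat_product V1 V2 ` carrier (tensor (St2 V1) (St2 V2)))"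

definition "St_infty = quot_module (St2 UNIV) decomposables"

definition "St_infty_proj x = decomposables +>\<^bsub>St2 UNIV\<^esub> x"

definition affine_basis :: "'b list \<Rightarrow> bool" where
  "affine_basis u \<longleftrightarrow> u \<noteq> [] \<and> basis_tuple UNIV (map (\<lambda>x. x - hd u) (tl u))"

definition FC_relations :: "('b list \<Rightarrow>\<^sub>0 rat) set" where
  "FC_relations =
     {Poly_Mapping.single u 1 - Poly_Mapping.single (map (\<lambda>x. x - t) u) 1
        | u t. affine_basis u} \<union>
     {Poly_Mapping.single (x # xs) 1 - Poly_Mapping.single (xs @ [x]) 1
        | x xs. affine_basis (x # xs)} \<union>
     {\<Sum>w\<in>shuffles xs ys. Poly_Mapping.single (x # w) 1
        | x xs ys. affine_basis (x # xs @ ys) \<and> xs \<noteq> [] \<and> ys \<noteq> []}"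

definition FC_hull :: "('b list \<Rightarrow>\<^sub>0 rat) set" where
  "FC_hull = submodule_hull (free_module (Collect affine_basis)) FC_relations"

definition FC :: "(rat, ('b list \<Rightarrow>\<^sub>0 rat) set) module" where
  "FC = quot_module (free_module (Collect affine_basis)) FC_hull"

definition FC_symbol :: "'b list \<Rightarrow> ('b list \<Rightarrow>\<^sub>0 rat) set" where
  "FC_symbol u = FC_hull +>\<^bsub>free_module (Collect affine_basis)\<^esub> Poly_Mapping.single u 1"

definition "pr_St_symbol u =
  (let n = length u - 1 in
     St_infty_proj
       (apartment2 UNIV
          (map (\<lambda>i. u ! i - u ! 0) (rev [1..<n + 1]))
          ((u ! n - u ! 0) # map (\<lambda>i. u ! i - u ! (i + 1)) (rev [1..<n]))))"

definition "pr_St = induced_map (lin_ext St_infty pr_St_symbol)"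

definition edge_vector :: "'b list \<Rightarrow> nat set \<Rightarrow> 'b" where
  "edge_vector u e = u ! Min e - u ! Max e"

text \<open>
  The sign with which a word \<open>\<iota>\<close> occurs is its coefficient in \<open>SS [0, \<dots>, n]\<close>. The vector
  \<open>(u\<^sub>i - u\<^sub>j) / h (u\<^sub>i - u\<^sub>j)\<close> does not depend on the order of \<open>i\<close> and \<open>j\<close>.
\<close>

definition D_symbol :: "('b \<Rightarrow> 'a) \<Rightarrow> 'b list \<Rightarrow> ('b list \<Rightarrow>\<^sub>0 rat) set" where
  "D_symbol h u =
     (\<Oplus>\<^bsub>FC\<^esub>\<iota>\<in>{\<iota> \<in> Poly_Mapping.keys (SS [0..<length u]).
                 \<forall>e\<in>set \<iota>. h (edge_vector u e) \<noteq> 0}.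
        of_int (Poly_Mapping.lookup (SS [0..<length u]) \<iota>) \<odot>\<^bsub>FC\<^esub>
        FC_symbol (0 # map (\<lambda>e. inverse (h (edge_vector u e)) *s edge_vector u e) \<iota>))"

definition D :: "('b \<Rightarrow> 'a) \<Rightarrow> ('b list \<Rightarrow>\<^sub>0 rat) set \<Rightarrow> ('b list \<Rightarrow>\<^sub>0 rat) set" where
  "D h = induced_map (lin_ext FC (D_symbol h))"

definition Dec :: "('b \<Rightarrow> 'a) set" where
  "Dec = {h. Vector_Spaces.linear scale (*) h \<and> h \<noteq> (\<lambda>x. 0)}"

definition Dec_mult :: "('b \<Rightarrow> 'a) \<Rightarrow> ('b \<Rightarrow> 'a) \<Rightarrow> ('b \<Rightarrow> 'a)" where
  "Dec_mult h1 h2 = h1"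

definition "H_Dec_FC p = semigroup_homology Dec Dec_mult D FC p"

text \<open>The class in \<open>H\<^sub>0\<close> of an element of \<open>FC\<close>, regarded as a bar chain of degree zero.\<close>

definition "H0_class m = homology_class Dec Dec_mult D FC 0 (bar_elem FC [] m)"

end

end

theory Submission
  imports Defs
begin

text \<open>
  For \<open>h\<close> in \<open>Dec\<close>, two opposite flags in general position have a unique frame of vectors on which
  \<open>h\<close> is \<open>1\<close>. Summing over these frames gives a bilinear map from pairs of cycles on full flags to
  formal correlators; it sends decomposable pairs to shuffles and hence induces
  \<open>T\<^sub>h\<close> from \<open>St_infty\<close> to \<open>FC\<close>. The recursion that defines \<open>SS\<close> is the expansion of the pair of
  apartments of a symbol at the last line of the frame, so \<open>D h\<close> is \<open>T\<^sub>h\<close> after \<open>pr_St\<close>.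

  Conversely \<open>pr_St\<close> is a left inverse of every \<open>T\<^sub>h\<close>: three-term relations and expansions along a
  vector reduce each pair of apartments, modulo decomposable ones, to pairs of symbols of frames
  on which \<open>h\<close> is \<open>1\<close>. The cyclic relation for \<open>pr_St\<close> follows from this by a suitable choice of \<open>h\<close>.
  Hence every \<open>D h\<close> has the kernel of \<open>pr_St\<close>.

  As \<open>h\<^sub>1 h\<^sub>2 = h\<^sub>1\<close> in \<open>Dec\<close>, prepending a fixed element contracts the bar complex in positive
  degrees, and in degree zero the homology is the image of \<open>pr_St\<close>.
\<close>

section \<open>Finitely supported rational functions: linear extension and pushforward\<close>

section \<open>Rational combinations\<close>

text \<open>\<open>pr_St\<close> and \<open>D h\<close> are defined through
  \<open>induced_map\<close>, and \<open>concat_product\<close> through a description, so that they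
  are well defined has to be shown. For \<open>pr_St\<close> translations and shuffles can be
  checked directly, but the cyclic relation is not visible on apartments, and neither are the
  relations of \<open>FC\<close> under \<open>D h\<close>. Therefore the identity that
  \<open>pr_St\<close> inverts \<open>T\<^sub>h\<close> is proved for formal combinations of affine
  bases, using decomposable pairs and shuffle relations only; the cyclic relation is then a
  consequence, and \<open>D h\<close> descends because it factors through \<open>pr_St\<close>.
  Apartments are compared through coefficients. In the top degree there are no boundaries, so a
  Steinberg class is a cycle, determined by its values on full flags. In dimension at least two a
  nonzero cycle contains a flag whose hyperplane omits a given nonzero vector; generation by
  apartments and the expansion along a vector both rest on this. The sign in
  \<open>T\<^sub>h\<close> is that of a reversal of order, because the second flag is read from the
  end of the frame.\<close>

definition pscale :: "rat \<Rightarrow> ('x \<Rightarrow>\<^sub>0 rat) \<Rightarrow> ('x \<Rightarrow>\<^sub>0 rat)" where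
  "pscale c = Poly_Mapping.map ((*) c)"

abbreviation psingle :: "'x \<Rightarrow> ('x \<Rightarrow>\<^sub>0 rat)" where
  "psingle x \<equiv> Poly_Mapping.single x 1"

lemma lookup_pscale [simp]:
  "Poly_Mapping.lookup (pscale c p) x = c * Poly_Mapping.lookup p x"
  by (simp add: pscale_def Poly_Mapping.map.rep_eq when_def)

lemma pscale_single [simp]: "pscale c (Poly_Mapping.single x d) = Poly_Mapping.single x (c * d)"
  by (auto intro!: poly_mapping_eqI simp: lookup_single when_def)

interpretation pm: vector_space "pscale :: rat \<Rightarrow> ('x \<Rightarrow>\<^sub>0 rat) \<Rightarrow> _"
  by unfold_locales
    (auto intro!: poly_mapping_eqI simp: lookup_add algebra_simps)

interpretation pmp: vector_space_pair
  "pscale :: rat \<Rightarrow> ('x \<Rightarrow>\<^sub>0 rat) \<Rightarrow> _" "pscale :: rat \<Rightarrow> ('y \<Rightarrow>\<^sub>0 rat) \<Rightarrow> _"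
  by unfold_locales

abbreviation plinear :: "(('x \<Rightarrow>\<^sub>0 rat) \<Rightarrow> ('y \<Rightarrow>\<^sub>0 rat)) \<Rightarrow> bool" where
  "plinear \<equiv> Vector_Spaces.linear pscale pscale"

lemma single_eq_pscale: "Poly_Mapping.single x c = pscale c (psingle x)"
  by simp

lemma keys_pscale: "Poly_Mapping.keys (pscale c p) \<subseteq> Poly_Mapping.keys p"
  by (auto simp: in_keys_iff)

text \<open>Counterpart of \<open>lin_ext\<close> for targets that are again spaces of finitely
  supported functions (\<open>lin_ext_free\<close>). The sums are those of the type, so no carrier
  conditions arise.\<close>

definition plin :: "('x \<Rightarrow> ('y \<Rightarrow>\<^sub>0 rat)) \<Rightarrow> ('x \<Rightarrow>\<^sub>0 rat) \<Rightarrow> ('y \<Rightarrow>\<^sub>0 rat)" where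
  "plin g p = (\<Sum>x\<in>Poly_Mapping.keys p. pscale (Poly_Mapping.lookup p x) (g x))"

lemma plin_superset:
  assumes "finite S" "Poly_Mapping.keys p \<subseteq> S"
  shows "plin g p = (\<Sum>x\<in>S. pscale (Poly_Mapping.lookup p x) (g x))"
  unfolding plin_def
  by (rule sum.mono_neutral_left[OF assms]) (auto simp: in_keys_iff)

lemma plin_add: "plin g (p + q) = plin g p + plin g q"
proof -
  let ?S = "Poly_Mapping.keys p \<union> Poly_Mapping.keys q"
  have "Poly_Mapping.keys (p + q) \<subseteq> ?S" by (rule keys_add)
  thus ?thesis
    by (simp add: plin_superset[of ?S] lookup_add pm.scale_left_distrib sum.distrib)
qed

lemma plin_scale: "plin g (pscale c p) = pscale c (plin g p)"
proof -
  have "plin g (pscale c p) =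
      (\<Sum>x\<in>Poly_Mapping.keys p. pscale (Poly_Mapping.lookup (pscale c p) x) (g x))"
    by (rule plin_superset) (auto simp: keys_pscale)
  thus ?thesis by (simp add: plin_def pm.scale_sum_right)
qed

lemma linear_plin [simp, intro]: "plinear (plin g)"
  by unfold_locales (auto simp: plin_add plin_scale)

lemmas plin_simps =
  pmp.linear_0[OF linear_plin] plin_add plin_scale pmp.linear_diff[OF linear_plin]
  pmp.linear_neg[OF linear_plin] pmp.linear_sum[OF linear_plin]

lemma plin_single [simp]: "plin g (Poly_Mapping.single x c) = pscale c (g x)"
  by (cases "c = 0") (simp_all add: plin_def)

lemma plin_cong: "(\<And>x. x \<in> Poly_Mapping.keys p \<Longrightarrow> g x = g' x) \<Longrightarrow> plin g p = plin g' p"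
  by (simp add: plin_def)

lemma plinear_plin: "plinear f \<Longrightarrow> f (plin g p) = plin (\<lambda>x. f (g x)) p"
  by (simp add: plin_def pmp.linear_sum pmp.linear_scale)

lemma plin_plin: "plin f (plin g p) = plin (\<lambda>x. plin f (g x)) p"
  by (rule plinear_plin) simp

lemma plin_psingle [simp]: "plin psingle p = p"
proof (rule poly_mapping_eqI)
  fix x
  have "Poly_Mapping.lookup (plin psingle p) x =
      (\<Sum>y\<in>Poly_Mapping.keys p. if y = x then Poly_Mapping.lookup p y else 0)"
    unfolding plin_def lookup_sum by (rule sum.cong) (auto simp: lookup_single when_def)
  thus "Poly_Mapping.lookup (plin psingle p) x = Poly_Mapping.lookup p x"
    by (simp add: in_keys_iff)
qed

lemma lookup_plin:
  "Poly_Mapping.lookup (plin g p) y =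
     (\<Sum>x\<in>Poly_Mapping.keys p. Poly_Mapping.lookup p x * Poly_Mapping.lookup (g x) y)"
  by (simp add: plin_def lookup_sum)

lemma keys_plin:
  "Poly_Mapping.keys (plin g p) \<subseteq> (\<Union>x\<in>Poly_Mapping.keys p. Poly_Mapping.keys (g x))"
proof
  fix y assume "y \<in> Poly_Mapping.keys (plin g p)"
  hence "(\<Sum>x\<in>Poly_Mapping.keys p. Poly_Mapping.lookup p x * Poly_Mapping.lookup (g x) y) \<noteq> 0"
    by (simp add: in_keys_iff lookup_plin)
  then obtain x where "x \<in> Poly_Mapping.keys p"
    "Poly_Mapping.lookup p x * Poly_Mapping.lookup (g x) y \<noteq> 0"
    by (meson sum.neutral)
  thus "y \<in> (\<Union>x\<in>Poly_Mapping.keys p. Poly_Mapping.keys (g x))"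
    by (auto simp: in_keys_iff)
qed

definition push :: "('x \<Rightarrow> 'y) \<Rightarrow> ('x \<Rightarrow>\<^sub>0 rat) \<Rightarrow> ('y \<Rightarrow>\<^sub>0 rat)" where
  "push f = plin (\<lambda>x. psingle (f x))"

lemma linear_push [simp, intro]: "plinear (push f)"
  by (simp add: push_def)

lemmas push_simps =
  pmp.linear_0[OF linear_push] pmp.linear_add[OF linear_push] pmp.linear_scale[OF linear_push]
  pmp.linear_diff[OF linear_push] pmp.linear_neg[OF linear_push] pmp.linear_sum[OF linear_push]

lemma push_single [simp]: "push f (Poly_Mapping.single x c) = Poly_Mapping.single (f x) c"
  by (simp add: push_def single_eq_pscale[symmetric])

lemma push_push: "push f (push g p) = push (\<lambda>x. f (g x)) p"
  by (simp add: push_def plin_plin)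

lemma plin_push: "plin f (push g p) = plin (\<lambda>x. f (g x)) p"
  by (simp add: push_def plin_plin)

lemma push_plin: "push f (plin g p) = plin (\<lambda>x. push f (g x)) p"
  by (simp add: push_def plin_plin)

lemma push_cong: "(\<And>x. x \<in> Poly_Mapping.keys p \<Longrightarrow> f x = g x) \<Longrightarrow> push f p = push g p"
  unfolding push_def by (rule plin_cong) simp

lemma keys_push: "Poly_Mapping.keys (push f p) \<subseteq> f ` Poly_Mapping.keys p"
  using keys_plin[of "\<lambda>x. psingle (f x)" p] by (auto simp: push_def)

lemma lookup_push:
  "Poly_Mapping.lookup (push f p) y =
     (\<Sum>x | x \<in> Poly_Mapping.keys p \<and> f x = y. Poly_Mapping.lookup p x)"
proof -
  have "Poly_Mapping.lookup (push f p) y =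
      (\<Sum>x\<in>Poly_Mapping.keys p. if f x = y then Poly_Mapping.lookup p x else 0)"
    unfolding push_def lookup_plin by (rule sum.cong) (auto simp: lookup_single when_def)
  thus ?thesis by (simp add: sum.If_cases Int_def)
qed

lemma lookup_push_inj:
  assumes "inj f"
  shows "Poly_Mapping.lookup (push f p) (f x) = Poly_Mapping.lookup p x"
proof -
  have "{y. y \<in> Poly_Mapping.keys p \<and> f y = f x} = (if x \<in> Poly_Mapping.keys p then {x} else {})"
    using assms by (auto dest: injD)
  thus ?thesis by (auto simp: lookup_push in_keys_iff)
qed

lemma subspace_keys: "pm.subspace {p. Poly_Mapping.keys p \<subseteq> X}"
  unfolding pm.subspace_def
  by (auto dest!: subsetD[OF keys_add] subsetD[OF keys_pscale])

section \<open>Antisymmetrisation of a list of vectors or indices\<close>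

section \<open>Signed sums over the orderings of a list\<close>

definition ins :: "'x \<Rightarrow> 'x list \<Rightarrow> ('x list \<Rightarrow>\<^sub>0 rat)" where
  "ins w l = (\<Sum>k\<le>length l. Poly_Mapping.single (take k l @ w # drop k l) ((- 1) ^ k))"

text \<open>Antisymmetrisation: all orderings of a list with their signs. The recursion applies to
  lists with repetitions as well, where orderings are counted by positions; for distinct lists
  \<open>alt_distinct\<close> gives the sum over permutations.\<close>

primrec alt :: "'x list \<Rightarrow> ('x list \<Rightarrow>\<^sub>0 rat)" where
  "alt [] = psingle []"
| "alt (w # x) = plin (ins w) (alt x)"

lemma alt_keys: "l \<in> Poly_Mapping.keys (alt v) \<Longrightarrow> mset l = mset v"
proof (induction v arbitrary: l)
  case (Cons w x)
  then obtain l0 where l0: "l0 \<in> Poly_Mapping.keys (alt x)" "l \<in> Poly_Mapping.keys (ins w l0)"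
    using keys_plin[of "ins w" "alt x"] by auto
  from l0(2) obtain k where "l = take k l0 @ w # drop k l0"
    using keys_sum[of "\<lambda>k. Poly_Mapping.single (take k l0 @ w # drop k l0) ((- 1) ^ k::rat)"
        "{..length l0}"] by (auto simp: ins_def split: if_splits)
  moreover have "mset (take k l0) + mset (drop k l0) = mset l0"
    by (metis append_take_drop_id mset_append)
  ultimately show ?case using Cons.IH[OF l0(1)] by simp
qed auto

lemma alt_keys_set: "l \<in> Poly_Mapping.keys (alt v) \<Longrightarrow> set l = set v"
  by (metis alt_keys mset_eq_setD)

lemma alt_keys_length: "l \<in> Poly_Mapping.keys (alt v) \<Longrightarrow> length l = length v"
  by (metis alt_keys mset_eq_length)

lemma alt_keys_distinct: "l \<in> Poly_Mapping.keys (alt v) \<Longrightarrow> distinct l \<longleftrightarrow> distinct v"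
  by (metis alt_keys mset_eq_imp_distinct_iff)

lemma ins_map: "ins (f w) (map f l) = push (map f) (ins w l)"
  by (simp add: ins_def push_simps take_map drop_map)

text \<open>Naturality. It reduces statements about arbitrary lists to the list of their indices,
  which is distinct.\<close>

lemma alt_map: "alt (map f v) = push (map f) (alt v)"
  by (induction v) (simp_all add: push_plin plin_push ins_map)

lemma alt_Cons_eq:
  "alt (w # x) =
     (\<Sum>k\<le>length x. pscale ((- 1) ^ k) (push (\<lambda>l. take k l @ w # drop k l) (alt x)))"
proof -
  have "plin (ins w) (alt x) =
      plin (\<lambda>l. \<Sum>k\<le>length x. Poly_Mapping.single (take k l @ w # drop k l) ((- 1) ^ k)) (alt x)"
    by (rule plin_cong) (simp add: ins_def alt_keys_length)
  also have "\<dots> =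
      (\<Sum>k\<le>length x. plin (\<lambda>l. Poly_Mapping.single (take k l @ w # drop k l) ((- 1) ^ k)) (alt x))"
    by (simp add: plin_def pm.scale_sum_right sum.swap[of _ "{..length x}"] del: pscale_single)
  also have "\<dots> = (\<Sum>k\<le>length x. pscale ((- 1) ^ k) (push (\<lambda>l. take k l @ w # drop k l) (alt x)))"
    by (rule sum.cong)
      (simp_all add: push_def plin_def pm.scale_sum_right mult.commute)
  finally show ?thesis by simp
qed

definition sw :: "nat \<Rightarrow> 'x list \<Rightarrow> 'x list" where
  "sw p l = l[p := l ! Suc p, Suc p := l ! p]"

lemma length_sw [simp]: "length (sw p l) = length l"
  by (simp add: sw_def)

lemma map_sw: "Suc p < length l \<Longrightarrow> map f (sw p l) = sw p (map f l)"
  by (simp add: sw_def map_update)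

lemma sw_append: "sw (length xs) (xs @ x # y # ys) = xs @ y # x # ys"
  by (simp add: sw_def list_update_append nth_append)


lemma map_transpose_eq_sw:
  assumes "distinct v" "Suc p < length v"
  shows "map (\<sigma> \<circ> transpose (v ! p) (v ! Suc p)) v = sw p (map \<sigma> v)"
  using assms
  by (intro nth_equalityI)
    (auto simp: sw_def nth_list_update transpose_def nth_eq_iff_index_eq)

lemma sign_compose_transpose:
  assumes "\<sigma> permutes S" "finite S" "a \<noteq> b"
  shows "sign (\<sigma> \<circ> transpose a b) = - sign \<sigma>"
proof -
  have "permutation \<sigma>" using assms(1,2) by (auto simp: permutation_permutes)
  thus ?thesis using assms(3) by (simp add: sign_compose permutation_swap_id sign_swap_id)
qed

lemma alt_distinct:
  assumes "distinct v"
  shows "alt v = (\<Sum>\<sigma> | \<sigma> permutes set v. Poly_Mapping.single (map \<sigma> v) (of_int (sign \<sigma>)))"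
  using assms
proof (induction v)
  case Nil
  thus ?case by (simp add: permutes_empty sign_id)
next
  case (Cons w x)
  define v where "v = w # x"
  have dv: "distinct v" "length v = Suc (length x)" using Cons.prems by (auto simp: v_def)
  define f where "f \<sigma> = Poly_Mapping.single (map \<sigma> v) (of_int (sign \<sigma>) :: rat)" for \<sigma> :: "'a \<Rightarrow> 'a"
  \<comment> \<open>Permutations are sorted by the place \<open>k\<close> at which \<open>w\<close>
    appears in \<open>map \<sigma> v\<close>.\<close>
  define P where "P k = {\<sigma>. \<sigma> permutes set v \<and> \<sigma> (v ! k) = w}" for k
  have P0: "P 0 = {\<sigma>. \<sigma> permutes set x}"
  proof (intro equalityI subsetI)
    fix \<sigma> assume "\<sigma> \<in> P 0"
    hence "\<sigma> permutes set v" "\<forall>y\<in>set v - set x. \<sigma> y = y" by (auto simp: P_def v_def)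
    thus "\<sigma> \<in> {\<sigma>. \<sigma> permutes set x}" by (auto dest: permutes_superset)
  next
    fix \<sigma> assume "\<sigma> \<in> {\<sigma>. \<sigma> permutes set x}"
    hence "\<sigma> permutes set x" by simp
    moreover from this have "\<sigma> permutes set v" by (rule permutes_subset) (auto simp: v_def)
    ultimately show "\<sigma> \<in> P 0" using Cons.prems by (simp add: P_def v_def permutes_not_in)
  qed
  \<comment> \<open>Composition with the transposition of the entries \<open>k\<close> and
    \<open>k + 1\<close> maps \<open>P k\<close> onto \<open>P (Suc k)\<close>, reverses the sign
    and swaps neighbours in the list, which pushes \<open>w\<close> one place to the right.\<close>
  have T: "sum f (P k) = pscale ((- 1) ^ k) (push (\<lambda>l. take k l @ w # drop k l) (alt x))"
    if "k \<le> length x" for k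
    using that
  proof (induction k)
    case 0
    have "sum f (P 0) = push ((#) w) (alt x)"
      unfolding P0 using Cons.IH Cons.prems
      by (auto simp: push_simps f_def v_def permutes_not_in intro!: sum.cong)
    thus ?case by simp
  next
    case (Suc k)
    let ?t = "transpose (v ! k) (v ! Suc k)"
    have k: "Suc k < length v" using Suc.prems dv by simp
    have t: "?t permutes set v" using k by (intro permutes_swap_id) auto
    have "sum f (P (Suc k)) = sum (\<lambda>\<sigma>. f (\<sigma> \<circ> ?t)) (P k)"
      by (rule sum.reindex_bij_witness[where i = "\<lambda>\<sigma>. \<sigma> \<circ> ?t" and j = "\<lambda>\<sigma>. \<sigma> \<circ> ?t"])
        (use t in \<open>auto simp: P_def o_assoc comp_assoc intro!: permutes_compose\<close>)
    also have "\<dots> = sum (\<lambda>\<sigma>. - push (sw k) (f \<sigma>)) (P k)"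
    proof (rule sum.cong[OF refl])
      fix \<sigma> assume "\<sigma> \<in> P k"
      hence "\<sigma> permutes set v" by (simp add: P_def)
      hence "sign (\<sigma> \<circ> ?t) = - sign \<sigma>"
        using k dv(1) by (intro sign_compose_transpose) (auto simp: nth_eq_iff_index_eq)
      thus "f (\<sigma> \<circ> ?t) = - push (sw k) (f \<sigma>)"
        by (simp add: f_def map_transpose_eq_sw[OF dv(1) k] single_uminus del: map_map)
    qed
    also have "\<dots> = - push (sw k) (sum f (P k))"
      by (simp add: push_simps sum_negf)
    also have "\<dots> = pscale ((- 1) ^ Suc k) (push (\<lambda>l. sw k (take k l @ w # drop k l)) (alt x))"
      using Suc by (simp add: push_simps push_push)
    also have "push (\<lambda>l. sw k (take k l @ w # drop k l)) (alt x) =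
        push (\<lambda>l. take (Suc k) l @ w # drop (Suc k) l) (alt x)"
    proof (rule push_cong)
      fix l assume "l \<in> Poly_Mapping.keys (alt x)"
      hence l: "k < length l" using Suc.prems by (simp add: alt_keys_length)
      hence "take k l @ w # drop k l = take k l @ w # l ! k # drop (Suc k) l"
        by (simp add: Cons_nth_drop_Suc)
      hence "sw k (take k l @ w # drop k l) = take k l @ l ! k # w # drop (Suc k) l"
        using sw_append[of "take k l"] l by simp
      thus "sw k (take k l @ w # drop k l) = take (Suc k) l @ w # drop (Suc k) l"
        using l by (simp add: take_Suc_conv_app_nth)
    qed
    finally show ?case .
  qed
  have "sum f {\<sigma>. \<sigma> permutes set v} =
      (\<Sum>\<sigma> | \<sigma> permutes set v. \<Sum>k | k \<in> {..length x} \<and> \<sigma> (v ! k) = w. f \<sigma>)"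
  proof (rule sum.cong[OF refl])
    fix \<sigma> assume s: "\<sigma> \<in> {\<sigma>. \<sigma> permutes set v}"
    hence "\<sigma> ` set v = set v" by (simp add: permutes_image)
    then obtain k where k: "k < length v" "\<sigma> (v ! k) = w"
      by (metis imageE in_set_conv_nth list.set_intros(1) v_def)
    have "{k. k \<in> {..length x} \<and> \<sigma> (v ! k) = w} = {k}"
    proof -
      have "k' = k" if "k' \<le> length x" "\<sigma> (v ! k') = w" for k'
      proof -
        have "v ! k' = v ! k" using that k s by (metis mem_Collect_eq permutes_inj injD)
        thus ?thesis using that k dv by (simp add: nth_eq_iff_index_eq)
      qed
      thus ?thesis using k dv by auto
    qed
    thus "f \<sigma> = (\<Sum>k | k \<in> {..length x} \<and> \<sigma> (v ! k) = w. f \<sigma>)" by simp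
  qed
  also have "\<dots> = (\<Sum>k\<le>length x. sum f (P k))"
    by (subst sum.swap_restrict) (auto simp: P_def finite_permutations)
  also have "\<dots> = alt v" unfolding v_def alt_Cons_eq by (simp add: T v_def)
  finally show ?case by (simp add: f_def v_def)
qed

lemma push_sw_alt_distinct:
  assumes "distinct v" "Suc p < length v"
  shows "push (sw p) (alt v) = - alt v" "alt (sw p v) = - alt v"
proof -
  let ?t = "transpose (v ! p) (v ! Suc p)"
  have t: "?t permutes set v" using assms by (intro permutes_swap_id) auto
  define f where "f \<sigma> = Poly_Mapping.single (map \<sigma> v) (of_int (sign \<sigma>) :: rat)" for \<sigma> :: "'a \<Rightarrow> 'a"
  have alt: "alt v = sum f {\<sigma>. \<sigma> permutes set v}"
    using alt_distinct[OF assms(1)] by (simp add: f_def)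
  have "alt v = sum (\<lambda>\<sigma>. f (\<sigma> \<circ> ?t)) {\<sigma>. \<sigma> permutes set v}"
    unfolding alt by (rule sum_permutations_compose_right[OF t])
  also have "\<dots> = sum (\<lambda>\<sigma>. - push (sw p) (f \<sigma>)) {\<sigma>. \<sigma> permutes set v}"
  proof (rule sum.cong[OF refl])
    fix \<sigma> assume "\<sigma> \<in> {\<sigma>. \<sigma> permutes set v}"
    hence "\<sigma> permutes set v" by simp
    hence "sign (\<sigma> \<circ> ?t) = - sign \<sigma>"
      using assms by (intro sign_compose_transpose) (auto simp: nth_eq_iff_index_eq)
    thus "f (\<sigma> \<circ> ?t) = - push (sw p) (f \<sigma>)"
      by (simp add: f_def map_transpose_eq_sw[OF assms] single_uminus del: map_map)
  qed
  also have "\<dots> = - push (sw p) (alt v)" by (simp add: alt push_simps sum_negf)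
  finally show *: "push (sw p) (alt v) = - alt v" by (metis minus_minus)
  have "sw p v = map ?t v"
    using map_transpose_eq_sw[OF assms, of id] by simp
  hence dsw: "distinct (sw p v)" "set (sw p v) = set v"
    using assms t by (simp_all add: distinct_map permutes_inj_on permutes_image)
  have "alt (sw p v) = (\<Sum>\<sigma> | \<sigma> permutes set v. push (sw p) (f \<sigma>))"
    unfolding alt_distinct[OF dsw(1)] dsw(2) using assms by (simp add: f_def map_sw)
  also have "\<dots> = push (sw p) (alt v)" by (simp add: alt push_simps)
  finally show "alt (sw p v) = - alt v" using * by simp
qed

text \<open>A list with repetitions is the image of the distinct list of its indices, where the
  claim is the sign rule for an adjacent transposition.\<close>

lemma push_sw_alt: "Suc p < length v \<Longrightarrow> push (sw p) (alt v) = - alt v"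
  and alt_sw: "Suc p < length v \<Longrightarrow> alt (sw p v) = - alt v"
proof -
  assume p: "Suc p < length v"
  let ?s = "[0..<length v]"
  have v: "v = map ((!) v) ?s" by (simp add: map_nth)
  have s: "push (sw p) (alt ?s) = - alt ?s" "alt (sw p ?s) = - alt ?s"
    using p by (auto intro!: push_sw_alt_distinct)
  have "push (sw p) (alt v) = push (\<lambda>l. sw p (map ((!) v) l)) (alt ?s)"
    by (subst v, subst alt_map) (simp add: push_push)
  also have "\<dots> = push (\<lambda>l. map ((!) v) (sw p l)) (alt ?s)"
    using p by (intro push_cong) (simp add: map_sw alt_keys_length)
  also have "\<dots> = push (map ((!) v)) (push (sw p) (alt ?s))" by (simp add: push_push)
  also have "\<dots> = - alt (map ((!) v) ?s)" by (simp add: s push_simps alt_map)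
  finally show "push (sw p) (alt v) = - alt v" by (simp add: map_nth)
  have "alt (sw p v) = alt (map ((!) v) (sw p ?s))"
    using p by (simp add: map_sw map_nth)
  also have "\<dots> = - alt (map ((!) v) ?s)" by (simp add: alt_map s push_simps)
  finally show "alt (sw p v) = - alt v" by (simp add: map_nth)
qed

lemma alt_swap: "alt (xs @ x # y # ys) = - alt (xs @ y # x # ys)"
  using alt_sw[of "length xs" "xs @ y # x # ys"] by (simp add: sw_append)

text \<open>One sign for each entry of \<open>xs\<close> that \<open>x\<close> passes.\<close>

lemma alt_move: "alt (xs @ x # ys) = pscale ((- 1) ^ length xs) (alt (x # xs @ ys))"
proof (induction xs arbitrary: ys rule: rev_induct)
  case (snoc y xs)
  have "alt ((xs @ [y]) @ x # ys) = - alt (xs @ x # y # ys)" using alt_swap[of xs y x ys] by simp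
  also have "\<dots> = - pscale ((- 1) ^ length xs) (alt (x # xs @ y # ys))"
    using snoc.IH[of "y # ys"] by (simp del: alt.simps)
  finally show ?case by (simp add: pm.scale_minus_left del: alt.simps)
qed simp

lemma delete_nth_Cons_0 [simp]: "delete_nth 0 (x # xs) = xs"
  and delete_nth_Cons_Suc [simp]: "delete_nth (Suc i) (x # xs) = x # delete_nth i xs"
  and length_delete_nth [simp]: "i < length xs \<Longrightarrow> length (delete_nth i xs) = length xs - 1"
  by (auto simp: delete_nth_def)

lemma map_delete_nth: "map f (delete_nth i xs) = delete_nth i (map f xs)"
  by (simp add: delete_nth_def take_map drop_map)

lemma delete_nth_append:
  "delete_nth i (xs @ ys) =
     (if i < length xs then delete_nth i xs @ ys else xs @ delete_nth (i - length xs) ys)"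
  by (simp add: delete_nth_def Suc_diff_le)

lemma set_delete_nth_subset: "set (delete_nth i xs) \<subseteq> set xs"
  using set_take_subset set_drop_subset by (fastforce simp: delete_nth_def)

lemma insert_set_delete_nth: "i < length xs \<Longrightarrow> insert (xs ! i) (set (delete_nth i xs)) = set xs"
  by (metis Un_insert_right delete_nth_def id_take_nth_drop list.simps(15) set_append)

lemma alt_delete: "i < length x \<Longrightarrow> alt x = pscale ((- 1) ^ i) (alt (x ! i # delete_nth i x))"
  using alt_move[of "take i x" "x ! i" "drop (Suc i) x"]
  by (simp add: id_take_nth_drop[symmetric] delete_nth_def)

text \<open>Orderings grouped by their last entry, dual to the recursion of \<open>alt\<close>,
  which inserts the first entry of the list. In the induction either \<open>w\<close> comes last, or
  it is inserted somewhere before the last entry, and this commutes with the choice of that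
  entry.\<close>

lemma alt_last:
  assumes "x \<noteq> []"
  shows "alt x = (\<Sum>i<length x. pscale ((- 1) ^ (length x - 1 - i))
                    (push (\<lambda>l. l @ [x ! i]) (alt (delete_nth i x))))"
  using assms
proof (induction x)
  case (Cons w x)
  show ?case
  proof (cases "x = []")
    case True
    thus ?thesis by (simp add: ins_def)
  next
    case False
    define n where "n = length x"
    have n: "n > 0" using False by (simp add: n_def)
    let ?I = "\<lambda>k l. take k l @ w # drop k l"
    have "alt (w # x) = pscale ((- 1) ^ n) (push (\<lambda>l. ?I n l) (alt x))
        + (\<Sum>k<n. pscale ((- 1) ^ k) (push (?I k) (alt x)))"
      unfolding alt_Cons_eq n_def[symmetric]
      using sum.lessThan_Suc[of "\<lambda>k. pscale ((- 1) ^ k) (push (?I k) (alt x))" n]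
      by (simp add: lessThan_Suc_atMost add.commute)
    also have "push (\<lambda>l. ?I n l) (alt x) = push (\<lambda>l. l @ [w]) (alt x)"
      by (rule push_cong) (simp add: alt_keys_length n_def)
    also have "(\<Sum>k<n. pscale ((- 1) ^ k) (push (?I k) (alt x))) =
        (\<Sum>i<n. pscale ((- 1) ^ (n - 1 - i)) (push (\<lambda>l. l @ [x ! i]) (alt (w # delete_nth i x))))"
    proof -
      have "(\<Sum>k<n. pscale ((- 1) ^ k) (push (?I k) (alt x))) =
          (\<Sum>k<n. \<Sum>i<n. pscale ((- 1) ^ k * (- 1) ^ (n - 1 - i))
             (push (\<lambda>l. ?I k (l @ [x ! i])) (alt (delete_nth i x))))"
        unfolding Cons.IH[OF False] n_def[symmetric]
        by (simp add: push_simps push_push pm.scale_sum_right)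
      also have "\<dots> = (\<Sum>i<n. \<Sum>k<n. pscale ((- 1) ^ k * (- 1) ^ (n - 1 - i))
             (push (\<lambda>l. ?I k (l @ [x ! i])) (alt (delete_nth i x))))"
        by (rule sum.swap)
      also have "\<dots> = (\<Sum>i<n. pscale ((- 1) ^ (n - 1 - i))
          (push (\<lambda>l. l @ [x ! i]) (alt (w # delete_nth i x))))"
      proof (rule sum.cong[OF refl])
        fix i assume "i \<in> {..<n}"
        hence i: "i < n" by simp
        have len: "length (delete_nth i x) = n - 1" using i by (simp add: n_def)
        have S: "{..<n} = {..n - 1}" using n by auto
        show "(\<Sum>k<n. pscale ((- 1) ^ k * (- 1) ^ (n - 1 - i))
             (push (\<lambda>l. ?I k (l @ [x ! i])) (alt (delete_nth i x)))) =
           pscale ((- 1) ^ (n - 1 - i)) (push (\<lambda>l. l @ [x ! i]) (alt (w # delete_nth i x)))"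
          unfolding alt_Cons_eq len S
          by (auto simp: push_simps push_push pm.scale_sum_right len alt_keys_length mult.commute
              intro!: sum.cong arg_cong[of _ _ "pscale _"] push_cong)
      qed
      finally show ?thesis .
    qed
    also have "pscale ((- 1) ^ n) (push (\<lambda>l. l @ [w]) (alt x)) +
        (\<Sum>i<n. pscale ((- 1) ^ (n - 1 - i)) (push (\<lambda>l. l @ [x ! i]) (alt (w # delete_nth i x)))) =
        (\<Sum>i<length (w # x). pscale ((- 1) ^ (length (w # x) - 1 - i))
                    (push (\<lambda>l. l @ [(w # x) ! i]) (alt (delete_nth i (w # x)))))"
      unfolding length_Cons n_def[symmetric] sum.lessThan_Suc_shift by (simp del: alt.simps)
    finally show ?thesis .
  qed
qed simp

section \<open>Submodules, quotients and tensor products over the rationals\<close>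

section \<open>Modules over the rationals\<close>

lemma rat_ring_simps [simp]:
  "carrier rat_ring = UNIV" "x \<otimes>\<^bsub>rat_ring\<^esub> y = x * y" "\<one>\<^bsub>rat_ring\<^esub> = 1"
  "\<zero>\<^bsub>rat_ring\<^esub> = 0" "x \<oplus>\<^bsub>rat_ring\<^esub> y = x + y"
  by (simp_all add: rat_ring_def)

lemma cring_rat_ring: "cring rat_ring"
proof (rule cringI)
  show "abelian_group rat_ring"
    by (rule abelian_groupI) (auto intro: exI[of _ "- x" for x])
  show "comm_monoid rat_ring"
    by (rule comm_monoidI) auto
qed (auto simp: algebra_simps)

lemma a_inv_rat_ring [simp]: "\<ominus>\<^bsub>rat_ring\<^esub> x = - x"
proof -
  interpret cring rat_ring by (rule cring_rat_ring)
  show ?thesis by (rule minus_equality) auto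
qed

locale qmodule = module rat_ring M for M :: "(rat, 'm) module" (structure)

lemma qmoduleI:
  fixes M :: "(rat, 'm) module" (structure)
  assumes "abelian_group M"
    "\<And>c x. x \<in> carrier M \<Longrightarrow> c \<odot> x \<in> carrier M"
    "\<And>a b x. x \<in> carrier M \<Longrightarrow> (a + b) \<odot> x = a \<odot> x \<oplus> b \<odot> x"
    "\<And>a x y. x \<in> carrier M \<Longrightarrow> y \<in> carrier M \<Longrightarrow> a \<odot> (x \<oplus> y) = a \<odot> x \<oplus> a \<odot> y"
    "\<And>a b x. x \<in> carrier M \<Longrightarrow> (a * b) \<odot> x = a \<odot> (b \<odot> x)"
    "\<And>x. x \<in> carrier M \<Longrightarrow> 1 \<odot> x = x"
  shows "qmodule M"
  unfolding qmodule_def using assms by (intro moduleI cring_rat_ring) auto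

context qmodule
begin

lemma scl [simp, intro]: "x \<in> carrier M \<Longrightarrow> c \<odot> x \<in> carrier M"
  by simp

lemma scl_zero [simp]: "x \<in> carrier M \<Longrightarrow> 0 \<odot> x = \<zero>"
  using smult_l_null by simp

lemma scl_zero_right [simp]: "c \<odot> \<zero> = \<zero>"
  using smult_r_null[of c] by simp

lemma scl_one [simp]: "x \<in> carrier M \<Longrightarrow> 1 \<odot> x = x"
  using smult_one by simp

lemma scl_add: "x \<in> carrier M \<Longrightarrow> (a + b) \<odot> x = a \<odot> x \<oplus> b \<odot> x"
  using smult_l_distr[of a b x] by simp

lemma scl_add_right:
  "x \<in> carrier M \<Longrightarrow> y \<in> carrier M \<Longrightarrow> a \<odot> (x \<oplus> y) = a \<odot> x \<oplus> a \<odot> y"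
  using smult_r_distr[of a x y] by simp

lemma scl_scl: "x \<in> carrier M \<Longrightarrow> a \<odot> (b \<odot> x) = (a * b) \<odot> x"
  using smult_assoc1[of a b x] by simp

lemma scl_uminus: "x \<in> carrier M \<Longrightarrow> (- a) \<odot> x = \<ominus> (a \<odot> x)"
  using smult_l_minus[of a x] by simp

lemma minus_eq_scl: "x \<in> carrier M \<Longrightarrow> \<ominus> x = (- 1) \<odot> x"
  by (simp add: scl_uminus)

lemma subI:
  assumes "H \<subseteq> carrier M" "\<zero> \<in> H" "\<And>x y. x \<in> H \<Longrightarrow> y \<in> H \<Longrightarrow> x \<oplus> y \<in> H"
    "\<And>c x. x \<in> H \<Longrightarrow> c \<odot> x \<in> H"
  shows "submodule H rat_ring M"
proof (rule submoduleI)
  show "\<ominus> x \<in> H" if "x \<in> H" for x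
    using assms(4)[OF that, of "- 1"] assms(1) that by (auto simp: minus_eq_scl)
qed (use assms in auto)

lemma subD:
  assumes "submodule H rat_ring M"
  shows "H \<subseteq> carrier M" "\<zero> \<in> H" "\<And>x y. x \<in> H \<Longrightarrow> y \<in> H \<Longrightarrow> x \<oplus> y \<in> H"
    "\<And>c x. x \<in> H \<Longrightarrow> c \<odot> x \<in> H" "\<And>x y. x \<in> H \<Longrightarrow> y \<in> H \<Longrightarrow> x \<ominus> y \<in> H"
    "subgroup H (add_monoid M)"
proof -
  interpret submodule H rat_ring M by (rule assms)
  show "subgroup H (add_monoid M)" by unfold_locales
  note E = submoduleE[OF assms]
  show "H \<subseteq> carrier M" by (rule E)
  show "\<And>x y. x \<in> H \<Longrightarrow> y \<in> H \<Longrightarrow> x \<oplus> y \<in> H" by (rule E)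
  show "\<zero> \<in> H" using one_closed by simp
  show "\<And>c x. x \<in> H \<Longrightarrow> c \<odot> x \<in> H" by (rule E) simp
  show "\<And>x y. x \<in> H \<Longrightarrow> y \<in> H \<Longrightarrow> x \<ominus> y \<in> H" unfolding a_minus_def by (intro E)
qed

lemma sub_finsum:
  assumes "submodule H rat_ring M" "g \<in> S \<rightarrow> H"
  shows "finsum M g S \<in> H"
  using assms(2)
proof (induction S rule: infinite_finite_induct)
  case (insert x F)
  have "g \<in> F \<rightarrow> carrier M" "g x \<in> carrier M"
    using insert.prems subD(1)[OF assms(1)] by auto
  thus ?case using insert subD(3)[OF assms(1)] by (auto simp: finsum_insert)
qed (use subD(2)[OF assms(1)] in auto)

lemma subset_submodule_hull: "A \<subseteq> submodule_hull M A"
  unfolding submodule_hull_def by (rule hull_subset)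

lemma submodule_hull_minimal:
  "A \<subseteq> N \<Longrightarrow> submodule N rat_ring M \<Longrightarrow> submodule_hull M A \<subseteq> N"
  unfolding submodule_hull_def by (rule hull_minimal)

lemma submodule_submodule_hull:
  assumes "A \<subseteq> carrier M"
  shows "submodule (submodule_hull M A) rat_ring M"
proof (rule subI)
  show "submodule_hull M A \<subseteq> carrier M"
    by (rule submodule_hull_minimal[OF assms carrier_is_submodule])
qed (auto simp: submodule_hull_def hull_def dest: subD(2-4))

end

subsection \<open>Linear maps\<close>

lemma linear_mapsI:
  assumes "\<And>x. x \<in> carrier M \<Longrightarrow> f x \<in> carrier N"
    "\<And>x y. x \<in> carrier M \<Longrightarrow> y \<in> carrier M \<Longrightarrow> f (x \<oplus>\<^bsub>M\<^esub> y) = f x \<oplus>\<^bsub>N\<^esub> f y"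
    "\<And>c x. x \<in> carrier M \<Longrightarrow> f (c \<odot>\<^bsub>M\<^esub> x) = c \<odot>\<^bsub>N\<^esub> f x"
  shows "f \<in> linear_maps M N"
  using assms by (auto simp: linear_maps_def)

lemma linear_mapsD:
  assumes "f \<in> linear_maps M N"
  shows "x \<in> carrier M \<Longrightarrow> f x \<in> carrier N"
    "x \<in> carrier M \<Longrightarrow> y \<in> carrier M \<Longrightarrow> f (x \<oplus>\<^bsub>M\<^esub> y) = f x \<oplus>\<^bsub>N\<^esub> f y"
    "x \<in> carrier M \<Longrightarrow> f (c \<odot>\<^bsub>M\<^esub> x) = c \<odot>\<^bsub>N\<^esub> f x"
  using assms by (auto simp: linear_maps_def)

lemma linear_maps_comp:
  "f \<in> linear_maps M N \<Longrightarrow> g \<in> linear_maps N P \<Longrightarrow> (\<lambda>x. g (f x)) \<in> linear_maps M P"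
  by (intro linear_mapsI) (simp_all add: linear_mapsD)

lemma linear_maps_zero:
  assumes "qmodule M" "qmodule N" "f \<in> linear_maps M N"
  shows "f \<zero>\<^bsub>M\<^esub> = \<zero>\<^bsub>N\<^esub>"
proof -
  interpret M: qmodule M by fact
  interpret N: qmodule N by fact
  have "f (0 \<odot>\<^bsub>M\<^esub> \<zero>\<^bsub>M\<^esub>) = 0 \<odot>\<^bsub>N\<^esub> f \<zero>\<^bsub>M\<^esub>" by (rule linear_mapsD(3)[OF assms(3)]) simp
  thus ?thesis using linear_mapsD(1)[OF assms(3)] by simp
qed

lemma linear_maps_minus:
  assumes "qmodule M" "qmodule N" "f \<in> linear_maps M N" "x \<in> carrier M" "y \<in> carrier M"
  shows "f (x \<ominus>\<^bsub>M\<^esub> y) = f x \<ominus>\<^bsub>N\<^esub> f y"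
proof -
  interpret M: qmodule M by fact
  interpret N: qmodule N by fact
  show ?thesis using assms
    by (simp add: a_minus_def M.minus_eq_scl N.minus_eq_scl linear_mapsD[OF assms(3)])
qed

lemma linear_maps_finsum:
  assumes "qmodule M" "qmodule N" "f \<in> linear_maps M N" "g \<in> S \<rightarrow> carrier M"
  shows "f (finsum M g S) = finsum N (\<lambda>x. f (g x)) S"
proof -
  interpret M: qmodule M by fact
  interpret N: qmodule N by fact
  note L = linear_mapsD[OF assms(3)]
  show ?thesis using assms(4)
  proof (induction S rule: infinite_finite_induct)
    case (insert x F)
    have "g \<in> F \<rightarrow> carrier M" "g x \<in> carrier M" using insert.prems by auto
    moreover from this have "(\<lambda>x. f (g x)) \<in> F \<rightarrow> carrier N" by (auto intro: L)
    ultimately show ?case using insert by (simp add: M.finsum_insert N.finsum_insert L)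
  qed (use assms linear_maps_zero in auto)
qed

lemma linear_maps_add:
  assumes "qmodule P" "f \<in> linear_maps M P" "g \<in> linear_maps M P"
  shows "(\<lambda>x. f x \<oplus>\<^bsub>P\<^esub> g x) \<in> linear_maps M P"
proof -
  interpret P: qmodule P by fact
  note F = linear_mapsD[OF assms(2)] and G = linear_mapsD[OF assms(3)]
  show ?thesis by (rule linear_mapsI) (simp_all add: F G P.a_ac P.scl_add_right)
qed

lemma linear_maps_scale:
  assumes "qmodule P" "f \<in> linear_maps M P"
  shows "(\<lambda>x. c \<odot>\<^bsub>P\<^esub> f x) \<in> linear_maps M P"
proof -
  interpret P: qmodule P by fact
  note F = linear_mapsD[OF assms(2)]
  show ?thesis by (rule linear_mapsI) (simp_all add: F P.scl_add_right P.scl_scl mult.commute)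
qed

lemma submodule_kernel:
  assumes "qmodule M" "qmodule N" "f \<in> linear_maps M N"
  shows "submodule {x \<in> carrier M. f x = \<zero>\<^bsub>N\<^esub>} rat_ring M"
proof -
  interpret M: qmodule M by fact
  interpret N: qmodule N by fact
  show ?thesis
    by (rule M.subI) (use assms in \<open>auto simp: linear_mapsD[OF assms(3)] linear_maps_zero\<close>)
qed

lemma submodule_equalizer:
  assumes "qmodule M" "qmodule N" "f \<in> linear_maps M N" "g \<in> linear_maps M N"
  shows "submodule {x \<in> carrier M. f x = g x} rat_ring M"
proof -
  interpret M: qmodule M by fact
  interpret N: qmodule N by fact
  show ?thesis
    by (rule M.subI)
      (use assms in \<open>auto simp: linear_mapsD[OF assms(3)] linear_mapsD[OF assms(4)] linear_maps_zero\<close>)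
qed

text \<open>Stated through submodules rather than linear combinations, so that generators pass to
  quotients and tensor products by pulling submodules back.\<close>

definition generates :: "(rat, 'm) module \<Rightarrow> 'm set \<Rightarrow> bool" where
  "generates M A \<longleftrightarrow>
     A \<subseteq> carrier M \<and> (\<forall>N. submodule N rat_ring M \<longrightarrow> A \<subseteq> N \<longrightarrow> carrier M \<subseteq> N)"

lemma linear_maps_eq_on_generators:
  assumes "qmodule M" "qmodule N" "f \<in> linear_maps M N" "g \<in> linear_maps M N"
    "generates M A" "\<And>x. x \<in> A \<Longrightarrow> f x = g x" "x \<in> carrier M"
  shows "f x = g x"
  using submodule_equalizer[OF assms(1-4)] assms(5-7) unfolding generates_def by blast

subsection \<open>Free modules\<close>

lemma free_module_simps [simp]:
  "carrier (free_module X) = {p. Poly_Mapping.keys p \<subseteq> X}"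
  "x \<oplus>\<^bsub>free_module X\<^esub> y = x + y" "\<zero>\<^bsub>free_module X\<^esub> = 0"
  "c \<odot>\<^bsub>free_module X\<^esub> x = pscale c x"
  by (simp_all add: free_module_def pscale_def)

lemma keys_add_subset:
  "Poly_Mapping.keys p \<subseteq> X \<Longrightarrow> Poly_Mapping.keys q \<subseteq> X \<Longrightarrow> Poly_Mapping.keys (p + q) \<subseteq> X"
  using keys_add[of p q] by blast

lemma keys_pscale_subset: "Poly_Mapping.keys p \<subseteq> X \<Longrightarrow> Poly_Mapping.keys (pscale c p) \<subseteq> X"
  using keys_pscale[of c p] by blast

lemma qmodule_free: "qmodule (free_module X)"
proof (rule qmoduleI)
  show "abelian_group (free_module X)"
  proof (rule abelian_groupI)
    fix x assume "x \<in> carrier (free_module X)"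
    thus "\<exists>y\<in>carrier (free_module X). y \<oplus>\<^bsub>free_module X\<^esub> x = \<zero>\<^bsub>free_module X\<^esub>"
      by (intro bexI[of _ "- x"]) auto
  qed (auto simp: keys_add_subset algebra_simps)
qed (auto simp: keys_pscale_subset pm.scale_left_distrib pm.scale_right_distrib)

lemma finsum_free:
  assumes "g \<in> S \<rightarrow> carrier (free_module X)"
  shows "finsum (free_module X) g S = sum g S"
proof -
  interpret qmodule "free_module X" by (rule qmodule_free)
  show ?thesis using assms
  proof (induction S rule: infinite_finite_induct)
    case (insert x F)
    have "g \<in> F \<rightarrow> carrier (free_module X)" "g x \<in> carrier (free_module X)"
      using insert.prems by auto
    thus ?case using insert by (simp add: finsum_insert del: free_module_simps(1))
  qed auto
qed

lemma submodule_free_iff: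
  "submodule N rat_ring (free_module X) \<longleftrightarrow>
     pm.subspace N \<and> N \<subseteq> {p. Poly_Mapping.keys p \<subseteq> X}"
proof -
  interpret qmodule "free_module X" by (rule qmodule_free)
  show ?thesis
  proof
    assume "submodule N rat_ring (free_module X)"
    from subD[OF this] show "pm.subspace N \<and> N \<subseteq> {p. Poly_Mapping.keys p \<subseteq> X}"
      by (auto simp: pm.subspace_def)
  next
    assume "pm.subspace N \<and> N \<subseteq> {p. Poly_Mapping.keys p \<subseteq> X}"
    thus "submodule N rat_ring (free_module X)"
      by (intro subI) (auto simp: pm.subspace_def)
  qed
qed

lemma submodule_hull_free:
  assumes "A \<subseteq> {p. Poly_Mapping.keys p \<subseteq> X}"
  shows "submodule_hull (free_module X) A = pm.span A"
proof -
  interpret qmodule "free_module X" by (rule qmodule_free)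
  have "submodule (pm.span A) rat_ring (free_module X)"
    unfolding submodule_free_iff using assms
    by (simp add: pm.span_minimal subspace_keys)
  moreover have "pm.span A \<subseteq> N" if "A \<subseteq> N" "submodule N rat_ring (free_module X)" for N
    using that by (simp add: submodule_free_iff pm.span_minimal)
  ultimately show ?thesis
    by (intro equalityI submodule_hull_minimal)
      (auto simp: pm.span_superset submodule_hull_def hull_def)
qed

lemma lin_ext_superset:
  assumes "qmodule M" "finite S" "Poly_Mapping.keys p \<subseteq> S" "g \<in> S \<rightarrow> carrier M"
  shows "lin_ext M g p = (\<Oplus>\<^bsub>M\<^esub>x\<in>S. Poly_Mapping.lookup p x \<odot>\<^bsub>M\<^esub> g x)"
proof -
  interpret qmodule M by fact
  show ?thesis unfolding lin_ext_def
    by (rule add.finprod_mono_neutral_cong_left[OF assms(2,3)])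
      (use assms(4) in \<open>auto simp: in_keys_iff Pi_iff\<close>)
qed

lemma lin_ext_linear:
  fixes M :: "(rat, 'm) module" (structure)
  assumes "qmodule M" "g \<in> X \<rightarrow> carrier M"
  shows "lin_ext M g \<in> linear_maps (free_module X) M"
proof -
  interpret qmodule M by fact
  have cl: "lin_ext M g p \<in> carrier M" if "Poly_Mapping.keys p \<subseteq> X" for p
    unfolding lin_ext_def using that assms by (intro finsum_closed) auto
  show ?thesis
  proof (rule linear_mapsI)
    fix p q assume pq: "p \<in> carrier (free_module X)" "q \<in> carrier (free_module X)"
    let ?S = "Poly_Mapping.keys p \<union> Poly_Mapping.keys q"
    have g: "g \<in> ?S \<rightarrow> carrier M" using pq assms by auto
    note L = lin_ext_superset[OF assms(1) _ _ g]
    have "lin_ext M g (p + q) = (\<Oplus>x\<in>?S. Poly_Mapping.lookup (p + q) x \<odot> g x)"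
      by (rule L) (auto dest: subsetD[OF keys_add])
    also have "\<dots> = (\<Oplus>x\<in>?S. Poly_Mapping.lookup p x \<odot> g x \<oplus> Poly_Mapping.lookup q x \<odot> g x)"
      using g by (intro finsum_cong') (auto simp: lookup_add scl_add Pi_iff)
    also have "\<dots> = lin_ext M g p \<oplus> lin_ext M g q"
      using g by (subst finsum_addf) (auto simp: L Pi_iff)
    finally show "lin_ext M g (p \<oplus>\<^bsub>free_module X\<^esub> q) = lin_ext M g p \<oplus> lin_ext M g q" by simp
  next
    fix c p assume p: "p \<in> carrier (free_module X)"
    have g: "g \<in> Poly_Mapping.keys p \<rightarrow> carrier M" using p assms by auto
    have "lin_ext M g (pscale c p) =
        (\<Oplus>x\<in>Poly_Mapping.keys p. Poly_Mapping.lookup (pscale c p) x \<odot> g x)"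
      by (rule lin_ext_superset[OF assms(1) _ _ g]) (auto simp: keys_pscale)
    also have "\<dots> = (\<Oplus>x\<in>Poly_Mapping.keys p. c \<odot> (Poly_Mapping.lookup p x \<odot> g x))"
      using g by (intro finsum_cong') (auto simp: scl_scl Pi_iff)
    also have "\<dots> = c \<odot> lin_ext M g p"
      unfolding lin_ext_def using g by (subst finsum_smult_ldistr) auto
    finally show "lin_ext M g (c \<odot>\<^bsub>free_module X\<^esub> p) = c \<odot> lin_ext M g p" by simp
  qed (simp add: cl)
qed

lemma lin_ext_single:
  fixes M :: "(rat, 'm) module" (structure)
  assumes "qmodule M" "g x \<in> carrier M"
  shows "lin_ext M g (Poly_Mapping.single x c) = c \<odot>\<^bsub>M\<^esub> g x"
proof -
  interpret qmodule M by fact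
  have "lin_ext M g (Poly_Mapping.single x c) =
      (\<Oplus>y\<in>{x}. Poly_Mapping.lookup (Poly_Mapping.single x c) y \<odot> g y)"
    by (rule lin_ext_superset) (use assms in auto)
  thus ?thesis using assms by (simp add: finsum_insert)
qed

lemma lin_ext_cong:
  assumes "qmodule M" "\<And>x. x \<in> Poly_Mapping.keys p \<Longrightarrow> g x = g' x"
    "\<And>x. x \<in> Poly_Mapping.keys p \<Longrightarrow> g' x \<in> carrier M"
  shows "lin_ext M g p = lin_ext M g' p"
proof -
  interpret qmodule M by fact
  show ?thesis unfolding lin_ext_def using assms by (intro finsum_cong') auto
qed

lemma linear_lin_ext:
  assumes "qmodule M" "qmodule P" "f \<in> linear_maps M P"
    "\<And>x. x \<in> Poly_Mapping.keys p \<Longrightarrow> g x \<in> carrier M"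
  shows "f (lin_ext M g p) = lin_ext P (\<lambda>x. f (g x)) p"
proof -
  interpret M: qmodule M by fact
  interpret P: qmodule P by fact
  show ?thesis unfolding lin_ext_def
    by (subst linear_maps_finsum[OF assms(1-3)])
      (use assms(4) in \<open>auto simp: linear_mapsD[OF assms(3)] intro!: P.finsum_cong'\<close>)
qed

lemma lin_ext_free:
  assumes "\<And>x. x \<in> Poly_Mapping.keys p \<Longrightarrow> Poly_Mapping.keys (g x) \<subseteq> X"
  shows "lin_ext (free_module X) g p = plin g p"
  unfolding lin_ext_def plin_def
  by (subst finsum_free) (use assms in \<open>auto simp: keys_pscale_subset\<close>)

lemma linear_plin_lin_ext:
  assumes "qmodule M" "f \<in> linear_maps (free_module Y) M"
    "\<And>x. x \<in> Poly_Mapping.keys p \<Longrightarrow> Poly_Mapping.keys (g x) \<subseteq> Y"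
  shows "f (plin g p) = lin_ext M (\<lambda>x. f (g x)) p"
  using linear_lin_ext[OF qmodule_free assms(1,2), of p g] assms(3)
  by (simp add: lin_ext_free)

lemma linear_free_expand:
  assumes "qmodule M" "f \<in> linear_maps (free_module X) M" "Poly_Mapping.keys p \<subseteq> X"
  shows "f p = lin_ext M (\<lambda>x. f (psingle x)) p"
  using linear_plin_lin_ext[OF assms(1,2), of p psingle] assms(3) by auto

lemma linear_free_eq:
  assumes "qmodule M" "f \<in> linear_maps (free_module X) M" "g \<in> linear_maps (free_module X) M"
    "\<And>x. x \<in> X \<Longrightarrow> f (psingle x) = g (psingle x)" "Poly_Mapping.keys p \<subseteq> X"
  shows "f p = g p"
  unfolding linear_free_expand[OF assms(1,2,5)] linear_free_expand[OF assms(1,3,5)]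
  by (rule lin_ext_cong) (use assms in \<open>auto intro!: linear_mapsD(1)[OF assms(3)]\<close>)

subsection \<open>Quotients\<close>

locale qquotient = qmodule M for M :: "(rat, 'm) module" (structure) +
  fixes N
  assumes sub: "submodule N rat_ring M"
begin

sublocale abelian_subgroup N M
  using subD(6)[OF sub] by (intro abelian_subgroupI3 additive_subgroupI) (auto, unfold_locales)

abbreviation "Q \<equiv> quot_module M N"

lemma quot_simps [simp]:
  "carrier Q = (\<lambda>x. N +> x) ` carrier M" "\<zero>\<^bsub>Q\<^esub> = N" "X \<oplus>\<^bsub>Q\<^esub> Y = X <+> Y"
  unfolding quot_module_def A_RCOSETS_def' by (simp_all add: UNION_singleton_eq_range)

lemma coset_eq_iff:
  assumes "x \<in> carrier M" "y \<in> carrier M"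
  shows "N +> x = N +> y \<longleftrightarrow> x \<ominus> y \<in> N"
proof
  assume eq: "N +> x = N +> y"
  have "x \<in> N +> x" by (rule a_rcos_self[OF assms(1)])
  hence "x \<in> N +> y" unfolding eq .
  then obtain n where "n \<in> N" "x = n \<oplus> y" by (auto simp: a_r_coset_def')
  moreover from this have "n \<in> carrier M" using a_subset by blast
  ultimately show "x \<ominus> y \<in> N" using assms by (simp add: a_minus_def a_assoc r_neg)
next
  assume *: "x \<ominus> y \<in> N"
  have "(x \<ominus> y) \<oplus> y = x" using assms by (simp add: a_minus_def a_assoc l_neg)
  with a_rcosI[OF * a_subset assms(2)] have "x \<in> N +> y" by (simp only:)
  from a_repr_independence[OF this assms(2) a_subgroup] show "N +> x = N +> y" by (rule sym)
qed

lemma coset_eq_zero_iff: "x \<in> carrier M \<Longrightarrow> N +> x = N \<longleftrightarrow> x \<in> N"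
  using a_coset_join1[OF _ _ a_subgroup] a_coset_join2[OF _ a_subgroup] by blast

lemma coset_add: "x \<in> carrier M \<Longrightarrow> y \<in> carrier M \<Longrightarrow> (N +> x) <+> (N +> y) = N +> (x \<oplus> y)"
  by (rule a_rcos_sum)

text \<open>The scalar product in \<open>quot_module\<close> is a union over all representatives. It
  is a single coset because the multiples of two representatives differ by an element of
  \<open>N\<close>.\<close>

lemma coset_smult:
  assumes "x \<in> carrier M"
  shows "c \<odot>\<^bsub>Q\<^esub> (N +> x) = N +> (c \<odot> x)"
proof -
  have *: "N +> (c \<odot> y) = N +> (c \<odot> x)" if "y \<in> N +> x" for y
  proof -
    from that obtain n where n: "n \<in> N" "y = n \<oplus> x" by (auto simp: a_r_coset_def')
    have nc: "n \<in> carrier M" using n a_subset by auto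
    have "c \<odot> y \<ominus> c \<odot> x = c \<odot> n"
      using n nc assms by (simp add: scl_add_right a_minus_def a_assoc r_neg)
    also have "\<dots> \<in> N" using n subD(4)[OF sub] by simp
    finally show ?thesis using n nc assms by (subst coset_eq_iff) auto
  qed
  have x: "x \<in> N +> x" using a_rcos_self assms by simp
  have "c \<odot>\<^bsub>Q\<^esub> (N +> x) = (\<Union>y\<in>N +> x. N +> (c \<odot> y))" by (simp add: quot_module_def)
  also have "\<dots> = (\<Union>y\<in>N +> x. N +> (c \<odot> x))" by (rule SUP_cong[OF refl]) (rule *)
  also have "\<dots> = N +> (c \<odot> x)" using x by auto
  finally show ?thesis .
qed

lemma quot_abelian_group: "abelian_group Q"
proof (rule abelian_groupI)
  show "\<zero>\<^bsub>Q\<^esub> \<in> carrier Q"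
    using coset_eq_zero_iff[of \<zero>] by (auto intro!: image_eqI[of _ _ \<zero>])
next
  fix X assume "X \<in> carrier Q"
  then obtain x where x: "x \<in> carrier M" "X = N +> x" by auto
  have N: "N +> \<zero> = N" using coset_eq_zero_iff[of \<zero>] by simp
  show "\<zero>\<^bsub>Q\<^esub> \<oplus>\<^bsub>Q\<^esub> X = X"
    using coset_add[of \<zero> x] x N by simp
  have "(N +> \<ominus> x) <+> X = N"
    using x coset_add[of "\<ominus> x" x] N by (simp add: l_neg)
  thus "\<exists>Y\<in>carrier Q. Y \<oplus>\<^bsub>Q\<^esub> X = \<zero>\<^bsub>Q\<^esub>"
    using x(1) by (intro bexI[of _ "N +> \<ominus> x"]) auto
  fix Y assume "Y \<in> carrier Q"
  then obtain y where y: "y \<in> carrier M" "Y = N +> y" by auto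
  show "X \<oplus>\<^bsub>Q\<^esub> Y \<in> carrier Q" using x y by (auto simp: coset_add)
  show "X \<oplus>\<^bsub>Q\<^esub> Y = Y \<oplus>\<^bsub>Q\<^esub> X" using x y by (simp add: coset_add a_comm)
  fix Z assume "Z \<in> carrier Q"
  then obtain z where z: "z \<in> carrier M" "Z = N +> z" by auto
  show "X \<oplus>\<^bsub>Q\<^esub> Y \<oplus>\<^bsub>Q\<^esub> Z = X \<oplus>\<^bsub>Q\<^esub> (Y \<oplus>\<^bsub>Q\<^esub> Z)"
    using x y z by (simp add: coset_add a_assoc)
qed

lemma qmodule_quot: "qmodule Q"
proof (rule qmoduleI[OF quot_abelian_group])
qed (auto simp: coset_smult coset_add scl_add scl_add_right scl_scl)

lemma quot_linear: "(\<lambda>x. N +> x) \<in> linear_maps M Q"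
  by (rule linear_mapsI) (auto simp: coset_add coset_smult)

lemma
  assumes P: "qmodule P" and f: "f \<in> linear_maps M P" and N: "\<And>x. x \<in> N \<Longrightarrow> f x = \<zero>\<^bsub>P\<^esub>"
  shows induced_map_coset: "x \<in> carrier M \<Longrightarrow> induced_map f (N +> x) = f x"
    and induced_map_linear: "induced_map f \<in> linear_maps Q P"
proof -
  interpret P: qmodule P by fact
  show *: "induced_map f (N +> x) = f x" if x: "x \<in> carrier M" for x
  proof -
    have "f y = f x" if y: "y \<in> N +> x" for y
    proof -
      from y obtain n where n: "n \<in> N" "y = n \<oplus> x" by (auto simp: a_r_coset_def')
      thus ?thesis using x a_subset N[of n] linear_mapsD(1,2)[OF f] by auto
    qed
    moreover have "x \<in> N +> x" using a_rcos_self x by simp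
    ultimately have "f ` (N +> x) = {f x}" by blast
    thus ?thesis by (simp add: induced_map_def)
  qed
  show "induced_map f \<in> linear_maps Q P"
    by (rule linear_mapsI)
      (auto simp: coset_add coset_smult * linear_mapsD[OF f])
qed

lemma quot_generates: "generates M A \<Longrightarrow> generates Q ((\<lambda>x. N +> x) ` A)"
  unfolding generates_def
proof (safe; (elim conjE)?)
  fix K x assume K: "submodule K rat_ring Q" and A: "(\<lambda>x. N +> x) ` A \<subseteq> K" and x: "x \<in> carrier Q"
    and AM: "A \<subseteq> carrier M" "\<forall>N. submodule N rat_ring M \<longrightarrow> A \<subseteq> N \<longrightarrow> carrier M \<subseteq> N"
  interpret Q: qmodule Q by (rule qmodule_quot)
  have "submodule {x \<in> carrier M. N +> x \<in> K} rat_ring M"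
  proof (rule subI; safe?)
    show "N +> \<zero> \<in> K" using Q.subD(2)[OF K] coset_eq_zero_iff[of \<zero>] by simp
    show "N +> (x \<oplus> y) \<in> K" if "x \<in> carrier M" "y \<in> carrier M" "N +> x \<in> K" "N +> y \<in> K" for x y
      using Q.subD(3)[OF K that(3,4)] that(1,2) by (simp add: coset_add)
    show "N +> (c \<odot> x) \<in> K" if "x \<in> carrier M" "N +> x \<in> K" for x c
      using Q.subD(4)[OF K that(2), of c] that(1) by (simp add: coset_smult)
  qed auto
  thus "x \<in> K" using AM A x by auto
qed auto

end

lemma qquotientI: "qmodule M \<Longrightarrow> submodule N rat_ring M \<Longrightarrow> qquotient M N"
  by (simp add: qquotient_def qquotient_axioms_def)


subsection \<open>Tensor products\<close>

locale qtensor = M: qmodule M + N: qmodule N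
  for M :: "(rat, 'm) module" and N :: "(rat, 'n) module"
begin

abbreviation "FM \<equiv> free_module (carrier M \<times> carrier N)"

lemma tensor_relations_subset:
  "tensor_relations M N \<subseteq> {p. Poly_Mapping.keys p \<subseteq> carrier M \<times> carrier N}"
proof -
  let ?A = "{p. Poly_Mapping.keys p \<subseteq> carrier M \<times> carrier N}"
  have S: "Poly_Mapping.single (x, y) c \<in> ?A" if "x \<in> carrier M" "y \<in> carrier N" for x y c
    using that by auto
  note D = pm.subspace_diff[OF subspace_keys[of "carrier M \<times> carrier N"]]
  show ?thesis
    unfolding tensor_relations_def
    by (rule subsetI, elim UnE CollectE exE conjE; hypsubst; intro D S)
      (auto simp: M.a_closed N.a_closed)
qed

lemma tensor_hull_eq: "tensor_hull M N = pm.span (tensor_relations M N)"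
  unfolding tensor_hull_def by (rule submodule_hull_free[OF tensor_relations_subset])

sublocale T: qquotient FM "tensor_hull M N"
proof (rule qquotientI[OF qmodule_free])
  interpret qmodule FM by (rule qmodule_free)
  show "submodule (tensor_hull M N) rat_ring FM"
    unfolding tensor_hull_def using tensor_relations_subset
    by (intro submodule_submodule_hull) simp
qed

lemma qmodule_tensor: "qmodule (tensor M N)"
  unfolding tensor_def by (rule T.qmodule_quot)

abbreviation "cls \<equiv> a_r_coset FM (tensor_hull M N)"

lemma cls_linear: "cls \<in> linear_maps FM (tensor M N)"
  unfolding tensor_def by (rule T.quot_linear)

lemma pure_closed: "x \<in> carrier M \<Longrightarrow> y \<in> carrier N \<Longrightarrow> pure_tensor M N x y \<in> carrier (tensor M N)"
  unfolding pure_tensor_def by (rule linear_mapsD(1)[OF cls_linear]) auto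

lemma cls_relation:
  assumes "p - q \<in> tensor_relations M N" "Poly_Mapping.keys p \<subseteq> carrier M \<times> carrier N"
    "Poly_Mapping.keys q \<subseteq> carrier M \<times> carrier N"
  shows "cls p = cls q"
proof -
  have "p \<ominus>\<^bsub>FM\<^esub> q = p - q"
    using assms T.minus_eq_scl[of q] by (simp add: a_minus_def pm.scale_minus_left)
  moreover have "p - q \<in> tensor_hull M N"
    using assms(1) by (simp add: tensor_hull_eq pm.span_base)
  ultimately show ?thesis using assms by (subst T.coset_eq_iff) auto
qed

lemma pure_add_left:
  assumes "x \<in> carrier M" "x' \<in> carrier M" "y \<in> carrier N"
  shows "pure_tensor M N (x \<oplus>\<^bsub>M\<^esub> x') y =
    pure_tensor M N x y \<oplus>\<^bsub>tensor M N\<^esub> pure_tensor M N x' y"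
proof -
  have "pure_tensor M N (x \<oplus>\<^bsub>M\<^esub> x') y = cls (psingle (x, y) + psingle (x', y))"
    unfolding pure_tensor_def
  proof (rule cls_relation)
    show "psingle (x \<oplus>\<^bsub>M\<^esub> x', y) - (psingle (x, y) + psingle (x', y)) \<in> tensor_relations M N"
      unfolding tensor_relations_def diff_diff_add[symmetric] using assms by blast
  qed (use assms in \<open>auto dest!: subsetD[OF keys_add]\<close>)
  also have "\<dots> = cls (psingle (x, y) \<oplus>\<^bsub>FM\<^esub> psingle (x', y))" by simp
  also have "\<dots> = pure_tensor M N x y \<oplus>\<^bsub>tensor M N\<^esub> pure_tensor M N x' y"
    unfolding pure_tensor_def by (rule linear_mapsD(2)[OF cls_linear]) (use assms in auto)
  finally show ?thesis .
qed

lemma pure_add_right: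
  assumes "x \<in> carrier M" "y \<in> carrier N" "y' \<in> carrier N"
  shows "pure_tensor M N x (y \<oplus>\<^bsub>N\<^esub> y') =
    pure_tensor M N x y \<oplus>\<^bsub>tensor M N\<^esub> pure_tensor M N x y'"
proof -
  have "pure_tensor M N x (y \<oplus>\<^bsub>N\<^esub> y') = cls (psingle (x, y) + psingle (x, y'))"
    unfolding pure_tensor_def
  proof (rule cls_relation)
    show "psingle (x, y \<oplus>\<^bsub>N\<^esub> y') - (psingle (x, y) + psingle (x, y')) \<in> tensor_relations M N"
      unfolding tensor_relations_def diff_diff_add[symmetric] using assms by blast
  qed (use assms in \<open>auto dest!: subsetD[OF keys_add]\<close>)
  also have "\<dots> = cls (psingle (x, y) \<oplus>\<^bsub>FM\<^esub> psingle (x, y'))" by simp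
  also have "\<dots> = pure_tensor M N x y \<oplus>\<^bsub>tensor M N\<^esub> pure_tensor M N x y'"
    unfolding pure_tensor_def by (rule linear_mapsD(2)[OF cls_linear]) (use assms in auto)
  finally show ?thesis .
qed

lemma cls_single:
  assumes "x \<in> carrier M" "y \<in> carrier N"
  shows "cls (Poly_Mapping.single (x, y) c) = c \<odot>\<^bsub>tensor M N\<^esub> pure_tensor M N x y"
proof -
  have "cls (Poly_Mapping.single (x, y) c) = cls (c \<odot>\<^bsub>FM\<^esub> psingle (x, y))" by simp
  also have "\<dots> = c \<odot>\<^bsub>tensor M N\<^esub> pure_tensor M N x y"
    unfolding pure_tensor_def by (rule linear_mapsD(3)[OF cls_linear]) (use assms in auto)
  finally show ?thesis .
qed

lemma pure_scale_left:
  assumes "x \<in> carrier M" "y \<in> carrier N"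
  shows "pure_tensor M N (c \<odot>\<^bsub>M\<^esub> x) y = c \<odot>\<^bsub>tensor M N\<^esub> pure_tensor M N x y"
proof -
  have "pure_tensor M N (c \<odot>\<^bsub>M\<^esub> x) y = cls (Poly_Mapping.single (x, y) c)"
    unfolding pure_tensor_def
  proof (rule cls_relation)
    show "psingle (c \<odot>\<^bsub>M\<^esub> x, y) - Poly_Mapping.single (x, y) c \<in> tensor_relations M N"
      unfolding tensor_relations_def using assms by blast
  qed (use assms in auto)
  thus ?thesis using assms by (simp add: cls_single)
qed

lemma pure_scale_right:
  assumes "x \<in> carrier M" "y \<in> carrier N"
  shows "pure_tensor M N x (c \<odot>\<^bsub>N\<^esub> y) = c \<odot>\<^bsub>tensor M N\<^esub> pure_tensor M N x y"
proof -
  have "pure_tensor M N x (c \<odot>\<^bsub>N\<^esub> y) = cls (Poly_Mapping.single (x, y) c)"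
    unfolding pure_tensor_def
  proof (rule cls_relation)
    show "psingle (x, c \<odot>\<^bsub>N\<^esub> y) - Poly_Mapping.single (x, y) c \<in> tensor_relations M N"
      unfolding tensor_relations_def using assms by blast
  qed (use assms in auto)
  thus ?thesis using assms by (simp add: cls_single)
qed

lemma pure_linear_right:
  "x \<in> carrier M \<Longrightarrow> pure_tensor M N x \<in> linear_maps N (tensor M N)"
  by (rule linear_mapsI) (simp_all add: pure_closed pure_add_right pure_scale_right)

lemma pure_linear_left:
  "y \<in> carrier N \<Longrightarrow> (\<lambda>x. pure_tensor M N x y) \<in> linear_maps M (tensor M N)"
  by (rule linear_mapsI) (simp_all add: pure_closed pure_add_left pure_scale_left)

lemma tensor_carrierE:
  assumes "X \<in> carrier (tensor M N)"
  obtains p where "Poly_Mapping.keys p \<subseteq> carrier M \<times> carrier N" "X = cls p"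
  using assms by (auto simp: tensor_def)

text \<open>Universal property of the tensor product: the extension of \<open>f\<close> to formal
  pairs kills the four families of relations. The last conclusion records the value on the class of
  a formal combination.\<close>

lemma tensor_lift:
  assumes P: "qmodule P"
    and l: "\<And>y. y \<in> carrier N \<Longrightarrow> (\<lambda>x. f x y) \<in> linear_maps M P"
    and r: "\<And>x. x \<in> carrier M \<Longrightarrow> f x \<in> linear_maps N P"
  obtains \<Phi> where "\<Phi> \<in> linear_maps (tensor M N) P"
    "\<And>x y. x \<in> carrier M \<Longrightarrow> y \<in> carrier N \<Longrightarrow> \<Phi> (pure_tensor M N x y) = f x y"
    "\<And>p. Poly_Mapping.keys p \<subseteq> carrier M \<times> carrier N \<Longrightarrow> \<Phi> (cls p) = lin_ext P (\<lambda>(x, y). f x y) p"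
proof -
  interpret P: qmodule P by (rule P)
  define g where "g = lin_ext P (\<lambda>(x, y). f x y)"
  note L = linear_mapsD[OF l] and R = linear_mapsD[OF r]
  have fc: "f x y \<in> carrier P" if "x \<in> carrier M" "y \<in> carrier N" for x y
    using L(1) that by blast
  have g: "g \<in> linear_maps FM P"
    unfolding g_def by (rule lin_ext_linear[OF P]) (auto simp: fc)
  have gs: "g (Poly_Mapping.single (x, y) c) = c \<odot>\<^bsub>P\<^esub> f x y"
    if "x \<in> carrier M" "y \<in> carrier N" for x y c
    using that unfolding g_def by (subst lin_ext_single[OF P]) (auto simp: fc)
  have gd: "g (p - q) = g p \<ominus>\<^bsub>P\<^esub> g q"
    if "Poly_Mapping.keys p \<subseteq> carrier M \<times> carrier N" "Poly_Mapping.keys q \<subseteq> carrier M \<times> carrier N" for p q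
  proof -
    have "p - q = p \<ominus>\<^bsub>FM\<^esub> q"
      using that T.minus_eq_scl[of q] by (simp add: a_minus_def pm.scale_minus_left)
    thus ?thesis using linear_maps_minus[OF qmodule_free P g, of p q] that by simp
  qed
  have ks: "Poly_Mapping.keys (Poly_Mapping.single (x, y) c) \<subseteq> carrier M \<times> carrier N"
    if "x \<in> carrier M" "y \<in> carrier N" for x y and c :: rat using that by auto
  have kd: "Poly_Mapping.keys (p - q) \<subseteq> carrier M \<times> carrier N"
    if "Poly_Mapping.keys p \<subseteq> carrier M \<times> carrier N" "Poly_Mapping.keys q \<subseteq> carrier M \<times> carrier N"
    for p q :: "'m \<times> 'n \<Rightarrow>\<^sub>0 rat"
    using pm.subspace_diff[OF subspace_keys[of "carrier M \<times> carrier N"]] that by auto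
  have "g p = \<zero>\<^bsub>P\<^esub>" if "p \<in> tensor_relations M N" for p
    using that unfolding tensor_relations_def
  proof (elim UnE CollectE exE conjE)
    fix x x' y assume *: "p = psingle (x \<oplus>\<^bsub>M\<^esub> x', y) - psingle (x, y) - psingle (x', y)"
      "x \<in> carrier M" "x' \<in> carrier M" "y \<in> carrier N"
    show ?thesis unfolding *(1) using *(2-)
      by (simp add: gd ks kd gs L(2) fc a_minus_def P.a_assoc P.minus_add P.r_neg
          del: keys_single)
        (simp add: P.minus_add[symmetric] fc P.r_neg P.a_assoc[symmetric] del: keys_single)
  next
    fix x y y' assume *: "p = psingle (x, y \<oplus>\<^bsub>N\<^esub> y') - psingle (x, y) - psingle (x, y')"
      "x \<in> carrier M" "y \<in> carrier N" "y' \<in> carrier N"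
    show ?thesis unfolding *(1) using *(2-)
      by (simp add: gd ks kd gs R(2) fc a_minus_def P.a_assoc P.minus_add P.r_neg
          del: keys_single)
        (simp add: P.minus_add[symmetric] fc P.r_neg P.a_assoc[symmetric] del: keys_single)
  next
    fix c x y assume *: "p = psingle (c \<odot>\<^bsub>M\<^esub> x, y) - Poly_Mapping.single (x, y) c"
      "x \<in> carrier M" "y \<in> carrier N"
    show ?thesis unfolding *(1) using *(2-)
      by (simp add: gd ks gs L(3) fc a_minus_def P.r_neg del: keys_single)
  next
    fix c x y assume *: "p = psingle (x, c \<odot>\<^bsub>N\<^esub> y) - Poly_Mapping.single (x, y) c"
      "x \<in> carrier M" "y \<in> carrier N"
    show ?thesis unfolding *(1) using *(2-)
      by (simp add: gd ks gs R(3) fc a_minus_def P.r_neg del: keys_single)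
  qed
  hence "tensor_relations M N \<subseteq> {p \<in> carrier FM. g p = \<zero>\<^bsub>P\<^esub>}"
    using tensor_relations_subset by auto
  hence "tensor_hull M N \<subseteq> {p \<in> carrier FM. g p = \<zero>\<^bsub>P\<^esub>}"
    unfolding tensor_hull_def
    by (rule T.submodule_hull_minimal) (rule submodule_kernel[OF qmodule_free P g])
  hence h0: "g x = \<zero>\<^bsub>P\<^esub>" if "x \<in> tensor_hull M N" for x using that by blast
  have cl: "induced_map g (cls p) = g p" if "Poly_Mapping.keys p \<subseteq> carrier M \<times> carrier N" for p
    using T.induced_map_coset[OF P g h0] that by simp
  show thesis
  proof (rule that[of "induced_map g"])
    show "induced_map g \<in> linear_maps (tensor M N) P"
      unfolding tensor_def by (rule T.induced_map_linear[OF P g h0])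
    show "induced_map g (pure_tensor M N x y) = f x y" if "x \<in> carrier M" "y \<in> carrier N" for x y
      unfolding pure_tensor_def using that by (subst cl) (auto simp: gs fc)
    show "induced_map g (cls p) = lin_ext P (\<lambda>(x, y). f x y) p"
      if "Poly_Mapping.keys p \<subseteq> carrier M \<times> carrier N" for p
      using cl[OF that] by (simp add: g_def)
  qed
qed

text \<open>One factor at a time: for \<open>a\<close> in \<open>A\<close> the elements
  \<open>y\<close> whose pure tensor with \<open>a\<close> lies in a given submodule form a
  submodule containing \<open>B\<close>; then the same argument is applied to the other
  factor.\<close>

lemma tensor_generates:
  assumes A: "generates M A" and B: "generates N B"
  shows "generates (tensor M N) {pure_tensor M N a b | a b. a \<in> A \<and> b \<in> B}"
  unfolding generates_def
proof (intro conjI allI impI)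
  interpret T': qmodule "tensor M N" by (rule qmodule_tensor)
  have AM: "A \<subseteq> carrier M" and BN: "B \<subseteq> carrier N" using A B by (auto simp: generates_def)
  thus "{pure_tensor M N a b | a b. a \<in> A \<and> b \<in> B} \<subseteq> carrier (tensor M N)"
    using pure_closed by blast
  fix K assume K: "submodule K rat_ring (tensor M N)"
    and sub: "{pure_tensor M N a b | a b. a \<in> A \<and> b \<in> B} \<subseteq> K"
  note K' = T'.subD[OF K]
  have 1: "pure_tensor M N a y \<in> K" if "a \<in> A" "y \<in> carrier N" for a y
  proof -
    have a: "a \<in> carrier M" using that AM by auto
    note R = linear_mapsD[OF pure_linear_right[OF a]]
      linear_maps_zero[OF N.qmodule_axioms qmodule_tensor pure_linear_right[OF a]]
    have "submodule {y \<in> carrier N. pure_tensor M N a y \<in> K} rat_ring N"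
      by (rule N.subI) (auto simp: R intro: K')
    moreover have "B \<subseteq> {y \<in> carrier N. pure_tensor M N a y \<in> K}"
      using sub that(1) BN by auto
    ultimately have "carrier N \<subseteq> {y \<in> carrier N. pure_tensor M N a y \<in> K}"
      using B by (simp add: generates_def)
    thus ?thesis using that by blast
  qed
  have 2: "pure_tensor M N x y \<in> K" if "x \<in> carrier M" "y \<in> carrier N" for x y
  proof -
    note R = linear_mapsD[OF pure_linear_left[OF that(2)]]
      linear_maps_zero[OF M.qmodule_axioms qmodule_tensor pure_linear_left[OF that(2)]]
    have "submodule {x \<in> carrier M. pure_tensor M N x y \<in> K} rat_ring M"
      by (rule M.subI) (auto simp: R intro: K')
    moreover have "A \<subseteq> {x \<in> carrier M. pure_tensor M N x y \<in> K}"
      using 1 that(2) AM by auto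
    ultimately have "carrier M \<subseteq> {x \<in> carrier M. pure_tensor M N x y \<in> K}"
      using A by (simp add: generates_def)
    thus ?thesis using that by blast
  qed
  show "carrier (tensor M N) \<subseteq> K"
  proof
    fix X assume "X \<in> carrier (tensor M N)"
    then obtain p where p: "Poly_Mapping.keys p \<subseteq> carrier M \<times> carrier N" "X = cls p"
      by (rule tensor_carrierE)
    have "X = lin_ext (tensor M N) (\<lambda>x. cls (psingle x)) p"
      unfolding p(2) by (rule linear_free_expand[OF qmodule_tensor cls_linear p(1)])
    also have "\<dots> \<in> K"
      unfolding lin_ext_def
    proof (rule T'.sub_finsum[OF K], rule funcsetI)
      fix z assume "z \<in> Poly_Mapping.keys p"
      then obtain x y where z: "z = (x, y)" "x \<in> carrier M" "y \<in> carrier N" using p by auto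
      thus "Poly_Mapping.lookup p z \<odot>\<^bsub>tensor M N\<^esub> cls (psingle z) \<in> K"
        using K'(4)[OF 2[OF z(2,3)]] by (simp add: pure_tensor_def)
    qed
    finally show "X \<in> K" .
  qed
qed

end

lemma (in qquotient) first_isomorphism:
  assumes P: "qmodule P" and f: "f \<in> linear_maps M P" and surj: "f ` carrier M = carrier P"
    and ker: "\<And>x. x \<in> carrier M \<Longrightarrow> x \<in> N \<longleftrightarrow> f x = \<zero>\<^bsub>P\<^esub>"
  shows "induced_map f \<in> linear_isos Q P"
proof -
  interpret P: qmodule P by (rule P)
  have N: "f x = \<zero>\<^bsub>P\<^esub>" if "x \<in> N" for x using that ker a_subset by blast
  note ind = induced_map_coset[OF P f N]
  have "inj_on (induced_map f) (carrier Q)"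
  proof (rule inj_onI)
    fix X Y assume "X \<in> carrier Q" "Y \<in> carrier Q" and eq: "induced_map f X = induced_map f Y"
    then obtain x y where xy: "x \<in> carrier M" "y \<in> carrier M" "X = N +> x" "Y = N +> y" by auto
    have "f (x \<ominus> y) = \<zero>\<^bsub>P\<^esub>"
      using eq xy linear_maps_minus[OF qmodule_axioms P f] linear_mapsD(1)[OF f]
      by (simp add: ind a_minus_def P.r_neg)
    thus "X = Y" using xy ker[of "x \<ominus> y"] coset_eq_iff by simp
  qed
  moreover have "induced_map f ` carrier Q = carrier P"
    using surj by (auto simp: ind image_image)
  ultimately show ?thesis
    using induced_map_linear[OF P f N] by (simp add: linear_isos_def bij_betw_def)
qed

section \<open>The bar complex of a semigroup with multiplication \<open>a b = a\<close>\<close>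

section \<open>Homology of left zero semigroups\<close>

lemma bar_chains_simps [simp]:
  "carrier (bar_chains S M k) = {f. (\<forall>l. f l \<in> carrier M) \<and> finite {l. f l \<noteq> \<zero>\<^bsub>M\<^esub>} \<and>
                    (\<forall>l. f l \<noteq> \<zero>\<^bsub>M\<^esub> \<longrightarrow> length l = k \<and> set l \<subseteq> S)}"
  "\<zero>\<^bsub>bar_chains S M k\<^esub> = (\<lambda>l. \<zero>\<^bsub>M\<^esub>)"
  "f \<oplus>\<^bsub>bar_chains S M k\<^esub> g = (\<lambda>l. f l \<oplus>\<^bsub>M\<^esub> g l)"
  "c \<odot>\<^bsub>bar_chains S M k\<^esub> f = (\<lambda>l. c \<odot>\<^bsub>M\<^esub> f l)"
  by (simp_all add: bar_chains_def)

context qmodule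
begin

lemma bar_chains_add_closed:
  assumes "f \<in> carrier (bar_chains S M k)" "g \<in> carrier (bar_chains S M k)"
  shows "f \<oplus>\<^bsub>bar_chains S M k\<^esub> g \<in> carrier (bar_chains S M k)"
proof -
  have "{l. f l \<oplus> g l \<noteq> \<zero>} \<subseteq> {l. f l \<noteq> \<zero>} \<union> {l. g l \<noteq> \<zero>}" by auto
  hence "finite {l. f l \<oplus> g l \<noteq> \<zero>}"
    by (rule finite_subset) (use assms in simp)
  moreover have "f l \<noteq> \<zero> \<or> g l \<noteq> \<zero>" if "f l \<oplus> g l \<noteq> \<zero>" for l using that by auto
  ultimately show ?thesis using assms by (simp, blast)
qed

lemma bar_chains_smult_closed:
  assumes "f \<in> carrier (bar_chains S M k)"
  shows "c \<odot>\<^bsub>bar_chains S M k\<^esub> f \<in> carrier (bar_chains S M k)"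
proof -
  have "finite {l. c \<odot> f l \<noteq> \<zero>}"
    by (rule finite_subset[of _ "{l. f l \<noteq> \<zero>}"]) (use assms in auto)
  moreover have "f l \<noteq> \<zero>" if "c \<odot> f l \<noteq> \<zero>" for l using that by auto
  ultimately show ?thesis using assms by (simp; blast)
qed

lemma qmodule_bar_chains: "qmodule (bar_chains S M k)"
proof (rule qmoduleI)
  show "abelian_group (bar_chains S M k)"
  proof (rule abelian_groupI)
    fix f assume f: "f \<in> carrier (bar_chains S M k)"
    show "\<exists>g\<in>carrier (bar_chains S M k). g \<oplus>\<^bsub>bar_chains S M k\<^esub> f = \<zero>\<^bsub>bar_chains S M k\<^esub>"
      by (rule bexI[OF _ bar_chains_smult_closed[OF f, of "- 1"]])
        (use f in \<open>auto simp: fun_eq_iff scl_uminus l_neg\<close>)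
  next
    fix f g assume "f \<in> carrier (bar_chains S M k)" "g \<in> carrier (bar_chains S M k)"
    thus "f \<oplus>\<^bsub>bar_chains S M k\<^esub> g \<in> carrier (bar_chains S M k)" by (rule bar_chains_add_closed)
  qed (auto simp: fun_eq_iff a_ac)
next
  fix c f assume "f \<in> carrier (bar_chains S M k)"
  thus "c \<odot>\<^bsub>bar_chains S M k\<^esub> f \<in> carrier (bar_chains S M k)" by (rule bar_chains_smult_closed)
qed (auto simp: fun_eq_iff scl_add scl_add_right scl_scl)

lemma bar_elem_linear:
  assumes "length l = k" "set l \<subseteq> S"
  shows "bar_elem M l \<in> linear_maps M (bar_chains S M k)"
proof (rule linear_mapsI)
  fix m assume m: "m \<in> carrier M"
  have "finite {l'. bar_elem M l m l' \<noteq> \<zero>}"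
    by (rule finite_subset[of _ "{l}"]) (auto simp: bar_elem_def)
  thus "bar_elem M l m \<in> carrier (bar_chains S M k)"
    using assms m by (auto simp: bar_elem_def split: if_splits)
qed (auto simp: bar_elem_def fun_eq_iff)

lemma eval_linear: "(\<lambda>f. f l) \<in> linear_maps (bar_chains S M k) M"
  by (rule linear_mapsI) auto

lemma bar_chains_expand:
  assumes f: "f \<in> carrier (bar_chains S M k)"
  shows "(\<Oplus>\<^bsub>bar_chains S M k\<^esub>l\<in>{l. f l \<noteq> \<zero>}. bar_elem M l (f l)) = f" (is "?s = f")
proof
  fix l0
  interpret B: qmodule "bar_chains S M k" by (rule qmodule_bar_chains)
  let ?S = "{l. f l \<noteq> \<zero>}"
  have fin: "finite ?S" and c: "\<And>l. f l \<in> carrier M" using f by auto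
  have "(\<lambda>l. bar_elem M l (f l)) \<in> ?S \<rightarrow> carrier (bar_chains S M k)"
    by (rule funcsetI, rule linear_mapsD(1)[OF bar_elem_linear]) (use f in auto)
  hence "?s l0 = (\<Oplus>l\<in>?S. bar_elem M l (f l) l0)"
    by (rule linear_maps_finsum[OF qmodule_bar_chains qmodule_axioms eval_linear])
  also have "\<dots> = (\<Oplus>l\<in>?S. if l0 = l then f l else \<zero>)"
    by (rule finsum_cong') (auto simp: bar_elem_def c)
  also have "\<dots> = f l0"
  proof (cases "f l0 = \<zero>")
    case True
    hence "(\<Oplus>l\<in>?S. if l0 = l then f l else \<zero>) = (\<Oplus>l\<in>?S. \<zero>)"
      by (intro finsum_cong') auto
    thus ?thesis using True by simp
  qed (use fin c in \<open>simp add: finsum_singleton\<close>)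
  finally show "?s l0 = f l0" .
qed

end

locale left_zero_bar = qmodule M for M :: "(rat, 'm) module" (structure) +
  fixes S :: "'s set" and mul :: "'s \<Rightarrow> 's \<Rightarrow> 's" and act :: "'s \<Rightarrow> 'm \<Rightarrow> 'm" and s0 :: 's
  assumes mul: "mul a b = a" and s0: "s0 \<in> S"
    and act: "s \<in> S \<Longrightarrow> act s \<in> linear_maps M M"
begin

abbreviation "B k \<equiv> bar_chains S M k"
abbreviation "face l \<equiv> bar_face_sum S mul act M l"
abbreviation "bd k \<equiv> bar_diff S mul act M k"

lemma linear_maps_sum:
  assumes "qmodule P" "finite I" "\<And>i. i \<in> I \<Longrightarrow> f i \<in> linear_maps M P"
  shows "(\<lambda>x. \<Oplus>\<^bsub>P\<^esub>i\<in>I. f i x) \<in> linear_maps M P"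
proof -
  interpret P: qmodule P by fact
  have F: "f i x \<in> carrier P" if "i \<in> I" "x \<in> carrier M" for i x
    using linear_mapsD(1)[OF assms(3)] that by blast
  show ?thesis
  proof (rule linear_mapsI)
    fix x y assume xy: "x \<in> carrier M" "y \<in> carrier M"
    have "(\<Oplus>\<^bsub>P\<^esub>i\<in>I. f i (x \<oplus> y)) = (\<Oplus>\<^bsub>P\<^esub>i\<in>I. f i x \<oplus>\<^bsub>P\<^esub> f i y)"
      by (rule P.finsum_cong') (use xy F linear_mapsD(2)[OF assms(3)] in auto)
    also have "\<dots> = (\<Oplus>\<^bsub>P\<^esub>i\<in>I. f i x) \<oplus>\<^bsub>P\<^esub> (\<Oplus>\<^bsub>P\<^esub>i\<in>I. f i y)"
      by (rule P.finsum_addf) (use xy F in auto)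
    finally show "(\<Oplus>\<^bsub>P\<^esub>i\<in>I. f i (x \<oplus> y)) = (\<Oplus>\<^bsub>P\<^esub>i\<in>I. f i x) \<oplus>\<^bsub>P\<^esub> (\<Oplus>\<^bsub>P\<^esub>i\<in>I. f i y)" .
  next
    fix c x assume x: "x \<in> carrier M"
    have "(\<Oplus>\<^bsub>P\<^esub>i\<in>I. f i (c \<odot> x)) = (\<Oplus>\<^bsub>P\<^esub>i\<in>I. c \<odot>\<^bsub>P\<^esub> f i x)"
      by (rule P.finsum_cong') (use x F linear_mapsD(3)[OF assms(3)] in auto)
    also have "\<dots> = c \<odot>\<^bsub>P\<^esub> (\<Oplus>\<^bsub>P\<^esub>i\<in>I. f i x)"
      by (rule P.finsum_smult_ldistr[symmetric]) (use assms(2) x F in auto)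
    finally show "(\<Oplus>\<^bsub>P\<^esub>i\<in>I. f i (c \<odot> x)) = c \<odot>\<^bsub>P\<^esub> (\<Oplus>\<^bsub>P\<^esub>i\<in>I. f i x)" .
  qed (use F in \<open>auto intro!: P.finsum_closed\<close>)
qed

lemma face_eq:
  "face l m = bar_elem M (tl l) m
     \<oplus>\<^bsub>B (length l - 1)\<^esub> (\<Oplus>\<^bsub>B (length l - 1)\<^esub>i\<in>{1..<length l}. (- 1) ^ i \<odot>\<^bsub>B (length l - 1)\<^esub>
               bar_elem M (take (i - 1) l @ [l ! (i - 1)] @ drop (i + 1) l) m)
     \<oplus>\<^bsub>B (length l - 1)\<^esub> ((- 1) ^ length l \<odot>\<^bsub>B (length l - 1)\<^esub> bar_elem M (butlast l) (act (last l) m))"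
  by (simp add: bar_face_sum_def Let_def mul)

lemma face_linear:
  assumes "l \<noteq> []" "set l \<subseteq> S"
  shows "face l \<in> linear_maps M (B (length l - 1))"
proof -
  have *: "bar_elem M l' \<in> linear_maps M (B (length l - 1))"
    if "length l' = length l - 1" "set l' \<subseteq> set l" for l'
    using that assms by (intro bar_elem_linear) auto
  have tl: "set (tl l) \<subseteq> set l" by (cases l) auto
  have sub: "set (take (i - 1) l @ [l ! (i - 1)] @ drop (i + 1) l) \<subseteq> set l" if "i < length l" for i
    using set_take_subset[of "i - 1" l] set_drop_subset[of "i + 1" l] that by auto
  have last: "act (last l) \<in> linear_maps M M" using assms by (intro act) auto
  show ?thesis
    unfolding face_eq
    by (intro linear_maps_add linear_maps_sum linear_maps_scale qmodule_bar_chains * tl sub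
        linear_maps_comp[OF last])
      (auto dest: in_set_butlastD)
qed

text \<open>The defining sum runs over the support of \<open>f\<close>. A common larger index set
  makes the differentials of sums and multiples comparable.\<close>

lemma diff_eq_superset:
  assumes "k > 0" "f \<in> carrier (B k)" "finite T" "{l. f l \<noteq> \<zero>} \<subseteq> T"
    "\<And>l. l \<in> T \<Longrightarrow> length l = k \<and> set l \<subseteq> S"
  shows "bd k f = (\<Oplus>\<^bsub>B (k - 1)\<^esub>l\<in>T. face l (f l))"
proof -
  interpret Bk: qmodule "B (k - 1)" by (rule qmodule_bar_chains)
  have L: "face l \<in> linear_maps M (B (k - 1))" if "l \<in> T" for l
  proof -
    have "l \<noteq> []" "length l = k" "set l \<subseteq> S" using assms(1) assms(5)[OF that] by auto
    thus ?thesis using face_linear[of l] by simp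
  qed
  have "(\<Oplus>\<^bsub>B (k - 1)\<^esub>l\<in>{l. f l \<noteq> \<zero>}. face l (f l)) = (\<Oplus>\<^bsub>B (k - 1)\<^esub>l\<in>T. face l (f l))"
  proof (rule Bk.add.finprod_mono_neutral_cong_left[OF assms(3,4)])
    show "face l (f l) = \<zero>\<^bsub>B (k - 1)\<^esub>" if "l \<in> T - {l. f l \<noteq> \<zero>}" for l
      using that linear_maps_zero[OF qmodule_axioms qmodule_bar_chains L] by simp
    show "(\<lambda>l. face l (f l)) \<in> T \<rightarrow> carrier (B (k - 1))"
      by (rule funcsetI, rule linear_mapsD(1)[OF L]) (use assms(2) in auto)
  qed simp
  thus ?thesis using assms(1) by (simp add: bar_diff_def)
qed

lemma diff_linear:
  assumes k: "k > 0"
  shows "bd k \<in> linear_maps (B k) (B (k - 1))"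
proof -
  interpret Bk: qmodule "B k" by (rule qmodule_bar_chains)
  interpret B': qmodule "B (k - 1)" by (rule qmodule_bar_chains)
  define supp where "supp f = {l. f l \<noteq> \<zero>}" for f :: "'s list \<Rightarrow> 'm"
  have ok: "finite (supp f)" "\<And>l. l \<in> supp f \<Longrightarrow> length l = k \<and> set l \<subseteq> S"
    if "f \<in> carrier (B k)" for f using that by (auto simp: supp_def)
  have L: "face l \<in> linear_maps M (B (k - 1))" if "length l = k \<and> set l \<subseteq> S" for l
    using face_linear[of l] that k by (cases l) auto
  have D: "bd k f = (\<Oplus>\<^bsub>B (k - 1)\<^esub>l\<in>T. face l (f l))"
    if "f \<in> carrier (B k)" "finite T" "supp f \<subseteq> T" "\<And>l. l \<in> T \<Longrightarrow> length l = k \<and> set l \<subseteq> S" for f T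
    using diff_eq_superset[OF k that(1,2) _ that(4)] that(3) by (simp add: supp_def)
  have fc: "f l \<in> carrier M" if "f \<in> carrier (B k)" for f l using that by simp
  have Fc: "(\<lambda>l. face l (f l)) \<in> T \<rightarrow> carrier (B (k - 1))"
    if "f \<in> carrier (B k)" "\<And>l. l \<in> T \<Longrightarrow> length l = k \<and> set l \<subseteq> S" for f T
    by (rule funcsetI, rule linear_mapsD(1)[OF L[OF that(2)]]) (use fc that in auto)
  show ?thesis
  proof (rule linear_mapsI)
    fix f assume f: "f \<in> carrier (B k)"
    have Fcf: "(\<lambda>l. face l (f l)) \<in> supp f \<rightarrow> carrier (B (k - 1))"
      by (rule Fc[OF f]) (rule ok(2)[OF f])
    have Df: "bd k f = (\<Oplus>\<^bsub>B (k - 1)\<^esub>l\<in>supp f. face l (f l))"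
      by (rule D[OF f ok(1)[OF f] subset_refl]) (rule ok(2)[OF f])
    show "bd k f \<in> carrier (B (k - 1))"
      unfolding Df by (rule B'.finsum_closed[OF Fcf])
    fix c
    have cf: "c \<odot>\<^bsub>B k\<^esub> f \<in> carrier (B k)" by (rule bar_chains_smult_closed[OF f])
    have "bd k (c \<odot>\<^bsub>B k\<^esub> f) = (\<Oplus>\<^bsub>B (k - 1)\<^esub>l\<in>supp f. face l ((c \<odot>\<^bsub>B k\<^esub> f) l))"
      by (rule D[OF cf ok(1)[OF f]]) (use ok(2)[OF f] in \<open>auto simp: supp_def\<close>)
    also have "\<dots> = (\<Oplus>\<^bsub>B (k - 1)\<^esub>l\<in>supp f. c \<odot>\<^bsub>B (k - 1)\<^esub> face l (f l))"
    proof (rule B'.finsum_cong'[OF refl])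
      show "(\<lambda>l. c \<odot>\<^bsub>B (k - 1)\<^esub> face l (f l)) \<in> supp f \<rightarrow> carrier (B (k - 1))"
        using Fcf by (intro funcsetI B'.scl) blast
      show "face l ((c \<odot>\<^bsub>B k\<^esub> f) l) = c \<odot>\<^bsub>B (k - 1)\<^esub> face l (f l)" if "l \<in> supp f" for l
        using linear_mapsD(3)[OF L[OF ok(2)[OF f that]] fc[OF f]] by simp
    qed
    also have "\<dots> = c \<odot>\<^bsub>B (k - 1)\<^esub> bd k f"
      unfolding Df by (rule B'.finsum_smult_ldistr[OF ok(1)[OF f] _ Fcf, symmetric]) simp
    finally show "bd k (c \<odot>\<^bsub>B k\<^esub> f) = c \<odot>\<^bsub>B (k - 1)\<^esub> bd k f" .
    fix g assume g: "g \<in> carrier (B k)"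
    let ?T = "supp f \<union> supp g"
    have T: "finite ?T" "\<And>l. l \<in> ?T \<Longrightarrow> length l = k \<and> set l \<subseteq> S"
      using ok[OF f] ok[OF g] by blast+
    have fg: "f \<oplus>\<^bsub>B k\<^esub> g \<in> carrier (B k)" by (rule bar_chains_add_closed[OF f g])
    have FcT: "(\<lambda>l. face l (f l)) \<in> ?T \<rightarrow> carrier (B (k - 1))"
      "(\<lambda>l. face l (g l)) \<in> ?T \<rightarrow> carrier (B (k - 1))"
      by (rule Fc[OF f T(2)] Fc[OF g T(2)]; assumption)+
    have DT: "bd k f = (\<Oplus>\<^bsub>B (k - 1)\<^esub>l\<in>?T. face l (f l))"
      "bd k g = (\<Oplus>\<^bsub>B (k - 1)\<^esub>l\<in>?T. face l (g l))"
      by (rule D[OF f T(1) Un_upper1 T(2)] D[OF g T(1) Un_upper2 T(2)]; assumption)+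
    have "bd k (f \<oplus>\<^bsub>B k\<^esub> g) = (\<Oplus>\<^bsub>B (k - 1)\<^esub>l\<in>?T. face l ((f \<oplus>\<^bsub>B k\<^esub> g) l))"
      by (rule D[OF fg T(1)]) (use T(2) in \<open>auto simp: supp_def\<close>)
    also have "\<dots> = (\<Oplus>\<^bsub>B (k - 1)\<^esub>l\<in>?T. face l (f l) \<oplus>\<^bsub>B (k - 1)\<^esub> face l (g l))"
    proof (rule B'.finsum_cong'[OF refl])
      show "(\<lambda>l. face l (f l) \<oplus>\<^bsub>B (k - 1)\<^esub> face l (g l)) \<in> ?T \<rightarrow> carrier (B (k - 1))"
        using FcT by (intro funcsetI B'.a_closed) blast+
      show "face l ((f \<oplus>\<^bsub>B k\<^esub> g) l) = face l (f l) \<oplus>\<^bsub>B (k - 1)\<^esub> face l (g l)" if "l \<in> ?T" for l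
        using linear_mapsD(2)[OF L[OF T(2)[OF that]] fc[OF f] fc[OF g]] by simp
    qed
    also have "\<dots> = bd k f \<oplus>\<^bsub>B (k - 1)\<^esub> bd k g"
      unfolding DT by (rule B'.finsum_addf[OF FcT])
    finally show "bd k (f \<oplus>\<^bsub>B k\<^esub> g) = bd k f \<oplus>\<^bsub>B (k - 1)\<^esub> bd k g" .
  qed
qed

lemma boundaries_submodule: "submodule (bar_boundaries S mul act M p) rat_ring (B p)"
proof -
  interpret B1: qmodule "B (Suc p)" by (rule qmodule_bar_chains)
  interpret B0: qmodule "B p" by (rule qmodule_bar_chains)
  have L: "bd (Suc p) \<in> linear_maps (B (Suc p)) (B p)" using diff_linear[of "Suc p"] by simp
  note L' = linear_mapsD[OF L]
  show ?thesis
  proof (rule B0.subI)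
    show "bar_boundaries S mul act M p \<subseteq> carrier (B p)"
      unfolding bar_boundaries_def using L'(1) by blast
    show "\<zero>\<^bsub>B p\<^esub> \<in> bar_boundaries S mul act M p"
      unfolding bar_boundaries_def
      by (rule image_eqI[OF _ B1.zero_closed])
        (rule linear_maps_zero[OF qmodule_bar_chains qmodule_bar_chains L, symmetric])
    fix x assume "x \<in> bar_boundaries S mul act M p"
    then obtain u where u: "u \<in> carrier (B (Suc p))" "x = bd (Suc p) u"
      unfolding bar_boundaries_def by blast
    show "c \<odot>\<^bsub>B p\<^esub> x \<in> bar_boundaries S mul act M p" for c
      unfolding bar_boundaries_def u(2) by (rule image_eqI[OF _ B1.scl[OF u(1)]]) (rule L'(3)[OF u(1), symmetric])
    fix y assume "y \<in> bar_boundaries S mul act M p"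
    then obtain v where v: "v \<in> carrier (B (Suc p))" "y = bd (Suc p) v"
      unfolding bar_boundaries_def by blast
    show "x \<oplus>\<^bsub>B p\<^esub> y \<in> bar_boundaries S mul act M p"
      unfolding bar_boundaries_def u(2) v(2)
      by (rule image_eqI[OF _ B1.a_closed[OF u(1) v(1)]]) (rule L'(2)[OF u(1) v(1), symmetric])
  qed
qed

text \<open>Prepending \<open>s0\<close> contracts the bar complex in positive degrees, because in the products
  \<open>s\<^sub>i s\<^sub>i\<^sub>+\<^sub>1 = s\<^sub>i\<close> the face maps delete an entry, as in a simplex.\<close>

definition cone :: "('s list \<Rightarrow> 'm) \<Rightarrow> 's list \<Rightarrow> 'm" where
  "cone f l = (if l \<noteq> [] \<and> hd l = s0 then f (tl l) else \<zero>)"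

lemma cone_linear: "cone \<in> linear_maps (B k) (B (Suc k))"
proof (rule linear_mapsI)
  fix f assume f: "f \<in> carrier (B k)"
  have "{l. cone f l \<noteq> \<zero>} \<subseteq> (#) s0 ` {l. f l \<noteq> \<zero>}"
  proof
    fix l assume "l \<in> {l. cone f l \<noteq> \<zero>}"
    thus "l \<in> (#) s0 ` {l. f l \<noteq> \<zero>}" by (cases l) (auto simp: cone_def split: if_splits)
  qed
  hence "finite {l. cone f l \<noteq> \<zero>}" by (rule finite_subset) (use f in auto)
  moreover have "length l = Suc k \<and> set l \<subseteq> S" if "cone f l \<noteq> \<zero>" for l
    using that f s0 by (cases l) (auto simp: cone_def split: if_splits)
  moreover have "cone f l \<in> carrier M" for l using f by (auto simp: cone_def)
  ultimately show "cone f \<in> carrier (B (Suc k))" by simp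
qed (auto simp: cone_def fun_eq_iff)

lemma cone_bar_elem: "cone (bar_elem M l m) = bar_elem M (s0 # l) m"
proof
  fix l' show "cone (bar_elem M l m) l' = bar_elem M (s0 # l) m l'"
    by (cases l') (auto simp: cone_def bar_elem_def)
qed

text \<open>The first face of \<open>s0 # l\<close> is \<open>l\<close>. By
  \<open>mul a b = a\<close> the next one replaces \<open>s0\<close> and the head of
  \<open>l\<close> by \<open>s0\<close>, that is, it deletes this head. So every face of
  \<open>l\<close> reappears behind \<open>s0\<close> with its index raised by one and its sign
  reversed. For \<open>l = []\<close> the pattern breaks, since the last face lets \<open>s0\<close>
  act on \<open>m\<close>.\<close>

lemma face_cone:
  assumes l: "l \<noteq> []" "set l \<subseteq> S" and m: "m \<in> carrier M"
  shows "face (s0 # l) m = bar_elem M l m \<ominus>\<^bsub>B (length l)\<^esub> cone (face l m)"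
proof -
  define k where "k = length l"
  have k: "k > 0" using l by (simp add: k_def)
  have Sk: "Suc (k - 1) = k" using k by simp
  interpret Bk: qmodule "B k" by (rule qmodule_bar_chains)
  interpret B': qmodule "B (k - 1)" by (rule qmodule_bar_chains)
  have C: "cone \<in> linear_maps (B (k - 1)) (B k)" using cone_linear[of "k - 1"] Sk by simp
  note C' = linear_mapsD[OF C]
  have bc: "bar_elem M l' x \<in> carrier (B j)" if "length l' = j" "set l' \<subseteq> S" "x \<in> carrier M" for l' j x
    using linear_mapsD(1)[OF bar_elem_linear] that by blast
  define d where "d i = take (i - 1) l @ [l ! (i - 1)] @ drop (i + 1) l" for i
  define am where "am = act (last l) m"
  have am: "am \<in> carrier M"
    unfolding am_def using linear_mapsD(1)[OF act m] l by (meson last_in_set subsetD)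
  have tl: "length (tl l) = k - 1" "set (tl l) \<subseteq> S" using l by (auto simp: k_def dest: list.set_sel(2))
  have bl: "length (butlast l) = k - 1" "set (butlast l) \<subseteq> S"
    using l by (auto simp: k_def dest: in_set_butlastD)
  have d: "length (d i) = k - 1" "set (d i) \<subseteq> S" if "i \<in> {1..<k}" for i
    using that l set_take_subset[of "i - 1" l] set_drop_subset[of "i + 1" l]
    by (auto simp: d_def k_def)
  have scB: "c \<odot>\<^bsub>B k\<^esub> x = c \<odot>\<^bsub>B (k - 1)\<^esub> x" for c x by simp
  have E0: "face l m = bar_elem M (tl l) m
     \<oplus>\<^bsub>B (k - 1)\<^esub> (\<Oplus>\<^bsub>B (k - 1)\<^esub>i\<in>{1..<k}. (- 1) ^ i \<odot>\<^bsub>B (k - 1)\<^esub> bar_elem M (d i) m)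
     \<oplus>\<^bsub>B (k - 1)\<^esub> ((- 1) ^ k \<odot>\<^bsub>B (k - 1)\<^esub> bar_elem M (butlast l) am)"
    by (simp only: face_eq k_def d_def am_def)
  have bcs: "(\<lambda>i. (- 1) ^ i \<odot>\<^bsub>B (k - 1)\<^esub> bar_elem M (d i) m) \<in> {1..<k} \<rightarrow> carrier (B (k - 1))"
    by (intro funcsetI B'.scl bc d m)
  have bcs': "(\<lambda>i. (- 1) ^ i \<odot>\<^bsub>B k\<^esub> bar_elem M (s0 # d i) m) \<in> {1..<k} \<rightarrow> carrier (B k)"
    using d Sk s0 k by (intro funcsetI Bk.scl bc m) auto
  \<comment> \<open>\<open>X\<close>, \<open>Y\<close> and \<open>Z\<close> are the three parts of
    \<open>cone (face l m)\<close>: the first face, the faces given by products, and the face that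
    acts on the coefficient.\<close>
  define X where "X = bar_elem M (s0 # tl l) m"
  define Y where "Y = (\<Oplus>\<^bsub>B k\<^esub>i\<in>{1..<k}. (- 1) ^ i \<odot>\<^bsub>B k\<^esub> bar_elem M (s0 # d i) m)"
  define Z where "Z = (- 1) ^ k \<odot>\<^bsub>B k\<^esub> bar_elem M (s0 # butlast l) am"
  have Xc: "X \<in> carrier (B k)" unfolding X_def by (rule bc) (use tl s0 Sk m in auto)
  have Yc: "Y \<in> carrier (B k)" unfolding Y_def by (rule Bk.finsum_closed[OF bcs'])
  have Zc: "Z \<in> carrier (B k)" unfolding Z_def by (rule Bk.scl, rule bc) (use bl s0 Sk am in auto)
  have T1: "bar_elem M (tl l) m \<in> carrier (B (k - 1))" by (rule bc[OF tl m])
  have T2: "(\<Oplus>\<^bsub>B (k - 1)\<^esub>i\<in>{1..<k}. (- 1) ^ i \<odot>\<^bsub>B (k - 1)\<^esub> bar_elem M (d i) m) \<in> carrier (B (k - 1))"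
    by (rule B'.finsum_closed[OF bcs])
  have T3: "bar_elem M (butlast l) am \<in> carrier (B (k - 1))" by (rule bc[OF bl am])
  have "cone (\<Oplus>\<^bsub>B (k - 1)\<^esub>i\<in>{1..<k}. (- 1) ^ i \<odot>\<^bsub>B (k - 1)\<^esub> bar_elem M (d i) m) =
      (\<Oplus>\<^bsub>B k\<^esub>i\<in>{1..<k}. cone ((- 1) ^ i \<odot>\<^bsub>B (k - 1)\<^esub> bar_elem M (d i) m))"
    by (rule linear_maps_finsum[OF qmodule_bar_chains qmodule_bar_chains C bcs])
  also have "\<dots> = Y"
    unfolding Y_def
    by (rule Bk.finsum_cong'[OF refl bcs'], subst C'(3)[OF bc[OF d m]])
      (simp_all add: cone_bar_elem)
  finally have cY: "cone (\<Oplus>\<^bsub>B (k - 1)\<^esub>i\<in>{1..<k}. (- 1) ^ i \<odot>\<^bsub>B (k - 1)\<^esub> bar_elem M (d i) m) = Y" .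
  have cF: "cone (face l m) = X \<oplus>\<^bsub>B k\<^esub> Y \<oplus>\<^bsub>B k\<^esub> Z"
    unfolding E0 using T1 T2 B'.scl[OF T3]
    by (simp only: C'(2) B'.a_closed cY C'(3)[OF T3] cone_bar_elem X_def Z_def)
  have E1: "face (s0 # l) m = bar_elem M l m
     \<oplus>\<^bsub>B k\<^esub> (\<Oplus>\<^bsub>B k\<^esub>i\<in>{1..<Suc k}. (- 1) ^ i \<odot>\<^bsub>B k\<^esub>
          bar_elem M (take (i - 1) (s0 # l) @ [(s0 # l) ! (i - 1)] @ drop (i + 1) (s0 # l)) m)
     \<oplus>\<^bsub>B k\<^esub> ((- 1) ^ Suc k \<odot>\<^bsub>B k\<^esub> bar_elem M (s0 # butlast l) am)"
    unfolding face_eq using l by (simp add: k_def am_def del: bar_chains_simps power_Suc)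
  let ?g = "\<lambda>i. (- 1) ^ i \<odot>\<^bsub>B k\<^esub>
          bar_elem M (take (i - 1) (s0 # l) @ [(s0 # l) ! (i - 1)] @ drop (i + 1) (s0 # l)) m"
  have g1: "?g 1 = \<ominus>\<^bsub>B k\<^esub> X"
    using Bk.minus_eq_scl[OF Xc] by (simp add: X_def drop_Suc del: bar_chains_simps)
  have gS: "?g (Suc i) = \<ominus>\<^bsub>B k\<^esub> ((- 1) ^ i \<odot>\<^bsub>B k\<^esub> bar_elem M (s0 # d i) m)" if "i \<in> {1..<k}" for i
  proof -
    have "take i (s0 # l) @ [(s0 # l) ! i] @ drop (i + 2) (s0 # l) = s0 # d i"
      using that by (cases i) (auto simp: d_def)
    moreover have "bar_elem M (s0 # d i) m \<in> carrier (B k)"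
      using d[OF that] Sk s0 k by (intro bc m) auto
    ultimately show ?thesis
      using Bk.scl_uminus[of "bar_elem M (s0 # d i) m" "(- 1) ^ i"] by (simp del: bar_chains_simps)
  qed
  have ins: "{1..<Suc k} = insert 1 (Suc ` {1..<k})" using k by (auto simp: image_Suc_atLeastLessThan)
  have gSc: "(\<lambda>i. ?g (Suc i)) \<in> {1..<k} \<rightarrow> carrier (B k)"
    using gS bcs' by (intro funcsetI) (metis (no_types, lifting) Bk.a_inv_closed PiE)
  have gc: "?g \<in> Suc ` {1..<k} \<rightarrow> carrier (B k)" using gSc by blast
  have "(\<Oplus>\<^bsub>B k\<^esub>i\<in>{1..<Suc k}. ?g i) = \<ominus>\<^bsub>B k\<^esub> X \<oplus>\<^bsub>B k\<^esub> (\<Oplus>\<^bsub>B k\<^esub>i\<in>Suc ` {1..<k}. ?g i)"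
    unfolding ins by (subst Bk.finsum_insert) (use gc g1 Xc in \<open>auto simp del: bar_chains_simps\<close>)
  also have "(\<Oplus>\<^bsub>B k\<^esub>i\<in>Suc ` {1..<k}. ?g i) = (\<Oplus>\<^bsub>B k\<^esub>i\<in>{1..<k}. ?g (Suc i))"
    by (rule Bk.finsum_reindex[OF gc]) simp
  also have "\<dots> = (\<Oplus>\<^bsub>B k\<^esub>i\<in>{1..<k}. (- 1) \<odot>\<^bsub>B k\<^esub> ((- 1) ^ i \<odot>\<^bsub>B k\<^esub> bar_elem M (s0 # d i) m))"
  proof (rule Bk.finsum_cong'[OF refl])
    show "(\<lambda>i. (- 1) \<odot>\<^bsub>B k\<^esub> ((- 1) ^ i \<odot>\<^bsub>B k\<^esub> bar_elem M (s0 # d i) m)) \<in> {1..<k} \<rightarrow> carrier (B k)"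
      by (rule funcsetI, rule Bk.scl) (use bcs' in blast)
    fix i assume i: "i \<in> {1..<k}"
    have "(- 1) ^ i \<odot>\<^bsub>B k\<^esub> bar_elem M (s0 # d i) m \<in> carrier (B k)" using bcs' i by blast
    thus "?g (Suc i) = (- 1) \<odot>\<^bsub>B k\<^esub> ((- 1) ^ i \<odot>\<^bsub>B k\<^esub> bar_elem M (s0 # d i) m)"
      unfolding gS[OF i] by (rule Bk.minus_eq_scl)
  qed
  also have "\<dots> = \<ominus>\<^bsub>B k\<^esub> Y"
    unfolding Y_def using bcs' Yc
    by (subst Bk.finsum_smult_ldistr[symmetric]) (auto simp: Bk.minus_eq_scl Y_def simp del: bar_chains_simps)
  finally have sum: "(\<Oplus>\<^bsub>B k\<^esub>i\<in>{1..<Suc k}. ?g i) = \<ominus>\<^bsub>B k\<^esub> X \<oplus>\<^bsub>B k\<^esub> \<ominus>\<^bsub>B k\<^esub> Y" .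
  have last: "(- 1) ^ Suc k \<odot>\<^bsub>B k\<^esub> bar_elem M (s0 # butlast l) am = \<ominus>\<^bsub>B k\<^esub> Z"
  proof -
    have "bar_elem M (s0 # butlast l) am \<in> carrier (B k)" by (rule bc) (use bl s0 Sk am in auto)
    thus ?thesis
      using Bk.scl_uminus[of "bar_elem M (s0 # butlast l) am" "(- 1) ^ k"]
      by (simp add: Z_def del: bar_chains_simps)
  qed
  have m': "bar_elem M l m \<in> carrier (B k)" by (rule bc) (use l m in \<open>auto simp: k_def\<close>)
  show ?thesis
    unfolding E1 sum last cF k_def[symmetric] a_minus_def
    using Xc Yc Zc m' by (simp add: Bk.minus_add Bk.a_ac del: bar_chains_simps)
qed

text \<open>The contraction identity \<open>d c + c d = 1\<close> for \<open>c = cone\<close>,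
  obtained by summing \<open>face_cone\<close> over the support of \<open>f\<close>.\<close>

lemma diff_cone:
  assumes p: "p > 0" and f: "f \<in> carrier (B p)"
  shows "bd (Suc p) (cone f) = f \<ominus>\<^bsub>B p\<^esub> cone (bd p f)"
proof -
  interpret Bp: qmodule "B p" by (rule qmodule_bar_chains)
  interpret B': qmodule "B (p - 1)" by (rule qmodule_bar_chains)
  have C: "cone \<in> linear_maps (B (p - 1)) (B p)" using cone_linear[of "p - 1"] p by simp
  let ?S = "{l. f l \<noteq> \<zero>}"
  have S: "finite ?S" "\<And>l. l \<in> ?S \<Longrightarrow> length l = p \<and> set l \<subseteq> S" using f by auto
  have fc: "f l \<in> carrier M" for l using f by simp
  have cf: "cone f \<in> carrier (B (Suc p))" by (rule linear_mapsD(1)[OF cone_linear f])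
  have Sl: "l \<noteq> []" "length l = p" "set l \<subseteq> S" if "l \<in> ?S" for l using S(2)[OF that] p by auto
  have F: "face l (f l) \<in> carrier (B (p - 1))" if "l \<in> ?S" for l
    using linear_mapsD(1)[OF face_linear[OF Sl(1,3)[OF that]] fc] Sl(2)[OF that] by simp
  have F': "cone (face l (f l)) \<in> carrier (B p)" if "l \<in> ?S" for l
    by (rule linear_mapsD(1)[OF C F[OF that]])
  have E: "bar_elem M l (f l) \<in> carrier (B p)" if "l \<in> ?S" for l
    by (rule linear_mapsD(1)[OF bar_elem_linear[OF Sl(2,3)[OF that]] fc])
  have "bd (Suc p) (cone f) = (\<Oplus>\<^bsub>B (Suc p - 1)\<^esub>l\<in>(#) s0 ` ?S. face l (cone f l))"
  proof (rule diff_eq_superset[OF _ cf])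
    show "{l. cone f l \<noteq> \<zero>} \<subseteq> (#) s0 ` ?S"
    proof
      fix l assume "l \<in> {l. cone f l \<noteq> \<zero>}"
      thus "l \<in> (#) s0 ` ?S" by (cases l) (auto simp: cone_def split: if_splits)
    qed
    show "length l = Suc p \<and> set l \<subseteq> S" if "l \<in> (#) s0 ` ?S" for l
    proof -
      from that obtain l' where l': "l' \<in> ?S" "l = s0 # l'" by blast
      thus ?thesis using S(2)[OF l'(1)] s0 by simp
    qed
  qed (use S(1) in auto)
  also have "\<dots> = (\<Oplus>\<^bsub>B p\<^esub>l\<in>(#) s0 ` ?S. face l (cone f l))" by simp
  also have "\<dots> = (\<Oplus>\<^bsub>B p\<^esub>l\<in>?S. face (s0 # l) (cone f (s0 # l)))"
  proof (rule Bp.finsum_reindex)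
    show "(\<lambda>l. face l (cone f l)) \<in> (#) s0 ` ?S \<rightarrow> carrier (B p)"
    proof (rule funcsetI)
      fix l assume "l \<in> (#) s0 ` ?S"
      then obtain l' where l': "l' \<in> ?S" "l = s0 # l'" by blast
      have "face l \<in> linear_maps M (B (length l - 1))"
        using Sl(3)[OF l'(1)] s0 l'(2) by (intro face_linear) auto
      moreover have "length l - 1 = p" using Sl(2)[OF l'(1)] l'(2) by simp
      moreover have "cone f l \<in> carrier M" using fc by (simp add: cone_def)
      ultimately show "face l (cone f l) \<in> carrier (B p)" using linear_mapsD(1) by metis
    qed
  qed simp
  also have "\<dots> = (\<Oplus>\<^bsub>B p\<^esub>l\<in>?S. bar_elem M l (f l) \<oplus>\<^bsub>B p\<^esub> (- 1) \<odot>\<^bsub>B p\<^esub> cone (face l (f l)))"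
  proof (rule Bp.finsum_cong'[OF refl])
    show "(\<lambda>l. bar_elem M l (f l) \<oplus>\<^bsub>B p\<^esub> (- 1) \<odot>\<^bsub>B p\<^esub> cone (face l (f l))) \<in> ?S \<rightarrow> carrier (B p)"
      by (intro funcsetI Bp.a_closed Bp.scl E F')
    fix l assume l: "l \<in> ?S"
    show "face (s0 # l) (cone f (s0 # l)) =
        bar_elem M l (f l) \<oplus>\<^bsub>B p\<^esub> (- 1) \<odot>\<^bsub>B p\<^esub> cone (face l (f l))"
      using face_cone[OF Sl(1,3)[OF l] fc] Bp.minus_eq_scl[OF F'[OF l]]
      unfolding Sl(2)[OF l] a_minus_def by (simp add: cone_def del: bar_chains_simps)
  qed
  also have "\<dots> = (\<Oplus>\<^bsub>B p\<^esub>l\<in>?S. bar_elem M l (f l)) \<oplus>\<^bsub>B p\<^esub> (\<Oplus>\<^bsub>B p\<^esub>l\<in>?S. (- 1) \<odot>\<^bsub>B p\<^esub> cone (face l (f l)))"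
    by (rule Bp.finsum_addf) (intro funcsetI Bp.scl E F' | assumption)+
  also have "(\<Oplus>\<^bsub>B p\<^esub>l\<in>?S. bar_elem M l (f l)) = f" by (rule bar_chains_expand[OF f])
  also have "(\<Oplus>\<^bsub>B p\<^esub>l\<in>?S. (- 1) \<odot>\<^bsub>B p\<^esub> cone (face l (f l))) = (- 1) \<odot>\<^bsub>B p\<^esub> (\<Oplus>\<^bsub>B p\<^esub>l\<in>?S. cone (face l (f l)))"
    by (rule Bp.finsum_smult_ldistr[OF S(1), symmetric]) (simp, rule funcsetI, rule F')
  also have "(\<Oplus>\<^bsub>B p\<^esub>l\<in>?S. cone (face l (f l))) = cone (\<Oplus>\<^bsub>B (p - 1)\<^esub>l\<in>?S. face l (f l))"
    by (rule linear_maps_finsum[OF qmodule_bar_chains qmodule_bar_chains C, symmetric])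
      (rule funcsetI, rule F)
  also have "(\<Oplus>\<^bsub>B (p - 1)\<^esub>l\<in>?S. face l (f l)) = bd p f"
    using p by (simp add: bar_diff_def del: bar_chains_simps)
  finally show ?thesis
    unfolding a_minus_def
    using Bp.minus_eq_scl linear_mapsD(1)[OF C linear_mapsD(1)[OF diff_linear[OF p] f]]
    by (simp del: bar_chains_simps)
qed

text \<open>A cycle of positive degree is the boundary of its cone.\<close>

theorem homology_positive:
  assumes p: "p > 0"
  shows "carrier (semigroup_homology S mul act M p) = {\<zero>\<^bsub>semigroup_homology S mul act M p\<^esub>}"
proof -
  interpret Bp: qmodule "B p" by (rule qmodule_bar_chains)
  let ?Z = "bar_cycles S mul act M p" and ?B = "bar_boundaries S mul act M p"
  interpret q: qquotient "B p" ?B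
    by (rule qquotientI[OF qmodule_bar_chains boundaries_submodule])
  have C: "cone \<in> linear_maps (B (p - 1)) (B p)" using cone_linear[of "p - 1"] p by simp
  have coset: "?B +>\<^bsub>?Z\<^esub> z = ?B +>\<^bsub>B p\<^esub> z" for z
    by (simp add: a_r_coset_def' bar_cycles_def)
  have "?B +>\<^bsub>?Z\<^esub> z = ?B" if "z \<in> carrier ?Z" for z
  proof -
    have z: "z \<in> carrier (B p)" "bd p z = \<zero>\<^bsub>B (p - 1)\<^esub>"
      using that unfolding bar_cycles_def by auto
    have "bd (Suc p) (cone z) = z \<ominus>\<^bsub>B p\<^esub> cone \<zero>\<^bsub>B (p - 1)\<^esub>"
      using diff_cone[OF p z(1)] z(2) by (simp del: bar_chains_simps)
    also have "cone \<zero>\<^bsub>B (p - 1)\<^esub> = \<zero>\<^bsub>B p\<^esub>"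
      by (rule linear_maps_zero[OF qmodule_bar_chains qmodule_bar_chains C])
    also have "z \<ominus>\<^bsub>B p\<^esub> \<zero>\<^bsub>B p\<^esub> = z" using z(1) by (simp add: a_minus_def del: bar_chains_simps)
    finally have "z \<in> ?B"
      unfolding bar_boundaries_def using linear_mapsD(1)[OF cone_linear z(1)] by (metis imageI)
    thus ?thesis unfolding coset using q.coset_eq_zero_iff[OF z(1)] by simp
  qed
  moreover have "(\<lambda>l. \<zero>) \<in> carrier ?Z"
  proof -
    have "bd p \<zero>\<^bsub>B p\<^esub> = \<zero>\<^bsub>B (p - 1)\<^esub>"
      by (rule linear_maps_zero[OF qmodule_bar_chains qmodule_bar_chains diff_linear[OF p]])
    thus ?thesis by (simp add: bar_cycles_def)
  qed
  ultimately show ?thesis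
    unfolding semigroup_homology_def quot_module_def A_RCOSETS_def' by auto
qed

text \<open>Invariance of \<open>pr\<close> under the action makes it vanish on boundaries.
  Conversely, if \<open>pr m\<close> is zero then \<open>s0\<close> annihilates \<open>m\<close>,
  and the boundary of \<open>[s0] \<otimes> m\<close> is \<open>m\<close> minus its image under
  \<open>s0\<close>, that is, \<open>m\<close> itself.\<close>

theorem homology_zero:
  assumes P: "qmodule P" and pr: "pr \<in> linear_maps M P" and surj: "pr ` carrier M = carrier P"
    and pr_act: "\<And>s m. s \<in> S \<Longrightarrow> m \<in> carrier M \<Longrightarrow> pr (act s m) = pr m"
    and ker: "\<And>m. m \<in> carrier M \<Longrightarrow> pr m = \<zero>\<^bsub>P\<^esub> \<Longrightarrow> act s0 m = \<zero>"
  shows "\<exists>\<Phi>\<in>linear_isos (semigroup_homology S mul act M 0) P.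
    \<forall>m\<in>carrier M. \<Phi> (homology_class S mul act M 0 (bar_elem M [] m)) = pr m"
proof -
  interpret P: qmodule P by (rule P)
  interpret B0: qmodule "B 0" by (rule qmodule_bar_chains)
  let ?B = "bar_boundaries S mul act M 0"
  interpret q: qquotient "B 0" ?B
    by (rule qquotientI[OF qmodule_bar_chains boundaries_submodule])
  \<comment> \<open>\<open>bar_diff\<close> is zero in degree 0, so every chain there is a
    cycle.\<close>
  have Z: "bar_cycles S mul act M 0 = B 0"
    by (simp add: bar_cycles_def bar_diff_def del: bar_chains_simps)
  define ev where "ev f = pr (f [])" for f :: "'s list \<Rightarrow> 'm"
  have ev: "ev \<in> linear_maps (B 0) P"
    unfolding ev_def by (rule linear_maps_comp[OF eval_linear pr])
  have elem: "bar_elem M [] m \<in> carrier (B 0)" if "m \<in> carrier M" for m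
    using linear_mapsD(1)[OF bar_elem_linear that, of "[]" 0 S] by simp
  have ev_elem: "ev (bar_elem M [] m) = pr m" for m by (simp add: ev_def bar_elem_def)
  have face1: "face [s] m = bar_elem M [] (m \<ominus> act s m)" if "s \<in> S" "m \<in> carrier M" for s m
  proof -
    have "act s m \<in> carrier M" using linear_mapsD(1)[OF act] that by blast
    thus ?thesis using that
      by (simp add: face_eq bar_elem_def fun_eq_iff B0.finsum_empty a_minus_def minus_eq_scl)
  qed
  have prm: "pr (m \<ominus> act s m) = \<zero>\<^bsub>P\<^esub>" if "s \<in> S" "m \<in> carrier M" for s m
  proof -
    have "act s m \<in> carrier M" using linear_mapsD(1)[OF act] that by blast
    hence "pr (m \<ominus> act s m) = pr m \<ominus>\<^bsub>P\<^esub> pr m"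
      using that by (simp add: linear_maps_minus[OF qmodule_axioms P pr] pr_act)
    thus ?thesis using linear_mapsD(1)[OF pr] that by (simp add: a_minus_def P.r_neg)
  qed
  have sub: "ev b = \<zero>\<^bsub>P\<^esub>" if "b \<in> ?B" for b
  proof -
    from that obtain f where f: "f \<in> carrier (B 1)" "b = bd 1 f" by (auto simp: bar_boundaries_def)
    let ?S = "{l. f l \<noteq> \<zero>}"
    have l1: "\<exists>s\<in>S. l = [s]" if "l \<in> ?S" for l
      using that f(1) by (cases l) (auto simp: Suc_length_conv)
    have fc: "f l \<in> carrier M" for l using f(1) by simp
    have Fc: "(\<lambda>l. face l (f l)) \<in> ?S \<rightarrow> carrier (B 0)"
    proof (rule funcsetI)
      fix l assume "l \<in> ?S"
      from l1[OF this] obtain s where "s \<in> S" "l = [s]" by blast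
      thus "face l (f l) \<in> carrier (B 0)" using linear_mapsD(1)[OF face_linear[of l] fc] by simp
    qed
    have "b = (\<Oplus>\<^bsub>B 0\<^esub>l\<in>?S. face l (f l))" using f(2) by (simp add: bar_diff_def del: bar_chains_simps)
    hence "ev b = (\<Oplus>\<^bsub>P\<^esub>l\<in>?S. ev (face l (f l)))"
      using linear_maps_finsum[OF qmodule_bar_chains P ev Fc] by simp
    also have "\<dots> = (\<Oplus>\<^bsub>P\<^esub>l\<in>?S. \<zero>\<^bsub>P\<^esub>)"
    proof (rule P.finsum_cong'[OF refl])
      fix l assume "l \<in> ?S"
      from l1[OF this] obtain s where s: "s \<in> S" "l = [s]" by blast
      show "ev (face l (f l)) = \<zero>\<^bsub>P\<^esub>"
        unfolding s(2) face1[OF s(1) fc] ev_elem by (rule prm[OF s(1) fc])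
    qed simp
    finally show ?thesis by simp
  qed
  have B: "f \<in> ?B \<longleftrightarrow> ev f = \<zero>\<^bsub>P\<^esub>" if f: "f \<in> carrier (B 0)" for f
  proof
    assume e: "ev f = \<zero>\<^bsub>P\<^esub>"
    have m: "f [] \<in> carrier M" using f by simp
    have fe: "f = bar_elem M [] (f [])" using f by (auto simp: bar_elem_def fun_eq_iff)
    have a0: "act s0 (f []) = \<zero>" using ker m e by (simp add: ev_def)
    have g: "bar_elem M [s0] (f []) \<in> carrier (B 1)"
      using linear_mapsD(1)[OF bar_elem_linear m, of "[s0]" 1 S] s0 by simp
    have "bd 1 (bar_elem M [s0] (f [])) = (\<Oplus>\<^bsub>B (1 - 1)\<^esub>l\<in>{[s0]}. face l (bar_elem M [s0] (f []) l))"
      by (rule diff_eq_superset[OF _ g]) (use s0 in \<open>auto simp: bar_elem_def\<close>)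
    also have "\<dots> = (\<Oplus>\<^bsub>B 0\<^esub>l\<in>{[s0]}. face l (bar_elem M [s0] (f []) l))" by simp
    also have "\<dots> = (\<Oplus>\<^bsub>B 0\<^esub>l\<in>{[s0]}. bar_elem M [] (f []))"
    proof (rule B0.finsum_cong'[OF refl])
      show "(\<lambda>l. bar_elem M [] (f [])) \<in> {[s0]} \<rightarrow> carrier (B 0)" by (rule funcsetI, rule elem[OF m])
      fix l assume "l \<in> {[s0]}"
      hence l: "l = [s0]" by simp
      have "face [s0] (f []) = bar_elem M [] (f [])"
        using face1[OF s0 m] a0 m by (simp add: a_minus_def minus_eq_scl)
      thus "face l (bar_elem M [s0] (f []) l) = bar_elem M [] (f [])"
        unfolding l by (simp add: bar_elem_def)
    qed
    also have "\<dots> = bar_elem M [] (f [])"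
      using elem[OF m] by (simp add: B0.finsum_insert del: bar_chains_simps)
    also have "\<dots> = f" by (rule fe[symmetric])
    finally show "f \<in> ?B" unfolding bar_boundaries_def using g by (metis One_nat_def imageI)
  qed (rule sub)
  have "ev ` carrier (B 0) = carrier P"
  proof
    show "ev ` carrier (B 0) \<subseteq> carrier P" using linear_mapsD(1)[OF ev] by blast
    show "carrier P \<subseteq> ev ` carrier (B 0)"
    proof
      fix y assume "y \<in> carrier P"
      then obtain m where "m \<in> carrier M" "y = pr m" using surj by blast
      thus "y \<in> ev ` carrier (B 0)" using elem ev_elem by (metis imageI)
    qed
  qed
  hence "induced_map ev \<in> linear_isos (quot_module (B 0) ?B) P"
    by (rule q.first_isomorphism[OF P ev _ B])
  moreover have "induced_map ev (?B +>\<^bsub>B 0\<^esub> bar_elem M [] m) = pr m" if "m \<in> carrier M" for m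
    using q.induced_map_coset[OF P ev sub elem[OF that]] ev_elem by simp
  ultimately show ?thesis
    unfolding semigroup_homology_def homology_class_def Z by blast
qed

end

section \<open>Lists of vectors, their flags, and apartments\<close>

section \<open>Flags and apartments\<close>

locale fd_steinberg = steinberg_space scale + finite_dimensional_vector_space scale Basis
  for scale :: "'a::field \<Rightarrow> 'b::ab_group_add \<Rightarrow> 'b" (infixr "*s" 75) and Basis
begin

declare dim_UNIV [simp del]

abbreviation spn :: "'b list \<Rightarrow> 'b set" where "spn v \<equiv> span (set v)"

definition indep :: "'b list \<Rightarrow> bool" where
  "indep v \<longleftrightarrow> distinct v \<and> independent (set v)"

lemma basis_tuple_iff: "basis_tuple W v \<longleftrightarrow> indep v \<and> spn v = W"
  by (auto simp: basis_tuple_def indep_def)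

text \<open>Independence of a list becomes a count that depends only on its span and its length;
  comparisons of lists with equal span go through this (\<open>indep_cong\<close>).\<close>

lemma indep_iff_dim: "indep v \<longleftrightarrow> dim (spn v) = length v"
proof
  assume "indep v"
  thus "dim (spn v) = length v"
    by (simp add: indep_def dim_eq_card_independent distinct_card)
next
  assume d: "dim (spn v) = length v"
  have "dim (set v) \<le> card (set v)" by (rule dim_le_card') simp
  hence c: "card (set v) = length v" using d card_length[of v] by simp
  hence "distinct v" by (rule card_distinct)
  moreover have "independent (set v)"
    using card_eq_dim[of "set v" "set v"] c d by (simp add: span_superset)
  ultimately show "indep v" by (simp add: indep_def)
qed

lemma indep_cong: "spn v = spn w \<Longrightarrow> length v = length w \<Longrightarrow> indep v \<longleftrightarrow> indep w"
  by (simp add: indep_iff_dim)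

lemma indep_Nil [simp]: "indep []"
  by (simp add: indep_def independent_empty)

lemma indep_Cons: "indep (x # xs) \<longleftrightarrow> x \<notin> spn xs \<and> indep xs"
  by (auto simp: indep_def independent_insert span_base)

lemma indep_mset: "mset v = mset w \<Longrightarrow> indep v \<longleftrightarrow> indep w"
  using mset_eq_setD[of v w] mset_eq_length[of v w] by (intro indep_cong) auto

lemma indep_appendD: "indep (xs @ ys) \<Longrightarrow> indep xs \<and> indep ys"
  using independent_mono[of "set (xs @ ys)" "set xs"] independent_mono[of "set (xs @ ys)" "set ys"]
  by (auto simp: indep_def)

lemma indep_snoc: "indep (xs @ [x]) \<longleftrightarrow> x \<notin> spn xs \<and> indep xs"
  using indep_mset[of "xs @ [x]" "x # xs"] by (simp add: indep_Cons)

lemma indep_take: "indep v \<Longrightarrow> indep (take k v)"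
  using indep_appendD[of "take k v" "drop k v"] by simp

lemma indep_delete_nth: "indep v \<Longrightarrow> indep (delete_nth i v)"
  using independent_mono[OF _ set_delete_nth_subset[of i v]]
  by (auto simp: indep_def delete_nth_def set_take_disj_set_drop_if_distinct)

lemma indep_move: "indep (xs @ x # ys) \<longleftrightarrow> indep (x # xs @ ys)"
  by (rule indep_mset) simp

lemma dim_spn_take: "indep v \<Longrightarrow> k \<le> length v \<Longrightarrow> dim (spn (take k v)) = k"
  using indep_iff_dim[of "take k v"] indep_take[of v k] by simp

lemma spn_subset: "set xs \<subseteq> spn ys \<Longrightarrow> spn xs \<subseteq> spn ys"
  by (rule span_minimal) auto

lemma spn_mono: "set xs \<subseteq> set ys \<Longrightarrow> spn xs \<subseteq> spn ys"
  by (rule span_mono)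

lemma in_spn: "x \<in> set xs \<Longrightarrow> x \<in> spn xs"
  by (rule span_base)

lemma span_eq_by_dim:
  assumes "subspace S" "subspace T" "S \<subseteq> T" "dim T \<le> dim S"
  shows "S = T"
  using subspace_dim_equal[OF assms(1,2,3,4)] .

lemma indep_spanning:
  assumes "length v = dim W" "subspace W" "set v \<subseteq> W" "W \<subseteq> spn v"
  shows "basis_tuple W v"
proof -
  have "spn v = W" using assms by (intro equalityI span_minimal)
  thus ?thesis using assms(1) by (simp add: basis_tuple_iff indep_iff_dim)
qed

lemma basis_of_indep:
  assumes "length v = dim W" "subspace W" "set v \<subseteq> W" "indep v"
  shows "basis_tuple W v"
proof -
  have "spn v = W"
    using assms by (intro span_eq_by_dim span_minimal) (auto simp: indep_iff_dim)
  thus ?thesis using assms(4) by (simp add: basis_tuple_iff)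
qed

lemma exists_basis_tuple: "subspace W \<Longrightarrow> \<exists>v. basis_tuple W v"
proof -
  assume W: "subspace W"
  then obtain B where B: "finite B" "independent B" "span B = W"
    using basis_subspace_exists by metis
  obtain v where "set v = B" "distinct v" using finite_distinct_list[OF B(1)] by blast
  thus ?thesis using B by (auto simp: basis_tuple_def)
qed

lemma length_basis_tuple: "basis_tuple W v \<Longrightarrow> length v = dim W"
  using indep_iff_dim basis_tuple_iff by auto

subsection \<open>Flags of lists\<close>

text \<open>\<open>fl\<close> keeps the full span as its last entry, while \<open>flag\<close> has
  only the proper subspaces, as in the Tits building. For lists with the same length and span the
  two carry the same information (\<open>flag_eq_iff_fl\<close>).\<close>

definition fl :: "'b list \<Rightarrow> 'b set list" where
  "fl v = map (\<lambda>k. spn (take k v)) [1..<Suc (length v)]"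

definition flag :: "'b list \<Rightarrow> 'b set list" where
  "flag v = map (\<lambda>k. spn (take k v)) [1..<length v]"

lemma length_fl [simp]: "length (fl v) = length v"
  and length_flag [simp]: "length (flag v) = length v - 1"
  by (simp_all add: fl_def flag_def del: upt_Suc)

lemma flag_nth: "i < length v - 1 \<Longrightarrow> flag v ! i = spn (take (Suc i) v)"
  by (simp add: flag_def)

lemma fl_nth: "i < length v \<Longrightarrow> fl v ! i = spn (take (Suc i) v)"
  by (simp add: fl_def del: upt_Suc)

lemma fl_snoc: "fl (v @ [y]) = fl v @ [spn (v @ [y])]"
proof -
  have "[1..<Suc (length (v @ [y]))] = [1..<Suc (length v)] @ [Suc (length v)]" by simp
  thus ?thesis by (auto simp: fl_def simp del: upt_Suc)
qed

lemma fl_Nil [simp]: "fl [] = []"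
  by (simp add: fl_def)

lemma flag_snoc: "v \<noteq> [] \<Longrightarrow> flag (v @ [y]) = flag v @ [spn v]"
proof -
  assume "v \<noteq> []"
  hence "[1..<length (v @ [y])] = [1..<length v] @ [length v]"
    by (cases v) simp_all
  thus ?thesis by (auto simp: flag_def simp del: upt_Suc)
qed

lemma flag_singleton [simp]: "flag [x] = []" "flag [] = []"
  by (simp_all add: flag_def)

lemma fl_eq_iff:
  "fl v = fl w \<longleftrightarrow> length v = length w \<and> (\<forall>k\<le>length v. spn (take k v) = spn (take k w))"
proof
  assume eq: "fl v = fl w"
  hence l: "length v = length w" by (metis length_fl)
  have "spn (take k v) = spn (take k w)" if "k \<le> length v" for k
    using that l fl_nth[of "k - 1" v] fl_nth[of "k - 1" w] eq by (cases k) auto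
  thus "length v = length w \<and> (\<forall>k\<le>length v. spn (take k v) = spn (take k w))" using l by blast
next
  assume "length v = length w \<and> (\<forall>k\<le>length v. spn (take k v) = spn (take k w))"
  thus "fl v = fl w" by (auto simp: fl_def simp del: upt_Suc)
qed

lemma fl_eqD:
  assumes "fl v = fl w"
  shows "length v = length w" "k \<le> length v \<Longrightarrow> spn (take k v) = spn (take k w)" "spn v = spn w"
  using assms unfolding fl_eq_iff by (auto dest: spec[of _ "length v"])

lemma flag_eq_iff_fl:
  assumes "length v = length w" "spn v = spn w"
  shows "flag v = flag w \<longleftrightarrow> fl v = fl w"
proof
  assume eq: "flag v = flag w"
  have "spn (take k v) = spn (take k w)" if "k \<le> length v" for k
  proof (cases "k = 0 \<or> k = length v")
    case False
    hence "k - 1 < length v - 1" "Suc (k - 1) = k" using that by auto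
    thus ?thesis using flag_nth[of "k - 1" v] flag_nth[of "k - 1" w] eq assms by simp
  qed (use assms in auto)
  thus "fl v = fl w" using assms by (simp add: fl_eq_iff)
next
  assume "fl v = fl w"
  thus "flag v = flag w" unfolding fl_eq_iff by (auto simp: flag_def)
qed

definition ap :: "'b list \<Rightarrow> ('b set list \<Rightarrow>\<^sub>0 rat)" where
  "ap v = push flag (alt v)"

text \<open>The permutations in \<open>apartment_cycle\<close> act on positions;
  \<open>alt_map\<close> transports them to the entries of \<open>v\<close>.\<close>

lemma apartment_cycle_eq: "apartment_cycle v = ap v"
proof -
  let ?n = "length v"
  have "alt v = alt (map ((!) v) [0..<?n])" by (simp add: map_nth)
  also have "\<dots> = push (map ((!) v)) (alt [0..<?n])" by (rule alt_map)
  also have "alt [0..<?n] =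
      (\<Sum>\<sigma> | \<sigma> permutes {..<?n}. Poly_Mapping.single (map \<sigma> [0..<?n]) (of_int (sign \<sigma>)))"
    by (simp add: alt_distinct atLeast0LessThan)
  finally have "ap v = (\<Sum>\<sigma> | \<sigma> permutes {..<?n}.
      Poly_Mapping.single (flag (map ((!) v) (map \<sigma> [0..<?n]))) (of_int (sign \<sigma>)))"
    by (simp add: ap_def push_simps)
  also have "\<dots> = apartment_cycle v"
    unfolding apartment_cycle_def
  proof (rule sum.cong[OF refl])
    fix \<sigma> :: "nat \<Rightarrow> nat"
    have "flag (map ((!) v) (map \<sigma> [0..<?n])) = map (\<lambda>k. span ((\<lambda>i. v ! \<sigma> i) ` {..<k})) [1..<?n]"
      by (auto simp: flag_def take_map image_image atLeast0LessThan)
    thus "Poly_Mapping.single (flag (map ((!) v) (map \<sigma> [0..<?n]))) (of_int (sign \<sigma>) :: rat) =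
        Poly_Mapping.single (map (\<lambda>k. span ((\<lambda>i. v ! \<sigma> i) ` {..<k})) [1..<?n]) (of_int (sign \<sigma>))"
      by simp
  qed
  finally show ?thesis by simp
qed

section \<open>Top-dimensional cycles of the Tits building\<close>

subsection \<open>Cycles on full flags\<close>

definition flags :: "'b set \<Rightarrow> 'b set list set" where
  "flags W = {c. sorted_wrt (\<subset>) c \<and> set c \<subseteq> tits_poset W \<and> length c = dim W - 1}"

definition bface :: "'b set list \<Rightarrow> ('b set list \<Rightarrow>\<^sub>0 rat)" where
  "bface c = (\<Sum>i<length c. Poly_Mapping.single (delete_nth i c) ((- 1) ^ i))"

lemma order_boundary_eq: "order_boundary = plin bface"
  unfolding order_boundary_def bface_def delete_nth_def by (rule ext) (rule lin_ext_free, simp)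

definition Z :: "'b set \<Rightarrow> ('b set list \<Rightarrow>\<^sub>0 rat) set" where
  "Z W = {z. Poly_Mapping.keys z \<subseteq> flags W \<and> order_boundary z = 0}"

lemma subspace_Z: "pm.subspace (Z W)"
proof -
  have "pm.subspace {z :: 'b set list \<Rightarrow>\<^sub>0 rat. order_boundary z = 0}"
    unfolding pm.subspace_def order_boundary_eq by (simp add: plin_simps)
  moreover have "Z W = {z. Poly_Mapping.keys z \<subseteq> flags W} \<inter> {z. order_boundary z = 0}"
    by (auto simp: Z_def)
  ultimately show ?thesis by (simp add: pm.subspace_inter subspace_keys)
qed

lemma strict_nat_list:
  fixes f :: "nat \<Rightarrow> nat"
  assumes step: "\<And>i. Suc i < m \<Longrightarrow> f i < f (Suc i)" and 0: "f 0 \<ge> 1" and m: "f (m - 1) \<le> m"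
    and i: "i < m"
  shows "f i = Suc i"
proof -
  have *: "i + d < m \<Longrightarrow> f i + d \<le> f (i + d)" for i d
  proof (induction d)
    case (Suc d)
    thus ?case using step[of "i + d"] by simp
  qed simp
  show ?thesis using *[of 0 i] *[of i "m - 1 - i"] 0 m i by simp
qed

text \<open>The \<open>dim W - 1\<close> members have strictly increasing dimensions between 1 and
  \<open>dim W - 1\<close>, which leaves no choice.\<close>

lemma flags_nth:
  assumes W: "subspace W" and c: "c \<in> flags W" and i: "i < dim W - 1"
  shows "subspace (c ! i)" "c ! i \<subset> W" "dim (c ! i) = Suc i"
proof -
  have len: "length c = dim W - 1" using c by (simp add: flags_def)
  have P: "subspace (c ! j)" "c ! j \<noteq> {0}" "c ! j \<subset> W" if j: "j < dim W - 1" for j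
  proof -
    have "c ! j \<in> set c" using j len by simp
    hence "c ! j \<in> tits_poset W" using c by (auto simp: flags_def)
    thus "subspace (c ! j)" "c ! j \<noteq> {0}" "c ! j \<subset> W" by (simp_all add: tits_poset_def)
  qed
  show "subspace (c ! i)" "c ! i \<subset> W" using P i by auto
  have dl: "dim S < dim T" if "subspace S" "subspace T" "S \<subset> T" for S T
    using dim_psubset[of S T] that by (simp add: span_eq_iff[THEN iffD2])
  show "dim (c ! i) = Suc i"
  proof (rule strict_nat_list[where f = "\<lambda>i. dim (c ! i)", OF _ _ _ i])
    show "dim (c ! j) < dim (c ! Suc j)" if "Suc j < dim W - 1" for j
    proof (rule dl)
      show "c ! j \<subset> c ! Suc j"
        using c that len by (auto simp: flags_def sorted_wrt_iff_nth_less)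
    qed (use P that in auto)
    show "1 \<le> dim (c ! 0)"
    proof -
      have "0 < dim W - 1" using i by simp
      from P(1,2)[OF this] have "\<not> c ! 0 \<subseteq> {0}" using subspace_0[of "c ! 0"] by blast
      hence "dim (c ! 0) \<noteq> 0" by simp
      thus ?thesis by linarith
    qed
    show "dim (c ! (dim W - 1 - 1)) \<le> dim W - 1"
    proof -
      have l: "dim W - 1 - 1 < dim W - 1" using i by simp
      show ?thesis using dl[OF P(1)[OF l] W P(3)[OF l]] by linarith
    qed
  qed
qed

lemma flags_mono_nth:
  assumes "c \<in> flags W" "i < j" "j < dim W - 1"
  shows "c ! i \<subset> c ! j"
  using assms by (auto simp: flags_def sorted_wrt_iff_nth_less)

lemma flag_in_flags:
  assumes v: "basis_tuple W v"
  shows "flag v \<in> flags W"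
proof -
  have iv: "indep v" and W: "spn v = W" using v by (auto simp: basis_tuple_iff)
  have len: "length v = dim W" by (rule length_basis_tuple[OF v])
  have d: "dim (spn (take k v)) = k" if "k \<le> length v" for k using dim_spn_take[OF iv that] .
  have sub: "spn (take i v) \<subset> spn (take j v)" if "i < j" "j \<le> length v" for i j
  proof -
    have "spn (take i v) \<subseteq> spn (take j v)" using that by (intro span_mono set_take_subset_set_take) auto
    moreover have "spn (take i v) \<noteq> spn (take j v)"
    proof
      assume "spn (take i v) = spn (take j v)"
      hence "dim (spn (take i v)) = dim (spn (take j v))" by (rule arg_cong)
      thus False using d[of i] d[of j] that by (simp del: dim_span)
    qed
    ultimately show ?thesis by blast
  qed
  have "sorted_wrt (\<subset>) (flag v)"
    unfolding sorted_wrt_iff_nth_less using sub by (simp add: flag_nth)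
  moreover have "set (flag v) \<subseteq> tits_poset W"
  proof
    fix U assume "U \<in> set (flag v)"
    then obtain k where k: "1 \<le> k" "k < length v" "U = spn (take k v)" by (auto simp: flag_def)
    hence "U \<subset> W" using sub[of k "length v"] W by simp
    moreover have "U \<noteq> {0}" using d[of k] k dim_eq_0[of U] by auto
    ultimately show "U \<in> tits_poset W" using k by (simp add: tits_poset_def)
  qed
  ultimately show ?thesis by (simp add: flags_def len)
qed

lemma rat_pm_neg_self: "p = - p \<Longrightarrow> p = (0 :: 'x \<Rightarrow>\<^sub>0 rat)"
proof -
  assume "p = - p"
  hence "Poly_Mapping.lookup p x = - Poly_Mapping.lookup p x" for x by (metis lookup_uminus)
  thus ?thesis by (intro poly_mapping_eqI) simp
qed

text \<open>Removing the span of the first \<open>i + 1\<close> entries leaves a chain that does not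
  see the order of the entries \<open>i\<close> and \<open>i + 1\<close> (counted from 0), while
  exchanging them changes the sign of \<open>alt\<close>. So each face equals its own
  negative.\<close>

lemma boundary_ap: "order_boundary (ap v) = 0"
proof -
  let ?n = "length v"
  have "order_boundary (ap v) = plin (\<lambda>l. bface (flag l)) (alt v)"
    by (simp add: order_boundary_eq ap_def plin_push)
  also have "\<dots> = plin (\<lambda>l. \<Sum>i<?n - 1. Poly_Mapping.single (delete_nth i (flag l)) ((- 1) ^ i)) (alt v)"
    by (rule plin_cong) (simp add: bface_def alt_keys_length)
  also have "\<dots> = (\<Sum>i<?n - 1. pscale ((- 1) ^ i) (push (\<lambda>l. delete_nth i (flag l)) (alt v)))"
    unfolding plin_def push_def pm.scale_sum_right
    by (subst sum.swap) (simp add: mult.commute)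
  also have "\<dots> = 0"
  proof (rule sum.neutral, rule ballI)
    fix i assume "i \<in> {..<?n - 1}"
    hence i: "Suc i < ?n" by auto
    let ?f = "\<lambda>l. delete_nth i (flag l)"
    have "?f (sw i l) = ?f l" if l: "length l = ?n" for l
    proof (rule nth_equalityI)
      show "length (?f (sw i l)) = length (?f l)" using l i by simp
      fix j assume j: "j < length (?f (sw i l))"
      have *: "set (take k (sw i l)) = set (take k l)" if "k \<noteq> Suc i" "k \<le> ?n" for k
      proof (cases "k \<le> i")
        case True
        thus ?thesis by (simp add: sw_def)
      next
        case False
        hence "take k (sw i l) = sw i (take k l)" using that l i
          by (simp add: sw_def take_update_swap)
        moreover have "mset (sw i (take k l)) = mset (take k l)"
          unfolding sw_def using False that l i by (intro mset_swap) auto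
        ultimately show ?thesis by (metis mset_eq_setD)
      qed
      show "?f (sw i l) ! j = ?f l ! j"
        using j l i by (auto simp: delete_nth_def nth_append flag_nth * min_def)
    qed
    hence "push ?f (alt v) = push (\<lambda>l. ?f (sw i l)) (alt v)"
      by (intro push_cong) (simp add: alt_keys_length)
    also have "\<dots> = push ?f (push (sw i) (alt v))" by (simp add: push_push)
    also have "\<dots> = - push ?f (alt v)" by (simp add: push_sw_alt i push_simps)
    finally have "push ?f (alt v) = 0" by (rule rat_pm_neg_self)
    thus "pscale ((- 1) ^ i) (push ?f (alt v)) = 0" by simp
  qed
  finally show ?thesis .
qed

lemma ap_in_Z: "basis_tuple W v \<Longrightarrow> ap v \<in> Z W"
proof -
  assume v: "basis_tuple W v"
  have "Poly_Mapping.keys (ap v) \<subseteq> flags W"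
  proof
    fix F assume "F \<in> Poly_Mapping.keys (ap v)"
    then obtain l where l: "l \<in> Poly_Mapping.keys (alt v)" "F = flag l"
      using keys_push[of flag "alt v"] by (auto simp: ap_def)
    have "basis_tuple W l"
      using v alt_keys_set[OF l(1)] alt_keys_distinct[OF l(1)] by (simp add: basis_tuple_def)
    thus "F \<in> flags W" unfolding l(2) by (rule flag_in_flags)
  qed
  thus ?thesis by (simp add: Z_def boundary_ap)
qed

text \<open>The missing dimension tells which member was removed.\<close>

lemma delete_nth_eq_flags:
  assumes W: "subspace W" and FF: "F \<in> flags W" "F' \<in> flags W" and ij: "i < dim W - 1" "j < dim W - 1"
    and eq: "delete_nth i F = delete_nth j F'"
  shows "i = j"
proof (rule ccontr)
  assume "i \<noteq> j"
  have *: False if "F \<in> flags W" "F' \<in> flags W" "i < j" "j < dim W - 1" "delete_nth i F = delete_nth j F'"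
    for i j F F'
  proof -
    have l: "length F = dim W - 1" "length F' = dim W - 1" using that by (auto simp: flags_def)
    have "delete_nth i F ! i = F ! Suc i"
      using that(3,4) l by (simp add: delete_nth_def nth_append min_def)
    moreover have "delete_nth j F' ! i = F' ! i"
      using that(3,4) l by (simp add: delete_nth_def nth_append)
    ultimately have "F ! Suc i = F' ! i" using that(5) by simp
    thus False using flags_nth(3)[OF W that(1), of "Suc i"] flags_nth(3)[OF W that(2), of i] that by simp
  qed
  show False
    using *[OF FF _ ij(2) eq] *[OF FF(2,1) _ ij(1) eq[symmetric]] \<open>i \<noteq> j\<close> by (meson linorder_neqE_nat)
qed

lemma lookup_bface:
  assumes W: "subspace W" and F: "F \<in> flags W" "F' \<in> flags W" and j: "j < dim W - 1"
  shows "Poly_Mapping.lookup (bface F') (delete_nth j F) =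
    (if delete_nth j F' = delete_nth j F then (- 1) ^ j else 0)"
proof -
  have l: "length F' = dim W - 1" using F by (simp add: flags_def)
  have "Poly_Mapping.lookup (bface F') (delete_nth j F) =
      (\<Sum>i<dim W - 1. if i = j then (if delete_nth j F' = delete_nth j F then (- 1) ^ j else 0) else 0)"
    unfolding bface_def lookup_sum l
    by (rule sum.cong[OF refl])
      (use delete_nth_eq_flags[OF W F(2,1) _ j] in \<open>auto simp: lookup_single when_def\<close>)
  thus ?thesis using j by simp
qed

text \<open>Removing from a flag of the cycle the first subspace \<open>F\<^sub>j\<close> containing \<open>w\<close>, all the other
  ways of refilling the gap move the entry of \<open>w\<close> into the flag to a later place.\<close>

lemma cycle_zeroI:
  assumes W: "subspace W" "dim W \<ge> 2" and z: "z \<in> Z W" and w: "w \<noteq> 0"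
    and last: "\<And>F. F \<in> Poly_Mapping.keys z \<Longrightarrow> w \<in> last F"
  shows "z = 0"
proof (rule ccontr)
  assume "z \<noteq> 0"
  hence ne: "Poly_Mapping.keys z \<noteq> {}" by simp
  let ?m = "dim W - 1"
  have K: "F \<in> flags W" if "F \<in> Poly_Mapping.keys z" for F using z that by (auto simp: Z_def)
  have len: "length F = ?m" if "F \<in> flags W" for F using that by (simp add: flags_def)
  define e where "e F = (LEAST j. w \<in> F ! j)" for F
  have lastw: "w \<in> F ! (?m - 1)" if "F \<in> Poly_Mapping.keys z" for F
  proof -
    have "F \<noteq> []" using len[OF K[OF that]] W(2) by auto
    thus ?thesis using last[OF that] len[OF K[OF that]] by (simp add: last_conv_nth)
  qed
  have e: "w \<in> F ! e F" "e F \<le> ?m - 1" "\<And>i. i < e F \<Longrightarrow> w \<notin> F ! i"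
    if "F \<in> Poly_Mapping.keys z" for F
    using LeastI[of "\<lambda>j. w \<in> F ! j", OF lastw[OF that]]
      Least_le[of "\<lambda>j. w \<in> F ! j", OF lastw[OF that]] not_less_Least[of _ "\<lambda>j. w \<in> F ! j"]
    unfolding e_def by blast+
  \<comment> \<open>\<open>F\<close> is a flag of \<open>z\<close> into which \<open>w\<close>
    enters as late as possible.\<close>
  obtain F where F: "F \<in> Poly_Mapping.keys z" and max: "\<And>F'. F' \<in> Poly_Mapping.keys z \<Longrightarrow> e F' \<le> e F"
  proof -
    have fin: "finite (e ` Poly_Mapping.keys z)" "e ` Poly_Mapping.keys z \<noteq> {}" using ne by auto
    have "Max (e ` Poly_Mapping.keys z) \<in> e ` Poly_Mapping.keys z" by (rule Max_in[OF fin])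
    then obtain F where "F \<in> Poly_Mapping.keys z" "e F = Max (e ` Poly_Mapping.keys z)" by auto
    thus thesis using that Max_ge[OF fin(1)] by (metis imageI)
  qed
  define j where "j = e F"
  have j: "j < ?m" using e(2)[OF F] W(2) by (simp add: j_def)
  have "F' = F" if F': "F' \<in> Poly_Mapping.keys z" and eq: "delete_nth j F' = delete_nth j F" for F'
  proof -
    have other: "F' ! i = F ! i" if "i \<noteq> j" "i < ?m" for i
    proof (cases "i < j")
      case True
      have "delete_nth j F' ! i = F' ! i" "delete_nth j F ! i = F ! i"
        using True that len[OF K[OF F]] len[OF K[OF F']] by (auto simp: delete_nth_def nth_append)
      thus ?thesis using eq by simp
    next
      case False
      hence "i = Suc (i - 1)" "\<not> i - 1 < j" using that by auto
      hence "delete_nth j F' ! (i - 1) = F' ! i" "delete_nth j F ! (i - 1) = F ! i"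
        using that j len[OF K[OF F]] len[OF K[OF F']]
        by (auto simp: delete_nth_def nth_append min_def)
      thus ?thesis using eq by simp
    qed
    have wj: "w \<in> F' ! j"
    proof (rule ccontr)
      assume n: "w \<notin> F' ! j"
      have "w \<notin> F' ! i" if "i \<le> j" for i
        using that n other[of i] e(3)[OF F, of i] j unfolding j_def by (cases "i = j") (auto simp: j_def)
      hence "j < e F'" using e(1)[OF F'] by (meson not_less)
      thus False using max[OF F'] by (simp add: j_def)
    qed
    \<comment> \<open>\<open>P\<close> is the member below the gap, or zero if the gap is at the
      bottom. A subspace that fills the gap and contains \<open>w\<close> is spanned by
      \<open>P\<close> and \<open>w\<close>, so the filling by \<open>F\<close> is the only
      one.\<close>
    define P where "P = (if j = 0 then {0} else F ! (j - 1))"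
    have P: "subspace P" "dim P = j" "w \<notin> P" "P \<subseteq> F ! j" "P \<subseteq> F' ! j"
    proof -
      show "subspace P" using flags_nth(1)[OF W(1) K[OF F], of "j - 1"] j
        by (auto simp: P_def subspace_single_0)
      show "dim P = j" using flags_nth(3)[OF W(1) K[OF F], of "j - 1"] j by (auto simp: P_def)
      show "w \<notin> P" using e(3)[OF F, of "j - 1"] w j by (auto simp: P_def j_def)
      show "P \<subseteq> F ! j"
        using flags_mono_nth[OF K[OF F], of "j - 1" j] j flags_nth(1)[OF W(1) K[OF F] j]
        by (auto simp: P_def subspace_0)
      show "P \<subseteq> F' ! j"
        using flags_mono_nth[OF K[OF F'], of "j - 1" j] j flags_nth(1)[OF W(1) K[OF F'] j] other[of "j - 1"]
        by (auto simp: P_def subspace_0)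
    qed
    have "F'' ! j = span (insert w P)" if "F'' \<in> Poly_Mapping.keys z" "w \<in> F'' ! j" "P \<subseteq> F'' ! j" for F''
    proof -
      note fn = flags_nth[OF W(1) K[OF that(1)] j]
      have "dim (insert w P) = Suc j" using P by (simp add: dim_insert span_eq_iff[THEN iffD2])
      hence "span (insert w P) = F'' ! j"
        using that fn by (intro span_eq_by_dim span_minimal) auto
      thus ?thesis by simp
    qed
    hence jj: "F' ! j = F ! j" using F F' wj e(1)[OF F] P unfolding j_def by metis
    show "F' = F"
    proof (rule nth_equalityI)
      show "length F' = length F" using len K F F' by simp
      show "F' ! i = F ! i" if "i < length F'" for i
        using that other[of i] jj len[OF K[OF F']] by (cases "i = j") auto
    qed
  qed
  hence *: "Poly_Mapping.lookup (bface F') (delete_nth j F) = (if F' = F then (- 1) ^ j else 0)"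
    if "F' \<in> Poly_Mapping.keys z" for F'
    using lookup_bface[OF W(1) K[OF F] K[OF that] j] that by auto
  have "Poly_Mapping.lookup (order_boundary z) (delete_nth j F) =
      (\<Sum>F'\<in>Poly_Mapping.keys z. if F' = F then Poly_Mapping.lookup z F * (- 1) ^ j else 0)"
    unfolding order_boundary_eq lookup_plin by (rule sum.cong) (auto simp: *)
  hence "Poly_Mapping.lookup z F * (- 1) ^ j = 0" using z F by (simp add: Z_def)
  thus False using F by (simp add: in_keys_iff)
qed

subsection \<open>Generation by apartments\<close>

text \<open>Insert \<open>w\<close> into the orderings of \<open>x\<close>. Put last, it leaves the
  flag of the ordering followed by the hyperplane \<open>spn x\<close>; put anywhere else, it
  belongs to the last proper subspace. Modulo flags whose hyperplane contains \<open>w\<close>, only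
  the apartment of \<open>x\<close> in its own span remains.\<close>

lemma ap_Cons_main:
  assumes "x \<noteq> []"
  obtains r where "ap (w # x) = pscale ((- 1) ^ length x) (push (\<lambda>F. F @ [spn x]) (ap x)) + r"
    "\<And>F. F \<in> Poly_Mapping.keys r \<Longrightarrow> w \<in> last F"
proof -
  let ?n = "length x"
  let ?I = "\<lambda>k l. take k l @ w # drop k l"
  define r where "r = (\<Sum>k<?n. pscale ((- 1) ^ k) (push (\<lambda>l. flag (?I k l)) (alt x)))"
  have "ap (w # x) = (\<Sum>k\<le>?n. pscale ((- 1) ^ k) (push (\<lambda>l. flag (?I k l)) (alt x)))"
    by (simp add: ap_def alt_Cons_eq push_simps push_push del: alt.simps)
  also have "\<dots> = pscale ((- 1) ^ ?n) (push (\<lambda>l. flag (?I ?n l)) (alt x)) + r"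
    unfolding r_def lessThan_Suc_atMost[symmetric] sum.lessThan_Suc by (simp add: add.commute)
  also have "push (\<lambda>l. flag (?I ?n l)) (alt x) = push (\<lambda>l. flag l @ [spn x]) (alt x)"
  proof (rule push_cong)
    fix l assume l: "l \<in> Poly_Mapping.keys (alt x)"
    have "l \<noteq> []" using alt_keys_length[OF l] assms by auto
    thus "flag (?I ?n l) = flag l @ [spn x]"
      using alt_keys_length[OF l] alt_keys_set[OF l] by (simp add: flag_snoc)
  qed
  also have "\<dots> = push (\<lambda>F. F @ [spn x]) (ap x)" by (simp add: ap_def push_push)
  finally have 1: "ap (w # x) = pscale ((- 1) ^ ?n) (push (\<lambda>F. F @ [spn x]) (ap x)) + r" .
  have 2: "w \<in> last F" if F: "F \<in> Poly_Mapping.keys r" for F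
  proof -
    obtain k where k: "k < ?n"
      "F \<in> Poly_Mapping.keys (pscale ((- 1) ^ k) (push (\<lambda>l. flag (?I k l)) (alt x)))"
      using subsetD[OF keys_sum F[unfolded r_def]] by blast
    obtain l where l: "l \<in> Poly_Mapping.keys (alt x)" "F = flag (?I k l)"
      using subsetD[OF keys_push subsetD[OF keys_pscale k(2)]] by blast
    have len: "length l = ?n" using l(1) by (rule alt_keys_length)
    have "flag (?I k l) \<noteq> []" using len k by (auto simp: flag_def)
    hence "last F = flag (?I k l) ! (?n - 1)"
      unfolding l(2) using k by (subst last_conv_nth) (simp_all add: len min_def)
    also have "\<dots> = spn (take ?n (?I k l))" using len k by (subst flag_nth) auto
    finally have "last F = spn (take ?n (?I k l))" .
    moreover have "w \<in> set (take ?n (?I k l))" using len k by (auto simp: take_Cons')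
    ultimately show "w \<in> last F" by (simp add: span_base)
  qed
  show thesis by (rule that[OF 1 2])
qed

text \<open>Projection of chains to the link of the hyperplane \<open>H\<close>.\<close>

definition prune :: "'b set \<Rightarrow> ('b set list \<Rightarrow>\<^sub>0 rat) \<Rightarrow> ('b set list \<Rightarrow>\<^sub>0 rat)" where
  "prune H = plin (\<lambda>c. if c \<noteq> [] \<and> last c = H then psingle (butlast c) else 0)"

lemma linear_prune [simp, intro]: "plinear (prune H)"
  by (simp add: prune_def)

lemma prune_flags:
  assumes W: "subspace W" and m: "dim W \<ge> 2" and F: "F \<in> flags W" and H: "dim H = dim W - 1"
    and l: "last F = H"
  shows "butlast F \<in> flags H"
proof -
  have len: "length F = dim W - 1" using F by (simp add: flags_def)
  hence ne: "F \<noteq> []" using m by auto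
  have lst: "H = F ! (dim W - 2)" using l ne len by (simp add: last_conv_nth numeral_2_eq_2)
  have "sorted_wrt (\<subset>) (butlast F)"
    using F by (simp add: flags_def butlast_conv_take sorted_wrt_take)
  moreover have "set (butlast F) \<subseteq> tits_poset H"
  proof
    fix U assume "U \<in> set (butlast F)"
    then obtain i where i: "i < dim W - 2" "U = F ! i"
      using len by (auto simp: in_set_conv_nth nth_butlast numeral_2_eq_2)
    have "U \<subset> H" unfolding lst i(2) using i(1) by (intro flags_mono_nth[OF F]) auto
    moreover have "U \<in> tits_poset W" using F i len by (auto simp: flags_def)
    ultimately show "U \<in> tits_poset H" by (simp add: tits_poset_def)
  qed
  ultimately show ?thesis using len H by (simp add: flags_def)
qed

text \<open>The face that deletes the last member is empty or ends in a subspace of smaller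
  dimension than \<open>H\<close>, so it is dropped; all other faces keep the last member.\<close>

lemma boundary_prune:
  assumes W: "subspace W" and m: "dim W \<ge> 2" and F: "F \<in> flags W" and H: "dim H = dim W - 1"
  shows "plin bface (prune H (psingle F)) = prune H (bface F)"
proof -
  let ?m = "dim W - 1"
  have len: "length F = ?m" using F by (simp add: flags_def)
  hence ne: "F \<noteq> []" using m by auto
  have lst: "last F = F ! (?m - 1)" using ne len by (simp add: last_conv_nth)
  have D: "prune H (psingle (delete_nth i F)) =
      (if i < ?m - 1 \<and> last F = H then psingle (delete_nth i (butlast F)) else 0)" if i: "i < ?m" for i
  proof (cases "i < ?m - 1")
    case True
    have F': "F = butlast F @ [last F]" using ne by simp
    have "delete_nth i F = delete_nth i (butlast F) @ [last F]"
      using True len by (subst F', subst delete_nth_append) simp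
    thus ?thesis using True by (simp add: prune_def)
  next
    case False
    hence i': "i = ?m - 1" using i by simp
    have b: "delete_nth i F = butlast F"
      using len i' m by (simp add: delete_nth_def butlast_conv_take)
    have "last (butlast F) \<noteq> H" if "butlast F \<noteq> []"
    proof -
      have l2: "length F \<ge> 2" using that by (cases F; cases "tl F") auto
      hence "last (butlast F) = F ! (?m - 2)"
        using that len by (simp add: last_conv_nth nth_butlast numeral_2_eq_2)
      moreover have "dim (F ! (?m - 2)) = ?m - 1"
        using flags_nth(3)[OF W F, of "?m - 2"] l2 len by simp
      ultimately show ?thesis using H l2 len by auto
    qed
    thus ?thesis using False b by (auto simp: prune_def)
  qed
  have "prune H (bface F) = (\<Sum>i<?m. pscale ((- 1) ^ i) (prune H (psingle (delete_nth i F))))"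
    unfolding bface_def len
    by (simp add: pmp.linear_sum[OF linear_prune] pmp.linear_scale[OF linear_prune, symmetric])
  also have "\<dots> = (\<Sum>i<?m. if i < ?m - 1 \<and> last F = H
      then Poly_Mapping.single (delete_nth i (butlast F)) ((- 1) ^ i) else 0)"
    by (rule sum.cong) (auto simp: D)
  also have "\<dots> = (\<Sum>i<?m - 1. if last F = H
      then Poly_Mapping.single (delete_nth i (butlast F)) ((- 1) ^ i) else 0)"
    by (rule sum.mono_neutral_cong_right) (use m in auto)
  also have "\<dots> = plin bface (prune H (psingle F))"
    using ne len by (auto simp: prune_def bface_def plin_simps(1))
  finally show ?thesis by simp
qed

lemma prune_in_Z:
  assumes W: "subspace W" and m: "dim W \<ge> 2" and z: "z \<in> Z W" and H: "dim H = dim W - 1"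
  shows "prune H z \<in> Z H"
proof -
  have K: "F \<in> flags W" if "F \<in> Poly_Mapping.keys z" for F using z that by (auto simp: Z_def)
  have "Poly_Mapping.keys (prune H z) \<subseteq> flags H"
  proof
    fix c assume "c \<in> Poly_Mapping.keys (prune H z)"
    then obtain F where F: "F \<in> Poly_Mapping.keys z"
      "c \<in> Poly_Mapping.keys (if F \<noteq> [] \<and> last F = H then psingle (butlast F) else 0)"
      using keys_plin[of "\<lambda>c. if c \<noteq> [] \<and> last c = H then psingle (butlast c) else 0" z]
      unfolding prune_def by auto
    hence "last F = H" "c = butlast F" by (auto split: if_splits)
    thus "c \<in> flags H" using prune_flags[OF W m K[OF F(1)] H] by simp
  qed
  moreover have "plin bface (prune H z) = prune H (plin bface z)"
    unfolding prune_def plin_plin[of _ bface] plin_plin[of bface]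
  proof (rule plin_cong)
    fix F assume "F \<in> Poly_Mapping.keys z"
    from boundary_prune[OF W m K[OF this] H]
    show "plin bface (if F \<noteq> [] \<and> last F = H then psingle (butlast F) else 0) =
        plin (\<lambda>c. if c \<noteq> [] \<and> last c = H then psingle (butlast c) else 0) (bface F)"
      unfolding prune_def by simp
  qed
  moreover have "prune H 0 = 0" by (simp add: prune_def plin_simps)
  ultimately show ?thesis using z by (simp add: Z_def order_boundary_eq)
qed

text \<open>The generation part of the Solomon-Tits theorem, by induction on the dimension. Fix
  \<open>w \<noteq> 0\<close> in \<open>W\<close>. For each hyperplane \<open>H\<close> that ends a
  flag of \<open>z\<close> and omits \<open>w\<close>, the link part \<open>prune H z\<close> is a
  cycle in \<open>H\<close>, hence a combination of apartments \<open>ap x\<close>; up to sign,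
  \<open>ap (w # x)\<close> has \<open>ap x\<close> as its part at \<open>H\<close>. After
  subtraction all flags end in hyperplanes containing \<open>w\<close>, and
  \<open>cycle_zeroI\<close> applies.\<close>

theorem Z_generated:
  assumes W: "subspace W" and d: "dim W \<ge> 1" and z: "z \<in> Z W"
  shows "z \<in> pm.span {ap v | v. basis_tuple W v}"
  using assms
proof (induction "dim W" arbitrary: W z)
  case (Suc n)
  show ?case
  proof (cases "n = 0")
    case True
    \<comment> \<open>In dimension 1 the only chain is the empty one, and it is the apartment of any
      nonzero vector.\<close>
    hence "flags W = {[]}" using Suc.hyps(2) by (auto simp: flags_def)
    hence keys: "Poly_Mapping.keys z \<subseteq> {[]}" using Suc.prems by (auto simp: Z_def)
    obtain v where v: "basis_tuple W v" using exists_basis_tuple Suc.prems by blast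
    hence "length v = Suc 0" using length_basis_tuple[OF v] Suc.hyps(2) True by simp
    then obtain x where "v = [x]" by (auto simp: length_Suc_conv)
    hence "ap v = psingle []" by (simp add: ap_def ins_def)
    moreover have "z = pscale (Poly_Mapping.lookup z []) (psingle [])"
      using keys by (auto intro!: poly_mapping_eqI simp: lookup_single when_def in_keys_iff)
    ultimately show ?thesis using v by (metis (mono_tags, lifting) mem_Collect_eq pm.span_base pm.span_scale)
  next
    case False
    hence m: "dim W \<ge> 2" using Suc.hyps(2) by simp
    obtain w where w: "w \<in> W" "w \<noteq> 0"
      using dim_eq_0[of W] Suc.hyps(2) by (metis nat.distinct(1) singletonI subsetI)
    have K: "F \<in> flags W" if "F \<in> Poly_Mapping.keys z" for F using Suc.prems that by (auto simp: Z_def)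
    define Hs where "Hs = {last F | F. F \<in> Poly_Mapping.keys z \<and> w \<notin> last F}"
    have fin: "finite Hs" unfolding Hs_def by simp
    have Hs: "subspace H" "dim H = n" "H \<subseteq> W" "w \<notin> H" if H: "H \<in> Hs" for H
    proof -
      obtain F where F: "F \<in> Poly_Mapping.keys z" "w \<notin> last F" "H = last F"
        using H by (auto simp: Hs_def)
      have len: "length F = n" using K[OF F(1)] Suc.hyps(2) by (simp add: flags_def)
      have H': "H = F ! (n - 1)" using len False F by (subst F, subst last_conv_nth) auto
      have n1: "n - 1 < dim W - 1" using False Suc.hyps(2) by simp
      note fn = flags_nth[OF Suc.prems(1) K[OF F(1)] n1, folded H']
      show "subspace H" by (rule fn(1))
      show "H \<subseteq> W" using fn(2) by blast
      show "dim H = n" using fn(3) False by simp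
      show "w \<notin> H" using F by simp
    qed
    let ?A = "pm.span {ap v | v. basis_tuple W v}"
    have bt: "basis_tuple W (w # x)" if "basis_tuple H x" "H \<in> Hs" for x H
    proof (rule basis_of_indep)
      have x: "indep x" "spn x = H" "length x = n"
        using that(1) Hs(2)[OF that(2)] length_basis_tuple[OF that(1)] by (auto simp: basis_tuple_iff)
      show "length (w # x) = dim W" using x Suc.hyps(2) by simp
      show "indep (w # x)" using x Hs[OF that(2)] by (simp add: indep_Cons)
      show "set (w # x) \<subseteq> W" using x Hs[OF that(2)] w span_superset[of "set x"] by auto
    qed (rule Suc.prems)
    \<comment> \<open>A cycle in \<open>H\<close>, extended by \<open>H\<close>, is congruent to a
      combination of apartments with vertex \<open>w\<close>, modulo flags whose last member
      contains \<open>w\<close>. The factor \<open>?e\<close> cancels the sign in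
      \<open>ap_Cons_main\<close>.\<close>
    have ex: "\<exists>y\<in>?A. \<forall>F\<in>Poly_Mapping.keys (push (\<lambda>F. F @ [H]) \<zeta> - y). w \<in> last F"
      if H: "H \<in> Hs" and \<zeta>: "\<zeta> \<in> pm.span {ap x | x. basis_tuple H x}" for H \<zeta>
      using \<zeta>
    proof (induction rule: pm.span_induct_alt)
      case base
      show ?case by (rule bexI[of _ 0]) (simp_all add: push_simps pm.span_zero)
    next
      case (step c p q)
      from step(1) obtain x where x: "basis_tuple H x" "p = ap x" by blast
      from step(2) obtain y where y: "y \<in> ?A"
        "\<And>F. F \<in> Poly_Mapping.keys (push (\<lambda>F. F @ [H]) q - y) \<Longrightarrow> w \<in> last F" by blast
      have xne: "x \<noteq> []" using length_basis_tuple[OF x(1)] Hs(2)[OF H] False by auto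
      have spx: "spn x = H" using x by (simp add: basis_tuple_iff)
      obtain r where r: "ap (w # x) = pscale ((- 1) ^ length x) (push (\<lambda>F. F @ [spn x]) (ap x)) + r"
        "\<And>F. F \<in> Poly_Mapping.keys r \<Longrightarrow> w \<in> last F" using ap_Cons_main[OF xne] by metis
      let ?e = "(- 1) ^ length x :: rat"
      have ee: "?e * ?e = 1" by (simp add: power_add[symmetric] mult_2[symmetric])
      let ?y = "pscale (c * ?e) (ap (w # x)) + y"
      have eq: "push (\<lambda>F. F @ [H]) (pscale c p + q) - ?y =
          (push (\<lambda>F. F @ [H]) q - y) - pscale (c * ?e) r"
        unfolding r(1) x(2) spx
        by (simp add: push_simps pm.scale_right_distrib mult.assoc ee)
      have "\<forall>F\<in>Poly_Mapping.keys (push (\<lambda>F. F @ [H]) (pscale c p + q) - ?y). w \<in> last F"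
      proof
        fix F assume "F \<in> Poly_Mapping.keys (push (\<lambda>F. F @ [H]) (pscale c p + q) - ?y)"
        from subsetD[OF keys_diff this[unfolded eq]] show "w \<in> last F"
        proof
          assume "F \<in> Poly_Mapping.keys (pscale (c * ?e) r)"
          from r(2)[OF subsetD[OF keys_pscale this]] show "w \<in> last F" .
        qed (rule y(2))
      qed
      moreover have "?y \<in> ?A"
        using bt[OF x(1) H] by (intro pm.span_add[OF pm.span_scale[OF pm.span_base] y(1)]) auto
      ultimately show ?case by blast
    qed
    have "\<exists>y\<in>?A. \<forall>F\<in>Poly_Mapping.keys (push (\<lambda>F. F @ [H]) (prune H z) - y). w \<in> last F"
      if H: "H \<in> Hs" for H
    proof (rule ex[OF H])
      have "prune H z \<in> Z H"
        using prune_in_Z[OF Suc.prems(1) m Suc.prems(3)] Hs(2)[OF H] Suc.hyps(2) by simp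
      thus "prune H z \<in> pm.span {ap x | x. basis_tuple H x}"
        using Hs[OF H] False by (intro Suc.hyps(1)) auto
    qed
    hence "\<forall>H\<in>Hs. \<exists>y. y \<in> ?A \<and>
        (\<forall>F\<in>Poly_Mapping.keys (push (\<lambda>F. F @ [H]) (prune H z) - y). w \<in> last F)" by blast
    from bchoice[OF this] obtain Y where Y': "\<forall>H\<in>Hs. Y H \<in> ?A \<and>
        (\<forall>F\<in>Poly_Mapping.keys (push (\<lambda>F. F @ [H]) (prune H z) - Y H). w \<in> last F)" ..
    hence Y: "\<And>H. H \<in> Hs \<Longrightarrow> Y H \<in> ?A"
      "\<And>H F. H \<in> Hs \<Longrightarrow> F \<in> Poly_Mapping.keys (push (\<lambda>F. F @ [H]) (prune H z) - Y H) \<Longrightarrow> w \<in> last F"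
      by blast+
    define y where "y = (\<Sum>H\<in>Hs. Y H)"
    have yA: "y \<in> ?A" unfolding y_def by (intro pm.span_sum Y)
    have AZ: "?A \<subseteq> Z W" by (rule pm.span_minimal) (auto simp: subspace_Z ap_in_Z)
    have zy: "z - y \<in> Z W"
      using AZ yA Suc.prems(3) by (intro pm.subspace_diff[OF subspace_Z]) auto
    have "w \<in> last F" if F: "F \<in> Poly_Mapping.keys (z - y)" for F
    proof (rule ccontr)
      assume nw: "w \<notin> last F"
      have FW: "F \<in> flags W"
        using F zy by (auto simp: Z_def)
      have Fne: "F \<noteq> []" using FW m by (auto simp: flags_def)
      have YH: "Poly_Mapping.lookup (Y H) F = Poly_Mapping.lookup (push (\<lambda>F. F @ [H]) (prune H z)) F"
        if "H \<in> Hs" for H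
        by (rule ccontr) (use Y(2)[OF that, of F] nw in \<open>auto simp: in_keys_iff lookup_minus\<close>)
      have PH: "Poly_Mapping.lookup (push (\<lambda>F. F @ [H]) (prune H z)) F =
          (if H = last F then Poly_Mapping.lookup z F else 0)" for H
      proof -
        have "push (\<lambda>F. F @ [H]) (prune H z) = plin (\<lambda>c. if c \<noteq> [] \<and> last c = H then psingle c else 0) z"
          unfolding prune_def push_plin
          by (rule plin_cong) (auto simp: push_simps)
        hence "Poly_Mapping.lookup (push (\<lambda>F. F @ [H]) (prune H z)) F =
            (\<Sum>c\<in>Poly_Mapping.keys z. if c = F then (if H = last F then Poly_Mapping.lookup z F else 0) else 0)"
          by (simp only: lookup_plin)
            (rule sum.cong[OF refl], use Fne in \<open>auto simp: lookup_single when_def\<close>)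
        thus ?thesis by (auto simp: in_keys_iff)
      qed
      have "Poly_Mapping.lookup y F = (\<Sum>H\<in>Hs. if H = last F then Poly_Mapping.lookup z F else 0)"
        unfolding y_def lookup_sum by (rule sum.cong) (auto simp: YH PH)
      also have "\<dots> = Poly_Mapping.lookup z F"
        using fin nw by (auto simp: Hs_def in_keys_iff)
      finally show False using F by (simp add: in_keys_iff lookup_minus)
    qed
    hence "z - y = 0" using cycle_zeroI[OF Suc.prems(1) m zy w(2)] by blast
    thus ?thesis using yA by simp
  qed
qed (simp del: dim_eq_0)

end

context fd_steinberg
begin

sublocale vp: vector_space_pair scale scale ..

subsection \<open>Relations between apartments\<close>

text \<open>The convention that dependent tuples give zero, on the level of cycles.\<close>

definition apz :: "'b list \<Rightarrow> ('b set list \<Rightarrow>\<^sub>0 rat)" where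
  "apz v = (if indep v then ap v else 0)"

text \<open>The flags of an apartment are grouped by their hyperplane, which is spanned by all
  entries but one.\<close>

lemma ap_last:
  assumes "length x \<ge> 2"
  shows "ap x = (\<Sum>i<length x. pscale ((- 1) ^ (length x - 1 - i))
    (push (\<lambda>F. F @ [spn (delete_nth i x)]) (ap (delete_nth i x))))"
proof -
  have "x \<noteq> []" using assms by auto
  have "ap x = (\<Sum>i<length x. pscale ((- 1) ^ (length x - 1 - i))
    (push (\<lambda>l. flag (l @ [x ! i])) (alt (delete_nth i x))))"
    unfolding ap_def by (subst alt_last[OF \<open>x \<noteq> []\<close>]) (simp add: push_simps push_push)
  also have "\<dots> = (\<Sum>i<length x. pscale ((- 1) ^ (length x - 1 - i))
    (push (\<lambda>F. F @ [spn (delete_nth i x)]) (ap (delete_nth i x))))"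
  proof (rule sum.cong[OF refl])
    fix i assume i: "i \<in> {..<length x}"
    have "push (\<lambda>l. flag (l @ [x ! i])) (alt (delete_nth i x)) =
        push (\<lambda>l. flag l @ [spn (delete_nth i x)]) (alt (delete_nth i x))"
    proof (rule push_cong)
      fix l assume l: "l \<in> Poly_Mapping.keys (alt (delete_nth i x))"
      have "l \<noteq> []" using alt_keys_length[OF l] i assms by auto
      thus "flag (l @ [x ! i]) = flag l @ [spn (delete_nth i x)]"
        using alt_keys_set[OF l] by (simp add: flag_snoc)
    qed
    thus "pscale ((- 1) ^ (length x - 1 - i)) (push (\<lambda>l. flag (l @ [x ! i])) (alt (delete_nth i x))) =
       pscale ((- 1) ^ (length x - 1 - i))
        (push (\<lambda>F. F @ [spn (delete_nth i x)]) (ap (delete_nth i x)))"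
      by (simp add: ap_def push_push)
  qed
  finally show ?thesis .
qed

lemma apz_in_Z:
  assumes "subspace W" "set v \<subseteq> W" "length v = dim W"
  shows "apz v \<in> Z W"
  using basis_of_indep[OF assms(3,1,2)] ap_in_Z pm.subspace_0[OF subspace_Z] by (simp add: apz_def)

text \<open>The \<open>(n + 1)\<close>-term relation for \<open>w\<close> followed by
  \<open>x\<close>, solved for the term without \<open>w\<close>. Both sides are cycles, and by
  \<open>ap_last\<close> and \<open>ap_Cons_main\<close> they agree on the flags whose hyperplane
  omits \<open>w\<close>, so \<open>cycle_zeroI\<close> applies to the difference.\<close>

lemma ap_expand:
  assumes x: "basis_tuple W x" and w: "w \<in> W" "w \<noteq> 0"
  shows "ap x = (\<Sum>i<length x. pscale ((- 1) ^ i) (apz (w # delete_nth i x)))"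
proof (cases "length x \<ge> 2")
  \<comment> \<open>In dimension 1 flags are empty and have no last member; both sides are the empty
    flag with coefficient 1.\<close>
  case False
  have "length x \<noteq> 0" using x w by (auto simp: basis_tuple_def)
  hence "length x = Suc 0" using False by linarith
  then obtain a where a: "x = [a]" by (auto simp: length_Suc_conv)
  have "indep [w]" using w by (simp add: indep_Cons)
  thus ?thesis by (simp add: a apz_def ap_def ins_def)
next
  case True
  let ?n = "length x"
  have ix: "indep x" and W: "spn x = W" using x by (auto simp: basis_tuple_iff)
  hence sW: "subspace W" by auto
  have n: "?n = dim W" by (rule length_basis_tuple[OF x])
  let ?d = "\<lambda>i. delete_nth i x"
  let ?P = "\<lambda>i. pscale ((- 1) ^ (?n - 1 - i)) (push (\<lambda>F. F @ [spn (?d i)]) (ap (?d i)))"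
  let ?Q = "\<lambda>i. pscale ((- 1) ^ i) (apz (w # ?d i))"
  define \<zeta> where "\<zeta> = ap x - (\<Sum>i<?n. ?Q i)"
  have "\<zeta> \<in> Z W"
    unfolding \<zeta>_def
  proof (intro pm.subspace_diff[OF subspace_Z] pm.subspace_sum[OF subspace_Z] pm.subspace_scale[OF subspace_Z])
    show "ap x \<in> Z W" by (rule ap_in_Z[OF x])
    fix i assume i: "i \<in> {..<?n}"
    have "set (w # ?d i) \<subseteq> W"
      using w(1) W set_delete_nth_subset[of i x] span_superset[of "set x"] by auto
    thus "apz (w # ?d i) \<in> Z W" using i n by (intro apz_in_Z[OF sW]) auto
  qed
  moreover have "w \<in> last F" if F: "F \<in> Poly_Mapping.keys \<zeta>" for F
  proof -
    have "\<zeta> = (\<Sum>i<?n. ?P i - ?Q i)" unfolding \<zeta>_def ap_last[OF True] by (simp add: sum_subtractf)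
    then obtain i where i: "i < ?n" "F \<in> Poly_Mapping.keys (?P i - ?Q i)"
      using subsetD[OF keys_sum, of F "\<lambda>i. ?P i - ?Q i" "{..<?n}"] F by auto
    have di: "?d i \<noteq> []" "length (?d i) = ?n - 1"
      using i True by (auto simp: delete_nth_def)
    show ?thesis
    proof (cases "indep (w # ?d i)")
      case True
      obtain r where r: "ap (w # ?d i) = pscale ((- 1) ^ length (?d i)) (push (\<lambda>F. F @ [spn (?d i)]) (ap (?d i))) + r"
        "\<And>F. F \<in> Poly_Mapping.keys r \<Longrightarrow> w \<in> last F" using ap_Cons_main[OF di(1)] by metis
      have "?n - 1 - i + 2 * i = i + (?n - 1)" using i by simp
      hence "(- 1 :: rat) ^ i * (- 1) ^ (?n - 1) = (- 1) ^ (?n - 1 - i + 2 * i)" by (simp only: power_add)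
      also have "\<dots> = (- 1) ^ (?n - 1 - i)" by (simp only: power_add power_mult) simp
      finally have "?P i - ?Q i = - pscale ((- 1) ^ i) r"
        using True by (simp add: apz_def r(1) di(2) pm.scale_right_distrib)
      hence "F \<in> Poly_Mapping.keys (pscale ((- 1) ^ i) r)" using i(2) by simp
      from r(2)[OF subsetD[OF keys_pscale this]] show ?thesis .
    next
      case False
      hence w: "w \<in> spn (?d i)" using indep_delete_nth[OF ix] by (simp add: indep_Cons)
      have "F \<in> Poly_Mapping.keys (?P i)" using i(2) False by (simp add: apz_def)
      hence "F \<in> Poly_Mapping.keys (push (\<lambda>F. F @ [spn (?d i)]) (ap (?d i)))"
        by (rule subsetD[OF keys_pscale])
      from subsetD[OF keys_push this] obtain G where G: "F = G @ [spn (?d i)]" by blast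
      show ?thesis unfolding G using w by simp
    qed
  qed
  ultimately have "\<zeta> = 0" using True n by (intro cycle_zeroI[OF sW _ _ w(2)]) auto
  thus ?thesis by (simp add: \<zeta>_def)
qed

lemma ap_move: "ap (xs @ x # ys) = pscale ((- 1) ^ length xs) (ap (x # xs @ ys))"
  unfolding ap_def by (subst alt_move) (simp add: push_simps)

lemma apz_move: "apz (xs @ x # ys) = pscale ((- 1) ^ length xs) (apz (x # xs @ ys))"
  by (simp add: apz_def ap_move indep_move)

lemma neg_one_sq: "(- 1 :: rat) ^ n * (- 1) ^ n = 1"
  by (simp add: power_add[symmetric] mult_2[symmetric])

lemma apz_move': "apz (x # xs @ ys) = pscale ((- 1) ^ length xs) (apz (xs @ x # ys))"
  by (simp add: apz_move[of xs x ys] neg_one_sq)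

lemma apz_scale:
  assumes c: "c \<noteq> 0"
  shows "apz (xs @ (c *s x) # ys) = apz (xs @ x # ys)"
proof -
  have sp: "span (insert (c *s x) S) = span (insert x S)" for S
  proof -
    have "x = inverse c *s (c *s x)" using c by simp
    hence "x \<in> span (insert (c *s x) S)" by (metis insertI1 span_base span_scale)
    thus ?thesis
      by (intro equalityI span_minimal)
        (auto intro: span_base span_scale)
  qed
  have iff: "indep (xs @ (c *s x) # ys) \<longleftrightarrow> indep (xs @ x # ys)"
    by (rule indep_cong) (simp_all add: sp)
  show ?thesis
  proof (cases "indep (xs @ x # ys)")
    case True
    let ?v = "xs @ x # ys"
    define f where "f y = (if y = x then c *s x else y)" for y
    have d: "x \<notin> set xs" "x \<notin> set ys" using True by (auto simp: indep_def)
    have v: "xs @ (c *s x) # ys = map f ?v"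
      using d by (auto simp: f_def intro!: map_idI[symmetric])
    have fm: "flag (map f l) = flag l" for l
    proof -
      have "span (f ` S) = span S" for S
      proof (cases "x \<in> S")
        case True
        hence "f ` S = insert (c *s x) (S - {x})" "S = insert x (S - {x})"
          by (auto simp: f_def)
        thus ?thesis using sp by metis
      next
        case False
        hence "f ` S = S" by (auto simp: f_def)
        thus ?thesis by simp
      qed
      thus ?thesis by (simp add: flag_def take_map)
    qed
    have "ap (map f ?v) = ap ?v" by (simp only: ap_def alt_map push_push fm)
    thus ?thesis using True iff v by (simp add: apz_def)
  qed (use iff in \<open>simp add: apz_def\<close>)
qed

lemma nth_in_delete_nth:
  assumes "k < length v" "k \<noteq> i"
  shows "v ! k \<in> set (delete_nth i v)"
proof (cases "k < i")
  case True
  hence "v ! k = take i v ! k" "k < length (take i v)" using assms by auto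
  hence "v ! k \<in> set (take i v)" by (metis nth_mem)
  thus ?thesis by (simp add: delete_nth_def)
next
  case False
  hence "v ! k = drop (Suc i) v ! (k - Suc i)" "k - Suc i < length (drop (Suc i) v)" using assms by auto
  hence "v ! k \<in> set (drop (Suc i) v)" by (metis nth_mem)
  thus ?thesis by (simp add: delete_nth_def)
qed

text \<open>Expansion along \<open>U = Y - c *s X\<close>: deleting any other entry leaves both
  \<open>X\<close> and \<open>Y\<close>, whose span contains \<open>U\<close>, so only the terms
  that delete \<open>X\<close> or \<open>Y\<close> can be nonzero.\<close>

lemma apz_three_term:
  assumes c: "c \<noteq> 0"
  shows "apz (p @ X # q @ Y # r) =
    apz (p @ X # q @ (Y - c *s X) # r) + apz (p @ (Y - c *s X) # q @ Y # r)"
proof -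
  define U where "U = Y - c *s X"
  let ?v = "p @ X # q @ Y # r"
  let ?S = "set p \<union> set q \<union> set r"
  have Uin: "U \<in> span {X, Y}" unfolding U_def by (intro span_diff span_scale span_base) auto
  have s1: "span (insert X (insert U T)) = span (insert X (insert Y T))"
    and s2: "span (insert U (insert Y T)) = span (insert X (insert Y T))" for T
  proof -
    have Y: "Y = U + c *s X" by (simp add: U_def)
    have X: "X = inverse c *s (Y - U)" using c by (simp add: U_def)
    have 1: "Y \<in> span (insert X (insert U T))" unfolding Y by (intro span_add span_scale span_base) auto
    have 2: "X \<in> span (insert U (insert Y T))" unfolding X by (intro span_diff span_scale span_base) auto
    have 3: "U \<in> span (insert X (insert Y T))" unfolding U_def by (intro span_diff span_scale span_base) auto
    show "span (insert X (insert U T)) = span (insert X (insert Y T))"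
      using 1 3 by (intro equalityI span_minimal) (auto intro: span_base)
    show "span (insert U (insert Y T)) = span (insert X (insert Y T))"
      using 2 3 by (intro equalityI span_minimal) (auto intro: span_base)
  qed
  have i1: "indep (p @ X # q @ U # r) \<longleftrightarrow> indep ?v"
    using s1[of ?S] by (intro indep_cong) (simp_all add: insert_commute Un_ac)
  have i2: "indep (p @ U # q @ Y # r) \<longleftrightarrow> indep ?v"
    using s2[of ?S] by (intro indep_cong) (simp_all add: insert_commute Un_ac)
  show ?thesis
  proof (cases "indep ?v")
    case False
    thus ?thesis using i1 i2 by (simp add: apz_def U_def)
  next
    case True
    let ?n = "length ?v" and ?i = "length p" and ?j = "length p + 1 + length q"
    have iXY: "indep (X # Y # p @ q @ r)" using True indep_mset[of ?v "X # Y # p @ q @ r"] by simp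
    have XY: "X \<notin> span (insert Y ?S)" "Y \<notin> span ?S"
      using iXY by (auto simp: indep_Cons Un_ac)
    have Une: "U \<noteq> 0"
    proof
      assume "U = 0"
      hence "X = inverse c *s Y" using c by (simp add: U_def)
      thus False using XY(1) by (metis insertI1 span_base span_scale)
    qed
    have UW: "U \<in> spn ?v" using Uin span_mono[of "{X, Y}" "set ?v"] by auto
    have "ap ?v = (\<Sum>i<?n. pscale ((- 1) ^ i) (apz (U # delete_nth i ?v)))"
      using True by (intro ap_expand[OF _ UW Une]) (simp add: basis_tuple_iff)
    also have "\<dots> = (\<Sum>i\<in>{?i, ?j}. pscale ((- 1) ^ i) (apz (U # delete_nth i ?v)))"
    proof (rule sum.mono_neutral_right)
      show "\<forall>i\<in>{..<?n} - {?i, ?j}. pscale ((- 1) ^ i) (apz (U # delete_nth i ?v)) = 0"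
      proof
        fix i assume i: "i \<in> {..<?n} - {?i, ?j}"
        have "X \<in> set (delete_nth i ?v)" "Y \<in> set (delete_nth i ?v)"
          using i nth_in_delete_nth[of ?i ?v i] nth_in_delete_nth[of ?j ?v i] by (auto simp: nth_append)
        hence "U \<in> spn (delete_nth i ?v)" using Uin span_mono[of "{X, Y}" "set (delete_nth i ?v)"] by auto
        hence "\<not> indep (U # delete_nth i ?v)" by (simp add: indep_Cons)
        thus "pscale ((- 1) ^ i) (apz (U # delete_nth i ?v)) = 0" by (simp add: apz_def)
      qed
    qed auto
    also have "\<dots> = pscale ((- 1) ^ ?i) (apz (U # p @ q @ Y # r)) + pscale ((- 1) ^ ?j) (apz (U # p @ X # q @ r))"
      by (simp add: delete_nth_append delete_nth_def)
    also have "apz (U # p @ q @ Y # r) = pscale ((- 1) ^ ?i) (apz (p @ U # q @ Y # r))"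
      using apz_move'[of U p "q @ Y # r"] by simp
    also have "apz (U # p @ X # q @ r) = pscale ((- 1) ^ ?j) (apz (p @ X # q @ U # r))"
      using apz_move'[of U "p @ X # q" r] by simp
    finally show ?thesis using True by (simp add: apz_def[of ?v] neg_one_sq U_def add.commute del: power_Suc power_add)
  qed
qed

subsection \<open>Coefficients of apartments\<close>

text \<open>
  Full flags \<open>fl\<close> include the whole space, which makes the coefficients amenable to induction.
\<close>

definition coeff :: "'b list \<Rightarrow> 'b list \<Rightarrow> rat" where
  "coeff a v = Poly_Mapping.lookup (push fl (alt a)) (fl v)"

lemma coeff_eq_sum: "coeff a v = (\<Sum>l | l \<in> Poly_Mapping.keys (alt a) \<and> fl l = fl v. Poly_Mapping.lookup (alt a) l)"
  by (simp add: coeff_def lookup_push)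

lemma coeff_nonzeroE:
  assumes "coeff a v \<noteq> 0"
  obtains l where "l \<in> Poly_Mapping.keys (alt a)" "fl l = fl v"
  using assms unfolding coeff_eq_sum by (metis (mono_tags, lifting) empty_Collect_eq sum.empty)

lemma coeff_nonzeroD:
  assumes "coeff a v \<noteq> 0"
  shows "length a = length v" "spn a = spn v" "indep a \<longleftrightarrow> indep v"
proof -
  obtain l where l: "l \<in> Poly_Mapping.keys (alt a)" "fl l = fl v" using assms by (rule coeff_nonzeroE)
  show 1: "length a = length v" using fl_eqD(1)[OF l(2)] alt_keys_length[OF l(1)] by simp
  show 2: "spn a = spn v" using fl_eqD(3)[OF l(2)] alt_keys_set[OF l(1)] by simp
  show "indep a \<longleftrightarrow> indep v" using indep_cong[OF 2 1] .
qed

lemma lookup_ap: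
  assumes "length a = length v" "spn a = spn v"
  shows "Poly_Mapping.lookup (ap a) (flag v) = coeff a v"
  unfolding ap_def coeff_eq_sum lookup_push
proof (rule sum.cong[OF _ refl])
  have "flag l = flag v \<longleftrightarrow> fl l = fl v" if "l \<in> Poly_Mapping.keys (alt a)" for l
    using alt_keys_length[OF that] alt_keys_set[OF that] assms by (intro flag_eq_iff_fl) auto
  thus "{l. l \<in> Poly_Mapping.keys (alt a) \<and> flag l = flag v} =
      {l. l \<in> Poly_Mapping.keys (alt a) \<and> fl l = fl v}" by blast
qed

lemma coeff_Nil: "coeff a [] = (if a = [] then 1 else 0)"
proof (cases "a = []")
  case False
  thus ?thesis using coeff_nonzeroD(1)[of a "[]"] by auto
qed (simp add: coeff_def)

lemma coeff_Nil_left: "coeff [] (v @ [y]) = 0"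
  using coeff_nonzeroD(1)[of "[]" "v @ [y]"] by auto

lemma lookup_push_snoc:
  "Poly_Mapping.lookup (push (\<lambda>F. F @ [W]) q) (G @ [W']) = (if W = W' then Poly_Mapping.lookup q G else 0)"
proof (cases "W = W'")
  case True
  thus ?thesis using lookup_push_inj[of "\<lambda>F. F @ [W]" q G] by (simp add: inj_def)
next
  case False
  hence "G @ [W'] \<notin> Poly_Mapping.keys (push (\<lambda>F. F @ [W]) q)"
    using keys_push[of "\<lambda>F. F @ [W]" q] by auto
  thus ?thesis using False by (simp add: in_keys_iff)
qed

text \<open>For \<open>fl\<close> the last step is the span of all of \<open>a\<close>, whichever
  entry comes last. So the last step only imposes a condition on spans, and the rest is an expansion
  over the entry of \<open>a\<close> in the last place.\<close>

lemma coeff_snoc: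
  "coeff a (v @ [y]) = (if spn a = spn (v @ [y])
     then (\<Sum>i<length a. (- 1) ^ (length a - 1 - i) * coeff (delete_nth i a) v) else 0)"
proof (cases "a = []")
  case False
  have "push fl (alt a) = (\<Sum>i<length a. pscale ((- 1) ^ (length a - 1 - i))
    (push (\<lambda>l. fl (l @ [a ! i])) (alt (delete_nth i a))))"
    by (subst alt_last[OF False]) (simp add: push_simps push_push)
  also have "\<dots> = (\<Sum>i<length a. pscale ((- 1) ^ (length a - 1 - i))
    (push (\<lambda>F. F @ [spn a]) (push fl (alt (delete_nth i a)))))"
  proof (rule sum.cong[OF refl])
    fix i assume i: "i \<in> {..<length a}"
    have "push (\<lambda>l. fl (l @ [a ! i])) (alt (delete_nth i a)) = push (\<lambda>l. fl l @ [spn a]) (alt (delete_nth i a))"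
    proof (rule push_cong)
      fix l assume l: "l \<in> Poly_Mapping.keys (alt (delete_nth i a))"
      have "set (l @ [a ! i]) = set a"
        using alt_keys_set[OF l] insert_set_delete_nth[of i a] i by simp
      thus "fl (l @ [a ! i]) = fl l @ [spn a]" by (simp add: fl_snoc)
    qed
    thus "pscale ((- 1) ^ (length a - 1 - i)) (push (\<lambda>l. fl (l @ [a ! i])) (alt (delete_nth i a))) =
      pscale ((- 1) ^ (length a - 1 - i)) (push (\<lambda>F. F @ [spn a]) (push fl (alt (delete_nth i a))))"
      by (simp add: push_push)
  qed
  finally have "coeff a (v @ [y]) = (\<Sum>i<length a. (- 1) ^ (length a - 1 - i) *
      Poly_Mapping.lookup (push (\<lambda>F. F @ [spn a]) (push fl (alt (delete_nth i a)))) (fl v @ [spn (v @ [y])]))"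
    unfolding coeff_def fl_snoc by (simp add: lookup_sum)
  thus ?thesis unfolding lookup_push_snoc by (simp add: coeff_def)
qed (simp add: coeff_Nil_left)

lemma coeff_move_front: "i < length a \<Longrightarrow> coeff a v = (- 1) ^ i * coeff (a ! i # delete_nth i a) v"
  unfolding coeff_def by (subst alt_delete[of i a]) (simp_all add: push_simps)

text \<open>A map \<open>\<phi>\<close> with the line of \<open>w\<close> as kernel stands for the
  quotient by \<open>w\<close>: a subspace containing \<open>w\<close> is the preimage of its
  image.\<close>

lemma span_insert_kernel:
  assumes lin: "Vector_Spaces.linear scale scale \<phi>" and ker: "\<And>y. \<phi> y = 0 \<longleftrightarrow> y \<in> span {w}"
  shows "span (insert w S) = {x. \<phi> x \<in> span (\<phi> ` S)}"
proof -
  have im: "span (\<phi> ` S) = \<phi> ` span S" by (rule vp.linear_span_image[OF lin])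
  have w: "\<phi> w = 0" using ker by (simp add: span_base)
  show ?thesis
  proof (intro equalityI subsetI)
    fix x assume "x \<in> span (insert w S)"
    then obtain k where k: "x - k *s w \<in> span S" by (auto simp: span_insert)
    have "\<phi> x = \<phi> (x - k *s w)"
      using w by (simp add: vp.linear_diff[OF lin] vp.linear_scale[OF lin])
    thus "x \<in> {x. \<phi> x \<in> span (\<phi> ` S)}" using k im by auto
  next
    fix x assume "x \<in> {x. \<phi> x \<in> span (\<phi> ` S)}"
    then obtain y where y: "y \<in> span S" "\<phi> x = \<phi> y" using im by auto
    hence "\<phi> (x - y) = 0" by (simp add: vp.linear_diff[OF lin])
    hence "x - y \<in> span {w}" using ker by simp
    hence "x - y \<in> span (insert w S)" using span_mono[of "{w}" "insert w S"] by auto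
    moreover have "y \<in> span (insert w S)" using y(1) span_mono[of S "insert w S"] by auto
    ultimately have "(x - y) + y \<in> span (insert w S)" by (rule span_add)
    thus "x \<in> span (insert w S)" by simp
  qed
qed

text \<open>Localisation at the first line of a flag. Only orderings of \<open>w # x\<close> that
  begin with \<open>w\<close> have this line as first step, and the rest of the flag is read in the
  quotient by \<open>w\<close>, which \<open>\<phi>\<close> models inside the same space.\<close>

lemma coeff_first:
  assumes ind: "indep (w # x)" and w': "span {w'} = span {w}"
    and lin: "Vector_Spaces.linear scale scale \<phi>" and ker: "\<And>y. \<phi> y = 0 \<longleftrightarrow> y \<in> span {w}"
  shows "coeff (w # x) (w' # v) = coeff (map \<phi> x) (map \<phi> v)"
proof -
  let ?n = "length x"
  let ?I = "\<lambda>k l. take k l @ w # drop k l"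
  have sp': "span (insert w' S) = span (insert w S)" for S
  proof -
    have "span ({w'} \<union> S) = span ({w} \<union> S)" unfolding span_Un w' ..
    thus ?thesis by simp
  qed
  have im: "span (\<phi> ` S) = \<phi> ` span S" for S by (rule vp.linear_span_image[OF lin])
  have eq: "span (insert w S) = span (insert w T) \<longleftrightarrow> span (\<phi> ` S) = span (\<phi> ` T)" for S T
  proof
    assume "span (insert w S) = span (insert w T)"
    hence "\<phi> x \<in> \<phi> ` span S \<longleftrightarrow> \<phi> x \<in> \<phi> ` span T" for x
      using span_insert_kernel[OF lin ker] im by blast
    thus "span (\<phi> ` S) = span (\<phi> ` T)" unfolding im by blast
  next
    assume "span (\<phi> ` S) = span (\<phi> ` T)"
    thus "span (insert w S) = span (insert w T)" by (simp add: span_insert_kernel[OF lin ker])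
  qed
  have "coeff (w # x) (w' # v) = (\<Sum>k\<le>?n. (- 1) ^ k *
      Poly_Mapping.lookup (push (\<lambda>l. fl (?I k l)) (alt x)) (fl (w' # v)))"
    unfolding coeff_def alt_Cons_eq by (simp add: push_simps push_push lookup_sum)
  also have "\<dots> = (\<Sum>k\<in>{0}. (- 1) ^ k * Poly_Mapping.lookup (push (\<lambda>l. fl (?I k l)) (alt x)) (fl (w' # v)))"
  proof (rule sum.mono_neutral_right)
    show "\<forall>k\<in>{..?n} - {0}. (- 1) ^ k * Poly_Mapping.lookup (push (\<lambda>l. fl (?I k l)) (alt x)) (fl (w' # v)) = 0"
    proof
      fix k assume k: "k \<in> {..?n} - {0}"
      have "fl (?I k l) \<noteq> fl (w' # v)" if l: "l \<in> Poly_Mapping.keys (alt x)" for l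
      proof
        assume f: "fl (?I k l) = fl (w' # v)"
        have "length l = ?n" using alt_keys_length[OF l] .
        then obtain b l' where bl: "l = b # l'" using k by (cases l) auto
        have "spn (take 1 (?I k l)) = spn (take 1 (w' # v))" by (rule fl_eqD(2)[OF f]) simp
        hence "span {b} = span {w}" using k bl w' by (auto simp: take_Cons')
        hence "w \<in> span {b}" by (simp add: span_base)
        moreover have "b \<in> set x" using alt_keys_set[OF l] bl by auto
        ultimately have "w \<in> spn x" using span_mono[of "{b}" "set x"] by auto
        thus False using ind by (simp add: indep_Cons)
      qed
      thus "(- 1) ^ k * Poly_Mapping.lookup (push (\<lambda>l. fl (?I k l)) (alt x)) (fl (w' # v)) = 0"
        by (auto simp: lookup_push intro!: sum.neutral)
    qed
  qed auto
  also have "\<dots> = Poly_Mapping.lookup (push (\<lambda>l. fl (w # l)) (alt x)) (fl (w' # v))" by simp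
  also have "\<dots> = Poly_Mapping.lookup (push (\<lambda>l. fl (map \<phi> l)) (alt x)) (fl (map \<phi> v))"
    unfolding lookup_push
  proof (rule sum.cong[OF _ refl])
    have "fl (w # l) = fl (w' # v) \<longleftrightarrow> fl (map \<phi> l) = fl (map \<phi> v)" for l
    proof -
      have "fl (w # l) = fl (w' # v) \<longleftrightarrow> length l = length v \<and>
          (\<forall>k\<le>length l. span (insert w (set (take k l))) = span (insert w' (set (take k v))))"
      proof -
        have "(\<forall>k\<le>Suc (length l). spn (take k (w # l)) = spn (take k (w' # v))) \<longleftrightarrow>
          (\<forall>k\<le>length l. span (insert w (set (take k l))) = span (insert w' (set (take k v))))"
        proof (safe)
          fix k assume "\<forall>k\<le>Suc (length l). spn (take k (w # l)) = spn (take k (w' # v))" "k \<le> length l"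
          from spec[OF this(1), of "Suc k"] this(2)
          show "x \<in> span (insert w (set (take k l))) \<Longrightarrow> x \<in> span (insert w' (set (take k v)))"
            "x \<in> span (insert w' (set (take k v))) \<Longrightarrow> x \<in> span (insert w (set (take k l)))" for x by auto
        next
          fix k assume *: "\<forall>k\<le>length l. span (insert w (set (take k l))) = span (insert w' (set (take k v)))"
            "k \<le> Suc (length l)"
          have "spn (take k (w # l)) = spn (take k (w' # v))" using * by (cases k) auto
          thus "x \<in> spn (take k (w # l)) \<Longrightarrow> x \<in> spn (take k (w' # v))"
            "x \<in> spn (take k (w' # v)) \<Longrightarrow> x \<in> spn (take k (w # l))" for x by auto
        qed
        thus ?thesis unfolding fl_eq_iff by simp
      qed
      also have "\<dots> \<longleftrightarrow> fl (map \<phi> l) = fl (map \<phi> v)"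
        unfolding fl_eq_iff by (simp add: sp' eq take_map)
      finally show ?thesis .
    qed
    thus "{l. l \<in> Poly_Mapping.keys (alt x) \<and> fl (w # l) = fl (w' # v)} =
      {l. l \<in> Poly_Mapping.keys (alt x) \<and> fl (map \<phi> l) = fl (map \<phi> v)}" by blast
  qed
  also have "\<dots> = coeff (map \<phi> x) (map \<phi> v)" by (simp add: coeff_def alt_map push_push)
  finally show ?thesis .
qed

subsection \<open>Coefficients of products\<close>

text \<open>The number of pairs of an entry with \<open>P\<close> and a later entry without. Applied
  to \<open>rev v\<close> it counts the pairs of \<open>v\<close> that are out of order when the
  entries with \<open>P\<close> ought to come first.\<close>

primrec invs :: "('b \<Rightarrow> bool) \<Rightarrow> 'b list \<Rightarrow> nat" where
  "invs P [] = 0"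
| "invs P (y # v) = invs P v + (if P y then length (filter (\<lambda>x. \<not> P x) v) else 0)"

lemma invs_snoc: "invs P (v @ [y]) = invs P v + (if P y then 0 else length (filter P v))"
  by (induction v) auto

lemma invs_rev: "invs P v + invs P (rev v) = length (filter P v) * length (filter (\<lambda>x. \<not> P x) v)"
  by (induction v) (auto simp: invs_snoc rev_filter[symmetric] simp del: rev_filter)

lemma Int_span_complement:
  assumes "subspace V1" "subspace V2" "V1 \<inter> V2 = {0}" "S \<subseteq> V1" "T \<subseteq> V2"
  shows "V1 \<inter> span (S \<union> T) = span S"
proof (intro equalityI subsetI)
  fix x assume x: "x \<in> V1 \<inter> span (S \<union> T)"
  then obtain s t where st: "s \<in> span S" "t \<in> span T" "x = s + t" by (auto simp: span_Un)
  have "s \<in> V1" "t \<in> V2" using st span_minimal[OF assms(4,1)] span_minimal[OF assms(5,2)] by auto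
  moreover have "t = x - s" using st by simp
  ultimately have "t \<in> V1 \<inter> V2" using x subspace_diff[OF assms(1), of x s] by auto
  thus "x \<in> span S" using assms(3) st by auto
next
  fix x assume "x \<in> span S"
  thus "x \<in> V1 \<inter> span (S \<union> T)"
    using span_minimal[OF assms(4,1)] span_mono[of S "S \<union> T"] by auto
qed

text \<open>A shuffle sign times a product over the two summands, by induction on the last vector
  \<open>y\<close>. If \<open>y\<close> lies in \<open>V1\<close>, the terms that delete an entry of
  \<open>b\<close> vanish: otherwise \<open>a\<close> would already have the span of the
  \<open>V1\<close>-part of \<open>v\<close>, and \<open>y\<close> would be redundant. The other
  case is symmetric. A vector of \<open>V1\<close> has to pass all earlier entries from
  \<open>V2\<close>, which is the source of the sign.\<close>

lemma coeff_append:
  assumes V: "subspace V1" "subspace V2" "V1 \<inter> V2 = {0}"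
    and a: "set a \<subseteq> V1" and b: "set b \<subseteq> V2"
    and v: "set v \<subseteq> V1 \<union> V2" "indep v"
  shows "coeff (a @ b) v = (- 1) ^ invs (\<lambda>x. x \<in> V1) (rev v) * coeff a (filter (\<lambda>x. x \<in> V1) v) *
    coeff b (filter (\<lambda>x. x \<notin> V1) v)"
  using a b v
proof (induction v arbitrary: a b rule: rev_induct)
  case Nil
  thus ?case by (simp add: coeff_Nil)
next
  case (snoc y v)
  let ?P = "\<lambda>x. x \<in> V1" and ?N = "\<lambda>x. x \<notin> V1"
  let ?n1 = "length a" and ?n2 = "length b"
  let ?s = "(- 1) ^ invs ?P (rev v) :: rat"
  have V': "V2 \<inter> V1 = {0}" using V(3) by auto
  have iv: "indep v" "y \<notin> spn v" using snoc.prems by (auto simp: indep_snoc)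
  have vs: "set v \<subseteq> V1 \<union> V2" and yv: "y \<in> V1 \<or> y \<in> V2" using snoc.prems by auto
  have fP: "set (filter ?P v) \<subseteq> V1" and fN: "set (filter ?N v) \<subseteq> V2" using vs by auto
  have setv: "set v = set (filter ?P v) \<union> set (filter ?N v)" by auto
  have da: "set (delete_nth i a) \<subseteq> V1" and db: "set (delete_nth i b) \<subseteq> V2" for i
    using set_delete_nth_subset[of i a] set_delete_nth_subset[of i b] snoc.prems by auto
  define T where "T \<longleftrightarrow> spn (a @ b) = spn (v @ [y])"
  have split: "(\<Sum>i<?n1 + n. g i) = (\<Sum>i<?n1. g i) + (\<Sum>j<n. g (?n1 + j))" for g :: "nat \<Rightarrow> rat" and n
    by (induction n) (simp_all add: add.assoc)
  have "coeff (a @ b) (v @ [y]) = (if T then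
      (\<Sum>i<?n1 + ?n2. (- 1) ^ (?n1 + ?n2 - 1 - i) * coeff (delete_nth i (a @ b)) v) else 0)"
    unfolding T_def coeff_snoc by simp
  also have "\<dots> = (if T then
      (\<Sum>i<?n1. (- 1) ^ (?n1 + ?n2 - 1 - i) * (?s * coeff (delete_nth i a) (filter ?P v) * coeff b (filter ?N v))) +
      (\<Sum>j<?n2. (- 1) ^ (?n2 - 1 - j) * (?s * coeff a (filter ?P v) * coeff (delete_nth j b) (filter ?N v))) else 0)"
    unfolding split using snoc.IH[OF da _ vs iv(1)] snoc.IH[OF _ db vs iv(1)] snoc.prems
    by (auto simp: delete_nth_append intro!: sum.cong arg_cong2[of _ _ _ _ "(+)"])
  finally have main: "coeff (a @ b) (v @ [y]) = (if T then
      (\<Sum>i<?n1. (- 1) ^ (?n1 + ?n2 - 1 - i) * (?s * coeff (delete_nth i a) (filter ?P v) * coeff b (filter ?N v))) +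
      (\<Sum>j<?n2. (- 1) ^ (?n2 - 1 - j) * (?s * coeff a (filter ?P v) * coeff (delete_nth j b) (filter ?N v))) else 0)" .
  show ?case
  proof (cases "y \<in> V1")
    case True
    have "coeff a (filter ?P v) = 0" if T
    proof (rule ccontr)
      assume "coeff a (filter ?P v) \<noteq> 0"
      hence "spn a = spn (filter ?P v)" by (rule coeff_nonzeroD)
      moreover have "y \<in> V1 \<inter> span (set a \<union> set b)"
        using that True span_base[of y "set (v @ [y])"] by (auto simp: T_def)
      hence "y \<in> spn a" using Int_span_complement[OF V snoc.prems(1,2)] by blast
      ultimately have "y \<in> spn v" using span_mono[of "set (filter ?P v)" "set v"] by auto
      thus False using iv by simp
    qed
    hence 1: "coeff (a @ b) (v @ [y]) = (if T then
        (\<Sum>i<?n1. (- 1) ^ (?n1 + ?n2 - 1 - i) * (?s * coeff (delete_nth i a) (filter ?P v) * coeff b (filter ?N v))) else 0)"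
      unfolding main by auto
    show ?thesis
    proof (cases "coeff b (filter ?N v) = 0")
      case False
      note bN = coeff_nonzeroD[OF False]
      have T: "T \<longleftrightarrow> spn a = spn (filter ?P v @ [y])"
      proof
        assume T
        have "spn a = V1 \<inter> span (set a \<union> set b)"
          using Int_span_complement[OF V snoc.prems(1,2)] by simp
        also have "\<dots> = V1 \<inter> span (insert y (set (filter ?P v)) \<union> set (filter ?N v))"
          using \<open>T\<close> setv unfolding T_def by (metis Un_insert_left Un_insert_right list.set(1) list.simps(15) set_append sup_bot_right)
        also have "\<dots> = spn (filter ?P v @ [y])"
          using Int_span_complement[OF V, of "insert y (set (filter ?P v))"] fP fN True by simp
        finally show "spn a = spn (filter ?P v @ [y])" .
      next
        assume a: "spn a = spn (filter ?P v @ [y])"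
        have "spn (a @ b) = {p + q |p q. p \<in> spn a \<and> q \<in> spn b}" by (simp add: span_Un)
        also have "\<dots> = {p + q |p q. p \<in> spn (filter ?P v @ [y]) \<and> q \<in> spn (filter ?N v)}" using a bN by simp
        also have "\<dots> = span (set (filter ?P v @ [y]) \<union> set (filter ?N v))" by (simp only: span_Un)
        also have "set (filter ?P v @ [y]) \<union> set (filter ?N v) = set (v @ [y])" by auto
        finally show T unfolding T_def .
      qed
      have "(\<Sum>i<?n1. (- 1) ^ (?n1 + ?n2 - 1 - i) * (?s * coeff (delete_nth i a) (filter ?P v) * coeff b (filter ?N v))) =
          ?s * (- 1) ^ ?n2 * (\<Sum>i<?n1. (- 1) ^ (?n1 - 1 - i) * coeff (delete_nth i a) (filter ?P v)) * coeff b (filter ?N v)"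
        unfolding sum_distrib_left sum_distrib_right
      proof (rule sum.cong[OF refl])
        fix i assume "i \<in> {..<?n1}"
        hence "?n1 + ?n2 - 1 - i = ?n2 + (?n1 - 1 - i)" by auto
        thus "(- 1) ^ (?n1 + ?n2 - 1 - i) * (?s * coeff (delete_nth i a) (filter ?P v) * coeff b (filter ?N v)) =
          ?s * (- 1) ^ ?n2 * ((- 1) ^ (?n1 - 1 - i) * coeff (delete_nth i a) (filter ?P v)) * coeff b (filter ?N v)"
          by (simp add: power_add)
      qed
      hence "coeff (a @ b) (v @ [y]) = ?s * (- 1) ^ ?n2 * coeff a (filter ?P v @ [y]) * coeff b (filter ?N v)"
        unfolding 1 coeff_snoc[of a] T by simp
      moreover have "length (filter ?N (rev v)) = ?n2" using bN(1) by (simp add: rev_filter[symmetric])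
      ultimately show ?thesis using True by (simp add: power_add)
    qed (use 1 True in simp)
  next
    case False
    hence y2: "y \<in> V2" using yv by simp
    have "coeff b (filter ?N v) = 0" if T
    proof (rule ccontr)
      assume "coeff b (filter ?N v) \<noteq> 0"
      hence "spn b = spn (filter ?N v)" by (rule coeff_nonzeroD)
      moreover have "y \<in> V2 \<inter> span (set b \<union> set a)"
        using that y2 span_base[of y "set (v @ [y])"] by (auto simp: T_def Un_commute)
      hence "y \<in> spn b" using Int_span_complement[OF V(2,1) V' snoc.prems(2,1)] by blast
      ultimately have "y \<in> spn v" using span_mono[of "set (filter ?N v)" "set v"] by auto
      thus False using iv by simp
    qed
    hence 1: "coeff (a @ b) (v @ [y]) = (if T then
        (\<Sum>j<?n2. (- 1) ^ (?n2 - 1 - j) * (?s * coeff a (filter ?P v) * coeff (delete_nth j b) (filter ?N v))) else 0)"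
      unfolding main by auto
    show ?thesis
    proof (cases "coeff a (filter ?P v) = 0")
      case aP: False
      note aP = coeff_nonzeroD[OF aP]
      have T: "T \<longleftrightarrow> spn b = spn (filter ?N v @ [y])"
      proof
        assume T
        have "spn b = V2 \<inter> span (set b \<union> set a)"
          using Int_span_complement[OF V(2,1) V' snoc.prems(2,1)] by simp
        also have "set b \<union> set a = set (a @ b)" by auto
        also have "span \<dots> = span (set (v @ [y]))" using \<open>T\<close> unfolding T_def .
        also have "set (v @ [y]) = insert y (set (filter ?N v)) \<union> set (filter ?P v)" by auto
        also have "V2 \<inter> span \<dots> = spn (filter ?N v @ [y])"
          using Int_span_complement[OF V(2,1) V', of "insert y (set (filter ?N v))"] fP fN y2 by simp
        finally show "spn b = spn (filter ?N v @ [y])" .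
      next
        assume b: "spn b = spn (filter ?N v @ [y])"
        have "spn (a @ b) = {p + q |p q. p \<in> spn a \<and> q \<in> spn b}" by (simp add: span_Un)
        also have "\<dots> = {p + q |p q. p \<in> spn (filter ?P v) \<and> q \<in> spn (filter ?N v @ [y])}" using b aP by simp
        also have "\<dots> = span (set (filter ?P v) \<union> set (filter ?N v @ [y]))" by (simp only: span_Un)
        also have "set (filter ?P v) \<union> set (filter ?N v @ [y]) = set (v @ [y])" by auto
        finally show T unfolding T_def .
      qed
      have "(\<Sum>j<?n2. (- 1) ^ (?n2 - 1 - j) * (?s * coeff a (filter ?P v) * coeff (delete_nth j b) (filter ?N v))) =
          ?s * coeff a (filter ?P v) * (\<Sum>j<?n2. (- 1) ^ (?n2 - 1 - j) * coeff (delete_nth j b) (filter ?N v))"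
        unfolding sum_distrib_left by (rule sum.cong) (simp_all add: mult_ac)
      hence "coeff (a @ b) (v @ [y]) = ?s * coeff a (filter ?P v) * coeff b (filter ?N v @ [y])"
        unfolding 1 coeff_snoc[of b] T by simp
      thus ?thesis using False by simp
    qed (use 1 False in simp)
  qed
qed

end

lemma generates_carrier: "generates M (carrier M)"
  by (auto simp: generates_def)

lemma tensor_eqI:
  assumes M: "qmodule M" "qmodule N" "qmodule P" and A: "generates M A" "generates N B"
    and fg: "f \<in> linear_maps (tensor M N) P" "g \<in> linear_maps (tensor M N) P"
    and eq: "\<And>a b. a \<in> A \<Longrightarrow> b \<in> B \<Longrightarrow> f (pure_tensor M N a b) = g (pure_tensor M N a b)"
    and x: "x \<in> carrier (tensor M N)"
  shows "f x = g x"
proof -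
  interpret qtensor M N using M by (simp add: qtensor_def)
  show ?thesis
    by (rule linear_maps_eq_on_generators[OF qmodule_tensor M(3) fg tensor_generates[OF A] _ x])
      (use eq in auto)
qed

text \<open>\<open>tensor_lift\<close> is applied to the second pair for fixed \<open>x1\<close> and
  \<open>y1\<close>, then to the first pair, then to the outer product. Linearity in the variables
  held fixed is checked on pure tensors each time.\<close>

lemma tensor_lift_quadrilinear:
  assumes Q: "qmodule M1" "qmodule N1" "qmodule M2" "qmodule N2" "qmodule P"
    and l1: "\<And>y1 x2 y2. y1 \<in> carrier N1 \<Longrightarrow> x2 \<in> carrier M2 \<Longrightarrow> y2 \<in> carrier N2 \<Longrightarrow>
      (\<lambda>x1. f x1 y1 x2 y2) \<in> linear_maps M1 P"
    and l2: "\<And>x1 x2 y2. x1 \<in> carrier M1 \<Longrightarrow> x2 \<in> carrier M2 \<Longrightarrow> y2 \<in> carrier N2 \<Longrightarrow>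
      (\<lambda>y1. f x1 y1 x2 y2) \<in> linear_maps N1 P"
    and l3: "\<And>x1 y1 y2. x1 \<in> carrier M1 \<Longrightarrow> y1 \<in> carrier N1 \<Longrightarrow> y2 \<in> carrier N2 \<Longrightarrow>
      (\<lambda>x2. f x1 y1 x2 y2) \<in> linear_maps M2 P"
    and l4: "\<And>x1 y1 x2. x1 \<in> carrier M1 \<Longrightarrow> y1 \<in> carrier N1 \<Longrightarrow> x2 \<in> carrier M2 \<Longrightarrow>
      (\<lambda>y2. f x1 y1 x2 y2) \<in> linear_maps N2 P"
  shows "\<exists>\<Phi>\<in>linear_maps (tensor (tensor M1 N1) (tensor M2 N2)) P.
    \<forall>x1\<in>carrier M1. \<forall>y1\<in>carrier N1. \<forall>x2\<in>carrier M2. \<forall>y2\<in>carrier N2.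
      \<Phi> (pure_tensor (tensor M1 N1) (tensor M2 N2) (pure_tensor M1 N1 x1 y1) (pure_tensor M2 N2 x2 y2))
      = f x1 y1 x2 y2"
proof -
  interpret T1: qtensor M1 N1 using Q by (simp add: qtensor_def)
  interpret T2: qtensor M2 N2 using Q by (simp add: qtensor_def)
  note q1 = T1.qmodule_tensor and q2 = T2.qmodule_tensor
  interpret T: qtensor "tensor M1 N1" "tensor M2 N2" using q1 q2 by (simp add: qtensor_def)
  interpret P: qmodule P by fact
  note g1 = generates_carrier[of M1] generates_carrier[of N1]
    and g2 = generates_carrier[of M2] generates_carrier[of N2]
  have "\<exists>\<Psi>. \<Psi> \<in> linear_maps (tensor M2 N2) P \<and>
      (\<forall>x2\<in>carrier M2. \<forall>y2\<in>carrier N2. \<Psi> (pure_tensor M2 N2 x2 y2) = f x1 y1 x2 y2)"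
    if "x1 \<in> carrier M1" "y1 \<in> carrier N1" for x1 y1
    using T2.tensor_lift[OF Q(5), of "f x1 y1"] l3[OF that] l4[OF that] by metis
  then obtain \<Psi> where \<Psi>: "\<And>x1 y1. x1 \<in> carrier M1 \<Longrightarrow> y1 \<in> carrier N1 \<Longrightarrow> \<Psi> x1 y1 \<in> linear_maps (tensor M2 N2) P"
    "\<And>x1 y1 x2 y2. x1 \<in> carrier M1 \<Longrightarrow> y1 \<in> carrier N1 \<Longrightarrow> x2 \<in> carrier M2 \<Longrightarrow> y2 \<in> carrier N2 \<Longrightarrow>
      \<Psi> x1 y1 (pure_tensor M2 N2 x2 y2) = f x1 y1 x2 y2"
    by metis
  have \<Psi>1: "(\<lambda>x1. \<Psi> x1 y1 q) \<in> linear_maps M1 P" if y1: "y1 \<in> carrier N1" and q: "q \<in> carrier (tensor M2 N2)" for y1 q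
  proof (rule linear_mapsI)
    show "\<Psi> x y1 q \<in> carrier P" if "x \<in> carrier M1" for x
      by (rule linear_mapsD(1)[OF \<Psi>(1)[OF that y1] q])
    show "\<Psi> (x \<oplus>\<^bsub>M1\<^esub> x') y1 q = \<Psi> x y1 q \<oplus>\<^bsub>P\<^esub> \<Psi> x' y1 q"
      if x: "x \<in> carrier M1" "x' \<in> carrier M1" for x x'
      by (rule tensor_eqI[OF Q(3-5) g2 _ linear_maps_add[OF Q(5)] _ q])
        (use x y1 linear_mapsD(2)[OF l1] in \<open>auto intro!: \<Psi>(1) simp: \<Psi>(2)\<close>)
    show "\<Psi> (c \<odot>\<^bsub>M1\<^esub> x) y1 q = c \<odot>\<^bsub>P\<^esub> \<Psi> x y1 q" if x: "x \<in> carrier M1" for c x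
      by (rule tensor_eqI[OF Q(3-5) g2 _ linear_maps_scale[OF Q(5)] _ q])
        (use x y1 linear_mapsD(3)[OF l1] in \<open>auto intro!: \<Psi>(1) simp: \<Psi>(2)\<close>)
  qed
  have \<Psi>2: "(\<lambda>y1. \<Psi> x1 y1 q) \<in> linear_maps N1 P" if x1: "x1 \<in> carrier M1" and q: "q \<in> carrier (tensor M2 N2)" for x1 q
  proof (rule linear_mapsI)
    show "\<Psi> x1 y q \<in> carrier P" if "y \<in> carrier N1" for y
      by (rule linear_mapsD(1)[OF \<Psi>(1)[OF x1 that] q])
    show "\<Psi> x1 (y \<oplus>\<^bsub>N1\<^esub> y') q = \<Psi> x1 y q \<oplus>\<^bsub>P\<^esub> \<Psi> x1 y' q"
      if y: "y \<in> carrier N1" "y' \<in> carrier N1" for y y'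
      by (rule tensor_eqI[OF Q(3-5) g2 _ linear_maps_add[OF Q(5)] _ q])
        (use x1 y linear_mapsD(2)[OF l2] in \<open>auto intro!: \<Psi>(1) simp: \<Psi>(2)\<close>)
    show "\<Psi> x1 (c \<odot>\<^bsub>N1\<^esub> y) q = c \<odot>\<^bsub>P\<^esub> \<Psi> x1 y q" if y: "y \<in> carrier N1" for c y
      by (rule tensor_eqI[OF Q(3-5) g2 _ linear_maps_scale[OF Q(5)] _ q])
        (use x1 y linear_mapsD(3)[OF l2] in \<open>auto intro!: \<Psi>(1) simp: \<Psi>(2)\<close>)
  qed
  have "\<exists>\<Xi>. \<Xi> \<in> linear_maps (tensor M1 N1) P \<and>
      (\<forall>x1\<in>carrier M1. \<forall>y1\<in>carrier N1. \<Xi> (pure_tensor M1 N1 x1 y1) = \<Psi> x1 y1 q)"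
    if "q \<in> carrier (tensor M2 N2)" for q
    using T1.tensor_lift[OF Q(5), of "\<lambda>x1 y1. \<Psi> x1 y1 q"] \<Psi>1[OF _ that] \<Psi>2[OF _ that] by metis
  then obtain \<Xi> where \<Xi>: "\<And>q. q \<in> carrier (tensor M2 N2) \<Longrightarrow> \<Xi> q \<in> linear_maps (tensor M1 N1) P"
    "\<And>q x1 y1. q \<in> carrier (tensor M2 N2) \<Longrightarrow> x1 \<in> carrier M1 \<Longrightarrow> y1 \<in> carrier N1 \<Longrightarrow>
      \<Xi> q (pure_tensor M1 N1 x1 y1) = \<Psi> x1 y1 q"
    by metis
  have \<Xi>': "(\<lambda>q. \<Xi> q p) \<in> linear_maps (tensor M2 N2) P" if p: "p \<in> carrier (tensor M1 N1)" for p
  proof (rule linear_mapsI)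
    interpret t2: qmodule "tensor M2 N2" by (rule q2)
    show "\<Xi> q p \<in> carrier P" if "q \<in> carrier (tensor M2 N2)" for q
      by (rule linear_mapsD(1)[OF \<Xi>(1)[OF that] p])
    show "\<Xi> (q \<oplus>\<^bsub>tensor M2 N2\<^esub> q') p = \<Xi> q p \<oplus>\<^bsub>P\<^esub> \<Xi> q' p"
      if q: "q \<in> carrier (tensor M2 N2)" "q' \<in> carrier (tensor M2 N2)" for q q'
      by (rule tensor_eqI[OF Q(1,2,5) g1 _ linear_maps_add[OF Q(5)] _ p])
        (use q linear_mapsD(2)[OF \<Psi>(1)] in \<open>auto intro!: \<Xi>(1) simp: \<Xi>(2)\<close>)
    show "\<Xi> (c \<odot>\<^bsub>tensor M2 N2\<^esub> q) p = c \<odot>\<^bsub>P\<^esub> \<Xi> q p" if q: "q \<in> carrier (tensor M2 N2)" for c q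
      by (rule tensor_eqI[OF Q(1,2,5) g1 _ linear_maps_scale[OF Q(5)] _ p])
        (use q linear_mapsD(3)[OF \<Psi>(1)] in \<open>auto intro!: \<Xi>(1) simp: \<Xi>(2)\<close>)
  qed
  obtain \<Phi> where \<Phi>: "\<Phi> \<in> linear_maps (tensor (tensor M1 N1) (tensor M2 N2)) P"
    "\<And>p q. p \<in> carrier (tensor M1 N1) \<Longrightarrow> q \<in> carrier (tensor M2 N2) \<Longrightarrow>
      \<Phi> (pure_tensor (tensor M1 N1) (tensor M2 N2) p q) = \<Xi> q p"
    using T.tensor_lift[OF Q(5), of "\<lambda>p q. \<Xi> q p"] \<Xi>(1) \<Xi>' by metis
  show ?thesis
    by (rule bexI[OF _ \<Phi>(1)]) (simp add: \<Phi>(2) \<Xi>(2) \<Psi>(2) T1.pure_closed T2.pure_closed)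
qed

section \<open>Steinberg classes as cycles, and the product on pairs of them\<close>

section \<open>Steinberg modules\<close>

context fd_steinberg
begin

text \<open>A chain of \<open>dim W\<close> proper nonzero subspaces would need \<open>dim W\<close>
  different positive dimensions below \<open>dim W\<close>. So there is nothing one degree above the
  top that could produce a boundary.\<close>

lemma order_boundaries_top:
  assumes W: "subspace W" "dim W \<ge> 1"
  shows "order_boundaries (tits_poset W) (dim W - 1) = {0}"
proof -
  have "\<not> (sorted_wrt (\<subset>) c \<and> set c \<subseteq> tits_poset W \<and> length c = dim W)" for c
  proof
    assume c: "sorted_wrt (\<subset>) c \<and> set c \<subseteq> tits_poset W \<and> length c = dim W"
    let ?m = "dim W - 1"
    have P: "subspace (c ! j)" "c ! j \<noteq> {0}" "c ! j \<subset> W" if "j < dim W" for j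
    proof -
      have "c ! j \<in> set c" using that c by simp
      hence "c ! j \<in> tits_poset W" using c by auto
      thus "subspace (c ! j)" "c ! j \<noteq> {0}" "c ! j \<subset> W" by (simp_all add: tits_poset_def)
    qed
    have dl: "dim S < dim T" if "subspace S" "subspace T" "S \<subset> T" for S T
      using dim_psubset[of S T] that by (simp add: span_eq_iff[THEN iffD2])
    have "j < dim W \<Longrightarrow> Suc j \<le> dim (c ! j)" for j
    proof (induction j)
      case 0
      have "\<not> c ! 0 \<subseteq> {0}" using P(1,2)[OF 0] subspace_0[of "c ! 0"] by blast
      hence "dim (c ! 0) \<noteq> 0" by simp
      thus ?case by linarith
    next
      case (Suc j)
      have "c ! j \<subset> c ! Suc j" using c Suc.prems by (auto simp: sorted_wrt_iff_nth_less)
      hence "dim (c ! j) < dim (c ! Suc j)" using P(1) Suc.prems by (intro dl) auto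
      thus ?case using Suc by simp
    qed
    from this[of ?m] dl[OF P(1) W(1) P(3), of ?m] W(2) show False by simp
  qed
  hence e: "{c. sorted_wrt (\<subset>) c \<and> set c \<subseteq> tits_poset W \<and> length c = Suc (dim W - 1)} = {}"
    using W(2) by auto
  have "carrier (order_chains (tits_poset W) (Suc (dim W - 1))) = {0}"
    unfolding order_chains_def e by auto
  thus ?thesis unfolding order_boundaries_def order_boundary_eq by (simp add: plin_simps(1))
qed

lemma order_chains_eq: "order_chains (tits_poset W) (dim W - 1) = free_module (flags W)"
  by (simp add: order_chains_def flags_def)

definition ZM :: "'b set \<Rightarrow> (rat, 'b set list \<Rightarrow>\<^sub>0 rat) module" where
  "ZM W = free_module (flags W)\<lparr>carrier := Z W\<rparr>"

lemma ZM_simps [simp]: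
  "carrier (ZM W) = Z W" "x \<oplus>\<^bsub>ZM W\<^esub> y = x + y" "\<zero>\<^bsub>ZM W\<^esub> = 0" "c \<odot>\<^bsub>ZM W\<^esub> x = pscale c x"
  by (simp_all add: ZM_def)

lemma qmodule_ZM: "qmodule (ZM W)"
proof -
  have "submodule (Z W) rat_ring (free_module (flags W))"
    unfolding submodule_free_iff using subspace_Z by (auto simp: Z_def)
  from submodule.submodule_is_module[OF this] show ?thesis
    using qmodule_free unfolding qmodule_def ZM_def by blast
qed

lemma qquotient_ZM: "qquotient (ZM W) {0}"
proof (rule qquotientI[OF qmodule_ZM])
  interpret qmodule "ZM W" by (rule qmodule_ZM)
  show "submodule {0} rat_ring (ZM W)"
    by (rule subI) (auto simp: pm.subspace_0[OF subspace_Z])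
qed

text \<open>With no boundaries the homology is a quotient by zero: its elements are singletons of
  cycles, and \<open>the_elem\<close> leads back to the cycles.\<close>

lemma St_eq:
  assumes "subspace W" "dim W \<ge> 1"
  shows "St W = quot_module (ZM W) {0}"
  unfolding St_def reduced_homology_def order_boundaries_top[OF assms] order_chains_eq ZM_def
  by (rule arg_cong2[of _ _ _ _ quot_module]) (auto simp: Z_def)

context
  fixes W assumes W: "subspace W" "dim W \<ge> 1"
begin

interpretation q: qquotient "ZM W" "{0}" by (rule qquotient_ZM)

lemma qmodule_St: "qmodule (St W)"
  unfolding St_eq[OF W] by (rule q.qmodule_quot)

lemma coset_ZM: "{0} +>\<^bsub>ZM W\<^esub> z = {z}"
  by (simp add: a_r_coset_def')

lemma St_linear: "(\<lambda>z. {z}) \<in> linear_maps (ZM W) (St W)"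
  using q.quot_linear unfolding coset_ZM St_eq[OF W] .

lemma carrier_St: "carrier (St W) = (\<lambda>z. {z}) ` Z W"
  unfolding St_eq[OF W] q.quot_simps(1) coset_ZM by simp

lemma the_elem_linear: "the_elem \<in> linear_maps (St W) (ZM W)"
proof -
  note L = linear_mapsD[OF St_linear]
  have "the_elem (X \<oplus>\<^bsub>St W\<^esub> Y) = the_elem X \<oplus>\<^bsub>ZM W\<^esub> the_elem Y"
    if XY: "X \<in> carrier (St W)" "Y \<in> carrier (St W)" for X Y
  proof -
    obtain x y where "x \<in> Z W" "y \<in> Z W" "X = {x}" "Y = {y}" using XY by (auto simp: carrier_St)
    thus ?thesis using L(2)[of x y, symmetric] by simp
  qed
  moreover have "the_elem (c \<odot>\<^bsub>St W\<^esub> X) = c \<odot>\<^bsub>ZM W\<^esub> the_elem X" if X: "X \<in> carrier (St W)" for c X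
  proof -
    obtain x where "x \<in> Z W" "X = {x}" using X by (auto simp: carrier_St)
    thus ?thesis using L(3)[of x c, symmetric] by simp
  qed
  ultimately show ?thesis by (intro linear_mapsI) (auto simp: carrier_St)
qed

lemma apartment_eq: "apartment W v = {apz v}"
proof -
  have "\<zero>\<^bsub>St W\<^esub> = {0}" unfolding St_eq[OF W] by simp
  thus ?thesis
    unfolding apartment_def order_boundaries_top[OF W] order_chains_eq
    by (simp add: apz_def indep_def apartment_cycle_eq a_r_coset_def')
qed

lemma apartment_closed: "v \<in> tuples W \<Longrightarrow> apartment W v \<in> carrier (St W)"
  unfolding apartment_eq carrier_St tuples_def using apz_in_Z[OF W(1)] by auto

lemma St_generated: "generates (St W) (apartment W ` tuples W)"
  unfolding generates_def
proof (intro conjI allI impI subsetI)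
  interpret S: qmodule "St W" by (rule qmodule_St)
  show "x \<in> carrier (St W)" if "x \<in> apartment W ` tuples W" for x
    using that apartment_closed by auto
  fix K x assume K: "submodule K rat_ring (St W)" and sub: "apartment W ` tuples W \<subseteq> K"
    and x: "x \<in> carrier (St W)"
  note L = linear_mapsD[OF St_linear] and K' = S.subD[OF K]
  obtain z where z: "z \<in> Z W" "x = {z}" using x by (auto simp: carrier_St)
  have "pm.subspace {z \<in> Z W. {z} \<in> K}"
    unfolding pm.subspace_def
    using K'(2-4) L(2,3) linear_maps_zero[OF qmodule_ZM qmodule_St St_linear] subspace_Z
    by (auto simp: pm.subspace_def)
  moreover have "{ap v | v. basis_tuple W v} \<subseteq> {z \<in> Z W. {z} \<in> K}"
  proof
    fix p assume "p \<in> {ap v | v. basis_tuple W v}"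
    then obtain v where v: "basis_tuple W v" "p = ap v" by blast
    hence "v \<in> tuples W" using length_basis_tuple[OF v(1)] span_superset by (auto simp: tuples_def basis_tuple_def)
    moreover have "apartment W v = {p}" using v by (simp add: apartment_eq apz_def basis_tuple_iff)
    ultimately show "p \<in> {z \<in> Z W. {z} \<in> K}" using sub ap_in_Z[OF v(1)] v(2) by auto
  qed
  ultimately have "pm.span {ap v | v. basis_tuple W v} \<subseteq> {z \<in> Z W. {z} \<in> K}" by (rule pm.span_minimal[rotated])
  thus "x \<in> K" using Z_generated[OF W z(1)] z(2) by auto
qed

lemma qtensor_St: "qtensor (St W) (St W)"
  using qmodule_St by (simp add: qtensor_def)

lemma qmodule_St2: "qmodule (St2 W)"
  unfolding St2_def using qtensor.qmodule_tensor[OF qtensor_St] .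

lemma apartment2_closed: "v \<in> tuples W \<Longrightarrow> w \<in> tuples W \<Longrightarrow> apartment2 W v w \<in> carrier (St2 W)"
  unfolding apartment2_def St2_def using qtensor.pure_closed[OF qtensor_St] apartment_closed by blast

lemma St2_generated: "generates (St2 W) {apartment2 W v w | v w. v \<in> tuples W \<and> w \<in> tuples W}"
proof -
  have "{pure_tensor (St W) (St W) a b |a b. a \<in> apartment W ` tuples W \<and> b \<in> apartment W ` tuples W} =
    {apartment2 W v w | v w. v \<in> tuples W \<and> w \<in> tuples W}"
    by (auto simp: apartment2_def)
  thus ?thesis
    unfolding St2_def using qtensor.tensor_generates[OF qtensor_St St_generated St_generated] by simp
qed

end

subsection \<open>The concatenation product\<close>

lemma indep_append:
  assumes V: "subspace V1" "subspace V2" "V1 \<inter> V2 = {0}" and "set a \<subseteq> V1" "set b \<subseteq> V2" "indep a" "indep b"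
  shows "indep (a @ b)"
  using assms(4-7)
proof (induction a)
  case (Cons x a)
  have "x \<notin> span (set a \<union> set b)"
    using Int_span_complement[OF V, of "set a" "set b"] Cons.prems by (auto simp: indep_Cons)
  thus ?case using Cons by (simp add: indep_Cons)
qed simp

definition adapted :: "'b set \<Rightarrow> 'b set \<Rightarrow> 'b list \<Rightarrow> bool" where
  "adapted V1 V2 v \<longleftrightarrow> basis_tuple UNIV v \<and> set v \<subseteq> V1 \<union> V2"

text \<open>
  The product of two cycles is supported on the flags of adapted bases. It is defined coefficientwise,
  with the sign of the shuffle that sorts an adapted basis into its two parts.
\<close>

definition joinf :: "'b set \<Rightarrow> 'b set \<Rightarrow> ('b set list \<Rightarrow>\<^sub>0 rat) \<Rightarrow> ('b set list \<Rightarrow>\<^sub>0 rat) \<Rightarrow> 'b set list \<Rightarrow> rat" where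
  "joinf V1 V2 z1 z2 F =
     (if \<exists>v. adapted V1 V2 v \<and> flag v = F
      then (let v = SOME v. adapted V1 V2 v \<and> flag v = F in
        (- 1) ^ invs (\<lambda>x. x \<in> V1) (rev v) * Poly_Mapping.lookup z1 (flag (filter (\<lambda>x. x \<in> V1) v)) *
        Poly_Mapping.lookup z2 (flag (filter (\<lambda>x. x \<notin> V1) v)))
      else 0)"

definition join :: "'b set \<Rightarrow> 'b set \<Rightarrow> ('b set list \<Rightarrow>\<^sub>0 rat) \<Rightarrow> ('b set list \<Rightarrow>\<^sub>0 rat) \<Rightarrow> ('b set list \<Rightarrow>\<^sub>0 rat)" where
  "join V1 V2 z1 z2 = Abs_poly_mapping (joinf V1 V2 z1 z2)"

lemma joinf_linear:
  "joinf V1 V2 (z + z') w F = joinf V1 V2 z w F + joinf V1 V2 z' w F"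
  "joinf V1 V2 (pscale c z) w F = c * joinf V1 V2 z w F"
  "joinf V1 V2 0 w F = 0"
  "joinf V1 V2 z (w + w') F = joinf V1 V2 z w F + joinf V1 V2 z w' F"
  "joinf V1 V2 z (pscale c w) F = c * joinf V1 V2 z w F"
  "joinf V1 V2 z 0 F = 0"
  by (auto simp: joinf_def Let_def lookup_add algebra_simps)

context
  fixes V1 V2 assumes dec: "(V1, V2) \<in> decompositions"
begin

lemma decD: "subspace V1" "subspace V2" "V1 \<inter> V2 = {0}" "span (V1 \<union> V2) = UNIV"
    "dim V1 \<ge> 1" "dim V2 \<ge> 1"
proof -
  have d: "subspace V1" "subspace V2" "V1 \<noteq> {0}" "V2 \<noteq> {0}" "V1 \<inter> V2 = {0}" "span (V1 \<union> V2) = UNIV"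
    using dec by (auto simp: decompositions_def)
  thus "subspace V1" "subspace V2" "V1 \<inter> V2 = {0}" "span (V1 \<union> V2) = UNIV" by auto
  have "\<not> V1 \<subseteq> {0}" "\<not> V2 \<subseteq> {0}" using d subspace_0 by auto
  hence "dim V1 \<noteq> 0" "dim V2 \<noteq> 0" by auto
  thus "dim V1 \<ge> 1" "dim V2 \<ge> 1" by linarith+
qed

lemma basis_append:
  assumes "basis_tuple V1 a" "basis_tuple V2 b"
  shows "basis_tuple UNIV (a @ b)"
proof -
  have s: "spn a = V1" "spn b = V2" "set a \<subseteq> V1" "set b \<subseteq> V2"
    using assms span_superset by (auto simp: basis_tuple_iff)
  have "indep (a @ b)"
    using assms by (intro indep_append[OF decD(1-3) s(3,4)]) (auto simp: basis_tuple_iff)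
  moreover have "V1 \<union> V2 \<subseteq> spn (a @ b)"
    using s span_mono[of "set a" "set (a @ b)"] span_mono[of "set b" "set (a @ b)"] by auto
  hence "span (V1 \<union> V2) \<subseteq> spn (a @ b)" by (rule span_minimal) simp
  ultimately show ?thesis using decD(4) by (auto simp: basis_tuple_iff)
qed

lemma dim_decomposition: "dim V1 + dim V2 = dim UNIV"
proof -
  obtain a b where "basis_tuple V1 a" "basis_tuple V2 b" using exists_basis_tuple decD by meson
  thus ?thesis using length_basis_tuple basis_append by (metis length_append)
qed

text \<open>Each part is independent in its summand, so its length is at most the dimension of the
  summand; the total count forces equality.\<close>

lemma adapted_parts:
  assumes "adapted V1 V2 v"
  shows "basis_tuple V1 (filter (\<lambda>x. x \<in> V1) v)" "basis_tuple V2 (filter (\<lambda>x. x \<notin> V1) v)"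
proof -
  let ?p = "filter (\<lambda>x. x \<in> V1) v" and ?q = "filter (\<lambda>x. x \<notin> V1) v"
  have v: "indep v" "length v = dim UNIV" "set v \<subseteq> V1 \<union> V2"
    using assms length_basis_tuple[of UNIV v] by (auto simp: adapted_def basis_tuple_iff)
  have ind: "indep ?p" "indep ?q"
    using v(1) independent_mono[of "set v" "set ?p"] independent_mono[of "set v" "set ?q"]
    by (auto simp: indep_def)
  have sub: "set ?p \<subseteq> V1" "set ?q \<subseteq> V2" using v(3) by auto
  have "dim (spn ?p) \<le> dim V1" "dim (spn ?q) \<le> dim V2"
    using sub decD by (auto intro!: dim_subset)
  hence "length ?p \<le> dim V1" "length ?q \<le> dim V2" using ind indep_iff_dim by auto
  moreover have "length ?p + length ?q = dim V1 + dim V2"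
    using v(2) dim_decomposition sum_length_filter_compl[of "\<lambda>x. x \<in> V1" v] by simp
  ultimately have "length ?p = dim V1" "length ?q = dim V2" by auto
  thus "basis_tuple V1 ?p" "basis_tuple V2 ?q" using ind sub decD by (auto intro!: basis_of_indep)
qed

lemma lookup_ap_append:
  assumes a: "basis_tuple V1 a" and b: "basis_tuple V2 b" and v: "adapted V1 V2 v"
  shows "coeff (a @ b) v = (- 1) ^ invs (\<lambda>x. x \<in> V1) (rev v) *
    Poly_Mapping.lookup (ap a) (flag (filter (\<lambda>x. x \<in> V1) v)) *
    Poly_Mapping.lookup (ap b) (flag (filter (\<lambda>x. x \<notin> V1) v))"
proof -
  note p = adapted_parts[OF v]
  have sub: "set a \<subseteq> V1" "set b \<subseteq> V2" using a b span_superset by (auto simp: basis_tuple_iff)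
  have "coeff (a @ b) v = (- 1) ^ invs (\<lambda>x. x \<in> V1) (rev v) * coeff a (filter (\<lambda>x. x \<in> V1) v) *
    coeff b (filter (\<lambda>x. x \<notin> V1) v)"
    using v by (intro coeff_append[OF decD(1-3) sub]) (auto simp: adapted_def basis_tuple_iff)
  also have "coeff a (filter (\<lambda>x. x \<in> V1) v) = Poly_Mapping.lookup (ap a) (flag (filter (\<lambda>x. x \<in> V1) v))"
    using length_basis_tuple[OF a] length_basis_tuple[OF p(1)] a p(1)
    by (intro lookup_ap[symmetric]) (auto simp: basis_tuple_iff)
  also have "coeff b (filter (\<lambda>x. x \<notin> V1) v) = Poly_Mapping.lookup (ap b) (flag (filter (\<lambda>x. x \<notin> V1) v))"
    using length_basis_tuple[OF b] length_basis_tuple[OF p(2)] b p(2)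
    by (intro lookup_ap[symmetric]) (auto simp: basis_tuple_iff)
  finally show ?thesis .
qed

text \<open>The formula for the coefficients of a concatenation holds for every adapted
  \<open>v\<close>, hence for the one picked by \<open>SOME\<close>. A flag without adapted basis
  does not occur in \<open>ap (a @ b)\<close>, since every ordering of \<open>a @ b\<close> is
  adapted.\<close>

lemma joinf_ap:
  assumes a: "basis_tuple V1 a" and b: "basis_tuple V2 b"
  shows "joinf V1 V2 (ap a) (ap b) F = Poly_Mapping.lookup (ap (a @ b)) F"
proof (cases "\<exists>v. adapted V1 V2 v \<and> flag v = F")
  case True
  define v where "v = (SOME v. adapted V1 V2 v \<and> flag v = F)"
  have v: "adapted V1 V2 v" "flag v = F" using someI_ex[OF True] by (auto simp: v_def)
  have "Poly_Mapping.lookup (ap (a @ b)) F = coeff (a @ b) v"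
    unfolding v(2)[symmetric]
    using v(1) basis_append[OF a b] length_basis_tuple[of UNIV]
    by (intro lookup_ap) (metis adapted_def, simp add: adapted_def basis_tuple_iff)
  thus ?thesis using True lookup_ap_append[OF a b v(1)] by (simp add: joinf_def Let_def v_def[symmetric])
next
  case False
  have "F \<notin> Poly_Mapping.keys (ap (a @ b))"
  proof
    assume "F \<in> Poly_Mapping.keys (ap (a @ b))"
    then obtain l where l: "l \<in> Poly_Mapping.keys (alt (a @ b))" "F = flag l"
      using keys_push[of flag "alt (a @ b)"] by (auto simp: ap_def)
    have "set l = set (a @ b)" "distinct l = distinct (a @ b)"
      using alt_keys_set[OF l(1)] alt_keys_distinct[OF l(1)] by auto
    moreover have "set (a @ b) \<subseteq> V1 \<union> V2" using a b span_superset by (auto simp: basis_tuple_iff)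
    ultimately have "adapted V1 V2 l"
      using basis_append[OF a b] by (simp add: adapted_def basis_tuple_def)
    thus False using False l(2) by blast
  qed
  moreover have "joinf V1 V2 (ap a) (ap b) F = 0"
    unfolding joinf_def using False by (rule if_not_P)
  ultimately show ?thesis by (simp add: in_keys_iff)
qed

text \<open>That \<open>joinf\<close> has finite support and gives a cycle is known for apartments
  by \<open>joinf_ap\<close>. It extends because apartments span the cycles and \<open>joinf\<close>
  is linear in both cycles.\<close>

lemma join_exists:
  assumes "z1 \<in> Z V1" "z2 \<in> Z V2"
  shows "\<exists>p\<in>Z UNIV. joinf V1 V2 z1 z2 = Poly_Mapping.lookup p"
proof -
  let ?S = "{(z1, z2). \<exists>p\<in>Z UNIV. joinf V1 V2 z1 z2 = Poly_Mapping.lookup p}"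
  have s1: "pm.subspace {z1. (z1, z2) \<in> ?S}" for z2
  proof (rule pm.subspaceI)
    show "0 \<in> {z1. (z1, z2) \<in> ?S}"
      using pm.subspace_0[OF subspace_Z[of UNIV]] by (auto simp: joinf_linear fun_eq_iff intro!: bexI[of _ 0])
  next
    fix x y assume "x \<in> {z1. (z1, z2) \<in> ?S}" "y \<in> {z1. (z1, z2) \<in> ?S}"
    then obtain p q where "p \<in> Z UNIV" "q \<in> Z UNIV" "joinf V1 V2 x z2 = Poly_Mapping.lookup p"
      "joinf V1 V2 y z2 = Poly_Mapping.lookup q" by auto
    thus "x + y \<in> {z1. (z1, z2) \<in> ?S}"
      using pm.subspace_add[OF subspace_Z] by (auto simp: joinf_linear fun_eq_iff lookup_add intro!: bexI[of _ "p + q"])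
  next
    fix c x assume "x \<in> {z1. (z1, z2) \<in> ?S}"
    then obtain p where "p \<in> Z UNIV" "joinf V1 V2 x z2 = Poly_Mapping.lookup p" by auto
    thus "pscale c x \<in> {z1. (z1, z2) \<in> ?S}"
      using pm.subspace_scale[OF subspace_Z] by (auto simp: joinf_linear fun_eq_iff intro!: bexI[of _ "pscale c p"])
  qed
  have s2: "pm.subspace {z2. (z1, z2) \<in> ?S}" for z1
  proof (rule pm.subspaceI)
    show "0 \<in> {z2. (z1, z2) \<in> ?S}"
      using pm.subspace_0[OF subspace_Z[of UNIV]] by (auto simp: joinf_linear fun_eq_iff intro!: bexI[of _ 0])
  next
    fix x y assume "x \<in> {z2. (z1, z2) \<in> ?S}" "y \<in> {z2. (z1, z2) \<in> ?S}"
    then obtain p q where "p \<in> Z UNIV" "q \<in> Z UNIV" "joinf V1 V2 z1 x = Poly_Mapping.lookup p"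
      "joinf V1 V2 z1 y = Poly_Mapping.lookup q" by auto
    thus "x + y \<in> {z2. (z1, z2) \<in> ?S}"
      using pm.subspace_add[OF subspace_Z] by (auto simp: joinf_linear fun_eq_iff lookup_add intro!: bexI[of _ "p + q"])
  next
    fix c x assume "x \<in> {z2. (z1, z2) \<in> ?S}"
    then obtain p where "p \<in> Z UNIV" "joinf V1 V2 z1 x = Poly_Mapping.lookup p" by auto
    thus "pscale c x \<in> {z2. (z1, z2) \<in> ?S}"
      using pm.subspace_scale[OF subspace_Z] by (auto simp: joinf_linear fun_eq_iff intro!: bexI[of _ "pscale c p"])
  qed
  have "(ap a, ap b) \<in> ?S" if "basis_tuple V1 a" "basis_tuple V2 b" for a b
    using joinf_ap[OF that] ap_in_Z[OF basis_append[OF that]] by (auto simp: fun_eq_iff)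
  hence "pm.span {ap b | b. basis_tuple V2 b} \<subseteq> {z2. (ap a, z2) \<in> ?S}" if "basis_tuple V1 a" for a
    using that by (intro pm.span_minimal s2) auto
  hence "(ap a, z2) \<in> ?S" if "basis_tuple V1 a" for a
    using Z_generated[OF decD(2,6) assms(2)] that by blast
  hence "pm.span {ap a | a. basis_tuple V1 a} \<subseteq> {z1. (z1, z2) \<in> ?S}"
    by (intro pm.span_minimal s1) auto
  thus ?thesis using Z_generated[OF decD(1,5) assms(1)] by blast
qed

lemma
  assumes "z1 \<in> Z V1" "z2 \<in> Z V2"
  shows join_in_Z: "join V1 V2 z1 z2 \<in> Z UNIV"
    and lookup_join: "Poly_Mapping.lookup (join V1 V2 z1 z2) = joinf V1 V2 z1 z2"
proof -
  obtain p where "p \<in> Z UNIV" "joinf V1 V2 z1 z2 = Poly_Mapping.lookup p" using join_exists[OF assms] by blast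
  moreover from this have "join V1 V2 z1 z2 = p" by (simp add: join_def Poly_Mapping.lookup_inverse)
  ultimately show "join V1 V2 z1 z2 \<in> Z UNIV" "Poly_Mapping.lookup (join V1 V2 z1 z2) = joinf V1 V2 z1 z2" by auto
qed

lemma join_linear_left: "w \<in> Z V2 \<Longrightarrow> (\<lambda>z. join V1 V2 z w) \<in> linear_maps (ZM V1) (ZM UNIV)"
  by (rule linear_mapsI)
    (auto simp: join_in_Z lookup_join pm.subspace_add[OF subspace_Z] pm.subspace_scale[OF subspace_Z]
      joinf_linear lookup_add intro!: poly_mapping_eqI)

lemma join_linear_right: "z \<in> Z V1 \<Longrightarrow> join V1 V2 z \<in> linear_maps (ZM V2) (ZM UNIV)"
  by (rule linear_mapsI)
    (auto simp: join_in_Z lookup_join pm.subspace_add[OF subspace_Z] pm.subspace_scale[OF subspace_Z]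
      joinf_linear lookup_add intro!: poly_mapping_eqI)

lemma join_apz:
  assumes "a \<in> tuples V1" "b \<in> tuples V2"
  shows "join V1 V2 (apz a) (apz b) = apz (a @ b)"
proof -
  have ab: "set a \<subseteq> V1" "length a = dim V1" "set b \<subseteq> V2" "length b = dim V2"
    using assms by (auto simp: tuples_def)
  have "joinf V1 V2 (apz a) (apz b) F = Poly_Mapping.lookup (apz (a @ b)) F" for F
  proof (cases "indep a \<and> indep b")
    case True
    hence "basis_tuple V1 a" "basis_tuple V2 b" using ab decD by (auto intro: basis_of_indep)
    thus ?thesis using joinf_ap basis_append True by (simp add: apz_def basis_tuple_iff)
  next
    case False
    hence "\<not> indep (a @ b)" using indep_appendD by blast
    thus ?thesis using False by (auto simp: apz_def joinf_linear)
  qed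
  thus ?thesis
    using lookup_join[of "apz a" "apz b"] apz_in_Z[OF decD(1) ab(1,2)] apz_in_Z[OF decD(2) ab(3,4)]
    by (auto intro!: poly_mapping_eqI)
qed

lemma dim_UNIV_ge1: "dim UNIV \<ge> 1"
  using decD(5) dim_subset[of V1 UNIV] by simp

definition "concat_spec \<Phi> \<longleftrightarrow>
  \<Phi> \<in> linear_maps (tensor (St2 V1) (St2 V2)) (St2 UNIV) \<and>
  (\<forall>a\<in>tuples V1. \<forall>a'\<in>tuples V1. \<forall>b\<in>tuples V2. \<forall>b'\<in>tuples V2.
     \<Phi> (pure_tensor (St2 V1) (St2 V2) (apartment2 V1 a a') (apartment2 V2 b b'))
     = apartment2 UNIV (a @ b) (a' @ b'))"

text \<open>The product is \<open>join\<close> in each of the two Steinberg factors. As a map out of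
  a tensor product of tensor products it comes from a quadrilinear map.\<close>

lemma concat_exists: "\<exists>\<Phi>. concat_spec \<Phi>"
proof -
  note U = subspace_UNIV dim_UNIV_ge1 and D1 = decD(1,5) and D2 = decD(2,6)
  define J where "J x y = {join V1 V2 (the_elem x) (the_elem y)}" for x y
  interpret U: qtensor "St UNIV" "St UNIV" by (rule qtensor_St[OF U])
  have te1: "the_elem x \<in> Z V1" if "x \<in> carrier (St V1)" for x
    using linear_mapsD(1)[OF the_elem_linear[OF D1] that] by simp
  have te2: "the_elem x \<in> Z V2" if "x \<in> carrier (St V2)" for x
    using linear_mapsD(1)[OF the_elem_linear[OF D2] that] by simp
  have JL: "(\<lambda>x. J x y) \<in> linear_maps (St V1) (St UNIV)" if "y \<in> carrier (St V2)" for y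
    unfolding J_def
    by (rule linear_maps_comp[OF linear_maps_comp[OF the_elem_linear[OF D1] join_linear_left[OF te2[OF that]]] St_linear[OF U]])
  have JR: "(\<lambda>y. J x y) \<in> linear_maps (St V2) (St UNIV)" if "x \<in> carrier (St V1)" for x
    unfolding J_def
    by (rule linear_maps_comp[OF linear_maps_comp[OF the_elem_linear[OF D2] join_linear_right[OF te1[OF that]]] St_linear[OF U]])
  have Jc: "J x y \<in> carrier (St UNIV)" if "x \<in> carrier (St V1)" "y \<in> carrier (St V2)" for x y
    using linear_mapsD(1)[OF JR] that by blast
  define f where "f x1 y1 x2 y2 = pure_tensor (St UNIV) (St UNIV) (J x1 x2) (J y1 y2)" for x1 y1 x2 y2
  have "\<exists>\<Phi>\<in>linear_maps (tensor (tensor (St V1) (St V1)) (tensor (St V2) (St V2))) (tensor (St UNIV) (St UNIV)).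
    \<forall>x1\<in>carrier (St V1). \<forall>y1\<in>carrier (St V1). \<forall>x2\<in>carrier (St V2). \<forall>y2\<in>carrier (St V2).
      \<Phi> (pure_tensor (tensor (St V1) (St V1)) (tensor (St V2) (St V2))
         (pure_tensor (St V1) (St V1) x1 y1) (pure_tensor (St V2) (St V2) x2 y2)) = f x1 y1 x2 y2"
    unfolding f_def
    by (rule tensor_lift_quadrilinear)
      (use D1 D2 U Jc in \<open>auto intro!: qmodule_St U.qmodule_tensor linear_maps_comp[OF JL U.pure_linear_left]
        linear_maps_comp[OF JR U.pure_linear_left] linear_maps_comp[OF JL U.pure_linear_right]
        linear_maps_comp[OF JR U.pure_linear_right]\<close>)
  then obtain \<Phi> where \<Phi>: "\<Phi> \<in> linear_maps (tensor (St2 V1) (St2 V2)) (St2 UNIV)"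
    "\<And>x1 y1 x2 y2. x1 \<in> carrier (St V1) \<Longrightarrow> y1 \<in> carrier (St V1) \<Longrightarrow> x2 \<in> carrier (St V2) \<Longrightarrow> y2 \<in> carrier (St V2) \<Longrightarrow>
      \<Phi> (pure_tensor (St2 V1) (St2 V2)
         (pure_tensor (St V1) (St V1) x1 y1) (pure_tensor (St V2) (St V2) x2 y2)) = f x1 y1 x2 y2"
    unfolding St2_def by blast
  have Jap: "J (apartment V1 a) (apartment V2 b) = apartment UNIV (a @ b)"
    if "a \<in> tuples V1" "b \<in> tuples V2" for a b
    using that by (simp add: J_def apartment_eq[OF D1] apartment_eq[OF D2] apartment_eq[OF U] join_apz)
  have "concat_spec \<Phi>"
    unfolding concat_spec_def
    using \<Phi> by (auto simp: apartment2_def f_def Jap apartment_closed[OF D1] apartment_closed[OF D2])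
  thus ?thesis by blast
qed

lemma tensor_St2_eqI:
  assumes P: "qmodule P" and f: "f \<in> linear_maps (tensor (St2 V1) (St2 V2)) P"
    and g: "g \<in> linear_maps (tensor (St2 V1) (St2 V2)) P"
    and eq: "\<And>a a' b b'. a \<in> tuples V1 \<Longrightarrow> a' \<in> tuples V1 \<Longrightarrow> b \<in> tuples V2 \<Longrightarrow> b' \<in> tuples V2 \<Longrightarrow>
      f (pure_tensor (St2 V1) (St2 V2) (apartment2 V1 a a') (apartment2 V2 b b')) =
      g (pure_tensor (St2 V1) (St2 V2) (apartment2 V1 a a') (apartment2 V2 b b'))"
    and x: "x \<in> carrier (tensor (St2 V1) (St2 V2))"
  shows "f x = g x"
  by (rule tensor_eqI[OF qmodule_St2[OF decD(1,5)] qmodule_St2[OF decD(2,6)] P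
        St2_generated[OF decD(1,5)] St2_generated[OF decD(2,6)] f g _ x]) (use eq in auto)

text \<open>The description is proper: restriction to the carrier makes an existing map extensional,
  and two such maps agree because pairs of apartments generate both tensor factors of the
  source.\<close>

lemma concat_product_spec: "concat_spec (concat_product V1 V2)"
proof -
  let ?T = "tensor (St2 V1) (St2 V2)"
  obtain \<Phi>0 where \<Phi>0: "concat_spec \<Phi>0" using concat_exists by blast
  interpret S1: qmodule "St2 V1" by (rule qmodule_St2[OF decD(1,5)])
  interpret S2: qmodule "St2 V2" by (rule qmodule_St2[OF decD(2,6)])
  interpret T: qtensor "St2 V1" "St2 V2" ..
  interpret T: qmodule ?T by (rule T.qmodule_tensor)
  have cl: "pure_tensor (St2 V1) (St2 V2) (apartment2 V1 a a') (apartment2 V2 b b') \<in> carrier ?T"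
    if "a \<in> tuples V1" "a' \<in> tuples V1" "b \<in> tuples V2" "b' \<in> tuples V2" for a a' b b'
    using that by (intro T.pure_closed apartment2_closed[OF decD(1,5)] apartment2_closed[OF decD(2,6)])
  define \<Phi> where "\<Phi> = restrict \<Phi>0 (carrier ?T)"
  have lin: "\<Phi> \<in> linear_maps ?T (St2 UNIV)"
    using \<Phi>0 unfolding concat_spec_def \<Phi>_def
    by (intro linear_mapsI) (auto simp: linear_mapsD[of \<Phi>0 ?T "St2 UNIV"])
  have \<Phi>: "concat_spec \<Phi>" using lin \<Phi>0 cl by (auto simp: concat_spec_def \<Phi>_def)
  have "concat_product V1 V2 = (THE \<Phi>. concat_spec \<Phi> \<and> \<Phi> \<in> extensional (carrier ?T))"
    unfolding concat_product_def concat_spec_def decD(4) by (rule arg_cong[of _ _ The]) (auto simp: fun_eq_iff)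
  also have "\<dots> = \<Phi>"
  proof (rule the_equality)
    show "concat_spec \<Phi> \<and> \<Phi> \<in> extensional (carrier ?T)" using \<Phi> by (simp add: \<Phi>_def)
    fix \<Psi> assume \<Psi>: "concat_spec \<Psi> \<and> \<Psi> \<in> extensional (carrier ?T)"
    show "\<Psi> = \<Phi>"
    proof (rule extensionalityI)
      show "\<Psi> \<in> extensional (carrier ?T)" "\<Phi> \<in> extensional (carrier ?T)" using \<Psi> by (simp_all add: \<Phi>_def)
      fix x assume "x \<in> carrier ?T"
      thus "\<Psi> x = \<Phi> x"
        by (rule tensor_St2_eqI[OF qmodule_St2[OF subspace_UNIV dim_UNIV_ge1], rotated -1])
          (use \<Psi> \<Phi> in \<open>auto simp: concat_spec_def\<close>)
    qed
  qed
  finally show ?thesis using \<Phi> by simp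
qed

end

end

context fd_steinberg
begin

section \<open>Frames of pairs of opposite flags, and their shuffles\<close>

section \<open>The decomposition of pairs of flags into frames\<close>

lemma indep_Int_spn: "indep (xs @ ys) \<Longrightarrow> spn xs \<inter> spn ys = {0}"
proof (induction xs)
  case Nil
  thus ?case by (auto simp: span_zero)
next
  case (Cons x xs)
  have x: "x \<notin> spn (xs @ ys)" and IH: "spn xs \<inter> spn ys = {0}"
    using Cons by (auto simp: indep_Cons)
  have "z = 0" if z: "z \<in> spn (x # xs)" "z \<in> spn ys" for z
  proof -
    obtain k where k: "z - k *s x \<in> spn xs" using z(1) by (auto simp: span_insert)
    have "k = 0"
    proof (rule ccontr)
      assume "k \<noteq> 0"
      have "z \<in> spn (xs @ ys)" "z - k *s x \<in> spn (xs @ ys)"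
        using z(2) k spn_mono[of ys "xs @ ys"] spn_mono[of xs "xs @ ys"] by auto
      hence "z - (z - k *s x) \<in> spn (xs @ ys)" by (rule span_diff)
      hence "k *s x \<in> spn (xs @ ys)" by simp
      from span_scale[OF this, of "inverse k"] show False using x \<open>k \<noteq> 0\<close> by simp
    qed
    thus ?thesis using k z IH by auto
  qed
  thus ?case by (auto simp: span_zero)
qed

text \<open>The \<open>i\<close>-th line of a frame, counted from 0, is the intersection of step
  \<open>i + 1\<close> of its flag with step \<open>length v - i\<close> of the flag of its
  reversal.\<close>

lemma frame_line:
  assumes v: "indep v" and i: "i < length v"
    and y: "y \<in> spn (take (Suc i) v)" "y \<in> spn (drop i v)"
  shows "y \<in> span {v ! i}"
proof -
  have "take (Suc i) v = take i v @ [v ! i]" using i by (rule take_Suc_conv_app_nth)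
  hence "y \<in> span (insert (v ! i) (set (take i v)))" using y(1) by simp
  then obtain k where k: "y - k *s (v ! i) \<in> spn (take i v)" by (auto simp: span_insert)
  have "v ! i \<in> set (drop i v)" using i by (metis Cons_nth_drop_Suc list.set_intros(1))
  hence "y - k *s (v ! i) \<in> spn (drop i v)" by (rule span_diff[OF y(2) span_scale[OF span_base]])
  moreover have "spn (take i v) \<inter> spn (drop i v) = {0}" using v by (intro indep_Int_spn) simp
  ultimately have "y - k *s (v ! i) = 0" using k by blast
  hence "y = k *s (v ! i)" by simp
  thus ?thesis using span_scale[OF span_base[of "v ! i" "{v ! i}"]] by simp
qed

lemma spn_take_rev: "i \<le> length v \<Longrightarrow> spn (take (length v - i) (rev v)) = spn (drop i v)"
  by (simp add: take_rev)

definition normal_frame :: "('b \<Rightarrow> 'a) \<Rightarrow> 'b list \<Rightarrow> bool" where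
  "normal_frame h v \<longleftrightarrow> basis_tuple UNIV v \<and> (\<forall>x\<in>set v. h x = 1)"

text \<open>The sign of the permutation that reverses \<open>n\<close> entries.\<close>

definition rev_sign :: "nat \<Rightarrow> rat" where
  "rev_sign n = (- 1) ^ (\<Sum>i<n. i)"

lemma rev_sign_Suc: "rev_sign (Suc n) = (- 1) ^ n * rev_sign n"
  by (simp add: rev_sign_def power_add)

lemma affine_basis_0: "affine_basis (0 # v) \<longleftrightarrow> basis_tuple UNIV v"
  by (simp add: affine_basis_def)

definition shuffle_relations :: "('b list \<Rightarrow>\<^sub>0 rat) set" where
  "shuffle_relations = {\<Sum>w\<in>shuffles xs ys. psingle (x # w)
     | x xs ys. affine_basis (x # xs @ ys) \<and> xs \<noteq> [] \<and> ys \<noteq> []}"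

context
  fixes h assumes h: "h \<in> Dec"
begin

lemma h_linear: "h (x + y) = h x + h y" "h (c *s x) = c * h x" "h (x - y) = h x - h y" "h 0 = 0" "h (- x) = - h x"
proof -
  interpret l: Vector_Spaces.linear scale "(*)" h using h by (simp add: Dec_def)
  show "h (x + y) = h x + h y" "h (c *s x) = c * h x" "h (x - y) = h x - h y" "h 0 = 0" "h (- x) = - h x"
    by (simp_all add: l.add l.scale l.diff l.zero l.neg)
qed

text \<open>The two flags fix the lines by \<open>frame_line\<close>, and the condition
  \<open>h x = 1\<close> fixes the vector on each line.\<close>

lemma normal_frame_unique:
  assumes v: "normal_frame h v" and w: "normal_frame h w" and f: "flag v = flag w" "flag (rev v) = flag (rev w)"
  shows "v = w"
proof -
  have b: "indep v" "indep w" "spn v = UNIV" "spn w = UNIV" "length v = dim UNIV" "length w = dim UNIV"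
    using v w length_basis_tuple[of UNIV v] length_basis_tuple[of UNIV w] by (auto simp: normal_frame_def basis_tuple_iff)
  hence F: "fl v = fl w" "fl (rev v) = fl (rev w)"
    using f by (auto simp: flag_eq_iff_fl)
  show ?thesis
  proof (rule nth_equalityI)
    show len: "length v = length w" using b by simp
    fix i assume i: "i < length v"
    have "w ! i \<in> set (take (Suc i) w)" using i len by (simp add: take_Suc_conv_app_nth)
    hence "w ! i \<in> spn (take (Suc i) v)"
      using fl_eqD(2)[OF F(1), of "Suc i"] i in_spn by auto
    moreover have "w ! i \<in> set (drop i w)" using i len by (metis Cons_nth_drop_Suc list.set_intros(1))
    hence "w ! i \<in> spn (drop i w)" by (rule in_spn)
    hence "w ! i \<in> spn (drop i v)"
      using fl_eqD(2)[OF F(2), of "length v - i"] spn_take_rev[of i v] spn_take_rev[of i w] i len by simp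
    ultimately have "w ! i \<in> span {v ! i}" by (rule frame_line[OF b(1) i])
    then obtain k where k: "w ! i = k *s (v ! i)" by (auto simp: span_singleton)
    moreover have "h (w ! i) = 1" "h (v ! i) = 1" using v w i len by (auto simp: normal_frame_def)
    ultimately have "k = 1" by (simp add: h_linear)
    thus "v ! i = w ! i" using k by simp
  qed
qed

text \<open>
  A pair of opposite flags determines the lines of its frame, and \<open>h\<close> picks a vector on each line.
  The map \<open>frame_sum\<close> is the section of \<open>pr_St\<close> attached to \<open>h\<close>; the sign is that of the reversal
  of \<open>dim UNIV\<close> entries.
\<close>

definition frames :: "('b set list \<Rightarrow>\<^sub>0 rat) \<Rightarrow> ('b set list \<Rightarrow>\<^sub>0 rat) \<Rightarrow> 'b list set" where
  "frames z z' = {v. normal_frame h v \<and> flag v \<in> Poly_Mapping.keys z \<and> flag (rev v) \<in> Poly_Mapping.keys z'}"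

lemma finite_frames: "finite (frames z z')"
proof (rule finite_imageD)
  show "inj_on (\<lambda>v. (flag v, flag (rev v))) (frames z z')"
    by (rule inj_onI) (auto simp: frames_def intro: normal_frame_unique)
  show "finite ((\<lambda>v. (flag v, flag (rev v))) ` frames z z')"
    by (rule finite_subset[of _ "Poly_Mapping.keys z \<times> Poly_Mapping.keys z'"]) (auto simp: frames_def)
qed

definition frame_sum :: "('b set list \<Rightarrow>\<^sub>0 rat) \<Rightarrow> ('b set list \<Rightarrow>\<^sub>0 rat) \<Rightarrow> ('b list \<Rightarrow>\<^sub>0 rat)" where
  "frame_sum z z' = (\<Sum>v\<in>frames z z'. Poly_Mapping.single (0 # v)
     (rev_sign (dim UNIV) * Poly_Mapping.lookup z (flag v) * Poly_Mapping.lookup z' (flag (rev v))))"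

lemma lookup_frame_sum: "Poly_Mapping.lookup (frame_sum z z') u =
  (if u \<noteq> [] \<and> hd u = 0 \<and> normal_frame h (tl u)
   then rev_sign (dim UNIV) * Poly_Mapping.lookup z (flag (tl u)) * Poly_Mapping.lookup z' (flag (rev (tl u))) else 0)"
proof -
  have "Poly_Mapping.lookup (frame_sum z z') u = (\<Sum>v\<in>frames z z'. if u = 0 # v then
     rev_sign (dim UNIV) * Poly_Mapping.lookup z (flag v) * Poly_Mapping.lookup z' (flag (rev v)) else 0)"
    unfolding frame_sum_def lookup_sum by (rule sum.cong) (auto simp: lookup_single when_def)
  also have "\<dots> = (if u \<noteq> [] \<and> hd u = 0 \<and> normal_frame h (tl u)
   then rev_sign (dim UNIV) * Poly_Mapping.lookup z (flag (tl u)) * Poly_Mapping.lookup z' (flag (rev (tl u))) else 0)"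
  proof (cases "u \<noteq> [] \<and> hd u = 0")
    case True
    then obtain v where u: "u = 0 # v" by (cases u) auto
    show ?thesis unfolding u using finite_frames[of z z']
      by (auto simp: frames_def in_keys_iff)
  next
    case False
    hence "u \<noteq> 0 # v" for v by auto
    thus ?thesis using False by auto
  qed
  finally show ?thesis .
qed

lemma frame_sum_linear:
  "frame_sum (z + y) z' = frame_sum z z' + frame_sum y z'" "frame_sum (pscale c z) z' = pscale c (frame_sum z z')"
  "frame_sum z (z' + y) = frame_sum z z' + frame_sum z y" "frame_sum z (pscale c z') = pscale c (frame_sum z z')"
  "frame_sum 0 z' = 0" "frame_sum z 0 = 0"
  by (auto intro!: poly_mapping_eqI simp: lookup_frame_sum lookup_add algebra_simps)

lemma keys_frame_sum: "Poly_Mapping.keys (frame_sum z z') \<subseteq> (#) 0 ` {v. normal_frame h v}"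
  by (auto simp: in_keys_iff lookup_frame_sum split: if_splits) (metis image_eqI list.collapse mem_Collect_eq)

lemma keys_frame_sum_affine: "Poly_Mapping.keys (frame_sum z z') \<subseteq> Collect affine_basis"
  using keys_frame_sum[of z z'] by (auto simp: affine_basis_0 normal_frame_def)

subsection \<open>Vanishing on products\<close>

lemma spn_component:
  assumes "subspace V1" "subspace V2" "V1 \<inter> V2 = {0}" and l: "set l \<subseteq> V1 \<union> V2"
    and x: "x1 + x2 \<in> spn l" "x1 \<in> V1" "x2 \<in> V2"
  shows "x1 \<in> spn l"
proof -
  have "set l = (set l \<inter> V1) \<union> (set l \<inter> V2)" using l by auto
  then obtain s t where st: "s \<in> span (set l \<inter> V1)" "t \<in> span (set l \<inter> V2)" "x1 + x2 = s + t"
    using x(1) span_Un[of "set l \<inter> V1" "set l \<inter> V2"] by auto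
  have "s \<in> V1" "t \<in> V2" using st span_minimal[of _ V1] span_minimal[of _ V2] assms(1,2) by blast+
  moreover have "x1 - s = t - x2" using st(3) by (simp add: algebra_simps)
  ultimately have "x1 - s \<in> V1 \<inter> V2"
    using x subspace_diff[OF assms(1), of x1 s] subspace_diff[OF assms(2), of t x2] by auto
  hence "x1 = s" using assms(3) by auto
  thus ?thesis using st(1) span_mono[of "set l \<inter> V1" "set l"] by auto
qed

text \<open>A line of the frame is the intersection of two subspaces spanned by vectors of
  \<open>V1 \<union> V2\<close>, hence contains the \<open>V1\<close>-component of each of its
  vectors. A line with this property lies in \<open>V1\<close> or in \<open>V2\<close>.\<close>

lemma frame_adapted:
  assumes V: "subspace V1" "subspace V2" "V1 \<inter> V2 = {0}" "span (V1 \<union> V2) = UNIV"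
    and v: "indep v" and l: "fl l = fl v" "fl l' = fl (rev v)" "set l \<subseteq> V1 \<union> V2" "set l' \<subseteq> V1 \<union> V2"
  shows "set v \<subseteq> V1 \<union> V2"
proof
  fix x assume "x \<in> set v"
  then obtain i where i: "i < length v" "x = v ! i" by (auto simp: in_set_conv_nth)
  have len: "length l = length v" "length l' = length v"
    using fl_eqD(1)[OF l(1)] fl_eqD(1)[OF l(2)] by auto
  have "x \<in> set (take (Suc i) v)"
    using i by (simp add: take_Suc_conv_app_nth)
  hence x1: "x \<in> spn (take (Suc i) l)"
    using fl_eqD(2)[OF l(1), of "Suc i"] i len in_spn by auto
  have "x \<in> set (drop i v)" using i by (metis Cons_nth_drop_Suc list.set_intros(1))
  hence "x \<in> spn (drop i v)" by (rule in_spn)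
  hence x2: "x \<in> spn (take (length v - i) l')"
    using fl_eqD(2)[OF l(2), of "length v - i"] spn_take_rev[of i v] i len by simp
  have "x \<in> span (V1 \<union> V2)" using V(4) by simp
  then obtain p q where pq: "p \<in> V1" "q \<in> V2" "x = p + q"
    using V(1,2) by (auto simp: span_Un span_eq_iff[THEN iffD2])
  have "set (take (Suc i) l) \<subseteq> V1 \<union> V2" "set (take (length v - i) l') \<subseteq> V1 \<union> V2"
    by (rule order_trans[OF set_take_subset l(3)], rule order_trans[OF set_take_subset l(4)])
  hence "p \<in> spn (take (Suc i) l)" "p \<in> spn (take (length v - i) l')"
    using spn_component[OF V(1-3) _ x1[unfolded pq(3)] pq(1,2)]
      spn_component[OF V(1-3) _ x2[unfolded pq(3)] pq(1,2)] by blast+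
  hence "p \<in> spn (take (Suc i) v)" "p \<in> spn (drop i v)"
    using fl_eqD(2)[OF l(1), of "Suc i"] fl_eqD(2)[OF l(2), of "length v - i"] spn_take_rev[of i v] i len by auto
  hence "p \<in> span {x}" unfolding i(2) by (rule frame_line[OF v i(1)])
  then obtain c where c: "p = c *s x" by (auto simp: span_singleton)
  show "x \<in> V1 \<union> V2"
  proof (cases "c = 0")
    case True
    thus ?thesis using c pq by simp
  next
    case False
    hence "x = inverse c *s p" using c by simp
    thus ?thesis using pq(1) subspace_scale[OF V(1)] by auto
  qed
qed

text \<open>The frames that occur are adapted to the decomposition. Those with given parts
  \<open>p\<close> in \<open>V1\<close> and \<open>q\<close> in \<open>V2\<close> are all the
  shuffles of \<open>p\<close> and \<open>q\<close>, and their coefficient depends only on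
  \<open>p\<close> and \<open>q\<close>; so each group is a multiple of a shuffle relation.\<close>

lemma frame_sum_product:
  assumes dec: "(V1, V2) \<in> decompositions"
    and a: "basis_tuple V1 a" "basis_tuple V1 a'" and b: "basis_tuple V2 b" "basis_tuple V2 b'"
  shows "frame_sum (ap (a @ b)) (ap (a' @ b')) \<in> pm.span shuffle_relations"
proof -
  note D = decD[OF dec]
  let ?P = "filter (\<lambda>x. x \<in> V1)" and ?N = "filter (\<lambda>x. x \<notin> V1)"
  let ?G = "frames (ap (a @ b)) (ap (a' @ b'))"
  \<comment> \<open>The sign of sorting \<open>v\<close> times that of sorting \<open>rev v\<close>
    is constant: each pair of entries from different summands is out of order in exactly one of the
    two lists. This gives the exponent \<open>dim V1 * dim V2\<close>.\<close>
  define k where "k = rev_sign (dim UNIV) * (- 1) ^ (dim V1 * dim V2)"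
  define c where "c p q = k * (Poly_Mapping.lookup (ap a) (flag p) * Poly_Mapping.lookup (ap b) (flag q) *
     (Poly_Mapping.lookup (ap a') (flag (rev p)) * Poly_Mapping.lookup (ap b') (flag (rev q))))" for p q
  have AA: "Poly_Mapping.lookup (ap (a @ b)) (flag v) = coeff (a @ b) v"
    "Poly_Mapping.lookup (ap (a' @ b')) (flag (rev v)) = coeff (a' @ b') (rev v)" if "basis_tuple UNIV v" for v
    using that basis_append[OF dec a(1) b(1)] basis_append[OF dec a(2) b(2)] length_basis_tuple[of UNIV v]
      length_basis_tuple[of UNIV "a @ b"] length_basis_tuple[of UNIV "a' @ b'"]
    by (auto intro!: lookup_ap simp: basis_tuple_iff)
  have perm: "set l \<subseteq> V1 \<union> V2" if "l \<in> Poly_Mapping.keys (alt (x @ y))" "basis_tuple V1 x" "basis_tuple V2 y" for l x y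
    using alt_keys_set[OF that(1)] that(2,3) span_superset by (auto simp: basis_tuple_iff)
  have ad: "adapted V1 V2 v" if v: "v \<in> ?G" for v
  proof -
    have bv: "basis_tuple UNIV v" "coeff (a @ b) v \<noteq> 0" "coeff (a' @ b') (rev v) \<noteq> 0"
      using v AA[of v] by (auto simp: frames_def normal_frame_def in_keys_iff)
    obtain l where l: "l \<in> Poly_Mapping.keys (alt (a @ b))" "fl l = fl v" using coeff_nonzeroE[OF bv(2)] .
    obtain l' where l': "l' \<in> Poly_Mapping.keys (alt (a' @ b'))" "fl l' = fl (rev v)" using coeff_nonzeroE[OF bv(3)] .
    show ?thesis
      unfolding adapted_def
      using frame_adapted[OF D(1-4) _ l(2) l'(2) perm[OF l(1) a(1) b(1)] perm[OF l'(1) a(2) b(2)]] bv(1)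
      by (auto simp: basis_tuple_iff)
  qed
  have rv: "adapted V1 V2 (rev v)" if "adapted V1 V2 v" for v
    using that by (simp add: adapted_def basis_tuple_def)
  have val: "rev_sign (dim UNIV) * Poly_Mapping.lookup (ap (a @ b)) (flag v) * Poly_Mapping.lookup (ap (a' @ b')) (flag (rev v))
      = c (?P v) (?N v)" if v: "adapted V1 V2 v" for v
  proof -
    have bv: "basis_tuple UNIV v" using v by (simp add: adapted_def)
    have lens: "length (?P v) = dim V1" "length (?N v) = dim V2"
      using adapted_parts[OF dec v] length_basis_tuple by auto
    have s: "(- 1 :: rat) ^ invs (\<lambda>x. x \<in> V1) (rev v) * (- 1) ^ invs (\<lambda>x. x \<in> V1) v = (- 1) ^ (dim V1 * dim V2)"
      using invs_rev[of "\<lambda>x. x \<in> V1" v] lens by (simp add: power_add[symmetric] add.commute)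
    have "rev_sign (dim UNIV) * Poly_Mapping.lookup (ap (a @ b)) (flag v) * Poly_Mapping.lookup (ap (a' @ b')) (flag (rev v)) =
      rev_sign (dim UNIV) * ((- 1) ^ invs (\<lambda>x. x \<in> V1) (rev v) * (- 1) ^ invs (\<lambda>x. x \<in> V1) v) *
        (Poly_Mapping.lookup (ap a) (flag (?P v)) * Poly_Mapping.lookup (ap b) (flag (?N v)) *
        (Poly_Mapping.lookup (ap a') (flag (rev (?P v))) * Poly_Mapping.lookup (ap b') (flag (rev (?N v)))))"
      unfolding AA[OF bv] lookup_ap_append[OF dec a(1) b(1) v] lookup_ap_append[OF dec a(2) b(2) rv[OF v]]
      by (simp add: rev_filter mult_ac)
    thus ?thesis unfolding s by (simp add: c_def k_def)
  qed
  let ?pq = "\<lambda>v. (?P v, ?N v)"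
  have "frame_sum (ap (a @ b)) (ap (a' @ b')) = (\<Sum>v\<in>?G. pscale (c (?P v) (?N v)) (psingle (0 # v)))"
    unfolding frame_sum_def using val ad by (intro sum.cong) (auto simp: mult_ac)
  also have "\<dots> = (\<Sum>x\<in>?pq ` ?G. \<Sum>v\<in>{v \<in> ?G. ?pq v = x}. pscale (c (?P v) (?N v)) (psingle (0 # v)))"
    by (rule sum.image_gen[OF finite_frames])
  also have "\<dots> \<in> pm.span shuffle_relations"
  proof (rule pm.span_sum)
    fix x assume "x \<in> ?pq ` ?G"
    then obtain v0 where v0: "v0 \<in> ?G" "x = (?P v0, ?N v0)" by auto
    define p q where "p = ?P v0" and "q = ?N v0"
    have x: "x = (p, q)" by (simp add: v0 p_def q_def)
    have ad0: "adapted V1 V2 v0" by (rule ad[OF v0(1)])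
    note parts = adapted_parts[OF dec ad0, folded p_def q_def]
    have pq: "\<And>y. y \<in> set p \<Longrightarrow> y \<in> V1" "\<And>y. y \<in> set q \<Longrightarrow> y \<notin> V1" by (auto simp: p_def q_def)
    have disj: "set p \<inter> set q = {}" using pq by auto
    have G: "v \<in> ?G \<longleftrightarrow> normal_frame h v \<and> Poly_Mapping.lookup (ap (a @ b)) (flag v) \<noteq> 0 \<and>
      Poly_Mapping.lookup (ap (a' @ b')) (flag (rev v)) \<noteq> 0" for v
      by (simp add: frames_def in_keys_iff)
    have e0: "rev_sign m \<noteq> 0" for m by (simp add: rev_sign_def)
    have G': "v \<in> ?G \<longleftrightarrow> normal_frame h v \<and> c (?P v) (?N v) \<noteq> 0" if "adapted V1 V2 v" for v
      unfolding G val[OF that, symmetric] using e0 by auto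
    \<comment> \<open>Every shuffle is a normal frame with the same nonzero coefficient as
      \<open>v0\<close>, so none is missing from the support.\<close>
    have "{v \<in> ?G. ?pq v = x} = shuffles p q"
    proof (intro equalityI subsetI)
      fix v assume "v \<in> {v \<in> ?G. ?pq v = x}"
      thus "v \<in> shuffles p q" using partition_in_shuffles[of v "\<lambda>x. x \<in> V1"] x by auto
    next
      fix v assume v: "v \<in> shuffles p q"
      have setv: "set v = set p \<union> set q" by (rule set_shuffles[OF v])
      have "?P v = filter (\<lambda>x. x \<in> set p) v" "?N v = filter (\<lambda>x. x \<notin> set p) v"
        using setv pq disj by (auto intro!: filter_cong)
      hence PN: "?P v = p" "?N v = q" using filter_shuffles_disjoint1[OF disj v] by auto
      have "set p \<union> set q = set v0" by (auto simp: p_def q_def)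
      hence s0: "set v = set v0" using setv by simp
      have "distinct v"
        using distinct_disjoint_shuffles[OF _ _ disj v] parts by (auto simp: basis_tuple_def)
      hence bv: "basis_tuple UNIV v" "adapted V1 V2 v" using ad0 s0 by (auto simp: adapted_def basis_tuple_def)
      moreover have "\<forall>x\<in>set v. h x = 1" using v0(1) s0 by (auto simp: frames_def normal_frame_def)
      ultimately have "v \<in> ?G"
        using G'[OF bv(2)] G'[OF ad0] v0(1) PN by (auto simp: normal_frame_def p_def q_def)
      thus "v \<in> {v \<in> ?G. ?pq v = x}" using PN x by auto
    qed
    hence "(\<Sum>v\<in>{v \<in> ?G. ?pq v = x}. pscale (c (?P v) (?N v)) (psingle (0 # v))) =
        (\<Sum>v\<in>{v \<in> ?G. ?pq v = x}. pscale (c p q) (psingle (0 # v)))"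
      using x by (intro sum.cong) auto
    also have "\<dots> = pscale (c p q) (\<Sum>v\<in>shuffles p q. psingle (0 # v))"
      unfolding \<open>{v \<in> ?G. ?pq v = x} = shuffles p q\<close> by (rule pm.scale_sum_right[symmetric])
    also have "\<dots> \<in> pm.span shuffle_relations"
    proof (rule pm.span_scale, rule pm.span_base)
      have "affine_basis (0 # p @ q)" using basis_append[OF dec parts] by (simp add: affine_basis_0)
      moreover have "p \<noteq> []" "q \<noteq> []"
      proof -
        have "length p \<noteq> 0" "length q \<noteq> 0"
          using length_basis_tuple[OF parts(1)] length_basis_tuple[OF parts(2)] D(5,6) by linarith+
        thus "p \<noteq> []" "q \<noteq> []" by auto
      qed
      ultimately show "(\<Sum>v\<in>shuffles p q. psingle (0 # v)) \<in> shuffle_relations"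
        unfolding shuffle_relations_def by blast
    qed
    finally show "(\<Sum>v\<in>{v \<in> ?G. ?pq v = x}. pscale (c (?P v) (?N v)) (psingle (0 # v))) \<in> pm.span shuffle_relations" .
  qed
  finally show ?thesis .
qed

end

section \<open>Paths and their edges, and the recursion of the polynomials \<open>SS\<close>\<close>

section \<open>The polynomials of the decomposition operators\<close>

text \<open>The edge vectors of the path that starts at \<open>r\<close> and runs through
  \<open>y\<close>. From the first point of a symbol through its other points in reverse order, this
  is the second tuple of \<open>pr_St_symbol\<close>.\<close>

primrec path :: "'b \<Rightarrow> 'b list \<Rightarrow> 'b list" where
  "path r [] = []"
| "path r (y # ys) = (y - r) # path y ys"

lemma length_path [simp]: "length (path r y) = length y"
  by (induction y arbitrary: r) auto

lemma path_nth: "j < length y \<Longrightarrow> path r y ! j = y ! j - (if j = 0 then r else y ! (j - 1))"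
proof (induction y arbitrary: r j)
  case (Cons x y)
  thus ?case by (cases j) (auto simp: nth_Cons')
qed simp

lemma spn_path: "spn (path r y) = spn (map (\<lambda>p. p - r) y)"
proof (induction y arbitrary: r)
  case (Cons x y)
  have "spn (path r (x # y)) = {p + q |p q. p \<in> span {x - r} \<and> q \<in> spn (path x y)}"
    using span_Un[of "{x - r}" "set (path x y)"] by simp
  also have "\<dots> = {p + q |p q. p \<in> span {x - r} \<and> q \<in> spn (map (\<lambda>p. p - x) y)}" by (simp only: Cons.IH)
  also have "\<dots> = span (insert (x - r) ((\<lambda>p. p - x) ` set y))"
    using span_Un[of "{x - r}" "(\<lambda>p. p - x) ` set y"] by simp
  also have "\<dots> = span (insert (x - r) ((\<lambda>p. p - r) ` set y))"
  proof (intro equalityI span_minimal subspace_span subsetI)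
    fix z assume "z \<in> insert (x - r) ((\<lambda>p. p - x) ` set y)"
    then consider "z = x - r" | p where "p \<in> set y" "z = (p - r) - (x - r)" by auto
    thus "z \<in> span (insert (x - r) ((\<lambda>p. p - r) ` set y))"
    proof cases
      case 2
      show ?thesis unfolding 2(2) by (intro span_diff span_base) (use 2(1) in auto)
    qed (simp add: span_base)
  next
    fix z assume "z \<in> insert (x - r) ((\<lambda>p. p - r) ` set y)"
    then consider "z = x - r" | p where "p \<in> set y" "z = (p - x) + (x - r)" by auto
    thus "z \<in> span (insert (x - r) ((\<lambda>p. p - x) ` set y))"
    proof cases
      case 2
      show ?thesis unfolding 2(2) by (intro span_add span_base) (use 2(1) in auto)
    qed (simp add: span_base)
  qed
  finally show ?case by simp
qed simp

lemma indep_path: "indep (path r y) \<longleftrightarrow> indep (map (\<lambda>p. p - r) y)"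
  by (rule indep_cong) (simp_all add: spn_path del: set_map)

lemma map_path:
  assumes "Vector_Spaces.linear scale scale \<phi>"
  shows "map \<phi> (path r y) = path (\<phi> r) (map \<phi> y)"
  by (induction y arbitrary: r) (simp_all add: vp.linear_diff[OF assms])

text \<open>If the edge \<open>j\<close> is zero, deleting it amounts to deleting its end point from
  the path.\<close>

lemma delete_nth_path:
  "j < length q \<Longrightarrow> (if j = 0 then q ! 0 = r else q ! j = q ! (j - 1)) \<Longrightarrow>
    delete_nth j (path r q) = path r (delete_nth j q)"
proof (induction q arbitrary: r j)
  case (Cons x q)
  show ?case
  proof (cases j)
    case (Suc k)
    have "delete_nth k (path x q) = path x (delete_nth k q)"
      using Cons.prems Suc by (intro Cons.IH) (auto simp: nth_Cons' split: if_splits)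
    thus ?thesis using Suc by simp
  qed (use Cons.prems in simp)
qed simp

lemma delete_nth_eq_pred:
  assumes "j < length q" "j > 0" "q ! j = q ! (j - 1)"
  shows "delete_nth (j - 1) q = delete_nth j q"
proof -
  obtain k where k: "j = Suc k" using assms by (cases j) auto
  have "delete_nth j q = take k q @ q ! k # drop (Suc (Suc k)) q"
    using assms k by (simp add: delete_nth_def take_Suc_conv_app_nth)
  moreover have "delete_nth k q = take k q @ q ! Suc k # drop (Suc (Suc k)) q"
    using Cons_nth_drop_Suc[of "Suc k" q] assms(1) k by (simp add: delete_nth_def)
  ultimately show ?thesis using assms k by simp
qed

text \<open>The end points of edge \<open>j\<close> other than the base point \<open>r\<close>: the
  vertices whose deletion is compensated by this edge, as \<open>span_insert_edge\<close> and
  \<open>edge_in_delete\<close> make precise.\<close>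

definition near :: "nat \<Rightarrow> nat set" where
  "near j = (if j = 0 then {0} else {j - 1, j})"

text \<open>The edge joins the deleted vertex to a neighbour that is still there or to the base
  point, so it recovers the difference of the deleted vertex from \<open>r\<close>.\<close>

lemma span_insert_edge:
  assumes j: "j < length y" and i: "i \<in> near j"
  shows "span (insert (path r y ! j) (set (map (\<lambda>p. p - r) (delete_nth i y)))) = spn (map (\<lambda>p. p - r) y)"
proof -
  have il: "i < length y" using i j by (auto simp: near_def split: if_splits)
  let ?e = "path r y ! j"
  let ?S = "insert ?e (set (map (\<lambda>p. p - r) (delete_nth i y)))"
  have del: "y ! m - r \<in> span ?S" if "m < length y" "m \<noteq> i" for m
    using nth_in_delete_nth[OF that] by (auto intro: span_base)
  have "y ! i - r \<in> span ?S"
  proof (cases "j = 0")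
    case True
    hence "?e = y ! i - r" using i j by (simp add: near_def path_nth)
    thus ?thesis by (metis insertI1 span_base)
  next
    case False
    hence e: "?e = y ! j - y ! (j - 1)" using j by (simp add: path_nth)
    have es: "?e \<in> span ?S" by (simp add: span_base)
    consider "i = j" | "i = j - 1" using i False by (auto simp: near_def)
    thus ?thesis
    proof cases
      case 1
      have "?e + (y ! (j - 1) - r) \<in> span ?S" by (rule span_add[OF es del]) (use 1 False j in auto)
      thus ?thesis using 1 e by simp
    next
      case 2
      have "(y ! j - r) - ?e \<in> span ?S" by (rule span_diff[OF del es]) (use 2 False j in auto)
      thus ?thesis using 2 e by simp
    qed
  qed
  hence all: "y ! m - r \<in> span ?S" if "m < length y" for m using del that by (cases "m = i") auto
  have "spn (map (\<lambda>p. p - r) y) \<subseteq> span ?S"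
    by (rule span_minimal) (use all in \<open>auto simp: in_set_conv_nth\<close>)
  moreover have "span ?S \<subseteq> spn (map (\<lambda>p. p - r) y)"
  proof (rule span_minimal)
    have "?e \<in> spn (path r y)" using j by (intro in_spn nth_mem) simp
    hence "?e \<in> spn (map (\<lambda>p. p - r) y)" by (simp only: spn_path)
    moreover have "set (map (\<lambda>p. p - r) (delete_nth i y)) \<subseteq> set (map (\<lambda>p. p - r) y)"
      using set_delete_nth_subset[of i y] by auto
    ultimately show "?S \<subseteq> spn (map (\<lambda>p. p - r) y)" using span_superset by blast
  qed simp
  ultimately show ?thesis by blast
qed

lemma edge_in_delete:
  assumes j: "j < length y" and i: "i \<notin> near j"
  shows "path r y ! j \<in> spn (map (\<lambda>p. p - r) (delete_nth i y))"
proof -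
  have del: "y ! m - r \<in> spn (map (\<lambda>p. p - r) (delete_nth i y))" if "m < length y" "m \<noteq> i" for m
    using nth_in_delete_nth[OF that] by (auto intro: span_base)
  show ?thesis
  proof (cases "j = 0")
    case True
    thus ?thesis using del[of 0] i j by (auto simp: path_nth near_def)
  next
    case False
    hence "path r y ! j = (y ! j - r) - (y ! (j - 1) - r)" using j by (simp add: path_nth)
    also have "\<dots> \<in> spn (map (\<lambda>p. p - r) (delete_nth i y))"
      by (rule span_diff[OF del del]) (use i j False in \<open>auto simp: near_def\<close>)
    finally show ?thesis .
  qed
qed

text \<open>A model of the quotient by \<open>w\<close>, as \<open>coeff_first\<close> asks for,
  that does not move \<open>spn v\<close>. It subtracts the coordinate along
  \<open>w\<close>.\<close>

lemma exists_projection: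
  assumes "indep (w # v)"
  obtains \<phi> where "Vector_Spaces.linear scale scale \<phi>" "\<And>y. \<phi> y = 0 \<longleftrightarrow> y \<in> span {w}"
    "\<And>y. y \<in> spn v \<Longrightarrow> \<phi> y = y"
proof -
  interpret fv: vector_space_pair scale "(*) :: 'a \<Rightarrow> 'a \<Rightarrow> 'a"
    by unfold_locales (auto simp: algebra_simps)
  have w: "w \<notin> set v" "independent (set (w # v))" using assms by (auto simp: indep_def)
  obtain g where g: "Vector_Spaces.linear scale (*) g" "\<And>x. x \<in> set (w # v) \<Longrightarrow> g x = (if x = w then 1 else 0)"
    using fv.linear_independent_extend[OF w(2), of "\<lambda>x. if x = w then 1 else 0"] by blast
  define \<phi> where "\<phi> y = y - g y *s w" for y
  have gw: "g w = 1" using g(2) by simp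
  have "Vector_Spaces.linear scale scale \<phi>"
    by unfold_locales
      (auto simp: \<phi>_def fv.linear_add[OF g(1)] fv.linear_scale[OF g(1)] algebra_simps
        scale_left_distrib scale_right_diff_distrib)
  moreover have "\<phi> y = 0 \<longleftrightarrow> y \<in> span {w}" for y
    by (auto simp: \<phi>_def span_singleton fv.linear_scale[OF g(1)] gw)
  moreover have "\<phi> y = y" if "y \<in> spn v" for y
  proof -
    have "g y = 0"
      using that
    proof (induction rule: span_induct_alt)
      case (step c x z)
      hence "g x = 0" using g(2)[of x] w(1) by auto
      thus ?case using step by (simp add: fv.linear_add[OF g(1)] fv.linear_scale[OF g(1)])
    qed (simp add: fv.linear_0[OF g(1)])
    thus ?thesis by (simp add: \<phi>_def)
  qed
  ultimately show thesis by (rule that)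
qed

text \<open>The recursion of the polynomials \<open>SS\<close> on the level of coefficients.\<close>

lemma coeff_path_recursion:
  fixes r y
  defines "a \<equiv> map (\<lambda>p. p - r) y" and "b \<equiv> path r y" and "E y' v \<equiv> rev_sign (length y') * coeff (map (\<lambda>p. p - r) y') v * coeff (path r y') (rev v)"
  assumes ia: "indep a" and y: "y \<noteq> []"
  shows "E y (v @ [w]) = (\<Sum>j<length y. if span {b ! j} = span {w}
    then E (delete_nth j y) v - (if j = 0 then 0 else E (delete_nth (j - 1) y) v) else 0)"
proof -
  let ?n = "length y"
  have ib: "indep b" using ia by (simp add: a_def b_def indep_path)
  have len: "length a = ?n" "length b = ?n" by (simp_all add: a_def b_def)
  have da: "delete_nth i a = map (\<lambda>p. p - r) (delete_nth i y)" for i by (simp add: a_def map_delete_nth)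
  show ?thesis
  proof (cases "\<exists>j<?n. span {b ! j} = span {w}")
    case False
    have "coeff b (w # rev v) = 0"
    proof (rule ccontr)
      assume "coeff b (w # rev v) \<noteq> 0"
      then obtain l where l: "l \<in> Poly_Mapping.keys (alt b)" "fl l = fl (w # rev v)" by (rule coeff_nonzeroE)
      obtain x l' where xl: "l = x # l'" using fl_eqD(1)[OF l(2)] by (cases l) auto
      have "span {x} = span {w}" using fl_eqD(2)[OF l(2), of 1] xl by simp
      moreover have "x \<in> set b" using alt_keys_set[OF l(1)] xl by auto
      ultimately show False using False len by (metis in_set_conv_nth)
    qed
    hence "E y (v @ [w]) = 0" by (simp add: E_def b_def)
    thus ?thesis using False by (auto intro!: sum.neutral[symmetric])
  next
    case True
    then obtain j where j: "j < ?n" "span {b ! j} = span {w}" by blast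
    \<comment> \<open>The edges are independent, so no two of them span the same line.\<close>
    have uniq: "j' = j" if "j' < ?n" "span {b ! j'} = span {w}" for j'
    proof (rule ccontr)
      assume "j' \<noteq> j"
      hence "b ! j' \<in> set (delete_nth j b)" using that len by (intro nth_in_delete_nth) auto
      hence "span {b ! j'} \<subseteq> spn (delete_nth j b)" by (intro span_mono) auto
      moreover have "b ! j \<in> span {b ! j'}" using j(2) that(2) span_base[of "b ! j" "{b ! j}"] by simp
      ultimately have "\<not> indep (b ! j # delete_nth j b)" by (auto simp: indep_Cons)
      moreover have "mset (b ! j # delete_nth j b) = mset b"
        using j(1) len by (metis add_mset_add_single delete_nth_def id_take_nth_drop mset.simps(2) mset_append union_mset_add_mset_right)
      ultimately show False using indep_mset ib by blast
    qed
    have bj: "indep (b ! j # delete_nth j b)"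
    proof -
      have "mset (b ! j # delete_nth j b) = mset b"
        using j(1) len by (metis add_mset_add_single delete_nth_def id_take_nth_drop mset.simps(2) mset_append union_mset_add_mset_right)
      thus ?thesis using indep_mset ib by blast
    qed
    have insw: "span (insert w S) = span (insert (b ! j) S)" for S
    proof -
      have "span ({w} \<union> S) = span ({b ! j} \<union> S)" unfolding span_Un j(2) ..
      thus ?thesis by simp
    qed
    have nearlt: "near j \<subseteq> {..<?n}" using j(1) by (auto simp: near_def)
    have top: "spn a = spn (v @ [w])" if "i \<in> near j" "coeff (delete_nth i a) v \<noteq> 0" for i
    proof -
      have "spn a = span (insert (b ! j) (set (delete_nth i a)))"
        unfolding da unfolding a_def b_def by (rule span_insert_edge[OF j(1) that(1), symmetric])
      also have "\<dots> = {p + q |p q. p \<in> span {b ! j} \<and> q \<in> spn (delete_nth i a)}"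
        using span_Un[of "{b ! j}" "set (delete_nth i a)"] by simp
      also have "\<dots> = {p + q |p q. p \<in> span {w} \<and> q \<in> spn v}"
        using coeff_nonzeroD(2)[OF that(2)] j(2) by simp
      also have "\<dots> = spn (v @ [w])" using span_Un[of "{w}" "set v"] by simp
      finally show ?thesis .
    qed
    have "coeff a (v @ [w]) = (\<Sum>i\<in>near j. (- 1) ^ (?n - 1 - i) * coeff (delete_nth i a) v)"
    proof (cases "spn a = spn (v @ [w])")
      case T: True
      have "coeff (delete_nth i a) v = 0" if i: "i < ?n" "i \<notin> near j" for i
      proof (rule ccontr)
        assume nz: "coeff (delete_nth i a) v \<noteq> 0"
        have "b ! j \<in> spn (delete_nth i a)"
          unfolding da b_def by (rule edge_in_delete[OF j(1) i(2)])
        hence "b ! j \<in> spn v" using coeff_nonzeroD(2)[OF nz] by simp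
        hence "span {b ! j} \<subseteq> spn v" by (intro span_minimal) auto
        hence "w \<in> spn v" using j(2) span_base[of w "{w}"] by auto
        hence "spn (v @ [w]) = spn v" by (simp add: span_redundant)
        hence "dim (spn a) = dim (spn (delete_nth i a))" using T coeff_nonzeroD(2)[OF nz] by simp
        hence "length a = length (delete_nth i a)"
          using ia indep_delete_nth[OF ia, of i] indep_iff_dim by simp
        thus False using i len by simp
      qed
      hence "(\<Sum>i<length a. (- 1) ^ (length a - 1 - i) * coeff (delete_nth i a) v) =
          (\<Sum>i\<in>near j. (- 1) ^ (length a - 1 - i) * coeff (delete_nth i a) v)"
        using nearlt len by (intro sum.mono_neutral_right) auto
      thus ?thesis using T len by (simp add: coeff_snoc)
    next
      case F: False
      have "(\<Sum>i\<in>near j. (- 1) ^ (?n - 1 - i) * coeff (delete_nth i a) v) = 0"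
        using top F by (intro sum.neutral) auto
      thus ?thesis using F by (simp add: coeff_snoc)
    qed
    hence "E y (v @ [w]) = rev_sign ?n * (\<Sum>i\<in>near j. (- 1) ^ (?n - 1 - i) * coeff (delete_nth i a) v) *
        ((- 1) ^ j * coeff (b ! j # delete_nth j b) (w # rev v))"
      using coeff_move_front[of j b "w # rev v"] j(1) len by (simp add: E_def a_def[symmetric] b_def[symmetric])
    also have "\<dots> = (\<Sum>i\<in>near j. (- 1) ^ (i + j) * E (delete_nth i y) v)"
      unfolding sum_distrib_left sum_distrib_right
    proof (rule sum.cong[OF refl])
      fix i assume i: "i \<in> near j"
      hence il: "i < ?n" using nearlt by auto
      \<comment> \<open>Modulo the edge \<open>b ! j\<close> its two ends coincide. So the path
        without this edge is the path without either of its ends, and \<open>\<phi>\<close> fixes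
        the edges that remain after deleting \<open>i\<close> because they lie in
        \<open>spn v\<close>.\<close>
      have key: "coeff (delete_nth i a) v * coeff (b ! j # delete_nth j b) (w # rev v) =
          coeff (delete_nth i a) v * coeff (path r (delete_nth i y)) (rev v)"
      proof (cases "coeff (delete_nth i a) v = 0")
        case nz: False
        note D = coeff_nonzeroD[OF nz]
        have iv: "indep v" using D(3) indep_delete_nth[OF ia] by simp
        have "b ! j \<notin> spn v"
        proof
          assume "b ! j \<in> spn v"
          hence "spn a = spn v" using top[OF i nz] insw[of "set v"] by (simp add: span_redundant)
          hence "dim (spn a) = dim (spn (delete_nth i a))" using D(2) by simp
          hence "length a = length (delete_nth i a)"
            using ia indep_delete_nth[OF ia, of i] indep_iff_dim by simp
          thus False using il len by simp
        qed
        hence "indep (b ! j # v)" using iv by (simp add: indep_Cons)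
        then obtain \<phi> where \<phi>: "Vector_Spaces.linear scale scale \<phi>" "\<And>y. \<phi> y = 0 \<longleftrightarrow> y \<in> span {b ! j}"
          "\<And>y. y \<in> spn v \<Longrightarrow> \<phi> y = y" by (rule exists_projection) blast
        have "coeff (b ! j # delete_nth j b) (w # rev v) = coeff (map \<phi> (delete_nth j b)) (map \<phi> (rev v))"
          by (rule coeff_first[OF bj j(2)[symmetric] \<phi>(1,2)])
        also have "map \<phi> (rev v) = rev v" using \<phi>(3) in_spn by (intro map_idI) auto
        also have "map \<phi> (delete_nth j b) = path r (delete_nth i y)"
        proof -
          have "\<phi> (b ! j) = 0" using \<phi>(2) span_base by blast
          hence eq: "if j = 0 then map \<phi> y ! 0 = \<phi> r else map \<phi> y ! j = map \<phi> y ! (j - 1)"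
            using j(1) by (auto simp: b_def path_nth vp.linear_diff[OF \<phi>(1)])
          have "map \<phi> (delete_nth j b) = delete_nth j (path (\<phi> r) (map \<phi> y))"
            by (simp add: map_delete_nth b_def map_path[OF \<phi>(1)])
          also have "\<dots> = path (\<phi> r) (delete_nth j (map \<phi> y))"
            using j(1) eq by (intro delete_nth_path) auto
          also have "delete_nth j (map \<phi> y) = delete_nth i (map \<phi> y)"
            using i eq j(1) delete_nth_eq_pred[of j "map \<phi> y"] by (auto simp: near_def split: if_splits)
          also have "path (\<phi> r) (delete_nth i (map \<phi> y)) = map \<phi> (path r (delete_nth i y))"
            by (simp add: map_path[OF \<phi>(1)] map_delete_nth)
          also have "\<dots> = path r (delete_nth i y)"
          proof (rule map_idI)
            fix x assume "x \<in> set (path r (delete_nth i y))"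
            hence "x \<in> spn (path r (delete_nth i y))" by (rule in_spn)
            hence "x \<in> spn v" using D(2) by (simp only: spn_path da)
            thus "\<phi> x = x" by (rule \<phi>(3))
          qed
          finally show ?thesis .
        qed
        finally show ?thesis by simp
      qed simp
      \<comment> \<open>The reversals of \<open>n\<close> and of \<open>n - 1\<close> entries differ
        by the sign \<open>(- 1) ^ (n - 1)\<close>. What is left is \<open>(- 1) ^ (i + j)\<close>:
        plus for \<open>i = j\<close> and minus for \<open>i = j - 1\<close>, as in the recursion of
        \<open>SS\<close>.\<close>
      have sg: "rev_sign ?n * (- 1) ^ (?n - 1 - i) * (- 1) ^ j = (- 1) ^ (i + j) * rev_sign (?n - 1)"
      proof -
        have "Suc (?n - 1) = ?n" using il by simp
        hence "rev_sign ?n = (- 1) ^ (?n - 1) * rev_sign (?n - 1)" using rev_sign_Suc[of "?n - 1"] by metis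
        moreover have "(- 1 :: rat) ^ (?n - 1) = (- 1) ^ (?n - 1 - i) * (- 1) ^ i"
          using il by (simp add: power_add[symmetric])
        ultimately show ?thesis using neg_one_sq[of "?n - 1 - i"] by (simp add: power_add mult_ac)
      qed
      have "rev_sign ?n * ((- 1) ^ (?n - 1 - i) * coeff (delete_nth i a) v) * ((- 1) ^ j * coeff (b ! j # delete_nth j b) (w # rev v)) =
        (rev_sign ?n * (- 1) ^ (?n - 1 - i) * (- 1) ^ j) * (coeff (delete_nth i a) v * coeff (b ! j # delete_nth j b) (w # rev v))"
        by (simp add: mult_ac)
      also have "\<dots> = (- 1) ^ (i + j) * E (delete_nth i y) v"
        unfolding sg key E_def using il by (simp add: da mult_ac)
      finally show "rev_sign ?n * ((- 1) ^ (?n - 1 - i) * coeff (delete_nth i a) v) * ((- 1) ^ j * coeff (b ! j # delete_nth j b) (w # rev v)) =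
        (- 1) ^ (i + j) * E (delete_nth i y) v" .
    qed
    also have "\<dots> = E (delete_nth j y) v - (if j = 0 then 0 else E (delete_nth (j - 1) y) v)"
    proof (cases j)
      case (Suc m)
      thus ?thesis by (simp add: near_def power_add neg_one_sq)
    qed (simp add: near_def)
    also have "\<dots> = (\<Sum>j'<?n. if j' = j then E (delete_nth j y) v - (if j = 0 then 0 else E (delete_nth (j - 1) y) v) else 0)"
      using j(1) by simp
    also have "\<dots> = (\<Sum>j<?n. if span {b ! j} = span {w}
      then E (delete_nth j y) v - (if j = 0 then 0 else E (delete_nth (j - 1) y) v) else 0)"
    proof (rule sum.cong[OF refl])
      fix j' assume "j' \<in> {..<?n}"
      hence "span {b ! j'} = span {w} \<longleftrightarrow> j' = j" using uniq[of j'] j(2) by auto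
      thus "(if j' = j then E (delete_nth j y) v - (if j = 0 then 0 else E (delete_nth (j - 1) y) v) else 0) =
        (if span {b ! j'} = span {w}
         then E (delete_nth j' y) v - (if j' = 0 then 0 else E (delete_nth (j' - 1) y) v) else 0)"
        by (simp only: split: if_split) simp
    qed
    finally show ?thesis .
  qed
qed

end

lemma frag_lookup_extend:
  "Poly_Mapping.lookup (frag_extend (\<lambda>i. frag_of (g i)) p) l =
     (\<Sum>i | i \<in> Poly_Mapping.keys p \<and> g i = l. Poly_Mapping.lookup p i)"
proof -
  have "Poly_Mapping.lookup (frag_extend (\<lambda>i. frag_of (g i)) p) l =
      (\<Sum>i\<in>Poly_Mapping.keys p. if g i = l then Poly_Mapping.lookup p i else 0)"
    unfolding frag_extend_def lookup_sum by (rule sum.cong) auto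
  thus ?thesis by (simp add: sum.If_cases Int_def)
qed

lemma frag_lookup_snoc:
  "Poly_Mapping.lookup (frag_extend (\<lambda>i. frag_of (g i @ [x])) p) (l @ [x']) =
     (if x = x' then Poly_Mapping.lookup (frag_extend (\<lambda>i. frag_of (g i)) p) l else 0)"
  by (simp add: frag_lookup_extend)

lemma frag_lookup_snoc_Nil: "Poly_Mapping.lookup (frag_extend (\<lambda>i. frag_of (g i @ [x])) p) [] = 0"
  by (simp add: frag_lookup_extend)

lemma lookup_append_letter:
  "Poly_Mapping.lookup (append_letter p e) (\<iota> @ [e']) = (if e = e' then Poly_Mapping.lookup p \<iota> else 0)"
  "Poly_Mapping.lookup (append_letter p e) [] = 0"
  using frag_lookup_snoc[of "\<lambda>w. w" e p \<iota> e'] frag_lookup_snoc_Nil[of "\<lambda>w. w" e p]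
  by (simp_all add: append_letter_def frag_expansion[symmetric])

lemma keys_append_letter: "\<iota> \<in> Poly_Mapping.keys (append_letter p e) \<Longrightarrow> \<exists>w\<in>Poly_Mapping.keys p. \<iota> = w @ [e]"
  unfolding append_letter_def using keys_frag_extend[of "\<lambda>w. frag_of (w @ [e])" p] by (auto simp: keys_frag_of)

lemma rev_delete_nth: "k < length t \<Longrightarrow> delete_nth k (rev t) = rev (delete_nth (length t - 1 - k) t)"
  by (simp add: delete_nth_def take_rev drop_rev Suc_diff_Suc)

text \<open>The indices are reversed so that their order is that of the vectors in \<open>pr_St_symbol\<close>.\<close>

lemma SS_rec:
  assumes n: "length t \<ge> 2"
  shows "SS (s0 # rev t) = append_letter (SS (s0 # rev (delete_nth 0 t))) {s0, t ! 0} +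
    (\<Sum>j\<in>{1..length t - 1}. append_letter (SS (s0 # rev (delete_nth j t))) {t ! j, t ! (j - 1)} -
      append_letter (SS (s0 # rev (delete_nth (j - 1) t))) {t ! j, t ! (j - 1)})"
proof -
  let ?s = "s0 # rev t" and ?n = "length t"
  have nth: "?s ! k = t ! (?n - k)" if "1 \<le> k" "k \<le> ?n" for k
    using that by (cases k) (auto simp: rev_nth)
  have del: "delete_nth k ?s = s0 # rev (delete_nth (?n - k) t)" if "1 \<le> k" "k \<le> ?n" for k
    using that by (cases k) (auto simp: rev_delete_nth)
  have bl: "butlast ?s = s0 # rev (delete_nth 0 t)"
    using n by (cases t) auto
  have g: "(\<Sum>i\<in>{1..?n - 1}. f i) = (\<Sum>j\<in>{1..?n - 1}. f (?n - j))" for f :: "nat \<Rightarrow> nat set list \<Rightarrow>\<^sub>0 int"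
    by (rule sum.reindex_bij_witness[where i = "\<lambda>j. ?n - j" and j = "\<lambda>j. ?n - j"]) auto
  have "SS ?s = append_letter (SS (butlast ?s)) {?s ! 0, ?s ! ?n}
        - (\<Sum>i\<in>{1..?n - 1}. append_letter (SS (delete_nth (i + 1) ?s)) {?s ! i, ?s ! (i + 1)})
        + (\<Sum>i\<in>{1..?n - 1}. append_letter (SS (delete_nth i ?s)) {?s ! i, ?s ! (i + 1)})"
  proof -
    have "\<not> length ?s < 2" "length ?s \<noteq> 2" "length ?s - 1 = ?n" using n by auto
    thus ?thesis by (subst SS.simps) (simp only: Let_def if_False)
  qed
  also have "?s ! ?n = t ! 0" using nth[of ?n] n by simp
  also have "(\<Sum>i\<in>{1..?n - 1}. append_letter (SS (delete_nth (i + 1) ?s)) {?s ! i, ?s ! (i + 1)}) =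
      (\<Sum>j\<in>{1..?n - 1}. append_letter (SS (s0 # rev (delete_nth (j - 1) t))) {t ! j, t ! (j - 1)})"
    unfolding g[of "\<lambda>i. append_letter (SS (delete_nth (i + 1) ?s)) {?s ! i, ?s ! (i + 1)}"]
  proof (rule sum.cong[OF refl])
    fix j assume j: "j \<in> {1..?n - 1}"
    hence e: "?n - (?n - j) = j" "?n - (?n - j + 1) = j - 1" by auto
    show "append_letter (SS (delete_nth (?n - j + 1) ?s)) {?s ! (?n - j), ?s ! (?n - j + 1)} =
      append_letter (SS (s0 # rev (delete_nth (j - 1) t))) {t ! j, t ! (j - 1)}"
      using j nth[of "?n - j"] nth[of "?n - j + 1"] del[of "?n - j + 1"] e by auto
  qed
  also have "(\<Sum>i\<in>{1..?n - 1}. append_letter (SS (delete_nth i ?s)) {?s ! i, ?s ! (i + 1)}) =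
      (\<Sum>j\<in>{1..?n - 1}. append_letter (SS (s0 # rev (delete_nth j t))) {t ! j, t ! (j - 1)})"
    unfolding g[of "\<lambda>i. append_letter (SS (delete_nth i ?s)) {?s ! i, ?s ! (i + 1)}"]
  proof (rule sum.cong[OF refl])
    fix j assume j: "j \<in> {1..?n - 1}"
    hence e: "?n - (?n - j) = j" "?n - (?n - j + 1) = j - 1" by auto
    show "append_letter (SS (delete_nth (?n - j) ?s)) {?s ! (?n - j), ?s ! (?n - j + 1)} =
      append_letter (SS (s0 # rev (delete_nth j t))) {t ! j, t ! (j - 1)}"
      using j nth[of "?n - j"] nth[of "?n - j + 1"] del[of "?n - j"] e by auto
  qed
  finally show ?thesis unfolding bl by (simp add: sum_subtractf)
qed

lemma SS_pair: "SS [s0, i] = frag_of [{s0, i}]"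
  by (subst SS.simps) simp

lemma length_cases: "t \<noteq> [] \<Longrightarrow> (\<exists>i. t = [i]) \<or> length t \<ge> 2"
  by (cases t; cases "tl t") auto

lemma SS_keys_rec:
  assumes n: "length t \<ge> 2" and \<iota>: "\<iota> \<in> Poly_Mapping.keys (SS (s0 # rev t))"
  obtains w j i where "\<iota> = w @ [if j = 0 then {s0, t ! 0} else {t ! j, t ! (j - 1)}]" "j < length t"
    "i = j \<or> (j > 0 \<and> i = j - 1)" "w \<in> Poly_Mapping.keys (SS (s0 # rev (delete_nth i t)))"
proof -
  let ?al = "\<lambda>i e. append_letter (SS (s0 # rev (delete_nth i t))) e"
  from \<iota> have "\<iota> \<in> Poly_Mapping.keys (?al 0 {s0, t ! 0}) \<union>
    Poly_Mapping.keys (\<Sum>j\<in>{1..length t - 1}. ?al j {t ! j, t ! (j - 1)} - ?al (j - 1) {t ! j, t ! (j - 1)})"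
    unfolding SS_rec[OF n] by (rule subsetD[OF keys_add])
  thus thesis
  proof
    assume "\<iota> \<in> Poly_Mapping.keys (?al 0 {s0, t ! 0})"
    from keys_append_letter[OF this] obtain w where
      "w \<in> Poly_Mapping.keys (SS (s0 # rev (delete_nth 0 t)))" "\<iota> = w @ [{s0, t ! 0}]" by blast
    thus thesis using n by (intro that[of w 0 0]) auto
  next
    assume "\<iota> \<in> Poly_Mapping.keys (\<Sum>j\<in>{1..length t - 1}. ?al j {t ! j, t ! (j - 1)} - ?al (j - 1) {t ! j, t ! (j - 1)})"
    from subsetD[OF keys_sum this] obtain j where j: "j \<in> {1..length t - 1}"
      "\<iota> \<in> Poly_Mapping.keys (?al j {t ! j, t ! (j - 1)} - ?al (j - 1) {t ! j, t ! (j - 1)})" by blast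
    hence jl: "j < length t" "j > 0" using n by auto
    from subsetD[OF keys_diff j(2)] show thesis
    proof
      assume "\<iota> \<in> Poly_Mapping.keys (?al j {t ! j, t ! (j - 1)})"
      from keys_append_letter[OF this] show thesis using jl that[of _ j j] by auto
    next
      assume "\<iota> \<in> Poly_Mapping.keys (?al (j - 1) {t ! j, t ! (j - 1)})"
      from keys_append_letter[OF this] show thesis using jl that[of _ j "j - 1"] by auto
    qed
  qed
qed

lemma SS_keys:
  assumes "t \<noteq> []" "distinct (s0 # t)" "\<iota> \<in> Poly_Mapping.keys (SS (s0 # rev t))"
  shows "length \<iota> = length t \<and> (\<forall>e\<in>set \<iota>. \<exists>i j. e = {i, j} \<and> i \<noteq> j \<and> i \<in> set (s0 # t) \<and> j \<in> set (s0 # t))"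
  using assms
proof (induction "length t" arbitrary: t \<iota> rule: less_induct)
  case less
  show ?case
  proof (cases "length t \<ge> 2")
    case False
    then obtain i where "t = [i]" using length_cases less.prems(1) by blast
    thus ?thesis using less.prems by (auto simp: SS_pair keys_frag_of)
  next
    case True
    from SS_keys_rec[OF True less.prems(3)] obtain w j i where
      w: "\<iota> = w @ [if j = 0 then {s0, t ! 0} else {t ! j, t ! (j - 1)}]" "j < length t"
      "i = j \<or> (j > 0 \<and> i = j - 1)" "w \<in> Poly_Mapping.keys (SS (s0 # rev (delete_nth i t)))" .
    have i: "i < length t" using w by auto
    have sub: "set (delete_nth i t) \<subseteq> set t" by (rule set_delete_nth_subset)
    have "length w = length (delete_nth i t) \<and> (\<forall>e\<in>set w. \<exists>i' j. e = {i', j} \<and> i' \<noteq> j \<and>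
      i' \<in> set (s0 # delete_nth i t) \<and> j \<in> set (s0 # delete_nth i t))"
    proof (rule less.hyps[OF _ _ _ w(4)])
      show "length (delete_nth i t) < length t" using i by simp
      have "length (delete_nth i t) \<noteq> 0" using i True by simp
      thus "delete_nth i t \<noteq> []" by auto
      show "distinct (s0 # delete_nth i t)"
        using less.prems(2) sub by (auto simp: delete_nth_def set_take_disj_set_drop_if_distinct)
    qed
    hence len: "length w = length t - 1"
      and letters: "\<And>e. e \<in> set w \<Longrightarrow> \<exists>i' j. e = {i', j} \<and> i' \<noteq> j \<and>
        i' \<in> set (s0 # delete_nth i t) \<and> j \<in> set (s0 # delete_nth i t)"
      using i by simp_all
    have sub': "set (s0 # delete_nth i t) \<subseteq> set (s0 # t)" using sub by auto
    have 1: "\<exists>i j. e = {i, j} \<and> i \<noteq> j \<and> i \<in> set (s0 # t) \<and> j \<in> set (s0 # t)" if "e \<in> set w" for e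
      using letters[OF that] sub' by blast
    have "\<exists>i' j'. (if j = 0 then {s0, t ! 0} else {t ! j, t ! (j - 1)}) = {i', j'} \<and> i' \<noteq> j' \<and>
      i' \<in> set (s0 # t) \<and> j' \<in> set (s0 # t)"
    proof (cases "j = 0")
      case True
      have "t ! 0 \<in> set t" "s0 \<noteq> t ! 0" using less.prems(1,2) by (cases t; auto)+
      thus ?thesis using True by (intro exI[of _ s0] exI[of _ "t ! 0"]) auto
    next
      case False
      have "t ! j \<noteq> t ! (j - 1)" using less.prems(2) w(2) False by (simp add: nth_eq_iff_index_eq)
      thus ?thesis using False w(2) by (intro exI[of _ "t ! j"] exI[of _ "t ! (j - 1)"]) auto
    qed
    moreover have "length \<iota> = length t" using len w(1) i by simp
    ultimately show ?thesis
    proof (intro conjI ballI)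
      let ?e = "if j = 0 then {s0, t ! 0} else {t ! j, t ! (j - 1)}"
      assume e: "\<exists>i' j'. ?e = {i', j'} \<and> i' \<noteq> j' \<and> i' \<in> set (s0 # t) \<and> j' \<in> set (s0 # t)"
      fix e assume "e \<in> set \<iota>"
      hence "e \<in> set w \<or> e = ?e" unfolding w(1) set_append by (simp only: Un_iff list.set singleton_iff)
      thus "\<exists>i j. e = {i, j} \<and> i \<noteq> j \<and> i \<in> set (s0 # t) \<and> j \<in> set (s0 # t)"
      proof
        assume "e \<in> set w"
        thus ?thesis by (rule 1)
      next
        assume "e = ?e"
        thus ?thesis using e by (simp only:)
      qed
    qed
  qed
qed

text \<open>In the recursion a last letter containing \<open>s0\<close> can only be
  \<open>{s0, t ! 0}\<close>, since the other letters join entries of \<open>t\<close>. So the only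
  word of this kind is the star at \<open>s0\<close>.\<close>

lemma SS_through_first:
  assumes "t \<noteq> []" "distinct (s0 # t)" "\<And>e. e \<in> set \<iota> \<Longrightarrow> s0 \<in> e"
  shows "Poly_Mapping.lookup (SS (s0 # rev t)) \<iota> = (if \<iota> = map (\<lambda>x. {s0, x}) (rev t) then 1 else 0)"
  using assms
proof (induction t arbitrary: \<iota>)
  case (Cons t0 ts)
  show ?case
  proof (cases "ts = []")
    case True
    thus ?thesis by (auto simp: SS_pair)
  next
    case False
    let ?t = "t0 # ts"
    have n: "length ?t \<ge> 2" using False by (cases ts) auto
    show ?thesis
    proof (cases \<iota> rule: rev_cases)
      case Nil
      thus ?thesis unfolding SS_rec[OF n] by (simp add: lookup_add lookup_sum lookup_minus lookup_append_letter)
    next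
      case (snoc w e)
      have se: "s0 \<in> e" and sw: "\<And>e. e \<in> set w \<Longrightarrow> s0 \<in> e" using Cons.prems(3) snoc by auto
      have ne: "{?t ! j, ?t ! (j - 1)} \<noteq> e" if "j \<in> {1..length ?t - 1}" for j
      proof -
        have "?t ! j \<in> set ?t" "?t ! (j - 1) \<in> set ?t" using that by (intro nth_mem; auto)+
        thus ?thesis using se Cons.prems(2) by auto
      qed
      have "Poly_Mapping.lookup (SS (s0 # rev ?t)) \<iota> =
          (if {s0, t0} = e then Poly_Mapping.lookup (SS (s0 # rev ts)) w else 0)"
        unfolding SS_rec[OF n] snoc
        using ne by (simp add: lookup_add lookup_sum lookup_minus lookup_append_letter)
      also have "Poly_Mapping.lookup (SS (s0 # rev ts)) w = (if w = map (\<lambda>x. {s0, x}) (rev ts) then 1 else 0)"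
        using Cons.prems(2) by (intro Cons.IH[OF False _ sw]) auto
      also have "(if {s0, t0} = e then if w = map (\<lambda>x. {s0, x}) (rev ts) then 1 else 0 else 0) =
          (if \<iota> = map (\<lambda>x. {s0, x}) (rev ?t) then 1 else (0 :: int))"
        by (auto simp: snoc)
      finally show ?thesis .
    qed
  qed
qed simp

text \<open>Once \<open>t0\<close> is deleted no letter contains it, so in each step only the term
  that deletes \<open>t1\<close> and ends in \<open>{t1, t0}\<close> survives. The result is the
  star at the last vertex.\<close>

lemma SS_through_last:
  assumes "distinct (s0 # t0 # ts)" "\<And>e. e \<in> set \<iota> \<Longrightarrow> t0 \<in> e"
  shows "Poly_Mapping.lookup (SS (s0 # rev (t0 # ts))) \<iota> =
    (if \<iota> = map (\<lambda>x. {x, t0}) (s0 # rev ts) then 1 else 0)"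
  using assms
proof (induction ts arbitrary: \<iota>)
  case Nil
  thus ?case by (auto simp: SS_pair)
next
  case (Cons t1 ts)
  let ?t = "t0 # t1 # ts"
  have n: "length ?t \<ge> 2" by simp
  have zero: "Poly_Mapping.lookup (SS (s0 # rev (t1 # ts))) w = 0" if "\<And>e. e \<in> set w \<Longrightarrow> t0 \<in> e" for w
  proof (rule ccontr)
    assume "Poly_Mapping.lookup (SS (s0 # rev (t1 # ts))) w \<noteq> 0"
    hence k: "length w = length (t1 # ts) \<and> (\<forall>e\<in>set w. \<exists>i j. e = {i, j} \<and> i \<noteq> j \<and>
      i \<in> set (s0 # t1 # ts) \<and> j \<in> set (s0 # t1 # ts))"
      using Cons.prems(1) by (intro SS_keys) (auto simp: in_keys_iff)
    then obtain e w' where "w = e # w'" by (cases w) auto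
    thus False using k that[of e] Cons.prems(1) by auto
  qed
  show ?case
  proof (cases \<iota> rule: rev_cases)
    case Nil
    thus ?thesis unfolding SS_rec[OF n] by (simp add: lookup_add lookup_sum lookup_minus lookup_append_letter)
  next
    case (snoc w e)
    have te: "t0 \<in> e" and tw: "\<And>e. e \<in> set w \<Longrightarrow> t0 \<in> e" using Cons.prems(2) snoc by auto
    let ?f = "\<lambda>j. Poly_Mapping.lookup (append_letter (SS (s0 # rev (delete_nth j ?t))) {?t ! j, ?t ! (j - 1)} -
      append_letter (SS (s0 # rev (delete_nth (j - 1) ?t))) {?t ! j, ?t ! (j - 1)}) (w @ [e])"
    have fj: "?f j = 0" if "j \<in> {1..length ?t - 1} - {1}" for j
    proof -
      have "?t ! j \<in> set (t1 # ts)" "?t ! (j - 1) \<in> set (t1 # ts)"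
        using that by (auto simp: nth_Cons' intro!: nth_mem)
      hence "{?t ! j, ?t ! (j - 1)} \<noteq> e" using te Cons.prems(1) by auto
      thus ?thesis by (simp add: lookup_minus lookup_append_letter)
    qed
    have "(\<Sum>j\<in>{1..length ?t - 1}. ?f j) = (\<Sum>j\<in>{1}. ?f j)"
      using fj by (intro sum.mono_neutral_right) auto
    also have "\<dots> = (if {t1, t0} = e then Poly_Mapping.lookup (SS (s0 # rev (t0 # ts))) w else 0)"
      using zero[OF tw] by (simp add: lookup_minus lookup_append_letter)
    finally have "Poly_Mapping.lookup (SS (s0 # rev ?t)) \<iota> =
        (if {t1, t0} = e then Poly_Mapping.lookup (SS (s0 # rev (t0 # ts))) w else 0)"
      unfolding SS_rec[OF n] snoc using zero[OF tw]
      by (simp add: lookup_add lookup_sum lookup_append_letter)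
    also have "Poly_Mapping.lookup (SS (s0 # rev (t0 # ts))) w = (if w = map (\<lambda>x. {x, t0}) (s0 # rev ts) then 1 else 0)"
      using Cons.prems(1) by (intro Cons.IH[OF _ tw]) auto
    also have "(if {t1, t0} = e then if w = map (\<lambda>x. {x, t0}) (s0 # rev ts) then 1 else 0 else 0) =
        (if \<iota> = map (\<lambda>x. {x, t0}) (s0 # rev (t1 # ts)) then 1 else (0 :: int))"
      by (auto simp: snoc)
    finally show ?thesis .
  qed
qed

context fd_steinberg
begin

lemma span_uminus: "span {- x} = span {x}"
proof -
  have "x \<in> span {- x}" using span_neg[OF span_base[of "- x" "{- x}"]] by simp
  moreover have "- x \<in> span {x}" by (rule span_neg) (simp add: span_base)
  ultimately show ?thesis by (intro equalityI span_minimal) auto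
qed

lemma edge_vector_cases: "edge_vector u {i, j} = u ! i - u ! j \<or> edge_vector u {i, j} = - (u ! i - u ! j)"
  by (cases "i \<le> j") (auto simp: edge_vector_def)

lemma span_edge_vector: "span {edge_vector u {i, j}} = span {u ! i - u ! j}"
  using edge_vector_cases[of u i j] span_uminus[of "u ! i - u ! j"] by metis

text \<open>Edges count only through the lines that they span. Different words can become equal, and
  their coefficients then add up.\<close>

definition lines :: "'b list \<Rightarrow> (nat set list \<Rightarrow>\<^sub>0 int) \<Rightarrow> ('b set list \<Rightarrow>\<^sub>0 int)" where
  "lines u p = frag_extend (\<lambda>\<iota>. frag_of (map (\<lambda>e. span {edge_vector u e}) \<iota>)) p"

lemma lines_append_letter:
  "lines u (append_letter p e) = frag_extend (\<lambda>\<iota>. frag_of (map (\<lambda>e. span {edge_vector u e}) \<iota> @ [span {edge_vector u e}])) p"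
  using frag_extend_compose[of "\<lambda>\<iota>. frag_of (map (\<lambda>e. span {edge_vector u e}) \<iota>)" "\<lambda>w. w @ [e]" p]
  by (simp add: lines_def append_letter_def o_def)

lemma lookup_lines_append_letter:
  "Poly_Mapping.lookup (lines u (append_letter p e)) (l @ [S]) =
    (if span {edge_vector u e} = S then Poly_Mapping.lookup (lines u p) l else 0)"
  "Poly_Mapping.lookup (lines u (append_letter p e)) [] = 0"
  unfolding lines_append_letter by (simp_all add: frag_lookup_snoc frag_lookup_snoc_Nil lines_def)

lemma lines_linear:
  "lines u (p + q) = lines u p + lines u q" "lines u (p - q) = lines u p - lines u q"
  "finite I \<Longrightarrow> lines u (sum f I) = (\<Sum>i\<in>I. lines u (f i))"
  by (simp_all add: lines_def frag_extend_add frag_extend_diff frag_extend_sum o_def)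

lemma coeff_singleton: "coeff [w] v = (if \<exists>x. v = [x] \<and> span {x} = span {w} then 1 else 0)"
proof -
  have "coeff [w] v = (if fl [w] = fl v then 1 else 0)"
    by (simp add: coeff_def ins_def lookup_single when_def)
  also have "fl [w] = fl v \<longleftrightarrow> (\<exists>x. v = [x] \<and> span {x} = span {w})"
  proof
    assume f: "fl [w] = fl v"
    have "length v = 1" using fl_eqD(1)[OF f] by simp
    then obtain x where x: "v = [x]" by (auto simp: length_Suc_conv)
    have "span {x} = span {w}" using fl_eqD(3)[OF f] unfolding x by simp
    thus "\<exists>x. v = [x] \<and> span {x} = span {w}" using x by blast
  next
    assume "\<exists>x. v = [x] \<and> span {x} = span {w}"
    thus "fl [w] = fl v" by (elim exE conjE) (simp add: fl_def)
  qed
  finally show ?thesis .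
qed

text \<open>Once edges are replaced by their lines, \<open>SS_rec\<close> and
  \<open>coeff_path_recursion\<close> are the same recursion, with the polynomial of a single letter
  as common start. For \<open>v = []\<close> both sides vanish.\<close>

theorem SS_coefficient:
  assumes "t \<noteq> []" "indep (map (\<lambda>i. u ! i - u ! s0) t)"
  shows "of_int (Poly_Mapping.lookup (lines u (SS (s0 # rev t))) (map (\<lambda>x. span {x}) v)) =
    rev_sign (length t) * coeff (map (\<lambda>i. u ! i - u ! s0) t) v * coeff (path (u ! s0) (map ((!) u) t)) (rev v)"
  using assms
proof (induction "length t" arbitrary: t v rule: less_induct)
  case less
  show ?case
  proof (cases "length t \<ge> 2")
    case False
    then obtain i where t: "t = [i]" using length_cases less.prems(1) by blast
    have "lines u (SS (s0 # rev t)) = frag_of [span {u ! i - u ! s0}]"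
      using span_edge_vector[of u i s0] by (simp add: t lines_def SS_pair insert_commute)
    thus ?thesis by (cases v) (auto simp: t coeff_singleton rev_sign_def)
  next
    case True
    let ?n = "length t"
    let ?r = "u ! s0" and ?y = "map ((!) u) t"
    define E where "E y' v = rev_sign (length y') * coeff (map (\<lambda>p. p - ?r) y') v * coeff (path ?r y') (rev v)" for y' v
    have nz: "{..<?n} = insert 0 {1..?n - 1}" using True by auto
    have IH: "of_int (Poly_Mapping.lookup (lines u (SS (s0 # rev (delete_nth i t)))) (map (\<lambda>x. span {x}) v)) =
        E (delete_nth i ?y) v" if "i < ?n" for i v
    proof -
      have "of_int (Poly_Mapping.lookup (lines u (SS (s0 # rev (delete_nth i t)))) (map (\<lambda>x. span {x}) v)) =
        rev_sign (length (delete_nth i t)) * coeff (map (\<lambda>i. u ! i - u ! s0) (delete_nth i t)) v *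
        coeff (path (u ! s0) (map ((!) u) (delete_nth i t))) (rev v)"
      proof (rule less.hyps)
        show "length (delete_nth i t) < length t" using that by simp
        have "length (delete_nth i t) \<noteq> 0" using that True by simp
        thus "delete_nth i t \<noteq> []" by auto
        show "indep (map (\<lambda>i. u ! i - u ! s0) (delete_nth i t))"
          using indep_delete_nth[OF less.prems(2)] by (simp add: map_delete_nth)
      qed
      thus ?thesis using that by (simp add: E_def map_delete_nth[symmetric] o_def)
    qed
    have goal: "rev_sign ?n * coeff (map (\<lambda>i. u ! i - u ! s0) t) v * coeff (path ?r ?y) (rev v) = E ?y v" for v
      by (simp add: E_def o_def)
    show ?thesis
    proof (cases v rule: rev_cases)
      case Nil
      have "coeff (map (\<lambda>i. u ! i - u ! s0) t) [] = 0" using less.prems(1) by (simp add: coeff_Nil)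
      thus ?thesis unfolding SS_rec[OF True] Nil
        by (simp add: lines_linear lookup_add lookup_sum lookup_minus lookup_lines_append_letter)
    next
      case (snoc v0 w)
      let ?b = "path ?r ?y"
      let ?l = "\<lambda>i. Poly_Mapping.lookup (lines u (SS (s0 # rev (delete_nth i t)))) (map (\<lambda>x. span {x}) v0)"
      have b: "span {edge_vector u (if j = 0 then {s0, t ! 0} else {t ! j, t ! (j - 1)})} = span {?b ! j}" if "j < ?n" for j
        using that span_edge_vector[of u "t ! 0" s0] span_edge_vector[of u "t ! j" "t ! (j - 1)"]
        by (auto simp: path_nth insert_commute)
      have "Poly_Mapping.lookup (lines u (SS (s0 # rev t))) (map (\<lambda>x. span {x}) v) =
        (if span {?b ! 0} = span {w} then ?l 0 else 0) +
        (\<Sum>j\<in>{1..?n - 1}. if span {?b ! j} = span {w} then ?l j - ?l (j - 1) else 0)"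
      proof -
        have s1: "span {edge_vector u {s0, t ! 0}} = span {?b ! 0}"
        proof -
          have "0 < ?n" using True by linarith
          from b[OF this] show ?thesis by simp
        qed
        have s2: "span {edge_vector u {t ! j, t ! (j - 1)}} = span {?b ! j}" if "j \<in> {1..?n - 1}" for j
          using b[of j] that by auto
        show ?thesis unfolding SS_rec[OF True] snoc
          by (auto simp: lines_linear lookup_add lookup_sum lookup_minus lookup_lines_append_letter s1 s2
            intro!: sum.cong simp del: One_nat_def)
      qed
      hence "of_int (Poly_Mapping.lookup (lines u (SS (s0 # rev t))) (map (\<lambda>x. span {x}) v)) =
        (if span {?b ! 0} = span {w} then of_int (?l 0) else 0) +
        (\<Sum>j\<in>{1..?n - 1}. if span {?b ! j} = span {w} then of_int (?l j) - of_int (?l (j - 1)) else (0 :: rat))"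
        by (simp add: if_distrib[of of_int] cong: if_cong)
      also have "\<dots> = (\<Sum>j<?n. if span {?b ! j} = span {w}
          then E (delete_nth j ?y) v0 - (if j = 0 then 0 else E (delete_nth (j - 1) ?y) v0) else 0)"
      proof -
        have l: "of_int (?l i) = E (delete_nth i ?y) v0" if "i < ?n" for i by (rule IH[OF that])
        have "(if span {?b ! 0} = span {w} then of_int (?l 0) else 0) =
          (if span {?b ! 0} = span {w} then E (delete_nth 0 ?y) v0 - (if (0::nat) = 0 then 0 else E (delete_nth (0 - 1) ?y) v0) else 0)"
        proof -
          have "0 < ?n" using True by linarith
          from l[OF this] show ?thesis by simp
        qed
        moreover have "(\<Sum>j\<in>{1..?n - 1}. if span {?b ! j} = span {w} then of_int (?l j) - of_int (?l (j - 1)) else (0 :: rat)) =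
          (\<Sum>j\<in>{1..?n - 1}. if span {?b ! j} = span {w}
            then E (delete_nth j ?y) v0 - (if j = 0 then 0 else E (delete_nth (j - 1) ?y) v0) else 0)"
        proof (rule sum.cong[OF refl])
          fix j assume "j \<in> {1..?n - 1}"
          hence "j < ?n" "j - 1 < ?n" "j \<noteq> 0" using True by auto
          thus "(if span {?b ! j} = span {w} then of_int (?l j) - of_int (?l (j - 1)) else (0 :: rat)) =
            (if span {?b ! j} = span {w}
            then E (delete_nth j ?y) v0 - (if j = 0 then 0 else E (delete_nth (j - 1) ?y) v0) else 0)"
            by (simp only: l if_False)
        qed
        ultimately show ?thesis unfolding nz by (subst sum.insert) simp_all
      qed
      also have "\<dots> = E ?y v"
        unfolding snoc E_def
        using coeff_path_recursion[of ?r ?y v0 w] less.prems by (simp add: o_def)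
      finally show ?thesis unfolding goal .
    qed
  qed
qed

lemma SS_spanning:
  assumes "t \<noteq> []" "distinct (s0 # t)" "\<iota> \<in> Poly_Mapping.keys (SS (s0 # rev t))"
  shows "spn (map (edge_vector u) \<iota>) = spn (map (\<lambda>i. u ! i - u ! s0) t)"
  using assms
proof (induction "length t" arbitrary: t \<iota> rule: less_induct)
  case less
  show ?case
  proof (cases "length t \<ge> 2")
    case False
    then obtain i where t: "t = [i]" using length_cases less.prems(1) by blast
    hence "\<iota> = [{s0, i}]" using less.prems by (simp add: SS_pair keys_frag_of)
    thus ?thesis using span_edge_vector[of u i s0] t by (simp add: insert_commute)
  next
    case True
    from SS_keys_rec[OF True less.prems(3)] obtain w j i where
      w: "\<iota> = w @ [if j = 0 then {s0, t ! 0} else {t ! j, t ! (j - 1)}]" "j < length t"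
      "i = j \<or> (j > 0 \<and> i = j - 1)" "w \<in> Poly_Mapping.keys (SS (s0 # rev (delete_nth i t)))" .
    let ?r = "u ! s0" and ?y = "map ((!) u) t"
    let ?e = "if j = 0 then {s0, t ! 0} else {t ! j, t ! (j - 1)}"
    have i: "i < length t" "i \<in> near j" using w by (auto simp: near_def)
    have "spn (map (edge_vector u) w) = spn (map (\<lambda>i. u ! i - u ! s0) (delete_nth i t))"
    proof (rule less.hyps[OF _ _ _ w(4)])
      show "length (delete_nth i t) < length t" using i by simp
      have "length (delete_nth i t) \<noteq> 0" using i True by simp
      thus "delete_nth i t \<noteq> []" by auto
      show "distinct (s0 # delete_nth i t)"
        using less.prems(2) set_delete_nth_subset[of i t]
        by (auto simp: delete_nth_def set_take_disj_set_drop_if_distinct)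
    qed
    moreover have "span {edge_vector u ?e} = span {path ?r ?y ! j}"
      using w(2) span_edge_vector[of u "t ! 0" s0] span_edge_vector[of u "t ! j" "t ! (j - 1)"]
      by (auto simp: path_nth insert_commute)
    ultimately have "{p + q |p q. p \<in> span {edge_vector u ?e} \<and> q \<in> spn (map (edge_vector u) w)} =
      {p + q |p q. p \<in> span {path ?r ?y ! j} \<and> q \<in> spn (map (\<lambda>p. p - ?r) (delete_nth i ?y))}"
      by (simp add: map_delete_nth[symmetric] o_def)
    hence "span ({edge_vector u ?e} \<union> set (map (edge_vector u) w)) =
      span ({path ?r ?y ! j} \<union> set (map (\<lambda>p. p - ?r) (delete_nth i ?y)))"
      by (simp only: span_Un)
    also have "\<dots> = spn (map (\<lambda>p. p - ?r) ?y)"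
      using span_insert_edge[of j ?y i ?r] w(2) i(2) by simp
    finally show ?thesis unfolding w(1) by (simp add: o_def)
  qed
qed

end

section \<open>Decomposition operators as sums over frames\<close>

locale pos_steinberg = fd_steinberg +
  assumes dim_pos: "dim UNIV > 0"
begin

definition fst_tuple :: "'b list \<Rightarrow> 'b list" where
  "fst_tuple u = map (\<lambda>x. x - hd u) (rev (tl u))"

definition snd_tuple :: "'b list \<Rightarrow> 'b list" where
  "snd_tuple u = path (hd u) (rev (tl u))"

lemma spn_fst_tuple_Cons: "spn (fst_tuple (r # xs)) = span ((\<lambda>x. x - r) ` set xs)"
  by (simp add: fst_tuple_def)

lemma spn_snd_tuple: "spn (snd_tuple u) = spn (fst_tuple u)"
  by (simp add: fst_tuple_def snd_tuple_def spn_path)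

lemma length_fst_tuple [simp]: "length (fst_tuple u) = length u - 1"
  and length_snd_tuple [simp]: "length (snd_tuple u) = length u - 1"
  by (simp_all add: fst_tuple_def snd_tuple_def)

lemma affine_basis_iff: "affine_basis u \<longleftrightarrow> u \<noteq> [] \<and> basis_tuple UNIV (fst_tuple u)"
proof -
  have "indep (map (\<lambda>x. x - hd u) (tl u)) \<longleftrightarrow> indep (fst_tuple u)"
    by (rule indep_mset) (simp add: fst_tuple_def mset_map)
  thus ?thesis by (simp add: affine_basis_def basis_tuple_iff fst_tuple_def)
qed

lemma length_affine: "affine_basis u \<Longrightarrow> length u = Suc (dim UNIV)"
  using length_basis_tuple[of UNIV "fst_tuple u"] by (cases u) (auto simp: affine_basis_iff)

lemma affine_basis_dim: "affine_basis u \<longleftrightarrow> length u = Suc (dim UNIV) \<and> spn (fst_tuple u) = UNIV"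
proof
  assume "length u = Suc (dim UNIV) \<and> spn (fst_tuple u) = UNIV"
  thus "affine_basis u" unfolding affine_basis_iff
    by (intro conjI indep_spanning) auto
qed (auto simp: length_affine affine_basis_iff basis_tuple_iff)

lemma basis_fst_tuple_snd_tuple:
  assumes "affine_basis u"
  shows "basis_tuple UNIV (fst_tuple u)" "basis_tuple UNIV (snd_tuple u)"
  using assms indep_cong[OF spn_snd_tuple[of u]] by (auto simp: affine_basis_iff basis_tuple_iff spn_snd_tuple)

lemma affine_indices:
  assumes u: "affine_basis u"
  defines "t \<equiv> rev [1..<length u]"
  shows "t \<noteq> []" "distinct (0 # t)" "[0..<length u] = 0 # rev t" "map ((!) u) t = rev (tl u)"
    "set (0 # t) = {..<length u}" "length t = dim UNIV" "u ! 0 = hd u"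
    "map (\<lambda>i. u ! i - u ! 0) t = fst_tuple u" "path (u ! 0) (map ((!) u) t) = snd_tuple u"
proof -
  have l: "length u = Suc (dim UNIV)" by (rule length_affine[OF u])
  show "t \<noteq> []" "length t = dim UNIV" using l dim_pos by (auto simp: t_def)
  show "distinct (0 # t)" by (simp add: t_def)
  show "[0..<length u] = 0 # rev t" using l by (simp add: t_def upt_rec[of 0] del: upt_Suc)
  show u0: "u ! 0 = hd u" using l by (cases u) auto
  show m: "map ((!) u) t = rev (tl u)"
  proof -
    have "map ((!) u) [1..<length u] = tl u"
      using l by (intro nth_equalityI) (auto simp: nth_tl simp del: upt_Suc)
    thus ?thesis unfolding t_def rev_map[symmetric] by simp
  qed
  show "set (0 # t) = {..<length u}" using l by (auto simp: t_def)
  have "map (\<lambda>i. u ! i - u ! 0) t = map (\<lambda>x. x - u ! 0) (map ((!) u) t)" by simp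
  thus "map (\<lambda>i. u ! i - u ! 0) t = fst_tuple u" unfolding m u0 fst_tuple_def .
  show "path (u ! 0) (map ((!) u) t) = snd_tuple u" unfolding m u0 snd_tuple_def ..
qed

definition rescale :: "('b \<Rightarrow> 'a) \<Rightarrow> 'b \<Rightarrow> 'b" where
  "rescale h x = inverse (h x) *s x"

definition words :: "('b \<Rightarrow> 'a) \<Rightarrow> 'b list \<Rightarrow> nat set list set" where
  "words h u = {\<iota> \<in> Poly_Mapping.keys (SS [0..<length u]). \<forall>e\<in>set \<iota>. h (edge_vector u e) \<noteq> 0}"

definition D_poly :: "('b \<Rightarrow> 'a) \<Rightarrow> 'b list \<Rightarrow> ('b list \<Rightarrow>\<^sub>0 rat)" where
  "D_poly h u = (\<Sum>\<iota>\<in>words h u. Poly_Mapping.single (0 # map (\<lambda>e. rescale h (edge_vector u e)) \<iota>)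
     (of_int (Poly_Mapping.lookup (SS [0..<length u]) \<iota>)))"

lemma finite_words: "finite (words h u)"
  by (simp add: words_def)

lemma spn_map_cong:
  assumes "\<And>e. e \<in> set l \<Longrightarrow> span {f e} = span {g e}"
  shows "spn (map f l) = spn (map g l)"
proof -
  have 1: "spn (map f l) \<subseteq> spn (map g l)" if "\<And>e. e \<in> set l \<Longrightarrow> span {f e} = span {g e}" for f g
  proof (rule spn_subset, rule subsetI)
    fix x assume "x \<in> set (map f l)"
    then obtain e where e: "e \<in> set l" "x = f e" by auto
    have "f e \<in> span {g e}" using that[OF e(1)] span_base[of "f e" "{f e}"] by simp
    also have "span {g e} \<subseteq> spn (map g l)" using e(1) by (intro span_mono) auto
    finally show "x \<in> spn (map g l)" using e(2) by simp
  qed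
  show ?thesis using 1[of f g] 1[of g f] assms by blast
qed

lemma SS_word:
  assumes u: "affine_basis u" and \<iota>: "\<iota> \<in> Poly_Mapping.keys (SS [0..<length u])"
  shows "length \<iota> = dim UNIV" "spn (map (edge_vector u) \<iota>) = UNIV"
    "e \<in> set \<iota> \<Longrightarrow> \<exists>i j. e = {i, j} \<and> i \<noteq> j \<and> i < length u \<and> j < length u"
proof -
  note t = affine_indices[OF u]
  have \<iota>': "\<iota> \<in> Poly_Mapping.keys (SS (0 # rev (rev [1..<length u])))" using \<iota> unfolding t(3)[symmetric] .
  note k = SS_keys[OF t(1,2) \<iota>']
  show "length \<iota> = dim UNIV" using k t(6) by simp
  show "spn (map (edge_vector u) \<iota>) = UNIV"
    unfolding SS_spanning[OF t(1,2) \<iota>'] t(8) using u by (simp add: affine_basis_dim)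
  show "\<exists>i j. e = {i, j} \<and> i \<noteq> j \<and> i < length u \<and> j < length u" if "e \<in> set \<iota>"
    using bspec[OF conjunct2[OF k] that] unfolding t(5) by auto
qed

context
  fixes h assumes h: "h \<in> Dec"
begin

lemma rescale_props:
  assumes "h x \<noteq> 0"
  shows "h (rescale h x) = 1" "span {rescale h x} = span {x}"
proof -
  show "h (rescale h x) = 1" using assms by (simp add: rescale_def h_linear[OF h])
  show "span {rescale h x} = span {x}"
  proof (intro equalityI span_minimal)
    show "{rescale h x} \<subseteq> span {x}" by (auto simp: rescale_def intro: span_scale span_base)
    have "x = h x *s rescale h x" using assms by (simp add: rescale_def)
    moreover have "h x *s rescale h x \<in> span {rescale h x}" by (intro span_scale span_base) simp
    ultimately show "{x} \<subseteq> span {rescale h x}" by simp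
  qed auto
qed

lemma rescale_eq_iff:
  assumes x: "h x = 1"
  shows "h y \<noteq> 0 \<and> rescale h y = x \<longleftrightarrow> span {y} = span {x}"
proof
  assume "span {y} = span {x}"
  hence "y \<in> span {x}" using span_base[of y "{y}"] by simp
  then obtain c where c: "y = c *s x" by (auto simp: span_singleton)
  have "c \<noteq> 0"
  proof
    assume "c = 0"
    hence "y = 0" using c by simp
    hence "x \<in> span {0}" using span_base[of x "{x}"] \<open>span {y} = span {x}\<close> by blast
    hence "x = 0" by simp
    thus False using x by (simp add: h_linear[OF h])
  qed
  thus "h y \<noteq> 0 \<and> rescale h y = x" using c x by (simp add: rescale_def h_linear[OF h])
qed (use rescale_props(2) in auto)

lemma word_normal_frame:
  assumes u: "affine_basis u" and \<iota>: "\<iota> \<in> words h u"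
  shows "normal_frame h (map (\<lambda>e. rescale h (edge_vector u e)) \<iota>)"
proof -
  have k: "\<iota> \<in> Poly_Mapping.keys (SS [0..<length u])" and nz: "\<And>e. e \<in> set \<iota> \<Longrightarrow> h (edge_vector u e) \<noteq> 0"
    using \<iota> by (auto simp: words_def)
  have "spn (map (\<lambda>e. rescale h (edge_vector u e)) \<iota>) = spn (map (edge_vector u) \<iota>)"
    by (rule spn_map_cong) (rule rescale_props(2)[OF nz])
  hence "basis_tuple UNIV (map (\<lambda>e. rescale h (edge_vector u e)) \<iota>)"
    using SS_word(1,2)[OF u k] by (intro indep_spanning) auto
  thus ?thesis using rescale_props(1)[OF nz] by (auto simp: normal_frame_def)
qed

lemma keys_D_poly: "affine_basis u \<Longrightarrow> Poly_Mapping.keys (D_poly h u) \<subseteq> Collect affine_basis"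
proof
  fix l assume u: "affine_basis u" and "l \<in> Poly_Mapping.keys (D_poly h u)"
  from subsetD[OF keys_sum this(2)[unfolded D_poly_def]] obtain \<iota> where \<iota>: "\<iota> \<in> words h u"
    "l \<in> Poly_Mapping.keys (Poly_Mapping.single (0 # map (\<lambda>e. rescale h (edge_vector u e)) \<iota>)
       (of_int (Poly_Mapping.lookup (SS [0..<length u]) \<iota>) :: rat))" by blast
  hence "l = 0 # map (\<lambda>e. rescale h (edge_vector u e)) \<iota>" by (simp split: if_splits)
  thus "l \<in> Collect affine_basis" using word_normal_frame[OF u \<iota>(1)] by (simp add: affine_basis_0 normal_frame_def)
qed

lemma frame_sum_symbol:
  assumes u: "affine_basis u"
  shows "frame_sum h (ap (fst_tuple u)) (ap (snd_tuple u)) = D_poly h u"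
proof (rule poly_mapping_eqI)
  fix l
  let ?S = "SS [0..<length u]" and ?w = "\<lambda>\<iota>. map (\<lambda>e. rescale h (edge_vector u e)) \<iota>"
  note t = affine_indices[OF u]
  have D: "Poly_Mapping.lookup (D_poly h u) l =
    (\<Sum>\<iota>\<in>words h u. if 0 # ?w \<iota> = l then of_int (Poly_Mapping.lookup ?S \<iota>) else 0)"
    unfolding D_poly_def lookup_sum by (rule sum.cong) (auto simp: lookup_single when_def)
  show "Poly_Mapping.lookup (frame_sum h (ap (fst_tuple u)) (ap (snd_tuple u))) l = Poly_Mapping.lookup (D_poly h u) l"
  proof (cases "l \<noteq> [] \<and> hd l = 0 \<and> normal_frame h (tl l)")
    case False
    have "0 # ?w \<iota> \<noteq> l" if "\<iota> \<in> words h u" for \<iota>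
      using word_normal_frame[OF u that] False by auto
    hence "Poly_Mapping.lookup (D_poly h u) l = 0" unfolding D by (intro sum.neutral) auto
    thus ?thesis unfolding lookup_frame_sum[OF h] by (simp only: False if_False)
  next
    case True
    then obtain v where l: "l = 0 # v" and v: "normal_frame h v" by (cases l) auto
    have bv: "length v = dim UNIV" "spn v = UNIV" and hv: "\<And>x. x \<in> set v \<Longrightarrow> h x = 1"
      using v by (auto simp: normal_frame_def basis_tuple_iff intro: length_basis_tuple)
    have set_eq: "{\<iota> \<in> words h u. 0 # ?w \<iota> = l} =
      {\<iota> \<in> Poly_Mapping.keys ?S. map (\<lambda>e. span {edge_vector u e}) \<iota> = map (\<lambda>x. span {x}) v}"
    proof -
      have "(\<forall>e\<in>set \<iota>. h (edge_vector u e) \<noteq> 0) \<and> ?w \<iota> = v \<longleftrightarrow>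
        map (\<lambda>e. span {edge_vector u e}) \<iota> = map (\<lambda>x. span {x}) v" for \<iota>
        using hv
      proof (induction \<iota> arbitrary: v)
        case Nil
        thus ?case by auto
      next
        case (Cons e \<iota> v)
        show ?case
        proof (cases v)
          case (Cons x v')
          have "(\<forall>e\<in>set \<iota>. h (edge_vector u e) \<noteq> 0) \<and> ?w \<iota> = v' \<longleftrightarrow>
            map (\<lambda>e. span {edge_vector u e}) \<iota> = map (\<lambda>x. span {x}) v'"
            using Cons.prems Cons by (intro Cons.IH) simp
          moreover have "h (edge_vector u e) \<noteq> 0 \<and> rescale h (edge_vector u e) = x \<longleftrightarrow> span {edge_vector u e} = span {x}"
            using Cons.prems Cons by (intro rescale_eq_iff) simp
          ultimately show ?thesis unfolding Cons list.map list.inject by (simp only: list.set ball_simps) blast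
        qed simp
      qed
      thus ?thesis unfolding words_def l by auto
    qed
    have "Poly_Mapping.lookup (D_poly h u) l = (\<Sum>\<iota>\<in>{\<iota> \<in> words h u. 0 # ?w \<iota> = l}. of_int (Poly_Mapping.lookup ?S \<iota>))"
      unfolding D using finite_words by (simp add: sum.If_cases Int_def)
    also have "\<dots> = of_int (Poly_Mapping.lookup (lines u ?S) (map (\<lambda>x. span {x}) v))"
      unfolding set_eq lines_def frag_lookup_extend by simp
    also have "\<dots> = rev_sign (dim UNIV) * coeff (fst_tuple u) v * coeff (snd_tuple u) (rev v)"
      using SS_coefficient[OF t(1), of u 0 v] basis_fst_tuple_snd_tuple(1)[OF u]
      unfolding t(3)[symmetric] t(6) t(8) t(9) by (simp add: basis_tuple_iff)
    also have "coeff (fst_tuple u) v = Poly_Mapping.lookup (ap (fst_tuple u)) (flag v)"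
      using basis_fst_tuple_snd_tuple(1)[OF u] length_basis_tuple[OF basis_fst_tuple_snd_tuple(1)[OF u]] bv
      by (intro lookup_ap[symmetric]) (auto simp: basis_tuple_iff)
    also have "coeff (snd_tuple u) (rev v) = Poly_Mapping.lookup (ap (snd_tuple u)) (flag (rev v))"
      using basis_fst_tuple_snd_tuple(2)[OF u] length_basis_tuple[OF basis_fst_tuple_snd_tuple(2)[OF u]] bv
      by (intro lookup_ap[symmetric]) (auto simp: basis_tuple_iff)
    finally show ?thesis unfolding lookup_frame_sum[OF h] using v by (simp add: l)
  qed
qed

lemma D_poly_single:
  assumes sub: "words h u \<subseteq> {\<iota>}" and nz: "\<And>e. e \<in> set \<iota> \<Longrightarrow> h (edge_vector u e) \<noteq> 0"
    and one: "Poly_Mapping.lookup (SS [0..<length u]) \<iota> = 1"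
  shows "D_poly h u = psingle (0 # map (\<lambda>e. rescale h (edge_vector u e)) \<iota>)"
proof -
  have "words h u = {\<iota>}" using sub nz one by (auto simp: words_def in_keys_iff)
  thus ?thesis by (simp add: D_poly_def one)
qed

lemma rescale_edge:
  assumes "h (u ! i - u ! j) = 1"
  shows "rescale h (edge_vector u {i, j}) = u ! i - u ! j" "h (edge_vector u {i, j}) \<noteq> 0"
  using edge_vector_cases[of u i j] assms h_linear(5)[OF h, of "u ! i - u ! j"]
  by (auto simp: rescale_def simp del: minus_diff_eq)

lemma h_edge_zero: "h (u ! i) = h (u ! j) \<Longrightarrow> h (edge_vector u {i, j}) = 0"
  using edge_vector_cases[of u i j] by (auto simp: h_linear[OF h] simp del: minus_diff_eq)

lemma D_poly_normal_frame:
  assumes v: "normal_frame h v"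
  shows "D_poly h (0 # v) = psingle (0 # v)"
proof -
  let ?u = "0 # v" and ?\<iota> = "map (\<lambda>x. {0, x}) [1..<length (0 # v)]"
  have u: "affine_basis ?u" using v by (simp add: affine_basis_0 normal_frame_def)
  note t = affine_indices[OF u]
  have hu: "h (?u ! i) = 1" if "0 < i" "i < length ?u" for i
    using that v by (cases i) (auto simp: normal_frame_def)
  have "words h ?u \<subseteq> {?\<iota>}"
  proof
    fix \<iota> assume \<iota>: "\<iota> \<in> words h ?u"
    hence k: "\<iota> \<in> Poly_Mapping.keys (SS [0..<length ?u])" by (simp add: words_def)
    have "0 \<in> e" if e: "e \<in> set \<iota>" for e
    proof (rule ccontr)
      assume "0 \<notin> e"
      obtain i j where ij: "e = {i, j}" "i < length ?u" "j < length ?u" using SS_word(3)[OF u k e] by blast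
      have "0 < i" "0 < j" using \<open>0 \<notin> e\<close> ij(1) by auto
      hence "h (edge_vector ?u e) = 0" unfolding ij(1)
        using hu ij(2,3) by (intro h_edge_zero) (simp only:)
      thus False using \<iota> e by (auto simp: words_def)
    qed
    from SS_through_first[OF t(1,2) this] k show "\<iota> \<in> {?\<iota>}"
      unfolding t(3)[symmetric] by (auto simp: in_keys_iff split: if_splits)
  qed
  moreover have e: "rescale h (edge_vector ?u {0, i}) = ?u ! i" "h (edge_vector ?u {0, i}) \<noteq> 0"
    if "0 < i" "i < length ?u" for i
    using rescale_edge[of ?u i 0] hu[OF that] unfolding insert_commute[of 0 i "{}"] by auto
  moreover have "Poly_Mapping.lookup (SS [0..<length ?u]) ?\<iota> = 1"
    using SS_through_first[OF t(1,2), of ?\<iota>] unfolding t(3)[symmetric] by (auto simp del: upt_Suc)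
  ultimately have "D_poly h ?u = psingle (0 # map (\<lambda>e. rescale h (edge_vector ?u e)) ?\<iota>)"
    by (intro D_poly_single) (auto simp del: upt_Suc)
  also have "map (\<lambda>e. rescale h (edge_vector ?u e)) ?\<iota> = map ((!) ?u) [1..<length ?u]"
    using e by (auto simp del: upt_Suc)
  also have "\<dots> = v" using t(4) by (simp add: rev_map[symmetric] del: upt_Suc)
  finally show ?thesis .
qed

lemma D_poly_last:
  assumes u: "affine_basis (xs @ [x])" and hx: "\<And>z. z \<in> set xs \<Longrightarrow> h (z - x) = 1"
  shows "D_poly h (xs @ [x]) = psingle (0 # map (\<lambda>z. z - x) xs)"
proof -
  let ?u = "xs @ [x]" and ?n = "length xs"
  let ?\<iota> = "map (\<lambda>i. {i, ?n}) [0..<?n]"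
  note t = affine_indices[OF u]
  have n: "?n > 0" using length_affine[OF u] dim_pos by simp
  hence n1: "1 \<le> ?n" by linarith
  have te: "rev [1..<length ?u] = ?n # rev [1..<?n]" using n1 by simp
  have te': "0 # rev (rev [1..<?n]) = [0..<?n]" using n by (simp add: upt_rec[of 0])
  have hu: "h (?u ! i - ?u ! ?n) = 1" if "i < ?n" for i
    using that hx by (auto simp: nth_append)
  have nn: "?u ! ?n = x" by simp
  have hu': "h (?u ! i) = 1 + h x" if "i < ?n" for i
    using hu[OF that] unfolding nn h_linear[OF h] by (simp add: algebra_simps)
  have th: "Poly_Mapping.lookup (SS [0..<length ?u]) \<iota> = (if \<iota> = ?\<iota> then 1 else 0)"
    if "\<And>e. e \<in> set \<iota> \<Longrightarrow> ?n \<in> e" for \<iota>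
    using SS_through_last[of 0 ?n "rev [1..<?n]" \<iota>] that n
    unfolding t(3) te te' by auto
  have "words h ?u \<subseteq> {?\<iota>}"
  proof
    fix \<iota> assume \<iota>: "\<iota> \<in> words h ?u"
    hence k: "\<iota> \<in> Poly_Mapping.keys (SS [0..<length ?u])" by (simp add: words_def)
    have "?n \<in> e" if e: "e \<in> set \<iota>" for e
    proof (rule ccontr)
      assume ne: "?n \<notin> e"
      obtain i j where ij: "e = {i, j}" "i < length ?u" "j < length ?u" using SS_word(3)[OF u k e] by blast
      have "i < ?n" "j < ?n" using ne ij by (auto simp: less_Suc_eq)
      hence "h (edge_vector ?u e) = 0" unfolding ij(1)
        by (intro h_edge_zero) (simp only: hu')
      thus False using \<iota> e by (auto simp: words_def)
    qed
    from th[OF this] k show "\<iota> \<in> {?\<iota>}"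
      by (auto simp: in_keys_iff split: if_splits)
  qed
  moreover have e: "rescale h (edge_vector ?u {i, ?n}) = ?u ! i - x" "h (edge_vector ?u {i, ?n}) \<noteq> 0"
    if "i < ?n" for i
    using rescale_edge[OF hu[OF that]] unfolding nn by blast+
  moreover have "Poly_Mapping.lookup (SS [0..<length ?u]) ?\<iota> = 1"
    using th[of ?\<iota>] by auto
  ultimately have "D_poly h ?u = psingle (0 # map (\<lambda>e. rescale h (edge_vector ?u e)) ?\<iota>)"
    by (intro D_poly_single) auto
  also have "map (\<lambda>e. rescale h (edge_vector ?u e)) ?\<iota> = map (\<lambda>z. z - x) xs"
  proof (rule nth_equalityI)
    fix i assume "i < length (map (\<lambda>e. rescale h (edge_vector ?u e)) ?\<iota>)"
    hence i: "i < ?n" by simp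
    thus "map (\<lambda>e. rescale h (edge_vector ?u e)) ?\<iota> ! i = map (\<lambda>z. z - x) xs ! i"
      using e(1)[OF i] by (simp add: nth_append)
  qed simp
  finally show ?thesis .
qed

end

end

lemma exists_map_with_kernel:
  fixes K :: "('x \<Rightarrow>\<^sub>0 rat) set"
  assumes "pm.subspace K"
  shows "\<exists>\<kappa> :: ('x \<Rightarrow>\<^sub>0 rat) \<Rightarrow> ('x \<Rightarrow>\<^sub>0 rat). plinear \<kappa> \<and> (\<forall>p. \<kappa> p = 0 \<longleftrightarrow> p \<in> K)"
proof -
  obtain B where B: "B \<subseteq> K" "pm.independent B" "K \<subseteq> pm.span B" using pm.basis_exists by metis
  obtain C where C: "B \<subseteq> C" "pm.independent C" "pm.span C = UNIV"
    using pm.extend_basis_superset[OF B(2)] pm.independent_extend_basis[OF B(2)] pm.span_extend_basis[OF B(2)] by metis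
  obtain \<kappa> where \<kappa>: "plinear \<kappa>" "\<And>b. b \<in> C \<Longrightarrow> \<kappa> b = (if b \<in> B then 0 else b)"
    using pmp.linear_independent_extend[OF C(2), of "\<lambda>b. if b \<in> B then 0 else b"] by metis
  have KB: "K = pm.span B" using B(1,3) pm.span_minimal[OF B(1) assms] by blast
  have zero: "\<kappa> p = 0" if "p \<in> K" for p
    using that unfolding KB
    by (rule pmp.linear_eq_0_on_span[OF \<kappa>(1), rotated]) (use \<kappa>(2) C(1) in auto)
  have "p - \<kappa> p \<in> K" for p
  proof -
    have "p \<in> pm.span C" using C(3) by simp
    thus ?thesis
    proof (induction rule: pm.span_induct_alt)
      case base
      show ?case using pm.subspace_0[OF assms] by (simp add: pmp.linear_0[OF \<kappa>(1)])
    next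
      case (step c x y)
      have "x - \<kappa> x \<in> K" using \<kappa>(2)[OF step(1)] B(1) pm.subspace_0[OF assms] by (cases "x \<in> B") auto
      hence "pscale c (x - \<kappa> x) + (y - \<kappa> y) \<in> K"
        using step(2) by (intro pm.subspace_add[OF assms] pm.subspace_scale[OF assms])
      thus ?case
        by (simp add: pmp.linear_add[OF \<kappa>(1)] pmp.linear_scale[OF \<kappa>(1)] pm.scale_right_diff_distrib algebra_simps)
    qed
  qed
  hence "p \<in> K" if "\<kappa> p = 0" for p using that by (metis diff_zero)
  hence "\<kappa> p = 0 \<longleftrightarrow> p \<in> K" for p by (rule iffI[OF _ zero])
  with \<kappa>(1) show ?thesis by (intro exI[of _ \<kappa>]) simp
qed

section \<open>Formal correlators and the infinite Steinberg module\<close>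

context fd_steinberg
begin

lemma span_diff_subset:
  assumes "y \<in> S"
  shows "span ((\<lambda>x. x - y) ` S) \<subseteq> span ((\<lambda>x. x - r) ` S)"
proof (intro span_minimal subspace_span image_subsetI)
  fix x assume "x \<in> S"
  hence "(x - r) - (y - r) \<in> span ((\<lambda>x. x - r) ` S)" using assms by (intro span_diff span_base imageI)
  thus "x - y \<in> span ((\<lambda>x. x - r) ` S)" by simp
qed

end

context pos_steinberg
begin

lemma affine_basis_set:
  assumes "u \<noteq> []"
  shows "affine_basis u \<longleftrightarrow> length u = Suc (dim UNIV) \<and> span ((\<lambda>x. x - hd u) ` set u) = UNIV"
proof -
  obtain r xs where u: "u = r # xs" using assms by (cases u) auto
  have "span ((\<lambda>x. x - hd u) ` set u) = span (insert 0 ((\<lambda>x. x - r) ` set xs))" by (simp add: u)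
  also have "\<dots> = spn (fst_tuple u)" by (simp add: u spn_fst_tuple_Cons)
  finally show ?thesis by (simp add: affine_basis_dim)
qed

lemma affine_basis_cong:
  assumes "set u = set w" "length u = length w"
  shows "affine_basis u \<longleftrightarrow> affine_basis w"
proof (cases "u = []")
  case True
  thus ?thesis using assms by (simp add: affine_basis_def)
next
  case False
  hence w: "w \<noteq> []" using assms by auto
  have "hd u \<in> set w" "hd w \<in> set w" using False w hd_in_set[of u] assms by auto
  hence "span ((\<lambda>x. x - hd u) ` set w) = span ((\<lambda>x. x - hd w) ` set w)"
    by (intro equalityI span_diff_subset)
  thus ?thesis using False w assms by (simp add: affine_basis_set)
qed

lemma affine_basis_translate: "affine_basis (map (\<lambda>x. x - t) u) \<longleftrightarrow> affine_basis u"
  by (cases u) (auto simp: affine_basis_def o_def)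

lemma FC_relations_keys: "FC_relations \<subseteq> {p. Poly_Mapping.keys p \<subseteq> Collect affine_basis}"
proof -
  note S = subspace_keys[of "Collect affine_basis"]
  have s: "psingle u \<in> {p. Poly_Mapping.keys p \<subseteq> Collect affine_basis}" if "affine_basis u" for u
    using that by simp
  have "affine_basis (x # w)" if "affine_basis (x # xs @ ys)" "w \<in> shuffles xs ys" for x w xs ys
  proof -
    have "set w = set xs \<union> set ys" "length w = length xs + length ys"
      using set_shuffles[OF that(2)] length_shuffles[OF that(2)] by auto
    thus ?thesis using that(1) affine_basis_cong[of "x # w" "x # xs @ ys"] by simp
  qed
  hence sh: "(\<Sum>w\<in>shuffles xs ys. psingle (x # w)) \<in> {p. Poly_Mapping.keys p \<subseteq> Collect affine_basis}"
    if "affine_basis (x # xs @ ys)" for x xs ys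
    using that by (intro pm.subspace_sum[OF S] s)
  have cy: "affine_basis (xs @ [x])" if "affine_basis (x # xs)" for x xs
    using that affine_basis_cong[of "x # xs" "xs @ [x]"] by simp
  show ?thesis
  proof
    fix p assume "p \<in> FC_relations"
    then consider (t) u t where "affine_basis u" "p = psingle u - psingle (map (\<lambda>x. x - t) u)"
      | (c) x xs where "affine_basis (x # xs)" "p = psingle (x # xs) - psingle (xs @ [x])"
      | (s) x xs ys where "affine_basis (x # xs @ ys)" "p = (\<Sum>w\<in>shuffles xs ys. psingle (x # w))"
      unfolding FC_relations_def by blast
    thus "p \<in> {p. Poly_Mapping.keys p \<subseteq> Collect affine_basis}"
    proof cases
      case t
      show ?thesis unfolding t(2) using t(1) by (intro pm.subspace_diff[OF S] s) (simp_all add: affine_basis_translate)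
    next
      case c
      show ?thesis unfolding c(2) using c(1) cy by (intro pm.subspace_diff[OF S] s) simp_all
    next
      case s
      show ?thesis unfolding s(2) by (rule sh[OF s(1)])
    qed
  qed
qed

abbreviation "FC_free \<equiv> free_module (Collect affine_basis)"
abbreviation "FC_cls \<equiv> a_r_coset FC_free FC_hull"

lemma FC_hull_eq: "FC_hull = pm.span FC_relations"
  unfolding FC_hull_def using FC_relations_keys by (rule submodule_hull_free)

lemma shuffle_hull: "pm.span shuffle_relations \<subseteq> FC_hull"
  unfolding FC_hull_eq shuffle_relations_def FC_relations_def by (intro pm.span_mono) blast

lemma qquotient_FC: "qquotient FC_free FC_hull"
proof (rule qquotientI[OF qmodule_free])
  show "submodule FC_hull rat_ring FC_free"
    unfolding FC_hull_def using FC_relations_keys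
    by (intro qmodule.submodule_submodule_hull[OF qmodule_free]) simp
qed

lemma qmodule_FC: "qmodule FC"
  unfolding FC_def by (rule qquotient.qmodule_quot[OF qquotient_FC])

lemma FC_cls_linear: "FC_cls \<in> linear_maps FC_free FC"
  unfolding FC_def by (rule qquotient.quot_linear[OF qquotient_FC])

lemma carrier_FC: "carrier FC = FC_cls ` {p. Poly_Mapping.keys p \<subseteq> Collect affine_basis}"
  unfolding FC_def qquotient.quot_simps[OF qquotient_FC] by simp

lemma FC_cls_zero_iff: "Poly_Mapping.keys p \<subseteq> Collect affine_basis \<Longrightarrow> FC_cls p = \<zero>\<^bsub>FC\<^esub> \<longleftrightarrow> p \<in> FC_hull"
  unfolding FC_def qquotient.quot_simps[OF qquotient_FC]
  by (rule qquotient.coset_eq_zero_iff[OF qquotient_FC]) simp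

lemma D_symbol_eq:
  assumes h: "h \<in> Dec" and u: "affine_basis u"
  shows "D_symbol h u = FC_cls (D_poly h u)"
proof -
  let ?w = "\<lambda>\<iota>. 0 # map (\<lambda>e. rescale h (edge_vector u e)) \<iota>" and ?c = "\<lambda>\<iota>. of_int (Poly_Mapping.lookup (SS [0..<length u]) \<iota>)"
  have aff: "affine_basis (?w \<iota>)" if "\<iota> \<in> words h u" for \<iota>
    using word_normal_frame[OF h u that] by (simp add: affine_basis_0 normal_frame_def)
  have fs: "(\<lambda>\<iota>. Poly_Mapping.single (?w \<iota>) (?c \<iota>)) \<in> words h u \<rightarrow> carrier FC_free"
    using aff by auto
  have "FC_cls (D_poly h u) = FC_cls (\<Oplus>\<^bsub>FC_free\<^esub>\<iota>\<in>words h u. Poly_Mapping.single (?w \<iota>) (?c \<iota>))"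
    unfolding D_poly_def using finsum_free[OF fs] by simp
  also have "\<dots> = (\<Oplus>\<^bsub>FC\<^esub>\<iota>\<in>words h u. FC_cls (Poly_Mapping.single (?w \<iota>) (?c \<iota>)))"
    by (rule linear_maps_finsum[OF qmodule_free qmodule_FC FC_cls_linear fs])
  also have "\<dots> = (\<Oplus>\<^bsub>FC\<^esub>\<iota>\<in>words h u. ?c \<iota> \<odot>\<^bsub>FC\<^esub> FC_symbol (?w \<iota>))"
  proof (rule abelian_monoid.finsum_cong'[OF _ refl])
    have "qmodule FC" by (rule qmodule_FC)
    then interpret qmodule FC .
    show "abelian_monoid FC" by (rule abelian_monoid_axioms)
    have sym: "FC_symbol (?w \<iota>) \<in> carrier FC" if "\<iota> \<in> words h u" for \<iota>
      unfolding FC_symbol_def using aff[OF that] by (intro linear_mapsD(1)[OF FC_cls_linear]) simp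
    show "(\<lambda>\<iota>. ?c \<iota> \<odot>\<^bsub>FC\<^esub> FC_symbol (?w \<iota>)) \<in> words h u \<rightarrow> carrier FC"
      using sym by auto
    fix \<iota> assume "\<iota> \<in> words h u"
    thus "FC_cls (Poly_Mapping.single (?w \<iota>) (?c \<iota>)) = ?c \<iota> \<odot>\<^bsub>FC\<^esub> FC_symbol (?w \<iota>)"
      using linear_mapsD(3)[OF FC_cls_linear, of "psingle (?w \<iota>)" "?c \<iota>"] aff by (simp add: FC_symbol_def)
  qed
  also have "\<dots> = D_symbol h u" by (simp only: D_symbol_def words_def rescale_def)
  finally show ?thesis ..
qed

lemma dim1: "dim UNIV \<ge> 1"
  using dim_pos by simp

lemmas St2_U = qmodule_St2[OF subspace_UNIV dim1]

lemma decomposables_submodule: "submodule decomposables rat_ring (St2 UNIV)"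
  unfolding decomposables_def
proof (rule qmodule.submodule_submodule_hull[OF St2_U], clarify)
  fix V1 V2 x assume d: "(V1, V2) \<in> decompositions" and x: "x \<in> carrier (tensor (St2 V1) (St2 V2))"
  show "concat_product V1 V2 x \<in> carrier (St2 UNIV)"
    using concat_product_spec[OF d] x unfolding concat_spec_def[OF d] by (blast intro: linear_mapsD(1))
qed

lemma qquotient_St: "qquotient (St2 UNIV) decomposables"
  by (rule qquotientI[OF St2_U decomposables_submodule])

lemma qmodule_St_infty: "qmodule St_infty"
  unfolding St_infty_def by (rule qquotient.qmodule_quot[OF qquotient_St])

lemma proj_linear: "St_infty_proj \<in> linear_maps (St2 UNIV) St_infty"
  unfolding St_infty_def St_infty_proj_def[abs_def] by (rule qquotient.quot_linear[OF qquotient_St])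

definition St_cls :: "('b set list \<Rightarrow>\<^sub>0 rat) \<Rightarrow> ('b set list \<Rightarrow>\<^sub>0 rat) \<Rightarrow> _" where
  "St_cls z z' = St_infty_proj (pure_tensor (St UNIV) (St UNIV) {z} {z'})"

lemma apartment2_eq: "St_infty_proj (apartment2 UNIV v w) = St_cls (apz v) (apz w)"
  by (simp add: St_cls_def apartment2_def apartment_eq[OF subspace_UNIV dim1])

lemma St_cls_linear:
  shows "w \<in> Z UNIV \<Longrightarrow> (\<lambda>z. St_cls z w) \<in> linear_maps (ZM UNIV) St_infty"
    and "z \<in> Z UNIV \<Longrightarrow> St_cls z \<in> linear_maps (ZM UNIV) St_infty"
proof -
  interpret t: qtensor "St UNIV" "St UNIV" by (rule qtensor_St[OF subspace_UNIV dim1])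
  have c: "{z} \<in> carrier (St UNIV)" if "z \<in> Z UNIV" for z
    using that by (simp add: carrier_St[OF subspace_UNIV dim1])
  note sl = St_linear[OF subspace_UNIV dim1]
  show "(\<lambda>z. St_cls z w) \<in> linear_maps (ZM UNIV) St_infty" if "w \<in> Z UNIV"
    unfolding St_cls_def
    using linear_maps_comp[OF linear_maps_comp[OF sl t.pure_linear_left[OF c[OF that]]] proj_linear[unfolded St2_def]] .
  show "St_cls z \<in> linear_maps (ZM UNIV) St_infty" if "z \<in> Z UNIV"
    unfolding St_cls_def[abs_def]
    using linear_maps_comp[OF linear_maps_comp[OF sl t.pure_linear_right[OF c[OF that]]] proj_linear[unfolded St2_def]] .
qed

lemma St_cls_closed: "z \<in> Z UNIV \<Longrightarrow> w \<in> Z UNIV \<Longrightarrow> St_cls z w \<in> carrier St_infty"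
  using linear_mapsD(1)[OF St_cls_linear(2)] by simp

lemma apz_tuples: "v \<in> tuples UNIV \<Longrightarrow> apz v \<in> Z UNIV"
  by (intro apz_in_Z subspace_UNIV) (auto simp: tuples_def)

lemma St_infty_generated: "generates St_infty {St_cls z w | z w. z \<in> Z UNIV \<and> w \<in> Z UNIV}"
proof -
  have g: "generates St_infty (St_infty_proj ` {apartment2 UNIV v w | v w. v \<in> tuples UNIV \<and> w \<in> tuples UNIV})"
    unfolding St_infty_def St_infty_proj_def[abs_def]
    by (rule qquotient.quot_generates[OF qquotient_St St2_generated[OF subspace_UNIV dim1]])
  have sub: "St_infty_proj ` {apartment2 UNIV v w | v w. v \<in> tuples UNIV \<and> w \<in> tuples UNIV} \<subseteq>
    {St_cls z w | z w. z \<in> Z UNIV \<and> w \<in> Z UNIV}"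
  proof clarify
    fix v w assume "v \<in> tuples UNIV" "w \<in> tuples UNIV"
    thus "\<exists>z w'. St_infty_proj (apartment2 UNIV v w) = St_cls z w' \<and> z \<in> Z UNIV \<and> w' \<in> Z UNIV"
      by (intro exI[of _ "apz v"] exI[of _ "apz w"] conjI apartment2_eq apz_tuples)
  qed
  show ?thesis unfolding generates_def
  proof (intro conjI allI impI)
    show "{St_cls z w | z w. z \<in> Z UNIV \<and> w \<in> Z UNIV} \<subseteq> carrier St_infty" using St_cls_closed by auto
    fix N assume "submodule N rat_ring St_infty" "{St_cls z w | z w. z \<in> Z UNIV \<and> w \<in> Z UNIV} \<subseteq> N"
    thus "carrier St_infty \<subseteq> N" using g sub unfolding generates_def by (meson subset_trans)
  qed
qed

lemma tuples_append:
  assumes d: "(V1, V2) \<in> decompositions" and "a \<in> tuples V1" "b \<in> tuples V2"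
  shows "a @ b \<in> tuples UNIV"
  using assms dim_decomposition[OF d] by (auto simp: tuples_def)

lemma St_cls_decomposable:
  assumes d: "(V1, V2) \<in> decompositions"
    and t: "a \<in> tuples V1" "a' \<in> tuples V1" "b \<in> tuples V2" "b' \<in> tuples V2"
  shows "St_cls (apz (a @ b)) (apz (a' @ b')) = \<zero>\<^bsub>St_infty\<^esub>"
proof -
  let ?x = "pure_tensor (St2 V1) (St2 V2) (apartment2 V1 a a') (apartment2 V2 b b')"
  note V = decD[OF d]
  have x: "?x \<in> carrier (tensor (St2 V1) (St2 V2))"
    by (intro qtensor.pure_closed qtensor.intro qmodule_St2 apartment2_closed V t)
  have eq: "apartment2 UNIV (a @ b) (a' @ b') = concat_product V1 V2 ?x"
    using concat_product_spec[OF d] t unfolding concat_spec_def[OF d] by auto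
  have "concat_product V1 V2 ?x \<in> decomposables"
    unfolding decomposables_def
  proof (rule subsetD[OF qmodule.subset_submodule_hull[OF St2_U]], rule UN_I[OF d], clarify)
    show "concat_product V1 V2 ?x \<in> concat_product V1 V2 ` carrier (tensor (St2 V1) (St2 V2))"
      using x by (rule imageI)
  qed
  hence in_dec: "apartment2 UNIV (a @ b) (a' @ b') \<in> decomposables" unfolding eq .
  have "apartment2 UNIV (a @ b) (a' @ b') \<in> carrier (St2 UNIV)"
    by (intro apartment2_closed subspace_UNIV dim1 tuples_append[OF d] t)
  hence "St_infty_proj (apartment2 UNIV (a @ b) (a' @ b')) = \<zero>\<^bsub>St_infty\<^esub>"
    unfolding St_infty_proj_def St_infty_def qquotient.quot_simps[OF qquotient_St]
    by (rule iffD2[OF qquotient.coset_eq_zero_iff[OF qquotient_St] in_dec])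
  thus ?thesis by (simp add: apartment2_eq)
qed

lemma frame_sum_decomposable:
  assumes h: "h \<in> Dec" and d: "(V1, V2) \<in> decompositions"
    and t: "a \<in> tuples V1" "a' \<in> tuples V1" "b \<in> tuples V2" "b' \<in> tuples V2"
  shows "frame_sum h (apz (a @ b)) (apz (a' @ b')) \<in> pm.span shuffle_relations"
proof (cases "indep (a @ b) \<and> indep (a' @ b')")
  case True
  have bt: "basis_tuple V v" if "subspace V" "v \<in> tuples V" "indep v" for V v
    using that by (intro basis_of_indep) (auto simp: tuples_def)
  have "basis_tuple V1 a" "basis_tuple V1 a'" "basis_tuple V2 b" "basis_tuple V2 b'"
    using True indep_appendD decD(1,2)[OF d] t bt by metis+
  thus ?thesis using frame_sum_product[OF h d] True by (simp add: apz_def)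
next
  case False
  hence "frame_sum h (apz (a @ b)) (apz (a' @ b')) = 0" by (auto simp: apz_def frame_sum_linear[OF h])
  thus ?thesis by (simp add: pm.span_zero)
qed

lemma theta_exists:
  assumes h: "h \<in> Dec"
  shows "\<exists>T\<in>linear_maps St_infty FC. \<forall>z\<in>Z UNIV. \<forall>w\<in>Z UNIV. T (St_cls z w) = FC_cls (frame_sum h z w)"
proof -
  interpret t: qtensor "St UNIV" "St UNIV" by (rule qtensor_St[OF subspace_UNIV dim1])
  define f where "f x y = FC_cls (frame_sum h (the_elem x) (the_elem y))" for x y :: "('b set list \<Rightarrow>\<^sub>0 rat) set"
  note el = the_elem_linear[OF subspace_UNIV dim1]
  have l: "(\<lambda>z. frame_sum h z w) \<in> linear_maps (ZM UNIV) FC_free" for w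
    using keys_frame_sum_affine[OF h] by (intro linear_mapsI) (auto simp: frame_sum_linear[OF h])
  have r: "frame_sum h z \<in> linear_maps (ZM UNIV) FC_free" for z
    using keys_frame_sum_affine[OF h] by (intro linear_mapsI) (auto simp: frame_sum_linear[OF h])
  obtain \<Phi> where \<Phi>: "\<Phi> \<in> linear_maps (tensor (St UNIV) (St UNIV)) FC"
    "\<And>x y. x \<in> carrier (St UNIV) \<Longrightarrow> y \<in> carrier (St UNIV) \<Longrightarrow> \<Phi> (pure_tensor (St UNIV) (St UNIV) x y) = f x y"
  proof (rule t.tensor_lift[OF qmodule_FC, of f])
    show "(\<lambda>x. f x y) \<in> linear_maps (St UNIV) FC" for y
      unfolding f_def by (rule linear_maps_comp[OF linear_maps_comp[OF el l] FC_cls_linear])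
    show "f x \<in> linear_maps (St UNIV) FC" for x
      unfolding f_def[abs_def] by (rule linear_maps_comp[OF linear_maps_comp[OF el r] FC_cls_linear])
  qed blast
  have \<Phi>': "\<Phi> (pure_tensor (St UNIV) (St UNIV) {z} {w}) = FC_cls (frame_sum h z w)" if "z \<in> Z UNIV" "w \<in> Z UNIV" for z w
    using \<Phi>(2) that by (simp add: carrier_St[OF subspace_UNIV dim1] f_def)
  have \<Phi>l: "\<Phi> \<in> linear_maps (St2 UNIV) FC" unfolding St2_def by (rule \<Phi>(1))
  have "decomposables \<subseteq> {x \<in> carrier (St2 UNIV). \<Phi> x = \<zero>\<^bsub>FC\<^esub>}"
    unfolding decomposables_def
  proof (rule qmodule.submodule_hull_minimal[OF St2_U _ submodule_kernel[OF St2_U qmodule_FC \<Phi>l]], clarify, intro conjI)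
    fix V1 V2 x assume d: "(V1, V2) \<in> decompositions" and x: "x \<in> carrier (tensor (St2 V1) (St2 V2))"
    note tuple_pair = concat_product_spec[OF d, unfolded concat_spec_def[OF d]]
    show "concat_product V1 V2 x \<in> carrier (St2 UNIV)"
      using tuple_pair x by (blast intro: linear_mapsD(1))
    interpret F: qmodule FC by (rule qmodule_FC)
    show "\<Phi> (concat_product V1 V2 x) = \<zero>\<^bsub>FC\<^esub>"
    proof (rule tensor_St2_eqI[OF d qmodule_FC _ _ _ x, of "\<lambda>x. \<Phi> (concat_product V1 V2 x)" "\<lambda>_. \<zero>\<^bsub>FC\<^esub>"])
      show "(\<lambda>x. \<Phi> (concat_product V1 V2 x)) \<in> linear_maps (tensor (St2 V1) (St2 V2)) FC"
        using tuple_pair by (blast intro: linear_maps_comp[OF _ \<Phi>l])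
      show "(\<lambda>_. \<zero>\<^bsub>FC\<^esub>) \<in> linear_maps (tensor (St2 V1) (St2 V2)) FC"
        by (intro linear_mapsI) auto
      fix a a' b b' assume t: "a \<in> tuples V1" "a' \<in> tuples V1" "b \<in> tuples V2" "b' \<in> tuples V2"
      have "\<Phi> (apartment2 UNIV (a @ b) (a' @ b')) = FC_cls (frame_sum h (apz (a @ b)) (apz (a' @ b')))"
        unfolding apartment2_def apartment_eq[OF subspace_UNIV dim1]
        by (intro \<Phi>' apz_tuples tuples_append[OF d] t)
      also have "\<dots> = \<zero>\<^bsub>FC\<^esub>"
        using FC_cls_zero_iff[OF keys_frame_sum_affine[OF h]] frame_sum_decomposable[OF h d t] shuffle_hull by auto
      finally show "\<Phi> (concat_product V1 V2 (pure_tensor (St2 V1) (St2 V2) (apartment2 V1 a a') (apartment2 V2 b b'))) = \<zero>\<^bsub>FC\<^esub>"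
        using tuple_pair t by auto
    qed
  qed
  hence kill: "\<And>x. x \<in> decomposables \<Longrightarrow> \<Phi> x = \<zero>\<^bsub>FC\<^esub>" by blast
  show ?thesis
  proof (intro bexI ballI)
    show "induced_map \<Phi> \<in> linear_maps St_infty FC"
      unfolding St_infty_def by (rule qquotient.induced_map_linear[OF qquotient_St qmodule_FC \<Phi>l kill])
    fix z w assume zw: "z \<in> Z UNIV" "w \<in> Z UNIV"
    hence "pure_tensor (St UNIV) (St UNIV) {z} {w} \<in> carrier (St2 UNIV)"
      unfolding St2_def by (intro t.pure_closed) (simp_all add: carrier_St[OF subspace_UNIV dim1])
    thus "induced_map \<Phi> (St_cls z w) = FC_cls (frame_sum h z w)"
      unfolding St_cls_def St_infty_proj_def
      using qquotient.induced_map_coset[OF qquotient_St qmodule_FC \<Phi>l kill] \<Phi>'[OF zw] by simp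
  qed
qed

text \<open>
  The classes of \<open>St_infty\<close> are represented inside a rational vector space given by a type, so
  that identities between them can be computed with the group operations of that type.
\<close>

definition "St_eval = lin_ext St_infty (\<lambda>(z, w). St_cls z w)"

definition "realize_kernel = {p. Poly_Mapping.keys p \<subseteq> Z UNIV \<times> Z UNIV \<and> St_eval p = \<zero>\<^bsub>St_infty\<^esub>}"

definition realize :: "(('b set list \<Rightarrow>\<^sub>0 rat) \<times> ('b set list \<Rightarrow>\<^sub>0 rat) \<Rightarrow>\<^sub>0 rat) \<Rightarrow>
    (('b set list \<Rightarrow>\<^sub>0 rat) \<times> ('b set list \<Rightarrow>\<^sub>0 rat) \<Rightarrow>\<^sub>0 rat)" where
  "realize = (SOME \<kappa>. plinear \<kappa> \<and> (\<forall>p. \<kappa> p = 0 \<longleftrightarrow> p \<in> realize_kernel))"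

definition tens :: "('b set list \<Rightarrow>\<^sub>0 rat) \<Rightarrow> ('b set list \<Rightarrow>\<^sub>0 rat) \<Rightarrow>
    (('b set list \<Rightarrow>\<^sub>0 rat) \<times> ('b set list \<Rightarrow>\<^sub>0 rat) \<Rightarrow>\<^sub>0 rat)" where
  "tens z w = realize (psingle (z, w))"

lemma St_eval_linear: "St_eval \<in> linear_maps (free_module (Z UNIV \<times> Z UNIV)) St_infty"
  unfolding St_eval_def by (intro lin_ext_linear qmodule_St_infty) (auto intro: St_cls_closed)

lemma St_eval_single: "z \<in> Z UNIV \<Longrightarrow> w \<in> Z UNIV \<Longrightarrow> St_eval (psingle (z, w)) = St_cls z w"
proof -
  assume zw: "z \<in> Z UNIV" "w \<in> Z UNIV"
  interpret qmodule St_infty by (rule qmodule_St_infty)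
  show ?thesis unfolding St_eval_def using zw St_cls_closed by (simp add: lin_ext_single[OF qmodule_St_infty])
qed

lemma realize: "plinear realize" "realize p = 0 \<longleftrightarrow> p \<in> realize_kernel"
proof -
  have "realize_kernel = {x \<in> carrier (free_module (Z UNIV \<times> Z UNIV)). St_eval x = \<zero>\<^bsub>St_infty\<^esub>}"
    by (auto simp: realize_kernel_def)
  hence "submodule realize_kernel rat_ring (free_module (Z UNIV \<times> Z UNIV))"
    using submodule_kernel[OF qmodule_free qmodule_St_infty St_eval_linear] by simp
  hence "pm.subspace realize_kernel" by (simp add: submodule_free_iff)
  from someI_ex[OF exists_map_with_kernel[OF this]] show "plinear realize" "realize p = 0 \<longleftrightarrow> p \<in> realize_kernel" unfolding realize_def by auto
qed

lemma realize_eq_plin: "realize p = plin (\<lambda>(z, w). tens z w) p"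
  using plinear_plin[OF realize(1), of psingle p] by (simp add: tens_def) (rule plin_cong, auto)

lemma plin_tens_eq_iff:
  assumes "Poly_Mapping.keys p \<subseteq> Z UNIV \<times> Z UNIV" "Poly_Mapping.keys q \<subseteq> Z UNIV \<times> Z UNIV"
  shows "plin (\<lambda>(z, w). tens z w) p = plin (\<lambda>(z, w). tens z w) q \<longleftrightarrow> St_eval p = St_eval q"
proof -
  interpret S: qmodule St_infty by (rule qmodule_St_infty)
  have pq: "Poly_Mapping.keys (p - q) \<subseteq> Z UNIV \<times> Z UNIV"
    using assms pm.subspace_diff[OF subspace_keys] by blast
  let ?m = "pscale (- 1) q"
  have "plin (\<lambda>(z, w). tens z w) p = plin (\<lambda>(z, w). tens z w) q \<longleftrightarrow> realize (p - q) = 0"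
    unfolding realize_eq_plin[symmetric] by (simp add: pmp.linear_diff[OF realize(1)])
  also have "\<dots> \<longleftrightarrow> St_eval (p - q) = \<zero>\<^bsub>St_infty\<^esub>" unfolding realize(2) using pq by (simp add: realize_kernel_def)
  also have "p - q = p + ?m" by (simp add: pm.scale_minus_left)
  also have "St_eval (p + ?m) = St_eval p \<oplus>\<^bsub>St_infty\<^esub> St_eval ?m"
    using linear_mapsD(2)[OF St_eval_linear, of p ?m] assms keys_pscale_subset[OF assms(2)] by simp
  also have "St_eval ?m = (- 1) \<odot>\<^bsub>St_infty\<^esub> St_eval q"
    using linear_mapsD(3)[OF St_eval_linear, of q "- 1"] assms(2) by simp
  also have "(- 1) \<odot>\<^bsub>St_infty\<^esub> St_eval q = \<ominus>\<^bsub>St_infty\<^esub> St_eval q"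
    using assms(2) linear_mapsD(1)[OF St_eval_linear] by (simp add: S.minus_eq_scl)
  also have "St_eval p \<oplus>\<^bsub>St_infty\<^esub> (\<ominus>\<^bsub>St_infty\<^esub> St_eval q) = \<zero>\<^bsub>St_infty\<^esub> \<longleftrightarrow> St_eval p = St_eval q"
  proof -
    have c: "St_eval p \<in> carrier St_infty" "St_eval q \<in> carrier St_infty"
      using assms linear_mapsD(1)[OF St_eval_linear] by simp_all
    have "St_eval p = St_eval q" if "St_eval p \<oplus>\<^bsub>St_infty\<^esub> (\<ominus>\<^bsub>St_infty\<^esub> St_eval q) = \<zero>\<^bsub>St_infty\<^esub>"
      using S.minus_equality[OF that] c by simp
    thus ?thesis using S.r_neg[OF c(2)] by metis
  qed
  finally show ?thesis .
qed

lemma tens_linear: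
  assumes "w \<in> Z UNIV" "z \<in> Z UNIV" "y \<in> Z UNIV"
  shows "tens (z + y) w = tens z w + tens y w" "tens (pscale c z) w = pscale c (tens z w)"
    "tens w (z + y) = tens w z + tens w y" "tens w (pscale c z) = pscale c (tens w z)"
    "tens 0 w = 0" "tens w 0 = 0"
proof -
  interpret S: qmodule St_infty by (rule qmodule_St_infty)
  have zy: "z + y \<in> Z UNIV" "\<And>c. pscale c z \<in> Z UNIV"
    using assms pm.subspace_add[OF subspace_Z] pm.subspace_scale[OF subspace_Z] by auto
  note l = St_cls_linear[OF assms(1)]
  have ad: "St_eval (psingle x + psingle x') = St_eval (psingle x) \<oplus>\<^bsub>St_infty\<^esub> St_eval (psingle x')"
    if "x \<in> Z UNIV \<times> Z UNIV" "x' \<in> Z UNIV \<times> Z UNIV" for x x'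
    using linear_mapsD(2)[OF St_eval_linear, of "psingle x" "psingle x'"] that by simp
  have sc: "St_eval (pscale c (psingle x)) = c \<odot>\<^bsub>St_infty\<^esub> St_eval (psingle x)"
    if "x \<in> Z UNIV \<times> Z UNIV" for x c
    using linear_mapsD(3)[OF St_eval_linear, of "psingle x" c] that by simp
  have pl: "plin (\<lambda>(z, w). tens z w) (psingle (z, w)) = tens z w" for z w by simp
  have k: "Poly_Mapping.keys (psingle x + psingle x') \<subseteq> Z UNIV \<times> Z UNIV"
    if "x \<in> Z UNIV \<times> Z UNIV" "x' \<in> Z UNIV \<times> Z UNIV" for x x' using that by (intro keys_add_subset) auto
  have add: "tens a b = tens a1 b1 + tens a2 b2" if "{a, b, a1, b1, a2, b2} \<subseteq> Z UNIV" "St_cls a b = St_cls a1 b1 \<oplus>\<^bsub>St_infty\<^esub> St_cls a2 b2"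
    for a b a1 b1 a2 b2
    using plin_tens_eq_iff[of "psingle (a, b)" "psingle (a1, b1) + psingle (a2, b2)"] that
    by (simp add: k ad St_eval_single plin_simps)
  have scale: "tens a b = pscale c (tens a1 b1)" if "{a, b, a1, b1} \<subseteq> Z UNIV" "St_cls a b = c \<odot>\<^bsub>St_infty\<^esub> St_cls a1 b1"
    for a b a1 b1 c
    using plin_tens_eq_iff[of "psingle (a, b)" "pscale c (psingle (a1, b1))"] that keys_pscale[of c "psingle (a1, b1)"] sc[of "(a1, b1)" c]
    by (simp add: St_eval_single plin_simps)
  show "tens (z + y) w = tens z w + tens y w" "tens w (z + y) = tens w z + tens w y"
    using assms zy linear_mapsD(2)[OF l(1), of z y] linear_mapsD(2)[OF l(2), of z y] by (auto intro!: add)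
  show s: "tens (pscale c z) w = pscale c (tens z w)" "tens w (pscale c z) = pscale c (tens w z)" for c
    using assms zy linear_mapsD(3)[OF l(1), of z c] linear_mapsD(3)[OF l(2), of z c] by (auto intro!: scale)
  show "tens 0 w = 0" "tens w 0 = 0" using s[of 0] by simp_all
qed

lemma tens_decomposable:
  assumes d: "(V1, V2) \<in> decompositions"
    and t: "a \<in> tuples V1" "a' \<in> tuples V1" "b \<in> tuples V2" "b' \<in> tuples V2"
  shows "tens (apz (a @ b)) (apz (a' @ b')) = 0"
proof -
  interpret S: qmodule St_infty by (rule qmodule_St_infty)
  have z: "apz (a @ b) \<in> Z UNIV" "apz (a' @ b') \<in> Z UNIV"
    by (intro apz_tuples tuples_append[OF d] t)+
  have "St_eval (psingle (apz (a @ b), apz (a' @ b'))) = \<zero>\<^bsub>St_infty\<^esub>"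
    using z St_cls_decomposable[OF d t] by (simp add: St_eval_single)
  thus ?thesis unfolding tens_def realize(2) using z by (simp add: realize_kernel_def)
qed

end

section \<open>Relations in the infinite Steinberg module\<close>

lemma rev_shuffles:
  assumes "set xs \<inter> set ys = {}"
  shows "bij_betw rev (shuffles xs ys) (shuffles (rev xs) (rev ys))"
proof -
  have 1: "rev w \<in> shuffles (rev xs) (rev ys)" if d: "set xs \<inter> set ys = {}" and w: "w \<in> shuffles xs ys" for w xs ys
    using partition_in_shuffles[of "rev w" "\<lambda>x. x \<in> set xs"] filter_shuffles_disjoint1[OF d w]
    by (simp add: rev_filter[symmetric])
  show ?thesis
  proof (rule bij_betwI[where g = rev])
    show "rev \<in> shuffles xs ys \<rightarrow> shuffles (rev xs) (rev ys)" using 1[OF assms] by blast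
    show "rev \<in> shuffles (rev xs) (rev ys) \<rightarrow> shuffles xs ys"
      using 1[of "rev xs" "rev ys"] assms by auto
  qed auto
qed

context pos_steinberg
begin

definition bilinear_Z :: "(('b set list \<Rightarrow>\<^sub>0 rat) \<Rightarrow> ('b set list \<Rightarrow>\<^sub>0 rat) \<Rightarrow> ('y \<Rightarrow>\<^sub>0 rat)) \<Rightarrow> bool" where
  "bilinear_Z Q \<longleftrightarrow> (\<forall>w\<in>Z UNIV. \<forall>z\<in>Z UNIV. \<forall>y\<in>Z UNIV. \<forall>c.
     Q (z + y) w = Q z w + Q y w \<and> Q (pscale c z) w = pscale c (Q z w) \<and>
     Q w (z + y) = Q w z + Q w y \<and> Q w (pscale c z) = pscale c (Q w z))"

lemma bilinear_Z_tens: "bilinear_Z tens"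
  by (simp add: bilinear_Z_def tens_linear)

abbreviation tup :: "'b list \<Rightarrow> bool" where "tup x \<equiv> length x = dim UNIV"

lemma apz_Z: "tup x \<Longrightarrow> apz x \<in> Z UNIV"
  by (intro apz_tuples) (simp add: tuples_def)

lemma apz_shift: "apz (p @ X # q @ r) = pscale ((- 1) ^ length q) (apz (p @ q @ X # r))"
proof -
  have "apz (p @ X # q @ r) = pscale ((- 1) ^ length p) (apz (X # p @ q @ r))" by (rule apz_move)
  also have "\<dots> = pscale ((- 1) ^ length p) (pscale ((- 1) ^ length (p @ q)) (apz ((p @ q) @ X # r)))"
    using apz_move'[of X "p @ q" r] by simp
  also have "\<dots> = pscale ((- 1) ^ length q) (apz (p @ q @ X # r))"
    using neg_one_sq[of "length p"] by (simp add: power_add mult.assoc[symmetric])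
  finally show ?thesis .
qed

context
  fixes Q :: "('b set list \<Rightarrow>\<^sub>0 rat) \<Rightarrow> ('b set list \<Rightarrow>\<^sub>0 rat) \<Rightarrow> ('y \<Rightarrow>\<^sub>0 rat)"
  assumes Q: "bilinear_Z Q"
begin

abbreviation QQ where "QQ x y \<equiv> Q (apz x) (apz y)"

lemma bilD:
  assumes "w \<in> Z UNIV" "z \<in> Z UNIV" "y \<in> Z UNIV"
  shows "Q (z + y) w = Q z w + Q y w" "Q w (z + y) = Q w z + Q w y"
  using Q assms unfolding bilinear_Z_def by blast+

lemma bilDs:
  assumes "w \<in> Z UNIV" "z \<in> Z UNIV"
  shows "Q (pscale c z) w = pscale c (Q z w)" "Q w (pscale c z) = pscale c (Q w z)" "Q 0 w = 0" "Q w 0 = 0"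
proof -
  show 1: "Q (pscale c z) w = pscale c (Q z w)" "Q w (pscale c z) = pscale c (Q w z)" for c
    using Q assms unfolding bilinear_Z_def by blast+
  show "Q 0 w = 0" "Q w 0 = 0" using 1[of 0] by simp_all
qed

lemma QQ_three:
  assumes "c \<noteq> 0" "tup x" "tup (p @ X # q @ Y # r)"
  shows "QQ x (p @ X # q @ Y # r) = QQ x (p @ X # q @ (Y - c *s X) # r) + QQ x (p @ (Y - c *s X) # q @ Y # r)"
  unfolding apz_three_term[OF assms(1), of p X q Y r] using assms by (intro bilD apz_Z) auto

lemma QQ_scale:
  assumes "c \<noteq> 0"
  shows "QQ x (p @ (c *s X) # q) = QQ x (p @ X # q)"
  by (simp only: apz_scale[OF assms])

lemma QQ_shift:
  assumes "tup x" "tup (p @ X # q @ r)"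
  shows "QQ x (p @ X # q @ r) = pscale ((- 1) ^ length q) (QQ x (p @ q @ X # r))"
    "QQ (p @ X # q @ r) x = pscale ((- 1) ^ length q) (QQ (p @ q @ X # r) x)"
  unfolding apz_shift[of p X q r] using assms by (auto intro!: bilDs apz_Z)

lemma QQ_shift2:
  assumes "tup (p @ X # q @ r)" "tup (p' @ X' # q' @ r')" "length q = length q'"
  shows "QQ (p @ X # q @ r) (p' @ X' # q' @ r') = QQ (p @ q @ X # r) (p' @ q' @ X' # r')"
proof -
  have "QQ (p @ X # q @ r) (p' @ X' # q' @ r') =
    pscale ((- 1) ^ length q') (pscale ((- 1) ^ length q) (QQ (p @ q @ X # r) (p' @ q' @ X' # r')))"
    using QQ_shift(1)[OF assms(1,2)] QQ_shift(2)[of "p' @ q' @ X' # r'" p X q r] assms by simp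
  thus ?thesis using neg_one_sq[of "length q"] by (simp add: assms(3))
qed

lemma QQ_dependent: "\<not> indep y \<Longrightarrow> tup x \<Longrightarrow> QQ x y = 0" "\<not> indep x \<Longrightarrow> tup y \<Longrightarrow> QQ x y = 0"
proof -
  have z: "apz v = 0" if "\<not> indep v" for v using that by (simp add: apz_def)
  show "QQ x y = 0" if "\<not> indep y" "tup x" unfolding z[OF that(1)] using apz_Z[OF that(2)] bilDs(4) by blast
  show "QQ x y = 0" if "\<not> indep x" "tup y" unfolding z[OF that(1)] using apz_Z[OF that(2)] bilDs(3) by blast
qed

lemma QQ_shuffles:
  assumes "set xs \<inter> set ys = {}" "tup (pa @ map f (xs @ ys))" "length pb = length pa"
  shows "(\<Sum>w\<in>shuffles xs ys. QQ (pa @ map f w) (pb @ path r w)) =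
    QQ (pa @ map f (xs @ ys)) (pb @ path r xs @ path r ys)"
  using assms
proof (induction xs ys arbitrary: pa pb r rule: shuffles.induct)
  case (3 x xs y ys)
  let ?P = "path x xs" and ?Q = "path y ys" and ?xs = "map f xs" and ?ys = "map f ys"
  have l: "length pa + Suc (length xs + Suc (length ys)) = dim UNIV" using 3 by simp
  have inj: "inj_on ((#) z) S" for z :: 'b and S by (rule inj_onI) simp
  have "(\<Sum>w\<in>shuffles (x # xs) (y # ys). QQ (pa @ map f w) (pb @ path r w)) =
    (\<Sum>w\<in>(#) x ` shuffles xs (y # ys). QQ (pa @ map f w) (pb @ path r w)) +
    (\<Sum>w\<in>(#) y ` shuffles (x # xs) ys. QQ (pa @ map f w) (pb @ path r w))"
    using 3(3) by (simp only: shuffles.simps) (rule sum.union_disjoint, auto)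
  also have "\<dots> = (\<Sum>w\<in>shuffles xs (y # ys). QQ ((pa @ [f x]) @ map f w) ((pb @ [x - r]) @ path x w)) +
    (\<Sum>w\<in>shuffles (x # xs) ys. QQ ((pa @ [f y]) @ map f w) ((pb @ [y - r]) @ path y w))"
    by (simp add: sum.reindex[OF inj])
  also have "(\<Sum>w\<in>shuffles xs (y # ys). QQ ((pa @ [f x]) @ map f w) ((pb @ [x - r]) @ path x w)) =
    QQ ((pa @ [f x]) @ map f (xs @ y # ys)) ((pb @ [x - r]) @ path x xs @ path x (y # ys))"
    using 3 by (intro "3.IH") auto
  also have "(\<Sum>w\<in>shuffles (x # xs) ys. QQ ((pa @ [f y]) @ map f w) ((pb @ [y - r]) @ path y w)) =
    QQ ((pa @ [f y]) @ map f ((x # xs) @ ys)) ((pb @ [y - r]) @ path y (x # xs) @ path y ys)"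
    using 3 by (intro "3.IH") auto
  also have "QQ ((pa @ [f y]) @ map f ((x # xs) @ ys)) ((pb @ [y - r]) @ path y (x # xs) @ path y ys) =
    QQ (pa @ f y # (f x # ?xs) @ ?ys) (pb @ (y - r) # ((- 1) *s (y - x) # ?P) @ ?Q)"
    by simp
  also have "\<dots> = QQ (pa @ (f x # ?xs) @ f y # ?ys) (pb @ ((- 1) *s (y - x) # ?P) @ (y - r) # ?Q)"
    using l 3(5) by (intro QQ_shift2) auto
  also have "\<dots> = QQ (pa @ (f x # ?xs) @ f y # ?ys) (pb @ (y - x) # ?P @ (y - r) # ?Q)"
  proof -
    have "(- 1 :: 'a) \<noteq> 0" by simp
    from QQ_scale[OF this, of "pa @ (f x # ?xs) @ f y # ?ys" pb "y - x" "?P @ (y - r) # ?Q"]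
    show ?thesis by (simp only: append_Cons)
  qed
  also have "QQ ((pa @ [f x]) @ map f (xs @ y # ys)) ((pb @ [x - r]) @ path x xs @ path x (y # ys)) + \<dots> =
    QQ (pa @ (f x # ?xs) @ f y # ?ys) (pb @ (x - r) # ?P @ (y - r) # ?Q)"
    using QQ_three[of 1 "pa @ (f x # ?xs) @ f y # ?ys" pb "x - r" ?P "y - r" ?Q] l 3(5) by simp
  finally show ?case by simp
qed simp_all

end

lemma decomposition_split:
  assumes b: "basis_tuple UNIV (a @ b)" and ne: "a \<noteq> []" "b \<noteq> []"
  shows "(spn a, spn b) \<in> decompositions"
    "set a' \<subseteq> spn a \<Longrightarrow> length a' = length a \<Longrightarrow> a' \<in> tuples (spn a)"
    "set b' \<subseteq> spn b \<Longrightarrow> length b' = length b \<Longrightarrow> b' \<in> tuples (spn b)"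
proof -
  have i: "indep (a @ b)" using b by (simp add: basis_tuple_iff)
  have ab: "indep a" "indep b" using indep_appendD[OF i] by auto
  have d: "dim (spn a) = length a" "dim (spn b) = length b" using ab by (simp_all only: indep_iff_dim)
  have nz: "spn v \<noteq> {0}" if "indep v" "v \<noteq> []" for v
  proof
    assume "spn v = {0}"
    moreover have "dim (spn v) = length v" using that(1) by (simp only: indep_iff_dim)
    moreover have "dim {0} = 0" by simp
    ultimately show False using that(2) by (metis length_0_conv)
  qed
  have "span (spn a \<union> spn b) = span (set a \<union> set b)"
  proof (rule equalityI)
    show "span (spn a \<union> spn b) \<subseteq> span (set a \<union> set b)"
      using span_mono[of "set a" "set a \<union> set b"] span_mono[of "set b" "set a \<union> set b"]
      by (intro span_minimal) auto
    show "span (set a \<union> set b) \<subseteq> span (spn a \<union> spn b)"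
      using span_superset by (intro span_mono) blast
  qed
  also have "\<dots> = UNIV" using b by (simp add: basis_tuple_iff)
  finally show "(spn a, spn b) \<in> decompositions"
    using indep_Int_spn[OF i] nz ab ne by (simp add: decompositions_def)
  show "set a' \<subseteq> spn a \<Longrightarrow> length a' = length a \<Longrightarrow> a' \<in> tuples (spn a)"
    "set b' \<subseteq> spn b \<Longrightarrow> length b' = length b \<Longrightarrow> b' \<in> tuples (spn b)"
    using d by (simp_all only: tuples_def mem_Collect_eq)
qed

definition sym_class :: "'b list \<Rightarrow> (('b set list \<Rightarrow>\<^sub>0 rat) \<times> ('b set list \<Rightarrow>\<^sub>0 rat) \<Rightarrow>\<^sub>0 rat)" where
  "sym_class u = tens (apz (fst_tuple u)) (apz (snd_tuple u))"

lemma sym_class_shuffles: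
  assumes u: "affine_basis (x # xs @ ys)" and ne: "xs \<noteq> []" "ys \<noteq> []"
  shows "(\<Sum>w\<in>shuffles xs ys. sym_class (x # w)) = 0"
proof -
  let ?f = "\<lambda>z. z - x"
  have b: "basis_tuple UNIV (map ?f (rev ys @ rev xs))"
    using basis_fst_tuple_snd_tuple(1)[OF u] by (simp add: fst_tuple_def)
  have "distinct (map ?f (rev ys @ rev xs))" using b by (simp only: basis_tuple_iff indep_def)
  hence "distinct (rev ys @ rev xs)" by (simp only: distinct_map)
  hence d: "set xs \<inter> set ys = {}" by auto
  have bf: "basis_tuple UNIV (map ?f (rev xs) @ map ?f (rev ys))"
    using b indep_mset[of "map ?f (rev ys @ rev xs)" "map ?f (rev xs) @ map ?f (rev ys)"]
    by (simp add: basis_tuple_iff Un_commute union_commute)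
  have t: "tup (map ?f (rev xs @ rev ys))" using length_basis_tuple[OF bf] by simp
  have "(\<Sum>w\<in>shuffles xs ys. sym_class (x # w)) =
    (\<Sum>w\<in>shuffles xs ys. tens (apz ([] @ map ?f (rev w))) (apz ([] @ path x (rev w))))"
    by (simp add: sym_class_def fst_tuple_def snd_tuple_def)
  also have "\<dots> = (\<Sum>w\<in>shuffles (rev xs) (rev ys). tens (apz ([] @ map ?f w)) (apz ([] @ path x w)))"
    by (rule sum.reindex_bij_betw[OF rev_shuffles[OF d]])
  also have "\<dots> = tens (apz ([] @ map ?f (rev xs @ rev ys))) (apz ([] @ path x (rev xs) @ path x (rev ys)))"
    using d t by (intro QQ_shuffles[OF bilinear_Z_tens]) auto
  also have "\<dots> = tens (apz (map ?f (rev xs) @ map ?f (rev ys))) (apz (path x (rev xs) @ path x (rev ys)))"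
    by simp
  also have "\<dots> = 0"
  proof -
    have ne': "map ?f (rev xs) \<noteq> []" "map ?f (rev ys) \<noteq> []" using ne by auto
    note ds = decomposition_split[OF bf ne']
    have sub: "set (path x v) \<subseteq> spn (map ?f v)" for v
      using span_superset[of "set (path x v)"] by (simp only: spn_path)
    show ?thesis
      by (rule tens_decomposable[OF ds(1)]) (rule ds(2) ds(3); (rule sub span_superset | simp))+
  qed
  finally show ?thesis .
qed

context
  fixes h assumes h: "h \<in> Dec"
begin

lemma sym_class_shuffle_span: "p \<in> pm.span shuffle_relations \<Longrightarrow> plin sym_class p = 0"
proof (rule pmp.linear_eq_0_on_span[OF linear_plin])
  fix q assume "q \<in> shuffle_relations"
  then obtain x xs ys where "affine_basis (x # xs @ ys)" "xs \<noteq> []" "ys \<noteq> []"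
    "q = (\<Sum>w\<in>shuffles xs ys. psingle (x # w))" unfolding shuffle_relations_def by blast
  thus "plin sym_class q = 0" using sym_class_shuffles by (simp add: plin_simps)
qed

definition defect :: "('b set list \<Rightarrow>\<^sub>0 rat) \<Rightarrow> ('b set list \<Rightarrow>\<^sub>0 rat) \<Rightarrow>
    (('b set list \<Rightarrow>\<^sub>0 rat) \<times> ('b set list \<Rightarrow>\<^sub>0 rat) \<Rightarrow>\<^sub>0 rat)" where
  "defect z w = tens z w - plin sym_class (frame_sum h z w)"

lemma bilinear_Z_defect: "bilinear_Z defect"
  unfolding bilinear_Z_def defect_def
  by (simp add: tens_linear frame_sum_linear[OF h] plin_simps pm.scale_right_diff_distrib)

lemma defect_split:
  assumes b: "basis_tuple UNIV (a @ b)" and ne: "a \<noteq> []" "b \<noteq> []"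
    and a': "set a' \<subseteq> spn a" "length a' = length a" and b': "set b' \<subseteq> spn b" "length b' = length b"
  shows "defect (apz (a @ b)) (apz (a' @ b')) = 0"
proof -
  note ds = decomposition_split[OF b ne]
  have t: "a \<in> tuples (spn a)" "a' \<in> tuples (spn a)" "b \<in> tuples (spn b)" "b' \<in> tuples (spn b)"
    using ds(2,3) a' b' span_superset by blast+
  show ?thesis
    unfolding defect_def tens_decomposable[OF ds(1) t] sym_class_shuffle_span[OF frame_sum_decomposable[OF h ds(1) t]] by simp
qed

lemma defect_symbol:
  assumes v: "normal_frame h v"
  shows "defect (apz (fst_tuple (0 # v))) (apz (snd_tuple (0 # v))) = 0"
proof -
  have u: "affine_basis (0 # v)" using v by (simp add: affine_basis_0 normal_frame_def)
  have "apz (fst_tuple (0 # v)) = ap (fst_tuple (0 # v))" "apz (snd_tuple (0 # v)) = ap (snd_tuple (0 # v))"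
    using basis_fst_tuple_snd_tuple[OF u] by (simp_all add: apz_def basis_tuple_iff)
  thus ?thesis using frame_sum_symbol[OF h u] D_poly_normal_frame[OF h v] by (simp add: defect_def sym_class_def)
qed

definition lift :: "'b list \<Rightarrow> 'b \<Rightarrow> 'b" where
  "lift ws z = z - h z *s last (0 # ws)"

lemma lift_diff: "lift ws (y - c *s x) = lift ws y - c *s lift ws x"
  by (simp add: lift_def h_linear[OF h] algebra_simps scale_left_diff_distrib)

lemma lift_scale: "lift ws (c *s x) = c *s lift ws x"
  by (simp add: lift_def h_linear[OF h] algebra_simps)

lemma path_snoc: "path r (xs @ [x]) = path r xs @ [x - last (r # xs)]"
  by (induction xs arbitrary: r) auto

text \<open>
  Pairs of the form \<open>(ws @ a, path 0 ws @ lift b)\<close> interpolate between arbitrary pairs (\<open>ws = []\<close>)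
  and the pairs of the symbols (\<open>a = []\<close>). If \<open>h\<close> does not vanish on \<open>b\<close>, three-term relations
  leave a single vector \<open>w\<close> of \<open>b\<close> with \<open>h w = 1\<close>, and expanding \<open>a\<close> along \<open>w\<close> makes \<open>ws\<close> longer.
  If \<open>h\<close> vanishes on \<open>b\<close>, the pair is decomposable.
\<close>

lemma defect_vanish:
  assumes "basis_tuple UNIV (ws @ a)" "\<And>w. w \<in> set ws \<Longrightarrow> h w = 1" "length b = length a" "set b \<subseteq> spn a"
  shows "defect (apz (ws @ a)) (apz (path 0 ws @ map (lift ws) b)) = 0"
  using assms
proof (induction "length a" arbitrary: ws a b)
  case 0
  hence a: "a = []" "b = []" by auto
  have "normal_frame h (rev ws)" using 0 a by (simp add: normal_frame_def basis_tuple_def)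
  from defect_symbol[OF this] show ?case by (simp add: a fst_tuple_def snd_tuple_def)
next
  case (Suc k)
  note bt = Suc.prems(1) and hws = Suc.prems(2) and lb = Suc.prems(3) and snd_tuple = Suc.prems(4)
  have tp: "tup (ws @ a)" using length_basis_tuple[OF bt] .
  have ind: "indep (ws @ a)" and full: "spn (ws @ a) = UNIV" using bt by (auto simp: basis_tuple_iff)
  have len: "length ws + length a = dim UNIV" using tp by simp
  show ?case
    using lb snd_tuple
  proof (induction "length (filter (\<lambda>y. h y \<noteq> 0) b)" arbitrary: b rule: less_induct)
    case less
    consider "\<forall>y\<in>set b. h y = 0" | p w x where "b = p @ w # x" "h w \<noteq> 0" "\<forall>y\<in>set (p @ x). h y = 0"
      | p X q Y r where "b = p @ X # q @ Y # r" "h X \<noteq> 0" "h Y \<noteq> 0"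
    proof (cases "filter (\<lambda>y. h y \<noteq> 0) b")
      case Nil
      thus thesis using that(1) by (simp add: filter_empty_conv)
    next
      case (Cons X fs)
      then obtain p b' where b: "b = p @ X # b'" "h X \<noteq> 0" "\<forall>y\<in>set p. \<not> h y \<noteq> 0" "fs = filter (\<lambda>y. h y \<noteq> 0) b'"
        using filter_eq_Cons_iff[of "\<lambda>y. h y \<noteq> 0" b X fs] by blast
      show thesis
      proof (cases fs)
        case Nil
        thus thesis using b that(2)[of p X b'] by (auto simp: filter_empty_conv)
      next
        case (Cons Y fs')
        hence "Y \<in> set (filter (\<lambda>y. h y \<noteq> 0) b')" using b(4) by simp
        hence "Y \<in> set b'" "h Y \<noteq> 0" by auto
        then obtain q r where "b' = q @ Y # r" by (metis split_list)
        thus thesis using b \<open>h Y \<noteq> 0\<close> that(3) by blast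
      qed
    qed
    thus ?case
    proof cases
      case 1
      have lift: "map (lift ws) b = b" using 1 by (intro map_idI) (simp add: lift_def)
      show ?thesis
      proof (cases "ws = []")
        case True
        have "\<not> indep b"
        proof
          assume "indep b"
          hence "basis_tuple UNIV b" using less.prems(1) len True by (intro basis_of_indep) auto
          hence "spn b = UNIV" by (simp add: basis_tuple_iff)
          have "h x = 0" if "x \<in> spn b" for x
            using that 1 by (induction rule: span_induct_alt) (auto simp: h_linear[OF h])
          hence "h = (\<lambda>x. 0)" using \<open>spn b = UNIV\<close> by auto
          thus False using h by (simp add: Dec_def)
        qed
        thus ?thesis using QQ_dependent(1)[OF bilinear_Z_defect] tp True lift by simp
      next
        case False
        have "set (path 0 ws) \<subseteq> spn ws" using span_superset[of "set (path 0 ws)"] by (simp add: spn_path)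
        moreover have "a \<noteq> []" using Suc.hyps(2) by auto
        ultimately show ?thesis unfolding lift using less.prems False by (intro defect_split bt) auto
      qed
    next
      case (2 p w x)
      define W where "W = inverse (h w) *s w"
      have hW: "h W = 1" using 2(2) by (simp add: W_def h_linear[OF h])
      have wW: "w = h w *s W" using 2(2) by (simp add: W_def)
      have Wa: "W \<in> spn a" using less.prems(2) 2(1) by (auto simp: W_def intro: span_scale)
      have W0: "W \<noteq> 0" using hW by (auto simp: h_linear[OF h])
      let ?P = "path 0 ws @ [lift ws W]" and ?y = "p @ x"
      have P: "?P = path 0 (ws @ [W])" by (simp add: path_snoc lift_def hW)
      have hy: "h y = 0" if "y \<in> set ?y" for y using 2(3) that by blast
      have ya: "y \<in> spn a" if "y \<in> set ?y" for y using less.prems(2) 2(1) that by auto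
      have ly: "length ?y = k" using less.prems(1) 2(1) Suc.hyps(2) by simp
      have lift: "map (lift ws) p = p" "map (lift ws) x = x"
        using hy by (auto intro!: map_idI simp: lift_def)
      have "apz (path 0 ws @ map (lift ws) b) = apz (path 0 ws @ p @ lift ws W # x)"
        unfolding 2(1) using lift apz_scale[OF 2(2), of "path 0 ws @ p" "lift ws W" x]
        by (simp add: lift_scale[symmetric] wW[symmetric])
      also have "\<dots> = pscale ((- 1) ^ length p) (apz (?P @ ?y))"
        using apz_shift[of "path 0 ws" "lift ws W" p x] neg_one_sq[of "length p"]
        by simp
      finally have second: "apz (path 0 ws @ map (lift ws) b) = pscale ((- 1) ^ length p) (apz (?P @ ?y))" .
      have tP: "tup (?P @ ?y)" using ly Suc.hyps(2) len by simp
      have zero: "defect (apz (W # delete_nth i (ws @ a))) (apz (?P @ ?y)) = 0" if i: "i < length (ws @ a)" for i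
      proof (cases "indep (W # delete_nth i (ws @ a))")
        case False
        thus ?thesis using QQ_dependent(2)[OF bilinear_Z_defect _ tP] i tp by simp
      next
        case True
        have "\<not> i < length ws"
        proof
          assume "i < length ws"
          hence "set a \<subseteq> set (delete_nth i (ws @ a))" by (simp add: delete_nth_append)
          hence "W \<in> spn (delete_nth i (ws @ a))" using Wa span_mono by blast
          thus False using True by (simp add: indep_Cons)
        qed
        then obtain j where j: "i = length ws + j" "j < length a" using i by (metis length_append nat_add_left_cancel_less not_less le_Suc_ex)
        let ?a = "delete_nth j a"
        have del: "delete_nth i (ws @ a) = ws @ ?a" using j by (simp add: delete_nth_append)
        have bt': "basis_tuple UNIV ((ws @ [W]) @ ?a)"
        proof (rule basis_of_indep)
          show "length ((ws @ [W]) @ ?a) = dim UNIV" using j(2) len by simp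
          show "indep ((ws @ [W]) @ ?a)" using True indep_move[of ws W ?a] by (simp add: del)
        qed auto
        have spa: "spn a = span (insert W (set ?a))"
        proof (rule span_eq_by_dim[symmetric])
          show "span (insert W (set ?a)) \<subseteq> spn a"
            using Wa set_delete_nth_subset[of j a] span_superset[of "set a"] by (intro span_minimal) auto
          have "indep (W # ?a)" using bt' indep_appendD[of ws "W # ?a"] by (simp add: basis_tuple_iff)
          hence "dim (spn (W # ?a)) = length (W # ?a)" by (simp only: indep_iff_dim)
          moreover have "dim (spn a) = length a" using indep_appendD[OF ind] by (simp only: indep_iff_dim)
          ultimately show "dim (spn a) \<le> dim (span (insert W (set ?a)))" using j(2) by simp
        qed auto
        have "\<forall>y\<in>set ?y. \<exists>c. y - c *s W \<in> spn ?a"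
          using ya unfolding spa span_insert by blast
        then obtain c where c: "\<And>y. y \<in> set ?y \<Longrightarrow> y - c y *s W \<in> spn ?a" by metis
        define b' where "b' = map (\<lambda>y. y - c y *s W) ?y"
        have lift': "map (lift (ws @ [W])) b' = ?y"
          unfolding b'_def map_map using hy
          by (intro map_idI) (simp add: lift_def h_linear[OF h] hW)
        have "defect (apz ((ws @ [W]) @ ?a)) (apz (path 0 (ws @ [W]) @ map (lift (ws @ [W])) b')) = 0"
        proof (rule Suc.hyps(1)[OF _ bt'])
          show "k = length ?a" using j(2) Suc.hyps(2) by simp
          show "h v = 1" if "v \<in> set (ws @ [W])" for v using that hws hW by auto
          show "length b' = length ?a" using ly j(2) Suc.hyps(2) by (simp add: b'_def)
          show "set b' \<subseteq> spn ?a" using c by (auto simp: b'_def)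
        qed
        hence z: "defect (apz (ws @ W # ?a)) (apz (?P @ ?y)) = 0" unfolding lift' P by simp
        have "apz (W # ws @ ?a) = pscale ((- 1) ^ length ws) (apz (ws @ W # ?a))" by (rule apz_move')
        thus ?thesis unfolding del using z bilDs(1)[OF bilinear_Z_defect apz_Z[OF tP] apz_Z[of "ws @ W # ?a"]] j(2) len by simp
      qed
      have "defect (apz (ws @ a)) (apz (?P @ ?y)) =
        (\<Sum>i<length (ws @ a). pscale ((- 1) ^ i) (defect (apz (W # delete_nth i (ws @ a))) (apz (?P @ ?y))))"
      proof -
        have zz: "apz (W # delete_nth i (ws @ a)) \<in> Z UNIV" if "i < length (ws @ a)" for i
          using that tp by (intro apz_Z) simp
        have sumG: "defect (\<Sum>i\<in>I. pscale ((- 1) ^ i) (f i)) w = (\<Sum>i\<in>I. pscale ((- 1) ^ i) (defect (f i) w)) \<and>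
          (\<Sum>i\<in>I. pscale ((- 1) ^ i) (f i)) \<in> Z UNIV"
          if "finite I" "\<And>i. i \<in> I \<Longrightarrow> f i \<in> Z UNIV" "w \<in> Z UNIV" for I f w
          using that
        proof (induction I rule: finite_induct)
          case empty
          thus ?case using bilDs(3)[OF bilinear_Z_defect] pm.subspace_0[OF subspace_Z] by simp
        next
          case (insert i I)
          thus ?case using pm.subspace_add[OF subspace_Z] pm.subspace_scale[OF subspace_Z]
            by (simp add: bilD(1)[OF bilinear_Z_defect] bilDs(1)[OF bilinear_Z_defect])
        qed
        have "apz (ws @ a) = (\<Sum>i<length (ws @ a). pscale ((- 1) ^ i) (apz (W # delete_nth i (ws @ a))))"
          using ap_expand[OF bt UNIV_I W0] ind by (simp add: apz_def[of "ws @ a"])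
        thus ?thesis using sumG[of "{..<length (ws @ a)}"] zz apz_Z[OF tP] by simp
      qed
      also have "\<dots> = 0" using zero by (intro sum.neutral) simp
      finally show ?thesis unfolding second using bilDs(2)[OF bilinear_Z_defect apz_Z[OF tp] apz_Z[OF tP]] by simp
    next
      case (3 p X q Y r)
      define c where "c = h Y / h X"
      have c0: "c \<noteq> 0" using 3 by (simp add: c_def)
      have hY: "h (Y - c *s X) = 0" using 3 by (simp add: c_def h_linear[OF h])
      let ?m = "map (lift ws)" and ?R = "path 0 ws"
      let ?b1 = "p @ X # q @ (Y - c *s X) # r" and ?b2 = "p @ (Y - c *s X) # q @ Y # r"
      have XY: "Y - c *s X \<in> spn a" using less.prems(2) 3(1) by (auto intro!: span_diff span_scale)
      have "defect (apz (ws @ a)) (apz (?R @ ?m b)) = defect (apz (ws @ a)) (apz (?R @ ?m ?b1)) + defect (apz (ws @ a)) (apz (?R @ ?m ?b2))"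
        using QQ_three[OF bilinear_Z_defect c0 tp, of "?R @ ?m p" "lift ws X" "?m q" "lift ws Y" "?m r"] less.prems(1) len
        unfolding 3(1) by (simp add: lift_diff)
      moreover have "defect (apz (ws @ a)) (apz (?R @ ?m ?b1)) = 0"
        using less.prems 3 hY XY by (intro less.hyps) auto
      moreover have "defect (apz (ws @ a)) (apz (?R @ ?m ?b2)) = 0"
        using less.prems 3 hY XY by (intro less.hyps) auto
      ultimately show ?thesis by simp
    qed
  qed
qed

lemma defect_zero:
  assumes "z \<in> Z UNIV" "w \<in> Z UNIV"
  shows "defect z w = 0"
proof -
  have bb: "defect (ap x) (ap y) = 0" if xy: "basis_tuple UNIV x" "basis_tuple UNIV y" for x y
  proof -
    have "map (lift []) y = y" by (intro map_idI) (simp add: lift_def)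
    moreover have "apz x = ap x" "apz y = ap y" using xy by (simp_all add: apz_def basis_tuple_iff)
    moreover have "length y = length x" using xy[THEN length_basis_tuple] by simp
    moreover have "spn x = UNIV" using xy by (simp add: basis_tuple_iff)
    ultimately show ?thesis using defect_vanish[of "[]" x y] xy(1) by simp
  qed
  have gen: "\<And>z. z \<in> Z UNIV \<Longrightarrow> z \<in> pm.span {ap v | v. basis_tuple UNIV v}"
    by (rule Z_generated[OF subspace_UNIV dim1])
  have sub': "ap v \<in> Z UNIV" "pscale c (ap v) \<in> Z UNIV" if "basis_tuple UNIV v" for v c
    using ap_in_Z[OF that] pm.subspace_scale[OF subspace_Z] by auto
  have left: "defect z (ap y) = 0" if z: "z \<in> pm.span {ap v | v. basis_tuple UNIV v}" and y: "basis_tuple UNIV y" for z y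
  proof -
    have "z \<in> Z UNIV \<and> defect z (ap y) = 0" using z
    proof (induction rule: pm.span_induct_alt)
      case base
      show ?case using bilDs(3)[OF bilinear_Z_defect ap_in_Z[OF y] ap_in_Z[OF y]] pm.subspace_0[OF subspace_Z] by simp
    next
      case (step c x z)
      then obtain v where v: "x = ap v" "basis_tuple UNIV v" by blast
      note zZ = sub'(1)[OF v(2)] sub'(2)[OF v(2), of c] conjunct1[OF step(2)]
      have "defect (pscale c x + z) (ap y) = 0"
        using step(2) bb[OF v(2) y] bilD(1)[OF bilinear_Z_defect ap_in_Z[OF y] zZ(2,3)] bilDs(1)[OF bilinear_Z_defect ap_in_Z[OF y] zZ(1), of c]
        by (simp add: v(1))
      thus ?case using pm.subspace_add[OF subspace_Z zZ(2,3)] v(1) by simp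
    qed
    thus ?thesis by simp
  qed
  have "w \<in> Z UNIV \<and> defect z w = 0" using gen[OF assms(2)]
  proof (induction rule: pm.span_induct_alt)
    case base
    show ?case using bilDs(4)[OF bilinear_Z_defect assms(1) assms(1)] pm.subspace_0[OF subspace_Z] by simp
  next
    case (step c x w)
    then obtain v where v: "x = ap v" "basis_tuple UNIV v" by blast
    note zZ = sub'(1)[OF v(2)] sub'(2)[OF v(2), of c] conjunct1[OF step(2)]
    have "defect z (pscale c x + w) = 0"
      using step(2) left[OF gen[OF assms(1)] v(2)] bilD(2)[OF bilinear_Z_defect assms(1) zZ(2,3)] bilDs(2)[OF bilinear_Z_defect assms(1) zZ(1), of c]
      by (simp add: v(1))
    thus ?case using pm.subspace_add[OF subspace_Z zZ(2,3)] v(1) by simp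
  qed
  thus ?thesis by simp
qed

lemma tens_eq_sym_class:
  assumes "z \<in> Z UNIV" "w \<in> Z UNIV"
  shows "tens z w = plin sym_class (frame_sum h z w)"
  using defect_zero[OF assms] by (simp add: defect_def)

end

end

section \<open>Homology of formal correlators\<close>

context pos_steinberg
begin

lemma path_translate: "path (r - t) (map (\<lambda>x. x - t) l) = path r l"
  by (induction l arbitrary: r) auto

lemma sym_class_translate: "u \<noteq> [] \<Longrightarrow> sym_class (map (\<lambda>x. x - t) u) = sym_class u"
  by (cases u) (simp_all add: sym_class_def fst_tuple_def snd_tuple_def rev_map path_translate o_def)

lemma exists_Dec:
  assumes v: "basis_tuple UNIV v"
  shows "\<exists>h\<in>Dec. \<forall>x\<in>set v. h x = 1"
proof -
  interpret f: vector_space_pair scale "(*) :: 'a \<Rightarrow> 'a \<Rightarrow> 'a"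
    by unfold_locales (auto simp: algebra_simps)
  obtain h where h: "Vector_Spaces.linear scale (*) h" "\<forall>x\<in>set v. h x = 1"
    using f.linear_independent_extend[of "set v" "\<lambda>_. 1"] v by (auto simp: basis_tuple_def)
  have "length v \<noteq> 0" using length_basis_tuple[OF v] dim_pos by linarith
  hence "hd v \<in> set v" by simp
  hence "h \<noteq> (\<lambda>x. 0)" using h(2) by force
  thus ?thesis using h by (auto simp: Dec_def)
qed

lemma Dec_nonempty: "Dec \<noteq> {}"
  using exists_basis_tuple[OF subspace_UNIV] exists_Dec by blast

lemma apz_symbol: "affine_basis u \<Longrightarrow> apz (fst_tuple u) = ap (fst_tuple u) \<and> apz (snd_tuple u) = ap (snd_tuple u)"
  using basis_fst_tuple_snd_tuple[of u] by (simp add: apz_def basis_tuple_iff)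

lemma symbol_Z: "affine_basis u \<Longrightarrow> apz (fst_tuple u) \<in> Z UNIV \<and> apz (snd_tuple u) \<in> Z UNIV"
  by (intro conjI apz_Z) (simp_all add: length_affine)

lemma sym_class_eq_D_poly:
  assumes "h \<in> Dec" "affine_basis u"
  shows "sym_class u = plin sym_class (D_poly h u)"
  using tens_eq_sym_class[OF assms(1)] symbol_Z[OF assms(2)] frame_sum_symbol[OF assms] apz_symbol[OF assms(2)]
  by (simp add: sym_class_def[of u])

text \<open>For \<open>h (u\<^sub>i - u\<^sub>0) = 1\<close> the operator of \<open>h\<close> sends \<open>u\<^sub>1, \<dots>, u\<^sub>n, u\<^sub>0\<close> to a translate of \<open>u\<^sub>0, \<dots>, u\<^sub>n\<close>.\<close>

lemma sym_class_cyclic: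
  assumes u: "affine_basis (x # xs)"
  shows "sym_class (x # xs) = sym_class (xs @ [x])"
proof -
  obtain h where h: "h \<in> Dec" "\<forall>z\<in>set (fst_tuple (x # xs)). h z = 1"
    using exists_Dec[OF basis_fst_tuple_snd_tuple(1)[OF u]] by blast
  have u': "affine_basis (xs @ [x])" using u affine_basis_cong[of "x # xs" "xs @ [x]"] by simp
  have "sym_class (xs @ [x]) = plin sym_class (psingle (0 # map (\<lambda>z. z - x) xs))"
    using sym_class_eq_D_poly[OF h(1) u'] D_poly_last[OF h(1) u'] h(2) by (simp add: fst_tuple_def)
  also have "\<dots> = sym_class (map (\<lambda>z. z - x) (x # xs))" by simp
  also have "\<dots> = sym_class (x # xs)" by (rule sym_class_translate) simp
  finally show ?thesis ..
qed

lemma sym_class_relations: "p \<in> FC_hull \<Longrightarrow> plin sym_class p = 0"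
  unfolding FC_hull_eq
proof (rule pmp.linear_eq_0_on_span[OF linear_plin])
  fix p assume "p \<in> FC_relations"
  then consider (t) u t where "affine_basis u" "p = psingle u - psingle (map (\<lambda>x. x - t) u)"
    | (c) x xs where "affine_basis (x # xs)" "p = psingle (x # xs) - psingle (xs @ [x])"
    | (s) x xs ys where "affine_basis (x # xs @ ys)" "xs \<noteq> []" "ys \<noteq> []" "p = (\<Sum>w\<in>shuffles xs ys. psingle (x # w))"
    unfolding FC_relations_def by blast
  thus "plin sym_class p = 0"
  proof cases
    case t
    hence "u \<noteq> []" by (auto simp: affine_basis_def)
    thus ?thesis using t sym_class_translate by (simp add: plin_simps)
  next
    case c
    thus ?thesis using sym_class_cyclic by (simp add: plin_simps)
  next
    case s
    thus ?thesis using sym_class_shuffles by (simp add: plin_simps)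
  qed
qed

lemma pr_St_symbol_eq:
  assumes u: "affine_basis u"
  shows "pr_St_symbol u = St_cls (apz (fst_tuple u)) (apz (snd_tuple u))"
proof -
  note t = affine_indices[OF u]
  let ?n = "length u - 1" and ?t = "rev [1..<length u]"
  have l: "length u = Suc (dim UNIV)" by (rule length_affine[OF u])
  have n: "?n + 1 = length u" "?n \<ge> 1" using l dim_pos by auto
  have te: "?t = ?n # rev [1..<?n]" using n by (metis rev_eq_Cons_iff rev_rev_ident upt_Suc_append Suc_eq_plus1 rev.simps(2))
  have "path (u ! 0) (map ((!) u) ?t) = (u ! ?n - u ! 0) # map (\<lambda>i. u ! i - u ! (i + 1)) (rev [1..<?n])"
  proof (rule nth_equalityI)
    fix j assume "j < length (path (u ! 0) (map ((!) u) ?t))"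
    hence j: "j < ?n" by (simp del: upt_Suc)
    show "path (u ! 0) (map ((!) u) ?t) ! j = ((u ! ?n - u ! 0) # map (\<lambda>i. u ! i - u ! (i + 1)) (rev [1..<?n])) ! j"
    proof (cases j)
      case 0
      thus ?thesis using j unfolding te by simp
    next
      case (Suc m)
      have "?t ! j = ?n - j" "?t ! m = ?n - j + 1" using j Suc l by (auto simp: rev_nth simp del: upt_Suc)
      moreover have "rev [1..<?n] ! m = ?n - j" using j Suc by (simp add: rev_nth)
      hence "map (\<lambda>i. u ! i - u ! (i + 1)) (rev [1..<?n]) ! m = u ! (?n - j) - u ! (?n - j + 1)"
        using j Suc by (subst nth_map) simp_all
      ultimately show ?thesis using j Suc l by (simp add: path_nth del: upt_Suc)
    qed
  qed (use l dim_pos in \<open>simp del: upt_Suc\<close>)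
  thus ?thesis unfolding pr_St_symbol_def Let_def n(1) apartment2_eq t(8) t(9) by simp
qed

abbreviation "pr_ext \<equiv> lin_ext St_infty pr_St_symbol"

lemma pr_symbol_closed: "affine_basis u \<Longrightarrow> pr_St_symbol u \<in> carrier St_infty"
  using symbol_Z St_cls_closed by (simp add: pr_St_symbol_eq)

lemma pr_ext_linear: "pr_ext \<in> linear_maps FC_free St_infty"
  by (intro lin_ext_linear qmodule_St_infty) (auto intro: pr_symbol_closed)

definition tuple_pair :: "'b list \<Rightarrow> _" where "tuple_pair u = (apz (fst_tuple u), apz (snd_tuple u))"

lemma keys_push_tuple_pair:
  assumes "Poly_Mapping.keys p \<subseteq> Collect affine_basis"
  shows "Poly_Mapping.keys (push tuple_pair p) \<subseteq> Z UNIV \<times> Z UNIV"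
  using keys_push[of tuple_pair p] assms symbol_Z by (force simp: tuple_pair_def)

lemma pr_ext_eq_St_eval:
  assumes "Poly_Mapping.keys p \<subseteq> Collect affine_basis"
  shows "pr_ext p = St_eval (push tuple_pair p)"
proof -
  have aff: "affine_basis u" if "u \<in> Poly_Mapping.keys p" for u using assms that by auto
  have "St_eval (push tuple_pair p) = lin_ext St_infty (\<lambda>u. St_eval (psingle (tuple_pair u))) p"
    unfolding push_def
    by (rule linear_plin_lin_ext[OF qmodule_St_infty St_eval_linear]) (use aff symbol_Z in \<open>auto simp: tuple_pair_def\<close>)
  also have "\<dots> = pr_ext p"
    using aff symbol_Z by (intro lin_ext_cong[OF qmodule_St_infty])
      (auto simp: tuple_pair_def St_eval_single pr_St_symbol_eq intro: St_cls_closed)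
  finally show ?thesis ..
qed

lemma plin_tens_push: "plin (\<lambda>(z, w). tens z w) (push tuple_pair p) = plin sym_class p"
  by (simp add: plin_push tuple_pair_def sym_class_def[abs_def])

lemma pr_ext_kills:
  assumes p: "p \<in> FC_hull"
  shows "pr_ext p = \<zero>\<^bsub>St_infty\<^esub>"
proof -
  have k: "Poly_Mapping.keys p \<subseteq> Collect affine_basis"
    using p pm.span_minimal[OF FC_relations_keys subspace_keys] by (auto simp: FC_hull_eq)
  have "St_eval (push tuple_pair p) = St_eval (push tuple_pair 0)"
    using plin_tens_eq_iff[OF keys_push_tuple_pair[OF k] keys_push_tuple_pair[of 0]] sym_class_relations[OF p]
    by (simp add: plin_tens_push plin_simps)
  hence "pr_ext p = pr_ext 0" using pr_ext_eq_St_eval[OF k] pr_ext_eq_St_eval[of 0] by simp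
  thus ?thesis using linear_maps_zero[OF qmodule_free qmodule_St_infty pr_ext_linear] by simp
qed

lemma pr_St_linear: "pr_St \<in> linear_maps FC St_infty"
  unfolding pr_St_def FC_def by (rule qquotient.induced_map_linear[OF qquotient_FC qmodule_St_infty pr_ext_linear pr_ext_kills])

lemma pr_St_coset: "Poly_Mapping.keys p \<subseteq> Collect affine_basis \<Longrightarrow> pr_St (FC_cls p) = pr_ext p"
  unfolding pr_St_def by (rule qquotient.induced_map_coset[OF qquotient_FC qmodule_St_infty pr_ext_linear pr_ext_kills]) simp_all

lemma D_section:
  assumes h: "h \<in> Dec"
  obtains T where "T \<in> linear_maps St_infty FC" "\<And>x. x \<in> carrier St_infty \<Longrightarrow> pr_St (T x) = x"
    "\<And>m. m \<in> carrier FC \<Longrightarrow> D h m = T (pr_St m)"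
proof -
  obtain T where T: "T \<in> linear_maps St_infty FC" "\<And>z w. z \<in> Z UNIV \<Longrightarrow> w \<in> Z UNIV \<Longrightarrow> T (St_cls z w) = FC_cls (frame_sum h z w)"
    using theta_exists[OF h] by blast
  have L1: "pr_ext (psingle u) = pr_St_symbol u" if "affine_basis u" for u
  proof -
    interpret qmodule St_infty by (rule qmodule_St_infty)
    show ?thesis using lin_ext_single[of St_infty pr_St_symbol u 1, OF qmodule_St_infty pr_symbol_closed[OF that]] pr_symbol_closed[OF that] by simp
  qed
  have Tsym: "T (pr_St_symbol u) = D_symbol h u" if u: "affine_basis u" for u
    using T(2) symbol_Z[OF u] apz_symbol[OF u] frame_sum_symbol[OF h u]
    by (simp add: pr_St_symbol_eq[OF u] D_symbol_eq[OF h u])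
  have Dc: "D_symbol h u \<in> carrier FC" if u: "affine_basis u" for u
    unfolding D_symbol_eq[OF h u] using keys_D_poly[OF h u] by (intro linear_mapsD(1)[OF FC_cls_linear]) simp
  have Dl: "lin_ext FC (D_symbol h) \<in> linear_maps FC_free FC"
    using Dc by (intro lin_ext_linear qmodule_FC) auto
  have D1: "lin_ext FC (D_symbol h) (psingle u) = D_symbol h u" if "affine_basis u" for u
  proof -
    interpret qmodule FC by (rule qmodule_FC)
    show ?thesis using lin_ext_single[of FC "D_symbol h" u 1, OF qmodule_FC Dc[OF that]] Dc[OF that] by simp
  qed
  have TL: "lin_ext FC (D_symbol h) p = T (pr_ext p)" if "Poly_Mapping.keys p \<subseteq> Collect affine_basis" for p
    by (rule linear_free_eq[OF qmodule_FC Dl linear_maps_comp[OF pr_ext_linear T(1)] _ that])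
      (simp add: L1 D1 Tsym)
  have Dk: "lin_ext FC (D_symbol h) p = \<zero>\<^bsub>FC\<^esub>" if p: "p \<in> FC_hull" for p
  proof -
    have "Poly_Mapping.keys p \<subseteq> Collect affine_basis"
      using p pm.span_minimal[OF FC_relations_keys subspace_keys] by (auto simp: FC_hull_eq)
    thus ?thesis using TL pr_ext_kills[OF p] linear_maps_zero[OF qmodule_St_infty qmodule_FC T(1)] by simp
  qed
  show thesis
  proof (rule that[OF T(1)])
    fix m assume "m \<in> carrier FC"
    then obtain p where p: "m = FC_cls p" "Poly_Mapping.keys p \<subseteq> Collect affine_basis"
      unfolding carrier_FC by blast
    have "D h (FC_cls p) = lin_ext FC (D_symbol h) p"
      unfolding D_def using p(2) by (intro qquotient.induced_map_coset[OF qquotient_FC qmodule_FC Dl Dk]) simp_all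
    thus "D h m = T (pr_St m)" using TL[OF p(2)] pr_St_coset[OF p(2)] p(1) by simp
  next
    fix x assume x: "x \<in> carrier St_infty"
    show "pr_St (T x) = x"
    proof (rule linear_maps_eq_on_generators[OF qmodule_St_infty qmodule_St_infty
        linear_maps_comp[OF T(1) pr_St_linear] _ St_infty_generated _ x, of "\<lambda>x. x"])
      show "(\<lambda>x. x) \<in> linear_maps St_infty St_infty" by (intro linear_mapsI) auto
      fix y assume "y \<in> {St_cls z w | z w. z \<in> Z UNIV \<and> w \<in> Z UNIV}"
      then obtain z w where y: "y = St_cls z w" and zw: "z \<in> Z UNIV" "w \<in> Z UNIV" by blast
      have k: "Poly_Mapping.keys (frame_sum h z w) \<subseteq> Collect affine_basis" by (rule keys_frame_sum_affine[OF h])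
      have "plin (\<lambda>(z, w). tens z w) (psingle (z, w)) = plin (\<lambda>(z, w). tens z w) (push tuple_pair (frame_sum h z w))"
        unfolding plin_tens_push using tens_eq_sym_class[OF h zw] by simp
      hence "St_eval (psingle (z, w)) = St_eval (push tuple_pair (frame_sum h z w))"
        using plin_tens_eq_iff[OF _ keys_push_tuple_pair[OF k], of "psingle (z, w)"] zw by simp
      thus "pr_St (T y) = y" using T(2)[OF zw] pr_St_coset[OF k] pr_ext_eq_St_eval[OF k] St_eval_single[OF zw] y by simp
    qed
  qed
qed

theorem homology_FC:
  "(\<exists>\<Phi>\<in>linear_isos (H_Dec_FC 0) St_infty. \<forall>m\<in>carrier FC. \<Phi> (H0_class m) = pr_St m) \<and>
   (\<forall>p. p \<noteq> 0 \<longrightarrow> carrier (H_Dec_FC p) = {\<zero>\<^bsub>H_Dec_FC p\<^esub>})"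
proof -
  obtain h0 where h0: "h0 \<in> Dec" using Dec_nonempty by blast
  interpret FC: qmodule FC by (rule qmodule_FC)
  have D_lin: "D h \<in> linear_maps FC FC" if h: "h \<in> Dec" for h
  proof -
    obtain T where T: "T \<in> linear_maps St_infty FC" "\<And>m. m \<in> carrier FC \<Longrightarrow> D h m = T (pr_St m)"
      using D_section[OF h] by metis
    note l = linear_maps_comp[OF pr_St_linear T(1)]
    show ?thesis using linear_mapsD[OF l] T(2) by (intro linear_mapsI) simp_all
  qed
  interpret left_zero_bar FC Dec Dec_mult D h0
    by unfold_locales (simp_all add: Dec_mult_def h0 D_lin)
  have surj: "pr_St ` carrier FC = carrier St_infty"
  proof
    show "pr_St ` carrier FC \<subseteq> carrier St_infty" using linear_mapsD(1)[OF pr_St_linear] by blast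
    obtain T where T: "T \<in> linear_maps St_infty FC" "\<And>x. x \<in> carrier St_infty \<Longrightarrow> pr_St (T x) = x"
      using D_section[OF h0] by metis
    show "carrier St_infty \<subseteq> pr_St ` carrier FC"
      using T(2) linear_mapsD(1)[OF T(1)] by (metis imageI subsetI)
  qed
  have inv: "pr_St (D h m) = pr_St m" if "h \<in> Dec" "m \<in> carrier FC" for h m
    using D_section[OF that(1)] linear_mapsD(1)[OF pr_St_linear that(2)] that(2) by metis
  have ker: "D h0 m = \<zero>\<^bsub>FC\<^esub>" if "m \<in> carrier FC" "pr_St m = \<zero>\<^bsub>St_infty\<^esub>" for m
    using D_section[OF h0] linear_maps_zero[OF qmodule_St_infty qmodule_FC] that by metis
  show ?thesis unfolding H_Dec_FC_def H0_class_def
    using homology_zero[OF qmodule_St_infty pr_St_linear surj inv ker] homology_positive by blast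
qed

end

theorem proposition5p12:
  fixes scale :: "'f::field \<Rightarrow> 'v::ab_group_add \<Rightarrow> 'v" and Basis :: "'v set"
  assumes "finite_dimensional_vector_space scale Basis"
    and "vector_space.dim scale UNIV > 0"
  shows "(\<exists>\<Phi> \<in> linear_isos (steinberg_space.H_Dec_FC scale 0) (steinberg_space.St_infty scale).
            \<forall>m \<in> carrier (steinberg_space.FC scale).
              \<Phi> (steinberg_space.H0_class scale m) = steinberg_space.pr_St scale m) \<and>
         (\<forall>p. p \<noteq> 0 \<longrightarrow>
            carrier (steinberg_space.H_Dec_FC scale p) = {\<zero>\<^bsub>steinberg_space.H_Dec_FC scale p\<^esub>})"
proof -
  interpret finite_dimensional_vector_space scale Basis by (rule assms(1))
  interpret pos_steinberg scale Basis
    by unfold_locales (rule assms(2))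
  show ?thesis by (rule homology_FC)
qed

end
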